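(* Let $\Omega\subset\mathbb R^n$ be open such that $\overline\Omega$ is a compact, convex, polyhedral domain. Let $\omega\subset\Omega$ be open and non-empty, and let $0<T_1<T$. Write $L=\partial_t-\Delta$. Then there is $C>0$ such that for all $u$ in the space $$H^1(0,T;H^{-1}(\Omega))\cap L^2(0,T;H^1_0(\Omega))$$ it holds that $$\|u\|_{C(T_1,T;L^2(\Omega))}+\|u\|_{L^2(T_1,T;H^1(\Omega))}+\|u\|_{H^1(T_1,T;H^{-1}(\Omega))}\le C\left(\|u\|_{L^2((0,T)\times\omega)}+\|Lu\|_{L^2(0,T;H^{-1}(\Omega))}\right).$$
   Context: $H^{-1}(\Omega)$ denotes the dual of $H^1_0(\Omega)$. The Laplacian $\Delta$ acts in the spatial variable only and $Lu$ is understood weakly. $\|u\|_{C(T_1,T;L^2(\Omega))}=\sup_{t\in[T_1,T]}\|u(t,\cdot)\|_{L^2(\Omega)}$; the space in the claim embeds continuously in $C([0,T];L^2(\Omega))$.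
   Formalization: Ω is additionally assumed to equal the interior of its closure (so Ω itself is convex); otherwise the claim fails, e.g. Ω=(0,1)∪(1,2), ω⊂(0,1), u=0 on (0,1) and a nonzero Dirichlet heat solution on (1,2). *)

theory Defs
  imports "HOL-Analysis.Analysis"
begin

(* Elements of function spaces are represented by functions; functions that agree almost everywhere
   represent the same element, and every norm below depends only on the element. *)

section \<open>Test functions\<close>

fun C_diff :: "nat \<Rightarrow> ('a::euclidean_space \<Rightarrow> real) \<Rightarrow> bool" where
  "C_diff 0 f \<longleftrightarrow> continuous_on UNIV f"
| "C_diff (Suc k) f \<longleftrightarrow>
     (\<forall>x. f differentiable (at x)) \<and>
     (\<forall>b\<in>Basis. C_diff k (\<lambda>x. frechet_derivative f (at x) b))"

definition test_functions :: "'a::euclidean_space set \<Rightarrow> ('a \<Rightarrow> real) set" where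
  "test_functions \<Omega> =
     {\<phi>. (\<forall>k. C_diff k \<phi>) \<and> (\<exists>K. compact K \<and> K \<subseteq> \<Omega> \<and> (\<forall>x. x \<notin> K \<longrightarrow> \<phi> x = 0))}"


section \<open>Sobolev spaces on a domain\<close>

definition L2 :: "'a::euclidean_space set \<Rightarrow> ('a \<Rightarrow> 'b::euclidean_space) set" where
  "L2 \<Omega> = {f. f \<in> borel_measurable (lebesgue_on \<Omega>) \<and>
              integrable (lebesgue_on \<Omega>) (\<lambda>x. (norm (f x))\<^sup>2)}"

definition normL2 :: "'a::euclidean_space set \<Rightarrow> ('a \<Rightarrow> 'b::euclidean_space) \<Rightarrow> real" where
  "normL2 \<Omega> f = sqrt (LINT x|lebesgue_on \<Omega>. (norm (f x))\<^sup>2)"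

definition has_weak_grad ::
  "'a::euclidean_space set \<Rightarrow> ('a \<Rightarrow> real) \<Rightarrow> ('a \<Rightarrow> 'a) \<Rightarrow> bool" where
  "has_weak_grad \<Omega> u g \<longleftrightarrow>
     (\<forall>\<phi>\<in>test_functions \<Omega>. \<forall>b\<in>Basis.
        (LINT x|lebesgue_on \<Omega>. u x * frechet_derivative \<phi> (at x) b)
        = - (LINT x|lebesgue_on \<Omega>. (g x \<bullet> b) * \<phi> x))"

definition H1 :: "'a::euclidean_space set \<Rightarrow> ('a \<Rightarrow> real) set" where
  "H1 \<Omega> = {u \<in> L2 \<Omega>. \<exists>g\<in>L2 \<Omega>. has_weak_grad \<Omega> u g}"

(* Unique almost everywhere for u in H1. *)
definition weak_grad :: "'a::euclidean_space set \<Rightarrow> ('a \<Rightarrow> real) \<Rightarrow> 'a \<Rightarrow> 'a" where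
  "weak_grad \<Omega> u = (SOME g. g \<in> L2 \<Omega> \<and> has_weak_grad \<Omega> u g)"

definition normH1 :: "'a::euclidean_space set \<Rightarrow> ('a \<Rightarrow> real) \<Rightarrow> real" where
  "normH1 \<Omega> u = sqrt ((normL2 \<Omega> u)\<^sup>2 + (normL2 \<Omega> (weak_grad \<Omega> u))\<^sup>2)"

definition H10 :: "'a::euclidean_space set \<Rightarrow> ('a \<Rightarrow> real) set" where
  "H10 \<Omega> = {u \<in> H1 \<Omega>. \<exists>\<phi>. (\<forall>k::nat. \<phi> k \<in> test_functions \<Omega>) \<and>
                          (\<lambda>k. normH1 \<Omega> (\<lambda>x. u x - \<phi> k x)) \<longlonglongrightarrow> 0}"

(* Functionals matter only through their values on H10. Boundedness forces them to respect
   almost-everywhere equality. *)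
definition Hm1 :: "'a::euclidean_space set \<Rightarrow> (('a \<Rightarrow> real) \<Rightarrow> real) set" where
  "Hm1 \<Omega> = {F. (\<forall>v\<in>H10 \<Omega>. \<forall>w\<in>H10 \<Omega>. \<forall>a b. F (\<lambda>x. a * v x + b * w x) = a * F v + b * F w) \<and>
               (\<exists>B. \<forall>v\<in>H10 \<Omega>. \<bar>F v\<bar> \<le> B * normH1 \<Omega> v)}"

definition normHm1 :: "'a::euclidean_space set \<Rightarrow> (('a \<Rightarrow> real) \<Rightarrow> real) \<Rightarrow> real" where
  "normHm1 \<Omega> F = (SUP v\<in>{v \<in> H10 \<Omega>. normH1 \<Omega> v \<le> 1}. \<bar>F v\<bar>)"

definition L2_functional :: "'a::euclidean_space set \<Rightarrow> ('a \<Rightarrow> real) \<Rightarrow> ('a \<Rightarrow> real) \<Rightarrow> real" where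
  "L2_functional \<Omega> u = (\<lambda>v. LINT x|lebesgue_on \<Omega>. u x * v x)"

definition neg_Laplace :: "'a::euclidean_space set \<Rightarrow> ('a \<Rightarrow> real) \<Rightarrow> ('a \<Rightarrow> real) \<Rightarrow> real" where
  "neg_Laplace \<Omega> u = (\<lambda>v. LINT x|lebesgue_on \<Omega>. weak_grad \<Omega> u x \<bullet> weak_grad \<Omega> v x)"


section \<open>Bochner spaces on a time interval\<close>

(* The target is a space X of real-valued functions with norm nrm: X = H10 on the one hand and
   X = Hm1 on the other. Strong measurability is almost everywhere approximation in norm by
   simple functions. *)
definition strongly_measurable ::
  "real \<Rightarrow> real \<Rightarrow> ('b \<Rightarrow> real) set \<Rightarrow> (('b \<Rightarrow> real) \<Rightarrow> real) \<Rightarrow> (real \<Rightarrow> 'b \<Rightarrow> real) \<Rightarrow> bool" where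
  "strongly_measurable a b X nrm f \<longleftrightarrow>
     (AE t in lebesgue_on {a<..<b}. f t \<in> X) \<and>
     (\<exists>s. (\<forall>k::nat. simple_function (lebesgue_on {a<..<b}) (s k) \<and> (\<forall>t. s k t \<in> X)) \<and>
          (AE t in lebesgue_on {a<..<b}. (\<lambda>k. nrm (\<lambda>y. f t y - s k t y)) \<longlonglongrightarrow> 0))"

definition L2_time ::
  "real \<Rightarrow> real \<Rightarrow> ('b \<Rightarrow> real) set \<Rightarrow> (('b \<Rightarrow> real) \<Rightarrow> real) \<Rightarrow> (real \<Rightarrow> 'b \<Rightarrow> real) set" where
  "L2_time a b X nrm = {f. strongly_measurable a b X nrm f \<and>
                           integrable (lebesgue_on {a<..<b}) (\<lambda>t. (nrm (f t))\<^sup>2)}"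

definition normL2_time ::
  "real \<Rightarrow> real \<Rightarrow> (('b \<Rightarrow> real) \<Rightarrow> real) \<Rightarrow> (real \<Rightarrow> 'b \<Rightarrow> real) \<Rightarrow> real" where
  "normL2_time a b nrm f = sqrt (LINT t|lebesgue_on {a<..<b}. (nrm (f t))\<^sup>2)"

(* The defining identity  int phi' f dt = - int phi g dt  of the weak time derivative holds in Hm1,
   i.e. as functionals on H10; an Hm1-valued integral acts on v by integrating the values at v. *)
definition has_weak_tderiv ::
  "'a::euclidean_space set \<Rightarrow> real \<Rightarrow> real \<Rightarrow>
     (real \<Rightarrow> ('a \<Rightarrow> real) \<Rightarrow> real) \<Rightarrow> (real \<Rightarrow> ('a \<Rightarrow> real) \<Rightarrow> real) \<Rightarrow> bool" where
  "has_weak_tderiv \<Omega> a b f g \<longleftrightarrow>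
     (\<forall>\<phi>\<in>test_functions {a<..<b}. \<forall>v\<in>H10 \<Omega>.
        (LINT t|lebesgue_on {a<..<b}. deriv \<phi> t * f t v)
        = - (LINT t|lebesgue_on {a<..<b}. \<phi> t * g t v))"

definition H1_time_Hm1 ::
  "'a::euclidean_space set \<Rightarrow> real \<Rightarrow> real \<Rightarrow> (real \<Rightarrow> ('a \<Rightarrow> real) \<Rightarrow> real) set" where
  "H1_time_Hm1 \<Omega> a b =
     {f \<in> L2_time a b (Hm1 \<Omega>) (normHm1 \<Omega>).
        \<exists>g\<in>L2_time a b (Hm1 \<Omega>) (normHm1 \<Omega>). has_weak_tderiv \<Omega> a b f g}"

(* Unique for almost every t, as an element of Hm1, for f in H1_time_Hm1. *)
definition weak_tderiv ::
  "'a::euclidean_space set \<Rightarrow> real \<Rightarrow> real \<Rightarrow>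
     (real \<Rightarrow> ('a \<Rightarrow> real) \<Rightarrow> real) \<Rightarrow> (real \<Rightarrow> ('a \<Rightarrow> real) \<Rightarrow> real)" where
  "weak_tderiv \<Omega> a b f =
     (SOME g. g \<in> L2_time a b (Hm1 \<Omega>) (normHm1 \<Omega>) \<and> has_weak_tderiv \<Omega> a b f g)"

definition normH1_time_Hm1 ::
  "'a::euclidean_space set \<Rightarrow> real \<Rightarrow> real \<Rightarrow> (real \<Rightarrow> ('a \<Rightarrow> real) \<Rightarrow> real) \<Rightarrow> real" where
  "normH1_time_Hm1 \<Omega> a b f =
     sqrt ((normL2_time a b (normHm1 \<Omega>) f)\<^sup>2 +
           (normL2_time a b (normHm1 \<Omega>) (weak_tderiv \<Omega> a b f))\<^sup>2)"


section \<open>The solution space and the heat operator\<close>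

(* H^1(0,T; H^{-1}) intersected with L^2(0,T; H^1_0), with H^1_0 embedded in H^{-1} through the L^2 product.
   An element of L^2(0,T; L^2) is also an element of L^2 of the cylinder (0,T) x Omega. The first
   conjunct says that u is a function of (t,x) representing it there; every element of
   the space has such a representative. *)
definition energy_space :: "'a::euclidean_space set \<Rightarrow> real \<Rightarrow> (real \<Rightarrow> 'a \<Rightarrow> real) set" where
  "energy_space \<Omega> T =
     {u. (\<lambda>(t, x). u t x) \<in> borel_measurable (lebesgue_on ({0<..<T} \<times> \<Omega>)) \<and>
         u \<in> L2_time 0 T (H10 \<Omega>) (normH1 \<Omega>) \<and>
         (\<lambda>t. L2_functional \<Omega> (u t)) \<in> H1_time_Hm1 \<Omega> 0 T}"

definition heat_op ::
  "'a::euclidean_space set \<Rightarrow> real \<Rightarrow> (real \<Rightarrow> 'a \<Rightarrow> real) \<Rightarrow> real \<Rightarrow> ('a \<Rightarrow> real) \<Rightarrow> real" where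
  "heat_op \<Omega> T u = (\<lambda>t v. weak_tderiv \<Omega> 0 T (\<lambda>s. L2_functional \<Omega> (u s)) t v
                            + neg_Laplace \<Omega> (u t) v)"

definition continuous_L2 :: "'a::euclidean_space set \<Rightarrow> real \<Rightarrow> (real \<Rightarrow> 'a \<Rightarrow> real) \<Rightarrow> bool" where
  "continuous_L2 \<Omega> T w \<longleftrightarrow>
     (\<forall>t\<in>{0..T}. w t \<in> L2 \<Omega> \<and>
        ((\<lambda>s. normL2 \<Omega> (\<lambda>x. w s x - w t x)) \<longlongrightarrow> 0) (at t within {0..T}))"

(* The energy space embeds in C([0,T]; L^2), so that its elements have a representative
   that is continuous in time; for every t in [0,T] its value at t is unique in L^2. *)
definition continuous_rep ::
  "'a::euclidean_space set \<Rightarrow> real \<Rightarrow> (real \<Rightarrow> 'a \<Rightarrow> real) \<Rightarrow> real \<Rightarrow> 'a \<Rightarrow> real" where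
  "continuous_rep \<Omega> T u =
     (SOME w. continuous_L2 \<Omega> T w \<and>
        (AE t in lebesgue_on {0<..<T}. AE x in lebesgue_on \<Omega>. w t x = u t x))"

definition normC_L2 ::
  "'a::euclidean_space set \<Rightarrow> real \<Rightarrow> real \<Rightarrow> (real \<Rightarrow> 'a \<Rightarrow> real) \<Rightarrow> real" where
  "normC_L2 \<Omega> T1 T u = (SUP t\<in>{T1..T}. normL2 \<Omega> (continuous_rep \<Omega> T u t))"

end

theory Submission
 imports Defs "HOL-Library.Diagonal_Subsequence"
begin

text \<open>Duhamel's formula splits each coefficient of \<open>u\<close> in the basis of Dirichlet eigenfunctions into a free part, which comes
from the value at time 0, and a part driven by the source, which the \<open>H\<^sup>-\<^sup>1\<close> norm of \<open>Lu\<close> bounds in all energy norms.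
The free part is a limit of finite sums of eigenfunctions. For these, observability from a ball about \<open>x0\<close> holds with a
constant independent of the number of terms: with the weight \<open>exp (- |x - x0|^2 / (4 \<Gamma>))\<close>, \<open>\<Gamma> = T + h - t\<close>, let \<open>H\<close> and \<open>D\<close> be
the weighted integrals of \<open>u^2\<close> and \<open>|grad u|^2\<close>. A convex domain is star-shaped about \<open>x0\<close>, so that the
boundary term in the Rellich--Pohozaev identity has a sign and the frequency \<open>\<Gamma> D / H\<close> is nonincreasing. The bound
on the frequency at the final time localises the energy to the ball and interpolates between it and the initial energy; a
telescoping sum over a sequence of times decreasing to 0 removes the initial energy. Observing the free part as \<open>u\<close> minus
the driven part bounds it at time \<open>T1\<close>, and by the decay of the heat flow at all later times.\<close>

section \<open>Square-integrable functions\<close>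

text \<open>All norms are weighted square sums over the modes. With \<open>\<kappa> k\<close> equal
  to one plus the Dirichlet eigenvalue, the H1 norm carries the weight \<open>\<kappa> k\<close> and
  the dual norm its inverse. Each mode solves a scalar linear equation whose decay kernel has
  integral at most \<open>(T + 1) / \<kappa> k\<close>; this is exactly the gain that turns the
  weight of the source into that of the solution. The obstacle in observability is that the
  frequency bound involves the logarithm K of the ratio of initial to final energy. A Gaussian of
  width h concentrates on the ball once 1/h is of order 1/T + K + 1, and undoing the weight costs
  exp (R^2 / (4 h)). This is exp (C / T) times a power of the energy ratio, and a power, unlike
  anything larger, can be interpolated and then telescoped away. Finite sums are used because their
  Laplacian lies again in \<open>H10\<close> and because they can be differentiated in time term by
  term under the integral. The truncated free part is the solution minus its discarded modes minus
  the driven part; as the constant does not see the number of terms, the discarded modes disappear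
  in the limit.\<close>

abbreviation (input) LIMSEQ_arrow :: "(nat => 'a::topological_space) => 'a => bool" ("((_)/ ----> (_))" [60, 60] 60) where
 "X ----> L \<equiv> X \<longlonglongrightarrow> L"

abbreviation nsq :: "'b::real_normed_vector => real" where
 "nsq v \<equiv> (norm v)\<^sup>2"

lemmas LINT_cong = Bochner_Integration.integral_cong
lemmas integrable_dominated = Bochner_Integration.integrable_bound
lemmas LINT_sum = Bochner_Integration.integral_sum

definition sqint :: "'x measure => ('x => 'b::euclidean_space) => bool" where
 "sqint M f \<longleftrightarrow> f \<in> borel_measurable M \<and> integrable M (%x. nsq (f x))"

definition nrm2 :: "'x measure => ('x => 'b::euclidean_space) => real" where
 "nrm2 M f = sqrt (LINT x|M. nsq (f x))"

abbreviation "ndist M f g \<equiv> nrm2 M (%x. f x - g x)"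

lemma L2_iff: "f \<in> L2 \<Omega> \<longleftrightarrow> sqint (lebesgue_on \<Omega>) f"
 by (simp add: L2_def sqint_def)

lemma normL2_eq: "normL2 \<Omega> = nrm2 (lebesgue_on \<Omega>)"
 by (simp add: normL2_def nrm2_def fun_eq_iff)

lemma sqint_measurable: "sqint M f ==> f \<in> borel_measurable M"
 by (simp add: sqint_def)

lemma sqint_integrable: "sqint M f ==> integrable M (%x. nsq (f x))"
 by (simp add: sqint_def)

lemma sqint_inner:
 assumes "sqint M f" "sqint M g"
 shows "integrable M (%x. f x \<bullet> g x)"
proof (rule integrable_dominated)
 show "integrable M (%x. nsq (f x) + nsq (g x))"
  using assms by (simp add: sqint_def)
 show "(%x. f x \<bullet> g x) \<in> borel_measurable M"
  using assms by (auto simp: sqint_def)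
 have "\<bar>a \<bullet> b\<bar> <= nsq a + nsq b" for a b :: 'b
 proof -
  have "\<bar>a \<bullet> b\<bar> <= norm a * norm b" by (rule Cauchy_Schwarz_ineq2)
  also have "... <= nsq a + nsq b"
   using sum_squares_bound[of "norm a" "norm b"] mult_nonneg_nonneg[OF norm_ge_zero[of a] norm_ge_zero[of b]]
   by linarith
  finally show ?thesis .
 qed
 then show "AE x in M. norm (f x \<bullet> g x) <= norm (nsq (f x) + nsq (g x))"
  by simp
qed

lemma sqint_mult:
 fixes f g :: "'x => real"
 shows "sqint M f ==> sqint M g ==> integrable M (%x. f x * g x)"
 using sqint_inner[of M f g] by simp

lemma sqint_dominated:
 assumes "sqint M f" "g \<in> borel_measurable M" "AE x in M. norm (g x) <= c * norm (f x)"
 shows "sqint M g"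
proof -
 have "integrable M (%x. c\<^sup>2 * nsq (f x))"
  using assms(1) by (simp add: sqint_def)
 then have "integrable M (%x. nsq (g x))"
 proof (rule integrable_dominated)
  show "(%x. nsq (g x)) \<in> borel_measurable M" using assms(2) by auto
  show "AE x in M. norm (nsq (g x)) <= norm (c\<^sup>2 * nsq (f x))"
   using assms(3)
  proof eventually_elim
   case (elim x)
   have "nsq (g x) <= (c * norm (f x))\<^sup>2" using elim by (intro power_mono) auto
   then show ?case by (simp add: power_mult_distrib)
  qed
 qed
 then show ?thesis using assms by (simp add: sqint_def)
qed

lemma sqint_scaleR: "sqint M f ==> sqint M (%x. c *\<^sub>R f x)"
 by (rule sqint_dominated[where c="\<bar>c\<bar>" and f=f]) (auto simp: sqint_def)

lemma sqint_cmult: "sqint M f ==> sqint M (%x. (c::real) * f x)"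
 using sqint_scaleR[of M f c] by simp

lemma sqint_minus: "sqint M f ==> sqint M (%x. - f x)"
 using sqint_scaleR[of M f "-1"] by simp

lemma norm_add_sq_le:
 fixes a b :: "'b::real_inner"
 shows "nsq (a + b) <= 2 * nsq a + 2 * nsq b"
proof -
 have "0 <= nsq (a - b)" by simp
 then show ?thesis by (simp add: power2_norm_eq_inner algebra_simps inner_commute)
qed

lemma sqint_add:
 assumes "sqint M f" "sqint M g"
 shows "sqint M (%x. f x + g x)"
proof -
 have "integrable M (%x. 2 * nsq (f x) + 2 * nsq (g x))"
  using assms by (simp add: sqint_def)
 then have "integrable M (%x. nsq (f x + g x))"
  by (rule integrable_dominated)
    (use assms norm_add_sq_le in \<open>auto simp: sqint_def abs_of_nonneg\<close>)
 then show ?thesis using assms by (auto simp: sqint_def)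
qed

lemma sqint_diff: "sqint M f ==> sqint M g ==> sqint M (%x. f x - g x)"
 using sqint_add[OF _ sqint_minus, of M f g] by simp

lemma sqint_zero: "sqint M (%x. 0)"
 by (simp add: sqint_def)

lemma sqint_sum: "finite I ==> (!!i. i \<in> I ==> sqint M (f i)) ==> sqint M (%x. \<Sum>i\<in>I. f i x)"
 by (induction I rule: finite_induct) (auto simp: sqint_zero sqint_add)

lemma sqint_bounded_mult:
 assumes "sqint M f" "w \<in> borel_measurable M" "!!x. x \<in> space M ==> \<bar>w x\<bar> <= c"
 shows "sqint M (%x. (w x :: real) *\<^sub>R f x)"
 by (rule sqint_dominated[where c=c, OF assms(1)])
   (use assms in \<open>auto simp: sqint_def intro!: AE_I2 mult_right_mono\<close>)

lemma sqint_cong_AE: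
 assumes "sqint M f" "g \<in> borel_measurable M" "AE x in M. f x = g x"
 shows "sqint M g"
 by (rule sqint_dominated[where c=1, OF assms(1,2)]) (use assms(3) in auto)

lemma nrm2_nonneg [simp]: "0 <= nrm2 M f"
 by (simp add: nrm2_def)

lemma nrm2_sq: "(nrm2 M f)\<^sup>2 = (LINT x|M. nsq (f x))"
 by (simp add: nrm2_def)

lemma nrm2_sq_inner: "(nrm2 M f)\<^sup>2 = (LINT x|M. f x \<bullet> f x)"
 by (simp add: nrm2_sq power2_norm_eq_inner)

lemma nrm2_cong_AE:
 assumes "AE x in M. f x = g x" "f \<in> borel_measurable M" "g \<in> borel_measurable M"
 shows "nrm2 M f = nrm2 M g"
 unfolding nrm2_def by (intro arg_cong[where f=sqrt] integral_cong_AE) (use assms in auto)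

lemma discriminant_nonneg:
 fixes a b c :: real
 assumes c: "0 <= c" and q: "!!t. 0 <= a + 2 * b * t + c * t\<^sup>2"
 shows "b\<^sup>2 <= a * c"
proof -
 show ?thesis
 proof (cases "c = 0")
  case True
  \<comment> \<open>If b were not zero, the affine function would take the value -1 at the chosen
    argument.\<close>
  then have "b = 0"
   using q[of "- (a + 1) / (2 * b)"] by (cases "b = 0") auto
  with True show ?thesis by simp
 next
  case False
  with c have "c > 0" by simp
  have "0 <= a + 2 * b * (- b / c) + c * (- b / c)\<^sup>2" by (rule q)
  also have "... = a - b\<^sup>2 / c" using \<open>c > 0\<close> by (simp add: power2_eq_square)
  finally show ?thesis using \<open>c > 0\<close> by (simp add: pos_divide_le_eq)
 qed
qed

lemma CS_sq:
 assumes "sqint M f" "sqint M g"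
 shows "(LINT x|M. f x \<bullet> g x)\<^sup>2 <= (LINT x|M. nsq (f x)) * (LINT x|M. nsq (g x))"
proof (rule discriminant_nonneg)
 show "0 <= (LINT x|M. nsq (g x))" by simp
 fix t
 have i: "integrable M (%x. f x \<bullet> g x)" using assms by (rule sqint_inner)
 have "0 <= (LINT x|M. nsq (f x + t *\<^sub>R g x))" by simp
 also have "... = (LINT x|M. nsq (f x) + 2 * t * (f x \<bullet> g x) + t\<^sup>2 * nsq (g x))"
  by (intro LINT_cong refl)
    (simp add: power2_norm_eq_inner inner_add_left inner_add_right inner_commute algebra_simps, simp add: power2_eq_square)
 also have "... = (LINT x|M. nsq (f x)) + 2 * (LINT x|M. f x \<bullet> g x) * t
   + (LINT x|M. nsq (g x)) * t\<^sup>2"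
  using sqint_integrable[OF assms(1)] sqint_integrable[OF assms(2)] i by simp
 finally show "0 <= (LINT x|M. nsq (f x)) + 2 * (LINT x|M. f x \<bullet> g x) * t
   + (LINT x|M. nsq (g x)) * t\<^sup>2" .
qed

lemma CS_ineq:
 assumes "sqint M f" "sqint M g"
 shows "\<bar>LINT x|M. f x \<bullet> g x\<bar> <= nrm2 M f * nrm2 M g"
 using CS_sq[OF assms] unfolding nrm2_sq[symmetric] power_mult_distrib[symmetric]
 by (rule abs_le_square_iff[THEN iffD2, THEN order_trans]) (simp add: abs_mult)

lemma nrm2_scaleR: "nrm2 M (%x. c *\<^sub>R f x) = \<bar>c\<bar> * nrm2 M f"
 by (simp add: nrm2_def power_mult_distrib real_sqrt_mult)

lemma nrm2_minus_commute: "ndist M f g = ndist M g f"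
 by (simp add: nrm2_def norm_minus_commute)

lemma nrm2_add_sq:
 assumes "sqint M f" "sqint M g"
 shows "(nrm2 M (%x. f x + g x))\<^sup>2 = (nrm2 M f)\<^sup>2 + 2 * (LINT x|M. f x \<bullet> g x) + (nrm2 M g)\<^sup>2"
proof -
 have "(LINT x|M. nsq (f x + g x)) = (LINT x|M. nsq (f x) + 2 * (f x \<bullet> g x) + nsq (g x))"
  by (intro LINT_cong refl)
    (simp add: power2_norm_eq_inner inner_add_left inner_add_right inner_commute algebra_simps)
 then show ?thesis
  using assms sqint_inner[OF assms] by (simp add: nrm2_sq sqint_def)
qed

lemma nrm2_triangle:
 assumes "sqint M f" "sqint M g"
 shows "nrm2 M (%x. f x + g x) <= nrm2 M f + nrm2 M g"
proof (rule power2_le_imp_le)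
 have "(LINT x|M. f x \<bullet> g x) <= nrm2 M f * nrm2 M g" using CS_ineq[OF assms] by simp
 then show "(nrm2 M (%x. f x + g x))\<^sup>2 <= (nrm2 M f + nrm2 M g)\<^sup>2"
  unfolding nrm2_add_sq[OF assms] by (simp add: power2_sum)
qed simp

lemma nrm2_triangle_diff:
 assumes "sqint M f" "sqint M g" "sqint M h"
 shows "ndist M f h <= ndist M f g + ndist M g h"
 using nrm2_triangle[OF sqint_diff[OF assms(1,2)] sqint_diff[OF assms(2,3)]] by simp

lemma nrm2_eq_0_iff:
 assumes "sqint M f"
 shows "nrm2 M f = 0 \<longleftrightarrow> (AE x in M. f x = 0)"
 using assms integral_nonneg_eq_0_iff_AE[of M "%x. nsq (f x)"]
 by (simp add: nrm2_def sqint_def)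

lemma nrm2_dominated:
 assumes "sqint M f" "g \<in> borel_measurable M" "AE x in M. norm (g x) <= c * norm (f x)" "0 <= c"
 shows "nrm2 M g <= c * nrm2 M f"
proof (rule power2_le_imp_le)
 have g: "sqint M g" using sqint_dominated[OF assms(1-3)] .
 have "(LINT x|M. nsq (g x)) <= (LINT x|M. c\<^sup>2 * nsq (f x))"
 proof (rule integral_mono_AE)
  show "AE x in M. nsq (g x) <= c\<^sup>2 * nsq (f x)"
   using assms(3) by eventually_elim (metis power_mono norm_ge_zero power_mult_distrib)
 qed (use g assms(1) in \<open>auto simp: sqint_def\<close>)
 then show "(nrm2 M g)\<^sup>2 <= (c * nrm2 M f)\<^sup>2"
  by (simp add: nrm2_sq power_mult_distrib)
qed (use assms in auto)

lemma nrm2_tendsto_norm: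
 assumes "!!n. sqint M (f n)" "sqint M g" "(%n. ndist M (f n) g) ----> 0"
 shows "(%n. nrm2 M (f n)) ----> nrm2 M g"
proof -
 have "\<bar>nrm2 M (f n) - nrm2 M g\<bar> <= ndist M (f n) g" for n
  using nrm2_triangle_diff[OF assms(1)[of n] assms(2) sqint_zero]
   nrm2_triangle_diff[OF assms(2) assms(1)[of n] sqint_zero]
   nrm2_minus_commute[of M "f n" g] by simp
 then have "(%n. nrm2 M (f n) - nrm2 M g) ----> 0"
  by (intro Lim_null_comparison[OF _ assms(3)]) auto
 then show ?thesis by (rule LIM_zero_cancel)
qed

lemma inner_tendsto:
 assumes "!!n. sqint M (f n)" "sqint M f'" "(%n. ndist M (f n) f') ----> 0"
  and "!!n. sqint M (g n)" "sqint M g'" "(%n. ndist M (g n) g') ----> 0"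
 shows "(%n. LINT x|M. f n x \<bullet> g n x) ----> (LINT x|M. f' x \<bullet> g' x)"
proof -
 have bd: "\<bar>(LINT x|M. f n x \<bullet> g n x) - (LINT x|M. f' x \<bullet> g' x)\<bar> \<le>
   ndist M (f n) f' * nrm2 M (g n) + nrm2 M f' * ndist M (g n) g'" for n
 proof -
  have "(LINT x|M. f n x \<bullet> g n x) - (LINT x|M. f' x \<bullet> g' x) =
    (LINT x|M. (f n x - f' x) \<bullet> g n x) + (LINT x|M. f' x \<bullet> (g n x - g' x))"
   unfolding inner_diff_left inner_diff_right
   by (subst (1 2) Bochner_Integration.integral_diff)
    (rule sqint_inner assms | simp)+
  also have "\<bar>...\<bar> <= ndist M (f n) f' * nrm2 M (g n) + nrm2 M f' * ndist M (g n) g'"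
   using CS_ineq[OF sqint_diff[OF assms(1)[of n] assms(2)] assms(4)[of n]]
    CS_ineq[OF assms(2) sqint_diff[OF assms(4)[of n] assms(5)]] by linarith
  finally show ?thesis .
 qed
 have "(%n. ndist M (f n) f' * nrm2 M (g n) + nrm2 M f' * ndist M (g n) g')
   ----> 0 * nrm2 M g' + nrm2 M f' * 0"
  by (intro tendsto_add tendsto_mult tendsto_const assms(3) assms(6) nrm2_tendsto_norm[OF assms(4-6)])
 then have lim: "(%n. ndist M (f n) f' * nrm2 M (g n) + nrm2 M f' * ndist M (g n) g') ----> 0"
  by simp
 have "(%n. (LINT x|M. f n x \<bullet> g n x) - (LINT x|M. f' x \<bullet> g' x)) ----> 0"
  by (rule Lim_null_comparison[OF _ lim]) (simp add: bd)
 then show ?thesis by (rule LIM_zero_cancel)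
qed

section \<open>Completeness of the space of square-integrable functions\<close>

lemma sqint_nn_bound:
 fixes f :: "'x => 'b::euclidean_space"
 assumes "f \<in> borel_measurable M" "(\<integral>\<^sup>+x. ennreal (nsq (f x)) \<partial>M) <= ennreal (c\<^sup>2)" "0 <= c"
 shows "sqint M f" "nrm2 M f <= c"
proof -
 have "(\<integral>\<^sup>+x. ennreal (nsq (f x)) \<partial>M) < \<infinity>"
  using assms(2) by (auto intro: le_less_trans)
 then have i: "integrable M (%x. nsq (f x))"
  using assms(1) by (intro integrableI_nonneg) auto
 then show "sqint M f" using assms(1) by (simp add: sqint_def)
 have "ennreal (LINT x|M. nsq (f x)) <= ennreal (c\<^sup>2)"
  using assms(2) nn_integral_eq_integral[OF i] by simp
 then have "(LINT x|M. nsq (f x)) <= c\<^sup>2" by (simp add: ennreal_le_iff)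
 then show "nrm2 M f <= c" unfolding nrm2_def by (rule real_le_lsqrt[OF assms(3)])
qed

lemma sqint_nn_integral:
 assumes "sqint M f"
 shows "(\<integral>\<^sup>+x. ennreal (nsq (f x)) \<partial>M) = ennreal ((nrm2 M f)\<^sup>2)"
 using assms unfolding nrm2_sq by (intro nn_integral_eq_integral) (auto simp: sqint_def)

text \<open>The factor \<open>2^k\<close> uses up the slack in the hypothesis: the sum of the
  weighted squared steps still has integral at most 2, hence is finite almost everywhere. There the
  k-th step is eventually at most \<open>sqrt (1/2) ^ k\<close>, and the steps form a geometrically
  dominated series.\<close>

lemma sqint_fast_Cauchy_converges:
 fixes f :: "nat => 'x => 'b::euclidean_space"
 assumes f: "!!n. sqint M (f n)" and d: "!!k. ndist M (f (Suc k)) (f k) <= (1/2)^k"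
 shows "AE x in M. convergent (%k. f k x)"
proof -
 define d where "d k x = f (Suc k) x - f k x" for k x
 have sd: "sqint M (d k)" for k unfolding d_def by (intro sqint_diff f)
 have [measurable]: "d k \<in> borel_measurable M" for k using sd by (rule sqint_measurable)
 have "(\<integral>\<^sup>+x. (\<Sum>k. ennreal (2^k * nsq (d k x))) \<partial>M) = (\<Sum>k. \<integral>\<^sup>+x. ennreal (2^k * nsq (d k x)) \<partial>M)"
  by (rule nn_integral_suminf) measurable
 also have "... <= (\<Sum>k. ennreal ((1/2)^k))"
 proof (intro suminf_le summableI)
  fix k
  have "(\<integral>\<^sup>+x. ennreal (2^k * nsq (d k x)) \<partial>M) = ennreal (2^k) * (\<integral>\<^sup>+x. ennreal (nsq (d k x)) \<partial>M)"
   by (simp add: ennreal_mult nn_integral_cmult)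
  also have "... = ennreal (2^k * (nrm2 M (d k))\<^sup>2)"
   by (simp add: sqint_nn_integral[OF sd] ennreal_mult)
  also have "... <= ennreal (2^k * ((1/2)^k)\<^sup>2)"
   using d[of k] by (intro ennreal_leI mult_left_mono power_mono) (auto simp: d_def[abs_def])
  also have "(2::real)^k * ((1/2)^k)\<^sup>2 = (1/2)^k"
   by (simp add: power2_eq_square power_mult_distrib[symmetric] mult.assoc[symmetric])
  finally show "(\<integral>\<^sup>+x. ennreal (2^k * nsq (d k x)) \<partial>M) <= ennreal ((1/2)^k)" .
 qed
 also have "... < \<infinity>"
  by (subst suminf_ennreal2) (auto intro: summable_geometric)
 finally have "(\<integral>\<^sup>+x. (\<Sum>k. ennreal (2^k * nsq (d k x))) \<partial>M) \<noteq> \<infinity>" by simp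
 then have "AE x in M. (\<Sum>k. ennreal (2^k * nsq (d k x))) \<noteq> \<infinity>"
  by (intro nn_integral_PInf_AE) measurable
 then show ?thesis
 proof eventually_elim
  case (elim x)
  have sm: "summable (%k. 2^k * nsq (d k x))"
   using elim by (intro summable_suminf_not_top) (auto simp: top_ennreal_def)
  then have "(%k. 2^k * nsq (d k x)) ----> 0" by (rule summable_LIMSEQ_zero)
  then have ev: "eventually (%k. 2^k * nsq (d k x) < 1) sequentially"
   by (rule order_tendstoD) simp
  define q where "q = sqrt (1/2::real)"
  have q: "0 < q" "q < 1" by (auto simp: q_def)
  have qq: "(q^k)\<^sup>2 = (1/2)^k" for k
   by (simp add: q_def power2_eq_square power_mult_distrib[symmetric] del: real_sqrt_divide)
  from ev have "eventually (%k. norm (d k x) <= q^k) sequentially"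
  proof eventually_elim
   case (elim k)
   then have "nsq (d k x) <= (q^k)\<^sup>2" unfolding qq by (simp add: field_simps)
   then show ?case by (rule power2_le_imp_le) (use q in auto)
  qed
  then have "summable (%k. d k x)"
   by (rule summable_comparison_test_ev) (use q in \<open>auto intro: summable_geometric\<close>)
  then have "(%n. f 0 x + (\<Sum>k<n. d k x)) ----> f 0 x + (\<Sum>k. d k x)"
   by (intro tendsto_intros summable_LIMSEQ)
  moreover have "f 0 x + (\<Sum>k<n. d k x) = f n x" for n
  proof (induction n)
   case (Suc n)
   have "f 0 x + (\<Sum>k<Suc n. d k x) = (f 0 x + (\<Sum>k<n. d k x)) + d n x" by simp
   then show ?case unfolding Suc by (simp add: d_def)
  qed simp
  ultimately show ?case by (auto simp: convergent_def)
 qed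
qed

text \<open>A fast subsequence converges almost everywhere. Fatou's lemma then carries the Cauchy
  bound from members of that subsequence to its limit, which gives convergence in norm of the whole
  sequence.\<close>

lemma sqint_complete:
 fixes f :: "nat => 'x => 'b::euclidean_space"
 assumes f: "!!n. sqint M (f n)"
  and c: "!!e. e > 0 ==> \<exists>N. \<forall>i\<ge>N. \<forall>j\<ge>N. ndist M (f i) (f j) < e"
 obtains g where "sqint M g" "(%n. ndist M (f n) g) ----> 0"
proof -
 have "\<exists>N. \<forall>i\<ge>N. \<forall>j\<ge>N. ndist M (f i) (f j) < (1/2)^k" for k by (rule c) simp
 then obtain N where N: "!!k i j. i \<ge> N k ==> j \<ge> N k ==> ndist M (f i) (f j) < (1/2)^k" by metis
 \<comment> \<open>The sum makes the indices nondecreasing and at least \<open>N k\<close>; the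
   summand k sends them to infinity, as the application of Fatou's lemma requires.\<close>
 define r where "r k = k + (\<Sum>i\<le>k. N i)" for k
 have rN: "N k <= r k" for k
  using member_le_sum[of k "{..k}" N] by (simp add: r_def)
 have rS: "r k <= r (Suc k)" for k by (simp add: r_def)
 have rk: "k <= r k" for k by (simp add: r_def)
 have fm[measurable]: "f k \<in> borel_measurable M" for k using f by (rule sqint_measurable)
 have ae: "AE x in M. convergent (%k. f (r k) x)"
  by (intro sqint_fast_Cauchy_converges f less_imp_le[OF N] rN order_trans[OF rN rS])
 define g where "g x = lim (%k. f (r k) x)" for x
 have gm[measurable]: "g \<in> borel_measurable M"
  unfolding g_def by (rule borel_measurable_lim_metric) measurable
 have bd: "(\<integral>\<^sup>+x. ennreal (nsq (f i x - g x)) \<partial>M) <= ennreal (e\<^sup>2)"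
  if e: "e > 0" and n: "!!j. j \<ge> n ==> ndist M (f i) (f j) <= e" for i e n
 proof -
  have "(\<integral>\<^sup>+x. ennreal (nsq (f i x - g x)) \<partial>M)
    = (\<integral>\<^sup>+x. liminf (%k. ennreal (nsq (f i x - f (r k) x))) \<partial>M)"
  proof (rule nn_integral_cong_AE)
   show "AE x in M. ennreal (nsq (f i x - g x)) = liminf (%k. ennreal (nsq (f i x - f (r k) x)))"
    using ae
   proof eventually_elim
    case (elim x)
    then have "(%k. f (r k) x) ----> g x" by (simp add: convergent_LIMSEQ_iff g_def)
    then have "(%k. ennreal (nsq (f i x - f (r k) x))) ----> ennreal (nsq (f i x - g x))"
     by (intro tendsto_ennrealI tendsto_intros)
    then show ?case by (intro lim_imp_Liminf[symmetric]) auto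
   qed
  qed
  also have "... <= liminf (%k. \<integral>\<^sup>+x. ennreal (nsq (f i x - f (r k) x)) \<partial>M)"
   by (intro nn_integral_liminf) measurable
  also have "... <= liminf (%k. ennreal (e\<^sup>2))"
  proof (rule Liminf_mono)
   show "eventually (%k. (\<integral>\<^sup>+x. ennreal (nsq (f i x - f (r k) x)) \<partial>M) <= ennreal (e\<^sup>2)) sequentially"
    using eventually_ge_at_top[of n]
   proof eventually_elim
    case (elim k)
    have "ndist M (f i) (f (r k)) <= e" using elim rk[of k] by (intro n) simp
    then show ?case
     unfolding sqint_nn_integral[OF sqint_diff[OF f f]] by (intro ennreal_leI power_mono) auto
   qed
  qed
  also have "... = ennreal (e\<^sup>2)" by (simp add: Liminf_const)
  finally show ?thesis .
 qed
 show ?thesis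
 proof (rule that)
  have "sqint M (%x. f (N 0) x - g x)"
   using bd[of 1 "N 0" "N 0"] N[of 0 "N 0"] by (intro sqint_nn_bound(1)[where c=1]) (auto intro: less_imp_le)
  then have "sqint M (%x. f (N 0) x - (f (N 0) x - g x))" by (rule sqint_diff[OF f])
  moreover have "f (N 0) x - (f (N 0) x - g x) = g x" for x by simp
  ultimately show "sqint M g" by (simp only:)
  show "(%n. ndist M (f n) g) ----> 0"
  proof (rule LIMSEQ_I)
   fix e :: real assume "e > 0"
   then obtain n where n: "!!i j. i \<ge> n ==> j \<ge> n ==> ndist M (f i) (f j) < e/2"
    using c[of "e/2"] by auto
   have le: "ndist M (f i) g <= e/2" if "i \<ge> n" for i
    using bd[of "e/2" n i] n[OF that] \<open>e > 0\<close> by (intro sqint_nn_bound(2)) (auto intro: less_imp_le)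
   show "\<exists>n. \<forall>i\<ge>n. norm (ndist M (f i) g - 0) < e"
   proof (intro exI[of _ n] allI impI)
    fix i assume "n <= i"
    then show "norm (ndist M (f i) g - 0) < e" using le[of i] \<open>e > 0\<close> by simp
   qed
  qed
 qed
qed

section \<open>Smooth functions and test functions\<close>

lemma C_diff_SucI:
 assumes "!!x. (f has_derivative F x) (at x)" "!!b. b \<in> Basis ==> C_diff k (%x. F x b)"
 shows "C_diff (Suc k) f"
proof -
 have "frechet_derivative f (at x) = F x" for x
  using frechet_derivative_at[OF assms(1)] by simp
 then show ?thesis using assms by (auto simp: differentiable_def)
qed

lemma C_diff_has_derivative:
 assumes "C_diff (Suc k) f"
 shows "(f has_derivative frechet_derivative f (at x)) (at x)"
 using assms by (simp add: frechet_derivative_works)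

lemma C_diff_continuous: "C_diff k f ==> continuous_on UNIV f"
proof (cases k)
 case (Suc m)
 assume "C_diff k f"
 then have "f differentiable_on UNIV"
  using Suc by (auto simp: differentiable_on_def differentiable_at_withinI)
 then show ?thesis by (rule differentiable_imp_continuous_on)
qed simp

lemma C_diff_Suc_imp: "C_diff (Suc k) f ==> C_diff k f"
proof (induction k arbitrary: f)
 case 0
 then show ?case using C_diff_continuous[of "Suc 0" f] by simp
next
 case (Suc k)
 then show ?case unfolding C_diff.simps(2)[of "Suc k"] C_diff.simps(2)[of k] by blast
qed

lemma C_diff_const: "C_diff k (%x. c)"
 by (induction k arbitrary: c) (auto intro!: C_diff_SucI[where F="%_ _. 0"] simp del: C_diff.simps(2))

lemma C_diff_add: "C_diff k f ==> C_diff k g ==> C_diff k (%x. f x + g x)"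
proof (induction k arbitrary: f g)
 case 0
 then show ?case by (auto intro: continuous_on_add)
next
 case (Suc k)
 have "C_diff k (%x. frechet_derivative f (at x) b + frechet_derivative g (at x) b)" if "b \<in> Basis" for b
  using Suc.prems that by (intro Suc.IH) auto
 then show ?case
  by (intro C_diff_SucI[where F="%x h. frechet_derivative f (at x) h + frechet_derivative g (at x) h"]
     has_derivative_add C_diff_has_derivative[OF Suc.prems(1)] C_diff_has_derivative[OF Suc.prems(2)])
qed

lemma C_diff_mult: "C_diff k f ==> C_diff k g ==> C_diff k (%x. f x * g x)"
proof (induction k arbitrary: f g)
 case 0
 then show ?case by (auto intro: continuous_on_mult)
next
 case (Suc k)
 have "C_diff k (%x. f x * frechet_derivative g (at x) b + frechet_derivative f (at x) b * g x)" if "b \<in> Basis" for b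
  using Suc.prems that C_diff_Suc_imp[OF Suc.prems(1)] C_diff_Suc_imp[OF Suc.prems(2)]
  by (intro C_diff_add Suc.IH) auto
 then show ?case
  by (intro C_diff_SucI[where F="%x h. f x * frechet_derivative g (at x) h + frechet_derivative f (at x) h * g x"]
     has_derivative_mult C_diff_has_derivative[OF Suc.prems(1)] C_diff_has_derivative[OF Suc.prems(2)])
qed

lemma C_diff_sum: "finite I ==> (!!i. i \<in> I ==> C_diff k (f i)) ==> C_diff k (%x. \<Sum>i\<in>I. f i x)"
 by (induction I rule: finite_induct) (auto simp: C_diff_const C_diff_add)

lemma C_diff_prod: "finite I ==> (!!i. i \<in> I ==> C_diff k (f i)) ==> C_diff k (%x. \<Prod>i\<in>I. f i x)"
 by (induction I rule: finite_induct) (auto simp: C_diff_const C_diff_mult)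

text \<open>The chain rule produces derivatives in the directions \<open>L b\<close>, which need not
  be basis vectors. Expanding them in the basis brings back the partial derivatives of which the
  induction hypothesis speaks.\<close>

lemma C_diff_affine:
 fixes f :: "'c::euclidean_space => real" and L :: "'a::euclidean_space => 'c"
 assumes L: "bounded_linear L"
 shows "C_diff k f ==> C_diff k (%x. f (L x + c))"
proof (induction k arbitrary: f)
 case 0
 then show ?case
  by (auto intro!: continuous_on_compose2[of UNIV f] continuous_intros linear_continuous_on[OF L])
next
 case (Suc k)
 have lin: "linear (frechet_derivative f (at x))" for x
  using C_diff_has_derivative[OF Suc.prems(1)] has_derivative_linear by blast
 have "C_diff k (%x. frechet_derivative f (at (L x + c)) (L b))" if "b \<in> Basis" for b
 proof -
  have "frechet_derivative f (at (L x + c)) (L b) = (\<Sum>i\<in>Basis. (L b \<bullet> i) * frechet_derivative f (at (L x + c)) i)" for x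
  proof -
   have "frechet_derivative f (at (L x + c)) (L b) = frechet_derivative f (at (L x + c)) (\<Sum>i\<in>Basis. (L b \<bullet> i) *\<^sub>R i)"
    by (simp add: euclidean_representation)
   also have "... = (\<Sum>i\<in>Basis. (L b \<bullet> i) * frechet_derivative f (at (L x + c)) i)"
    by (simp add: linear_sum[OF lin] linear_cmul[OF lin])
   finally show ?thesis .
  qed
  then show ?thesis
   using Suc.prems by (auto intro!: C_diff_sum C_diff_mult C_diff_const Suc.IH)
 qed
 moreover have "((%x. f (L x + c)) has_derivative (%h. frechet_derivative f (at (L x + c)) (L h))) (at x)" for x
 proof -
  have "((%x. L x + c) has_derivative (%h. L h)) (at x)"
   using has_derivative_add[OF bounded_linear.has_derivative[OF L has_derivative_ident] has_derivative_const, of c "at x"]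
   by simp
  from has_derivative_compose[OF this C_diff_has_derivative[OF Suc.prems]]
  show ?thesis .
 qed
 ultimately show ?case
  by (intro C_diff_SucI[where F="%x h. frechet_derivative f (at (L x + c)) (L h)"])
qed

lemma C_diff_linear:
 fixes L :: "'a::euclidean_space => real"
 assumes "bounded_linear L" shows "C_diff k L"
proof (cases k)
 case 0 then show ?thesis using assms by (simp add: linear_continuous_on)
next
 case (Suc m)
 show ?thesis unfolding Suc
  by (rule C_diff_SucI[where F="%_. L"]) (auto intro: C_diff_const bounded_linear_imp_has_derivative assms)
qed

lemma C_diff_exp:
 fixes q :: "'a::euclidean_space => real"
 assumes "!!k. C_diff k q"
 shows "C_diff k (%x. exp (q x))"
proof (induction k)
 case 0
 then show ?case using assms[of 0] by (auto intro: continuous_on_exp)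
next
 case (Suc k)
 show ?case
 proof (rule C_diff_SucI[where F="%x h. exp (q x) * frechet_derivative q (at x) h"])
  show "((%x. exp (q x)) has_derivative (%h. exp (q x) * frechet_derivative q (at x) h)) (at x)" for x
   using C_diff_has_derivative[OF assms[of "Suc 0"], of x]
   by (auto intro!: derivative_eq_intros)
  show "C_diff k (%x. exp (q x) * frechet_derivative q (at x) b)" if "b \<in> Basis" for b
   using assms[of "Suc k"] that by (intro C_diff_mult Suc) auto
 qed
qed

text \<open>The functions \<open>t\<^sup>-\<^sup>n exp (-1/t)\<close> for \<open>t > 0\<close> span a space closed under differentiation.\<close>

definition flat :: "nat => real => real" where
 "flat n t = (if t > 0 then (1/t)^n * exp (- (1/t)) else 0)"

lemma flat_tendsto_0: "(flat n \<longlongrightarrow> 0) (at 0)"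
proof -
 have "((%t::real. (1/t)^n / exp (1/t)) \<longlongrightarrow> 0) (at_right 0)"
  using filterlim_compose[OF tendsto_power_div_exp_0[of n] filterlim_inverse_at_top_right]
  by (simp add: inverse_eq_divide)
 moreover have "eventually (%t. (1/t)^n / exp (1/t) = flat n t) (at_right 0)"
  by (auto simp: eventually_at_filter flat_def exp_minus field_simps)
 ultimately have "(flat n \<longlongrightarrow> 0) (at_right 0)"
  by (rule Lim_transform_eventually)
 moreover have "(flat n \<longlongrightarrow> 0) (at_left 0)"
 proof (rule tendsto_eventually)
  show "eventually (%t. flat n t = 0) (at_left 0)"
   by (auto simp: eventually_at_filter flat_def)
 qed
 ultimately show ?thesis by (simp add: filterlim_at_split)
qed

lemma flat_deriv: "(flat n has_real_derivative (flat (n+2) t - real n * flat (Suc n) t)) (at t)"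
proof -
 consider "t > 0" | "t < 0" | "t = 0" by linarith
 then show ?thesis
 proof cases
  case 1
  have "((%t. (1/t)^n * exp (- (1/t))) has_real_derivative (flat (n+2) t - real n * flat (Suc n) t)) (at t)"
  proof -
   define s where "s = 1 / t"
   have d: "((%t. 1 / t) has_real_derivative - (s * s)) (at t)"
    using 1 by (auto intro!: derivative_eq_intros simp: s_def)
   have "((%t. (1/t)^n * exp (- (1/t))) has_real_derivative
     (real n * (- (s * s) * s ^ (n - Suc 0))) * exp (- s) + (exp (- s) * - (- (s * s))) * s ^ n) (at t)"
    using DERIV_mult[OF DERIV_power[OF d, of n] DERIV_chain2[OF DERIV_exp DERIV_minus[OF d]]]
    by (simp add: s_def)
   moreover have "(real n * (- (s * s) * s ^ (n - Suc 0))) * exp (- s) + (exp (- s) * - (- (s * s))) * s ^ n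
     = flat (n+2) t - real n * flat (Suc n) t"
    using 1 by (cases n) (simp_all add: flat_def s_def[symmetric] algebra_simps)
   ultimately show ?thesis by simp
  qed
  then show ?thesis
   by (rule has_field_derivative_transform_within_open[of _ _ _ "{0<..}"]) (use 1 in \<open>auto simp: flat_def\<close>)
 next
  case 2
  have "((%t. 0) has_real_derivative (flat (n+2) t - real n * flat (Suc n) t)) (at t)"
   using 2 by (simp add: flat_def)
  then show ?thesis
   by (rule has_field_derivative_transform_within_open[of _ _ _ "{..<0}"]) (use 2 in \<open>auto simp: flat_def\<close>)
 next
  case 3
  \<comment> \<open>At the gluing point the difference quotient of \<open>flat n\<close> is
    \<open>flat (Suc n)\<close>, which tends to 0.\<close>
  have "((%h. (flat n (0 + h) - flat n 0) / h) \<longlongrightarrow> 0) (at 0)"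
  proof (rule Lim_transform_eventually[OF flat_tendsto_0[of "Suc n"]])
   show "eventually (%h. flat (Suc n) h = (flat n (0 + h) - flat n 0) / h) (at 0)"
    by (auto simp: eventually_at_filter flat_def)
  qed
  then have "(flat n has_real_derivative 0) (at 0)" by (simp add: DERIV_def)
  then show ?thesis using 3 by (simp add: flat_def)
 qed
qed

lemma C_diff_flat: "C_diff k (flat n)"
proof (induction k arbitrary: n)
 case 0
 have "isCont (flat n) t" for t by (rule DERIV_isCont[OF flat_deriv])
 then show ?case by (simp add: continuous_on_eq_continuous_at)
next
 case (Suc k)
 show ?case
 proof (rule C_diff_SucI[where F="%t h. (flat (n+2) t + (- real n) * flat (Suc n) t) * h"])
  show "(flat n has_derivative (%h. (flat (n+2) t + (- real n) * flat (Suc n) t) * h)) (at t)" for t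
   using flat_deriv[of n t] by (simp add: has_field_derivative_def)
  show "C_diff k (%t. (flat (n+2) t + (- real n) * flat (Suc n) t) * b)" for b
   by (intro C_diff_mult C_diff_add C_diff_const Suc)
 qed
qed

definition smooth_fun :: "('a::euclidean_space => real) => bool" where
 "smooth_fun f \<longleftrightarrow> (\<forall>k. C_diff k f)"

lemma smooth_fun_add: "smooth_fun f ==> smooth_fun g ==> smooth_fun (%x. f x + g x)"
 and smooth_fun_mult: "smooth_fun f ==> smooth_fun g ==> smooth_fun (%x. f x * g x)"
 and smooth_fun_const: "smooth_fun (%x. c)"
 and smooth_fun_sum: "finite I ==> (!!i. i \<in> I ==> smooth_fun (F i)) ==> smooth_fun (%x. \<Sum>i\<in>I. F i x)"
 and smooth_fun_prod: "finite I ==> (!!i. i \<in> I ==> smooth_fun (F i)) ==> smooth_fun (%x. \<Prod>i\<in>I. F i x)"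
 and smooth_fun_exp: "smooth_fun f ==> smooth_fun (%x. exp (f x))"
 and smooth_fun_linear: "bounded_linear f ==> smooth_fun f"
 and smooth_fun_affine: "bounded_linear L ==> smooth_fun h ==> smooth_fun (%x. h (L x + c'))"
 unfolding smooth_fun_def
 by (auto intro: C_diff_add C_diff_mult C_diff_const C_diff_sum C_diff_prod C_diff_exp C_diff_linear C_diff_affine)

lemma smooth_fun_continuous: "smooth_fun f ==> continuous_on S f"
 using C_diff_continuous continuous_on_subset unfolding smooth_fun_def by blast

lemma smooth_fun_has_derivative: "smooth_fun f ==> (f has_derivative frechet_derivative f (at x)) (at x)"
 using C_diff_has_derivative unfolding smooth_fun_def by blast

lemma smooth_fun_deriv: "smooth_fun f ==> b \<in> Basis ==> smooth_fun (%x. frechet_derivative f (at x) b)"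
 unfolding smooth_fun_def using C_diff.simps(2) by blast

lemma smooth_funI:
 assumes "!!x. (f has_derivative F x) (at x)" "!!b. b \<in> Basis ==> smooth_fun (%x. F x b)"
 shows "smooth_fun f"
 unfolding smooth_fun_def
proof
 fix k
 have "C_diff (Suc k) f" using assms by (intro C_diff_SucI) (auto simp: smooth_fun_def)
 then show "C_diff k f" by (rule C_diff_Suc_imp)
qed

lemma smooth_fun_norm_sq: "smooth_fun (%x::'a::euclidean_space. nsq (x - a))"
proof -
 have "smooth_fun (%x::'a. \<Sum>b\<in>Basis. (x \<bullet> b + (- (a \<bullet> b))) * (x \<bullet> b + (- (a \<bullet> b))))"
  by (intro smooth_fun_sum smooth_fun_mult smooth_fun_add smooth_fun_const smooth_fun_linear
    bounded_linear_inner_left finite_Basis)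
 moreover have "(\<Sum>b\<in>Basis. (x \<bullet> b + (- (a \<bullet> b))) * (x \<bullet> b + (- (a \<bullet> b)))) = nsq (x - a)" for x
  unfolding power2_norm_eq_inner by (subst euclidean_inner) (simp add: inner_diff_left)
 ultimately show ?thesis by simp
qed

section \<open>Gradients of smooth functions\<close>

definition grad :: "('a::euclidean_space => real) => 'a => 'a" where
 "grad f x = (\<Sum>b\<in>Basis. frechet_derivative f (at x) b *\<^sub>R b)"

lemma frechet_derivative_grad:
 assumes "(f has_derivative D) (at x)"
 shows "D h = grad f x \<bullet> h"
proof -
 have D: "D = frechet_derivative f (at x)" using frechet_derivative_at[OF assms] .
 have lin: "linear D" using assms has_derivative_linear by blast
 have "D h = D (\<Sum>b\<in>Basis. (h \<bullet> b) *\<^sub>R b)" by (simp add: euclidean_representation)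
 also have "... = (\<Sum>b\<in>Basis. (h \<bullet> b) * D b)" by (simp add: linear_sum[OF lin] linear_cmul[OF lin])
 also have "... = (\<Sum>b\<in>Basis. D b * (b \<bullet> h))" by (intro sum.cong refl) (simp add: inner_commute)
 also have "... = grad f x \<bullet> h" by (simp add: grad_def D inner_sum_left)
 finally show ?thesis .
qed

lemma grad_eqI:
 assumes "(f has_derivative (%h. g \<bullet> h)) (at x)"
 shows "grad f x = g"
proof -
 have "grad f x \<bullet> h = g \<bullet> h" for h using frechet_derivative_grad[OF assms, of h] by simp
 then show ?thesis by (metis vector_eq_rdot)
qed

lemma smooth_fun_has_derivative_grad: "smooth_fun f ==> (f has_derivative (%h. grad f x \<bullet> h)) (at x)"
proof -
 assume f: "smooth_fun f"
 have "frechet_derivative f (at x) = (%h. grad f x \<bullet> h)"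
  using frechet_derivative_grad[OF smooth_fun_has_derivative[OF f]] by (simp add: fun_eq_iff)
 then show ?thesis using smooth_fun_has_derivative[OF f, of x] by simp
qed

lemma grad_inner_Basis: "b \<in> Basis ==> grad f x \<bullet> b = frechet_derivative f (at x) b"
 by (simp add: grad_def inner_sum_left inner_Basis if_distrib sum.delta cong: if_cong)

lemma continuous_on_grad: "smooth_fun f ==> continuous_on S (grad f)"
 unfolding grad_def[abs_def]
 by (intro continuous_intros smooth_fun_continuous smooth_fun_deriv)

lemma grad_mult:
 assumes "smooth_fun f" "smooth_fun g"
 shows "grad (%x. f x * g x) x = f x *\<^sub>R grad g x + g x *\<^sub>R grad f x"
 by (rule grad_eqI)
   (auto intro!: derivative_eq_intros smooth_fun_has_derivative_grad assms simp: inner_add_left)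

lemma grad_lincomb:
 assumes "smooth_fun f" "smooth_fun g"
 shows "grad (%x. a * f x + b * g x) x = a *\<^sub>R grad f x + b *\<^sub>R grad g x"
 by (rule grad_eqI)
   (auto intro!: derivative_eq_intros smooth_fun_has_derivative_grad assms simp: inner_add_left)

section \<open>Test functions\<close>

lemma test_functions_iff:
 "\<phi> \<in> test_functions \<Omega> \<longleftrightarrow> smooth_fun \<phi> \<and> (\<exists>K. compact K \<and> K \<subseteq> \<Omega> \<and> (\<forall>x. x \<notin> K \<longrightarrow> \<phi> x = 0))"
 by (simp add: test_functions_def smooth_fun_def)

lemma test_smooth: "\<phi> \<in> test_functions \<Omega> ==> smooth_fun \<phi>"
 by (simp add: test_functions_iff)

lemma grad_zero_off:
 assumes "closed K" "!!x. x \<notin> K ==> \<phi> x = 0" "x \<notin> K"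
 shows "grad \<phi> x = 0"
proof (rule grad_eqI)
 have "((%x. 0) has_derivative (%h. 0)) (at x)" by simp
 then have "(\<phi> has_derivative (%h. 0)) (at x)"
  by (rule has_derivative_transform_within_open[of _ _ _ _ "- K"]) (use assms in auto)
 then show "(\<phi> has_derivative (%h. 0 \<bullet> h)) (at x)" by simp
qed

lemma test_obtain:
 assumes "\<phi> \<in> test_functions \<Omega>"
 obtains K where "compact K" "K \<subseteq> \<Omega>" "!!x. x \<notin> K ==> \<phi> x = 0" "!!x. x \<notin> K ==> grad \<phi> x = 0"
 using assms grad_zero_off[of _ \<phi>] compact_imp_closed unfolding test_functions_iff by metis

lemma test_lincomb:
 assumes "\<phi> \<in> test_functions \<Omega>" "\<psi> \<in> test_functions \<Omega>"
 shows "(%x. a * \<phi> x + b * \<psi> x) \<in> test_functions \<Omega>"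
proof -
 obtain K where K: "compact K" "K \<subseteq> \<Omega>" "!!x. x \<notin> K ==> \<phi> x = 0" using test_obtain[OF assms(1)] by metis
 obtain L where L: "compact L" "L \<subseteq> \<Omega>" "!!x. x \<notin> L ==> \<psi> x = 0" using test_obtain[OF assms(2)] by metis
 show ?thesis unfolding test_functions_iff
  using K L assms
  by (intro conjI exI[of _ "K \<union> L"]) (auto intro!: smooth_fun_add smooth_fun_mult smooth_fun_const simp: test_functions_iff)
qed

lemma test_mult:
 assumes "\<phi> \<in> test_functions \<Omega>" "smooth_fun p"
 shows "(%x. \<phi> x * p x) \<in> test_functions \<Omega>"
 using assms by (auto simp: test_functions_iff intro!: smooth_fun_mult)

lemma test_zero: "(%x. 0) \<in> test_functions \<Omega>"
 by (auto simp: test_functions_iff smooth_fun_const intro!: exI[of _ "{}"])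

lemma test_bounded:
 assumes "\<phi> \<in> test_functions \<Omega>"
 obtains B where "0 <= B" "!!x. \<bar>\<phi> x\<bar> <= B" "!!x. norm (grad \<phi> x) <= B"
proof -
 obtain K where K: "compact K" "K \<subseteq> \<Omega>" "!!x. x \<notin> K ==> \<phi> x = 0" "!!x. x \<notin> K ==> grad \<phi> x = 0"
  using test_obtain[OF assms] by metis
 have "bounded (\<phi> ` K)" "bounded (grad \<phi> ` K)"
  using K test_smooth[OF assms]
  by (auto intro!: compact_imp_bounded compact_continuous_image smooth_fun_continuous continuous_on_grad)
 then obtain B1 B2 where "!!x. x \<in> K ==> \<bar>\<phi> x\<bar> <= B1" "!!x. x \<in> K ==> norm (grad \<phi> x) <= B2"
  unfolding bounded_iff by auto
 then show ?thesis using K(3,4)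
  by (intro that[of "max 0 (max B1 B2)"]) (metis abs_zero norm_zero max.coboundedI1 max.coboundedI2 order_refl)+
qed

text \<open>Smooth functions with values in [0, 1] that vanish off the open box and tend to its
  indicator pointwise as k grows. By dominated convergence, an integral that vanishes against test
  functions then vanishes over boxes.\<close>

definition bump :: "'a::euclidean_space => 'a => nat => 'a => real" where
 "bump a b k x = (\<Prod>i\<in>Basis. flat 0 (real (Suc k) * (x \<bullet> i - a \<bullet> i)) * flat 0 (real (Suc k) * (b \<bullet> i - x \<bullet> i)))"

lemma flat_0_bounds: "0 <= flat 0 t" "flat 0 t <= 1"
 by (auto simp: flat_def)

lemma bump_bounds: "0 <= bump a b k x" "bump a b k x <= 1"
 unfolding bump_def by (auto intro!: prod_nonneg prod_le_1 mult_nonneg_nonneg mult_le_one flat_0_bounds)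

lemma bump_zero: "x \<notin> box a b ==> bump a b k x = 0"
 by (auto simp: bump_def mem_box flat_def zero_less_mult_iff)

lemma smooth_bump: "smooth_fun (bump a b k)"
proof -
 have f: "smooth_fun (flat 0)" by (simp add: smooth_fun_def C_diff_flat)
 have 1: "smooth_fun (%x::'a. flat 0 (real (Suc k) * (x \<bullet> i) + (- real (Suc k) * (a \<bullet> i))))" for i
  by (rule smooth_fun_affine[OF _ f]) (intro bounded_linear_const_mult bounded_linear_inner_left)
 have 2: "smooth_fun (%x::'a. flat 0 (- real (Suc k) * (x \<bullet> i) + (real (Suc k) * (b \<bullet> i))))" for i
  by (rule smooth_fun_affine[OF _ f]) (intro bounded_linear_const_mult bounded_linear_inner_left)
 have "smooth_fun (%x::'a. \<Prod>i\<in>Basis. flat 0 (real (Suc k) * (x \<bullet> i) + (- real (Suc k) * (a \<bullet> i))) *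
   flat 0 (- real (Suc k) * (x \<bullet> i) + (real (Suc k) * (b \<bullet> i))))"
  by (intro smooth_fun_prod smooth_fun_mult 1 2 finite_Basis)
 then show ?thesis by (simp add: bump_def[abs_def] algebra_simps)
qed

lemma bump_test: "cbox a b \<subseteq> \<Omega> ==> bump a b k \<in> test_functions \<Omega>"
 unfolding test_functions_iff
 by (intro conjI smooth_bump exI[of _ "cbox a b"]) (auto intro!: bump_zero compact_cbox simp: box_subset_cbox[THEN subsetD])

lemma flat_0_tendsto:
 assumes "t > 0" shows "(%k. flat 0 (real (Suc k) * t)) ----> 1"
proof -
 have "(%k. exp (- ((1/t) * inverse (real (Suc k))))) ----> exp (- ((1/t) * 0))"
  by (intro tendsto_intros LIMSEQ_inverse_real_of_nat)
 moreover have "flat 0 (real (Suc k) * t) = exp (- ((1/t) * inverse (real (Suc k))))" for k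
  using assms by (simp add: flat_def inverse_eq_divide mult.commute)
 ultimately show ?thesis by simp
qed

lemma bump_tendsto: "(%k. bump a b k x) ----> indicator (box a b) x"
proof (cases "x \<in> box a b")
 case True
 have "(%k. bump a b k x) ----> (\<Prod>i\<in>(Basis::'a set). 1 * 1)"
  unfolding bump_def using True
  by (intro tendsto_prod tendsto_mult flat_0_tendsto) (auto simp: mem_box)
 then show ?thesis using True by simp
qed (simp add: bump_zero)

section \<open>The fundamental lemma\<close>

lemma DERIV_integral:
 fixes f f' :: "real => 'x => real"
 assumes ab: "a < r0" "r0 < b"
  and int: "!!r. a < r ==> r < b ==> integrable M (f r)"
  and der: "!!r x. a < r ==> r < b ==> x \<in> space M ==> ((%r. f r x) has_real_derivative f' r x) (at r)"
  and bd: "!!r x. a < r ==> r < b ==> x \<in> space M ==> \<bar>f' r x\<bar> <= w x"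
  and w: "integrable M w" and meas: "f' r0 \<in> borel_measurable M"
 shows "((%r. LINT x|M. f r x) has_real_derivative (LINT x|M. f' r0 x)) (at r0)"
 unfolding DERIV_def tendsto_at_iff_sequentially
proof (intro allI impI)
 fix h :: "nat => real" assume h: "\<forall>i. h i \<in> UNIV - {0}" and h0: "h ----> 0"
 have "eventually (%n. a - r0 < h n) sequentially" "eventually (%n. h n < b - r0) sequentially"
  using ab by (intro order_tendstoD[OF h0]; simp)+
 then have "eventually (%n. a < r0 + h n \<and> r0 + h n < b) sequentially"
  by eventually_elim auto
 then obtain N where N: "!!n. n \<ge> N ==> a < r0 + h n \<and> r0 + h n < b"
  by (auto simp: eventually_sequentially)
 \<comment> \<open>Dropping the first N terms keeps all increments inside the interval on which the
   derivative is dominated; there the mean value inequality bounds the difference quotients by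
   \<open>w\<close>.\<close>
 define k where "k n = h (n + N)" for n
 have k0: "k ----> 0" unfolding k_def using h0 by (rule LIMSEQ_ignore_initial_segment)
 have k: "a < r0 + k n" "r0 + k n < b" "k n \<noteq> 0" for n using N[of "n + N"] h by (auto simp: k_def)
 have "(%n. LINT x|M. (f (r0 + k n) x - f r0 x) / k n) ----> (LINT x|M. f' r0 x)"
 proof (rule integral_dominated_convergence[where w=w])
  show "(%x. (f (r0 + k n) x - f r0 x) / k n) \<in> borel_measurable M" for n
   using int[OF k(1,2), of n] int[OF ab] by (auto intro!: borel_measurable_divide borel_measurable_diff)
  show "AE x in M. (%n. (f (r0 + k n) x - f r0 x) / k n) ----> f' r0 x"
  proof (rule AE_I2)
   fix x assume "x \<in> space M"
   then have "((%h. (f (r0 + h) x - f r0 x) / h) \<longlongrightarrow> f' r0 x) (at 0)"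
    using der[OF ab] by (simp add: DERIV_def)
   then show "(%n. (f (r0 + k n) x - f r0 x) / k n) ----> f' r0 x"
    unfolding tendsto_at_iff_sequentially using k k0 by (auto simp: comp_def)
  qed
  show "AE x in M. norm ((f (r0 + k n) x - f r0 x) / k n) <= w x" for n
  proof (rule AE_I2)
   fix x assume x: "x \<in> space M"
   have "norm (f (r0 + k n) x - f r0 x) <= w x * norm (r0 + k n - r0)"
    by (rule field_differentiable_bound[where S="{a<..<b}" and f'="%r. f' r x"])
      (use x k ab bd der in \<open>auto intro: has_field_derivative_at_within\<close>)
   then show "norm ((f (r0 + k n) x - f r0 x) / k n) <= w x"
    using k(3)[of n] by (simp add: field_simps)
  qed
 qed (use w meas in auto)
 then have "(%n. ((LINT x|M. f (r0 + k n) x) - (LINT x|M. f r0 x)) / k n) ----> (LINT x|M. f' r0 x)"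
  using Bochner_Integration.integral_diff[OF int[OF k(1,2)] int[OF ab]] by simp
 then have "(%n. ((%h. ((LINT x|M. f (r0 + h) x) - (LINT x|M. f r0 x)) / h) \<circ> h) (n + N)) ----> (LINT x|M. f' r0 x)"
  by (simp add: k_def comp_def)
 then show "((%h. ((LINT x|M. f (r0 + h) x) - (LINT x|M. f r0 x)) / h) \<circ> h) ----> (LINT x|M. f' r0 x)"
  by (rule LIMSEQ_offset)
qed

text \<open>Open boxes form an intersection-stable generator of the Borel sets, so the vanishing of
  the set integral spreads to all Borel sets. The step to complements needs the integral over the
  whole space, obtained in \<open>all0\<close> by exhausting the space with growing cubes.\<close>

lemma lborel_AE_zero_boxes:
 fixes g :: "'a::euclidean_space => real"
 assumes g: "integrable lborel g" and z: "!!a b. (LINT x|lborel. indicator (box a b) x * g x) = 0"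
 shows "AE x in lborel. g x = 0"
proof (rule sigma_finite_measure.density_zero[OF sigma_finite_lborel g])
 have all0: "(LINT x|lborel. g x) = 0"
 proof -
  have "(%n::nat. LINT x|lborel. indicator (box (- real n *\<^sub>R One) (real n *\<^sub>R One)) x * g x) ----> (LINT x|lborel. g x)"
  proof (rule integral_dominated_convergence[where w="%x. norm (g x)"])
   show "AE x in lborel. (%n::nat. indicator (box (- real n *\<^sub>R One) (real n *\<^sub>R One)) x * g x) ----> g x"
   proof (rule AE_I2)
    fix x :: 'a
    obtain N :: nat where N: "norm x < real N" using reals_Archimedean2 by blast
    have "indicator (box (- real n *\<^sub>R One) (real n *\<^sub>R One)) x * g x = g x" if "n \<ge> N" for n
    proof -
     have "\<bar>x \<bullet> i\<bar> < real n" if "i \<in> Basis" for i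
      using Basis_le_norm[OF that, of x] N \<open>n \<ge> N\<close> by linarith
     then have "x \<in> box (- real n *\<^sub>R One) (real n *\<^sub>R One)"
      by (auto simp: mem_box abs_less_iff minus_less_iff)
     then show ?thesis by simp
    qed
    then show "(%n::nat. indicator (box (- real n *\<^sub>R One) (real n *\<^sub>R One)) x * g x) ----> g x"
     by (intro tendsto_eventually) (auto simp: eventually_sequentially)
   qed
  qed (use g in \<open>auto simp: indicator_def intro!: integrable_norm\<close>)
  then show ?thesis by (simp add: z LIMSEQ_const_iff)
 qed
 have si: "set_integrable lborel A g" if "A \<in> sets borel" for A
  using that integrable_mult_indicator[OF _ g, of A] by (simp add: set_integrable_def)
 fix A :: "'a set" assume "A \<in> sets lborel"
 then have A: "A \<in> sigma_sets UNIV (range (%(a, b). box a b))"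
  using borel_eq_box by (metis sets_lborel sets_measure_of subset_UNIV Pow_UNIV)
 have "Int_stable (range (%(a, b). box a b :: 'a set))" "range (%(a, b). box a b :: 'a set) \<subseteq> Pow UNIV"
  by (auto simp: Int_stable_def box_Int_box)
 then show "set_lebesgue_integral lborel A g = 0"
  using A
 proof (induction rule: sigma_sets_induct_disjoint)
  case (basic A)
  then obtain a b where "A = box a b" by auto
  then show ?case using z[of a b] by (simp add: set_lebesgue_integral_def)
 next
  case empty then show ?case by (simp add: set_lebesgue_integral_def)
 next
  case (compl A)
  have A: "A \<in> sets borel" using compl(1) borel_eq_box by (metis sets_measure_of subset_UNIV Pow_UNIV)
  have "set_lebesgue_integral lborel (UNIV - A) g = (LINT x|lborel. g x - indicator A x * g x)"
   unfolding set_lebesgue_integral_def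
   by (intro LINT_cong) (auto simp: indicator_def)
  also have "... = 0"
   using compl(2) all0 g si[OF A] by (simp add: set_lebesgue_integral_def set_integrable_def)
  finally show ?case .
 next
  case (union A)
  have A: "A i \<in> sets borel" for i using union(2) borel_eq_box
   by (metis sets_measure_of subset_UNIV Pow_UNIV rangeI subsetD)
  have "(\<Union>i. A i) \<in> sets borel" using A by auto
  then show ?case
   using union(1,3) A si by (subst lebesgue_integral_countable_add) (auto simp: disjoint_family_on_def)
 qed
qed

lemma lebesgue_AE_zero_boxes:
 fixes g :: "'a::euclidean_space => real"
 assumes g: "integrable lebesgue g" and z: "!!a b. (LINT x|lebesgue. indicator (box a b) x * g x) = 0"
 shows "AE x in lebesgue. g x = 0"
proof -
 obtain g' where g'[measurable]: "g' \<in> borel_measurable lborel" and ae: "AE x in lborel. g x = g' x"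
  using completion_ex_borel_measurable_real[of g lborel] g by auto
 have ae': "AE x in lebesgue. g x = g' x" using ae by (rule AE_completion)
 have [measurable]: "g \<in> borel_measurable lebesgue" using g by auto
 have [measurable]: "g' \<in> borel_measurable lebesgue" by (rule measurable_completion) (use g' in simp)
 have [measurable]: "box a b \<in> sets lebesgue" for a b :: 'a by simp
 have "integrable lebesgue g'" using g ae' by (subst integrable_cong_AE[of _ _ g]) auto
 then have "integrable lborel g'" by (simp add: integrable_completion)
 moreover have "(LINT x|lborel. indicator (box a b) x * g' x) = 0" for a b
 proof -
  have "(LINT x|lborel. indicator (box a b) x * g' x) = (LINT x|lebesgue. indicator (box a b) x * g' x)"
   by (rule integral_completion[symmetric]) measurable
  also have "... = (LINT x|lebesgue. indicator (box a b) x * g x)"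
   by (rule integral_cong_AE, measurable) (use ae' in auto)
  finally show ?thesis using z by simp
 qed
 ultimately have "AE x in lborel. g' x = 0" by (rule lborel_AE_zero_boxes)
 then have "AE x in lebesgue. g' x = 0" by (rule AE_completion)
 with ae' show ?thesis by eventually_elim simp
qed

text \<open>Bump functions reduce the hypothesis to integrals over boxes whose closure lies in the
  domain. These determine the function on each such box, and countably many closed boxes cover an
  open set.\<close>

lemma fundamental_lemma:
 fixes g :: "'a::euclidean_space => real"
 assumes \<Omega>: "open \<Omega>" and g: "integrable (lebesgue_on \<Omega>) g"
  and z: "!!\<phi>. \<phi> \<in> test_functions \<Omega> ==> (LINT x|lebesgue_on \<Omega>. g x * \<phi> x) = 0"
 shows "AE x in lebesgue_on \<Omega>. g x = 0"
proof -
 have [simp]: "\<Omega> \<in> sets lebesgue" using \<Omega> by auto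
 define G where "G x = indicator \<Omega> x * g x" for x
 have G: "integrable lebesgue G"
  using g by (simp add: integrable_restrict_space G_def[abs_def])
 then have Gm[measurable]: "G \<in> borel_measurable lebesgue" by auto
 have bm[measurable]: "bump a b k \<in> borel_measurable lebesgue" for a b :: 'a and k
  by (intro measurable_completion) (simp add: borel_measurable_continuous_onI[OF smooth_fun_continuous[OF smooth_bump]])
 have zbox: "(LINT x|lebesgue. indicator (box a b) x * G x) = 0" if ab: "cbox a b \<subseteq> \<Omega>" for a b
 proof -
  have "(%k. LINT x|lebesgue. bump a b k x * G x) ----> (LINT x|lebesgue. indicator (box a b) x * G x)"
  proof (rule integral_dominated_convergence[where w="%x. norm (G x)"])
   show "AE x in lebesgue. (%k. bump a b k x * G x) ----> indicator (box a b) x * G x"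
    by (auto intro!: tendsto_intros bump_tendsto)
   show "AE x in lebesgue. norm (bump a b k x * G x) <= norm (G x)" for k
    using bump_bounds[of a b k] by (intro AE_I2) (simp add: abs_mult mult_left_le_one_le)
  next
   have [measurable]: "box a b \<in> sets lebesgue" by simp
   show "(%x. indicator (box a b) x * G x) \<in> borel_measurable lebesgue" by measurable
  qed (use G in auto)
  moreover have "(LINT x|lebesgue. bump a b k x * G x) = 0" for k
   using z[OF bump_test[OF ab, of k]] by (simp add: integral_restrict_space G_def mult_ac)
  ultimately show ?thesis by (simp add: LIMSEQ_const_iff)
 qed
 have AEbox: "AE x in lebesgue. x \<in> cbox c d \<longrightarrow> G x = 0" if cd: "cbox c d \<subseteq> \<Omega>" for c d
 proof -
  have "AE x in lebesgue. indicator (box c d) x * G x = 0"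
  proof (rule lebesgue_AE_zero_boxes)
   show "integrable lebesgue (%x. indicator (box c d) x * G x)"
    using integrable_mult_indicator[OF _ G, of "box c d"] by simp
   fix a b :: 'a
   \<comment> \<open>Cutting an arbitrary box with the fixed one gives a box whose closure stays in
     the domain, so that the bump functions supported there are admissible.\<close>
   obtain e f where ef: "box a b \<inter> box c d = box e f" using box_Int_box by blast
   have "(LINT x|lebesgue. indicator (box e f) x * G x) = 0"
   proof (cases "box e f = {}")
    case False
    have "closure (box e f) \<subseteq> closure (box c d)" using ef by (intro closure_mono) auto
    moreover have "box c d \<noteq> {}" using False ef by auto
    ultimately have "cbox e f \<subseteq> cbox c d" using False by simp
    then show ?thesis using cd by (intro zbox) auto
   qed simp
   then show "(LINT x|lebesgue. indicator (box a b) x * (indicator (box c d) x * G x)) = 0"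
    by (simp add: mult.assoc[symmetric] indicator_inter_arith[symmetric] ef)
  qed
  \<comment> \<open>The cover consists of closed boxes, while only open ones have been treated; the
    faces between them are a null set.\<close>
  moreover have "AE x in lebesgue. x \<notin> cbox c d - box c d"
   by (rule AE_not_in) (use negligible_frontier_interval[of c d] in \<open>simp only: negligible_iff_null_sets\<close>)
  ultimately show ?thesis by eventually_elim (auto simp: indicator_def split: if_splits)
 qed
 obtain D where D: "countable D" "D \<subseteq> Pow \<Omega>" "!!X. X \<in> D ==> \<exists>a b. X = cbox a b" "\<Union>D = \<Omega>"
  using open_countable_Union_open_cbox[OF \<Omega>] by metis
 have "AE x in lebesgue. \<forall>X\<in>D. x \<in> X \<longrightarrow> G x = 0"
 proof (subst AE_ball_countable[OF D(1)], rule ballI)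
  fix X assume X: "X \<in> D"
  then obtain a b where "X = cbox a b" using D(3) by blast
  then show "AE x in lebesgue. x \<in> X \<longrightarrow> G x = 0" using AEbox[of a b] D(2) X by auto
 qed
 then have "AE x in lebesgue. x \<in> \<Omega> \<longrightarrow> g x = 0"
 proof eventually_elim
  case (elim x)
  show ?case
  proof
   assume x: "x \<in> \<Omega>"
   then obtain X where "X \<in> D" "x \<in> X" using D(4) by blast
   with elim x show "g x = 0" by (auto simp: G_def)
  qed
 qed
 then show ?thesis by (simp add: AE_restrict_space_iff)
qed

lemma lebesgue_on_eq_lborel:
 fixes f :: "'a::euclidean_space => 'b::euclidean_space"
 assumes "f \<in> borel_measurable borel" "!!x. x \<notin> \<Omega> ==> f x = 0" "\<Omega> \<in> sets lebesgue"
 shows "(LINT x|lebesgue_on \<Omega>. f x) = (LINT x|lborel. f x)"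
  and "integrable (lebesgue_on \<Omega>) f \<longleftrightarrow> integrable lborel f"
proof -
 have i: "(%x. indicator \<Omega> x *\<^sub>R f x) = f" using assms(2) by (auto simp: indicator_def)
 show "(LINT x|lebesgue_on \<Omega>. f x) = (LINT x|lborel. f x)"
  using assms i by (simp add: integral_restrict_space integral_completion)
 show "integrable (lebesgue_on \<Omega>) f \<longleftrightarrow> integrable lborel f"
  using assms i by (simp add: integrable_restrict_space integrable_completion)
qed

lemma borel_measurable_continuous_lebesgue_on:
 fixes f :: "'a::euclidean_space => 'b::euclidean_space"
 assumes "continuous_on UNIV f"
 shows "f \<in> borel_measurable (lebesgue_on S)"
 using borel_measurable_continuous_onI[OF assms]
 by (intro measurable_restrict_space1 measurable_completion) simp

lemma integrable_compact_support:
 fixes f :: "'a::euclidean_space => 'b::euclidean_space"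
 assumes "continuous_on UNIV f" "compact K" "!!x. x \<notin> K ==> f x = 0"
 shows "integrable lborel f"
proof -
 have "integrable lborel (%x. indicator K x *\<^sub>R f x)"
  by (rule borel_integrable_compact[OF assms(2)]) (use assms(1) continuous_on_subset in auto)
 moreover have "(%x. indicator K x *\<^sub>R f x) = f" using assms(3) by (auto simp: indicator_def)
 ultimately show ?thesis by simp
qed

text \<open>By translation invariance the integral of \<open>\<phi> (x + r *\<^sub>R v)\<close> is
  constant in r, and its derivative at r = 0 is the integral in question.\<close>

lemma integral_directional_derivative_zero:
 fixes \<phi> :: "'a::euclidean_space => real"
 assumes \<phi>: "\<phi> \<in> test_functions UNIV"
 shows "(LINT x|lborel. grad \<phi> x \<bullet> v) = 0"
proof -
 obtain K where K: "compact K" "!!x. x \<notin> K ==> \<phi> x = 0" "!!x. x \<notin> K ==> grad \<phi> x = 0"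
  using test_obtain[OF \<phi>] by metis
 obtain B where B: "0 <= B" "!!x. norm (grad \<phi> x) <= B" using test_bounded[OF \<phi>] by metis
 obtain R where R: "!!x. x \<in> K ==> norm x <= R" using K(1) compact_imp_bounded bounded_iff by metis
 have \<phi>c: "continuous_on UNIV \<phi>" by (rule smooth_fun_continuous[OF test_smooth[OF \<phi>]])
 have [measurable]: "\<phi> \<in> borel_measurable borel" "grad \<phi> \<in> borel_measurable borel"
  using test_smooth[OF \<phi>] by (auto intro!: borel_measurable_continuous_onI smooth_fun_continuous continuous_on_grad)
 have i: "integrable lborel \<phi>" by (rule integrable_compact_support[OF \<phi>c K(1,2)])
 have distr: "distr lborel borel ((+) c) = (lborel :: 'a measure)" for c by (rule lborel_distr_plus)
 have it: "integrable lborel (%x. \<phi> (x + r *\<^sub>R v))" for r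
  using i integrable_distr_eq[of "(+) (r *\<^sub>R v)" lborel borel \<phi>] distr[of "r *\<^sub>R v"] by (simp add: add.commute)
 have ii: "(LINT x|lborel. \<phi> (x + r *\<^sub>R v)) = (LINT x|lborel. \<phi> x)" for r
  using integral_distr[of "(+) (r *\<^sub>R v)" lborel borel \<phi>] distr[of "r *\<^sub>R v"] by (simp add: add.commute)
 have "((%r. LINT x|lborel. \<phi> (x + r *\<^sub>R v)) has_real_derivative (LINT x|lborel. grad \<phi> (x + 0 *\<^sub>R v) \<bullet> v)) (at 0)"
 \<comment> \<open>For shifts with parameter in (-1, 1) all integrands live in the support enlarged
   by the length of \<open>v\<close>, so one bounded function with bounded support dominates
   them.\<close>
 proof (rule DERIV_integral[where a="-1" and b=1 and w="%x. (B * norm v) * indicator (cball 0 (R + norm v)) x" and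
    f' = "%r x. grad \<phi> (x + r *\<^sub>R v) \<bullet> v"])
  fix r :: real and x assume r: "-1 < r" "r < 1"
  have "((%r. x + r *\<^sub>R v) has_derivative (%h. h *\<^sub>R v)) (at r)" by (auto intro!: derivative_eq_intros)
  from has_derivative_compose[OF this smooth_fun_has_derivative_grad[OF test_smooth[OF \<phi>]]]
  show "((%r. \<phi> (x + r *\<^sub>R v)) has_real_derivative grad \<phi> (x + r *\<^sub>R v) \<bullet> v) (at r)"
   unfolding has_field_derivative_def by (rule has_derivative_eq_rhs) (simp add: fun_eq_iff)
  show "\<bar>grad \<phi> (x + r *\<^sub>R v) \<bullet> v\<bar> <= B * norm v * indicator (cball 0 (R + norm v)) x"
  proof (cases "x + r *\<^sub>R v \<in> K")
   case True
   have "norm x <= norm (x + r *\<^sub>R v) + norm (r *\<^sub>R v)" using norm_triangle_ineq4[of "x + r *\<^sub>R v" "r *\<^sub>R v"] by simp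
   also have "norm (r *\<^sub>R v) <= norm v" using r by (simp add: mult_left_le_one_le)
   finally have "norm x <= R + norm v" using R[OF True] by simp
   moreover have "\<bar>grad \<phi> (x + r *\<^sub>R v) \<bullet> v\<bar> <= B * norm v"
    by (rule order_trans[OF Cauchy_Schwarz_ineq2 mult_right_mono[OF B(2) norm_ge_zero]])
   ultimately show ?thesis by simp
  qed (use K B in simp)
 qed (use it in \<open>auto intro!: integrable_mult_right integrable_real_indicator simp: emeasure_bounded_finite[OF bounded_cball, simplified]\<close>)
 then have "((%r. LINT x|lborel. \<phi> x) has_real_derivative (LINT x|lborel. grad \<phi> x \<bullet> v)) (at 0)"
  by (simp add: ii)
 from DERIV_unique[OF this DERIV_const] show ?thesis .
qed

lemma test_UNIV: "\<phi> \<in> test_functions \<Omega> ==> \<phi> \<in> test_functions UNIV"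
 by (auto simp: test_functions_iff)

lemma test_measurable:
 assumes "\<phi> \<in> test_functions \<Omega>"
 shows "\<phi> \<in> borel_measurable borel" "grad \<phi> \<in> borel_measurable borel"
  "\<phi> \<in> borel_measurable (lebesgue_on S)" "grad \<phi> \<in> borel_measurable (lebesgue_on S)"
 using test_smooth[OF assms]
 by (auto intro!: borel_measurable_continuous_onI borel_measurable_continuous_lebesgue_on smooth_fun_continuous continuous_on_grad)

text \<open>Multiplying by \<open>\<phi>\<close> supplies the compact support that
  \<open>\<psi>\<close> lacks; the integral of a directional derivative of the product
  vanishes.\<close>

lemma test_ibp:
 assumes \<phi>: "\<phi> \<in> test_functions \<Omega>" and \<psi>: "smooth_fun \<psi>" and \<Omega>: "\<Omega> \<in> sets lebesgue"
 shows "(LINT x|lebesgue_on \<Omega>. \<psi> x * (grad \<phi> x \<bullet> v)) = - (LINT x|lebesgue_on \<Omega>. (grad \<psi> x \<bullet> v) * \<phi> x)"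
proof -
 obtain K where K: "compact K" "K \<subseteq> \<Omega>" "!!x. x \<notin> K ==> \<phi> x = 0" "!!x. x \<notin> K ==> grad \<phi> x = 0"
  using test_obtain[OF \<phi>] by metis
 have c: "continuous_on UNIV \<phi>" "continuous_on UNIV \<psi>" "continuous_on UNIV (grad \<phi>)" "continuous_on UNIV (grad \<psi>)"
  using \<psi> test_smooth[OF \<phi>] by (auto intro: smooth_fun_continuous continuous_on_grad)
 have off: "\<phi> x = 0" "grad \<phi> x = 0" if "x \<notin> \<Omega>" for x using K that by auto
 have i: "integrable lborel (%x. \<psi> x * (grad \<phi> x \<bullet> v))" "integrable lborel (%x. (grad \<psi> x \<bullet> v) * \<phi> x)"
  by (rule integrable_compact_support[OF _ K(1)]; use c K in \<open>auto intro!: continuous_intros\<close>)+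
 have "(LINT x|lborel. grad (%x. \<phi> x * \<psi> x) x \<bullet> v) = 0"
  by (rule integral_directional_derivative_zero[OF test_UNIV[OF test_mult[OF \<phi> \<psi>]]])
 then have "(LINT x|lborel. (grad \<psi> x \<bullet> v) * \<phi> x + \<psi> x * (grad \<phi> x \<bullet> v)) = 0"
  by (simp add: grad_mult[OF test_smooth[OF \<phi>] \<psi>] inner_add_left mult.commute)
 then have "(LINT x|lborel. \<psi> x * (grad \<phi> x \<bullet> v)) = - (LINT x|lborel. (grad \<psi> x \<bullet> v) * \<phi> x)"
  using i by simp
 moreover have "(LINT x|lebesgue_on \<Omega>. \<psi> x * (grad \<phi> x \<bullet> v)) = (LINT x|lborel. \<psi> x * (grad \<phi> x \<bullet> v))"
  by (rule lebesgue_on_eq_lborel) (use c off \<Omega> in \<open>auto intro!: borel_measurable_continuous_onI continuous_intros\<close>)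
 moreover have "(LINT x|lebesgue_on \<Omega>. (grad \<psi> x \<bullet> v) * \<phi> x) = (LINT x|lborel. (grad \<psi> x \<bullet> v) * \<phi> x)"
  by (rule lebesgue_on_eq_lborel) (use c off \<Omega> in \<open>auto intro!: borel_measurable_continuous_onI continuous_intros\<close>)
 ultimately show ?thesis by simp
qed

lemma sqint_test:
 assumes \<phi>: "\<phi> \<in> test_functions \<Omega>" and \<Omega>: "\<Omega> \<in> sets lebesgue"
 shows "sqint (lebesgue_on \<Omega>) \<phi>" "sqint (lebesgue_on \<Omega>) (grad \<phi>)"
proof -
 obtain K where K: "compact K" "K \<subseteq> \<Omega>" "!!x. x \<notin> K ==> \<phi> x = 0" "!!x. x \<notin> K ==> grad \<phi> x = 0"
  using test_obtain[OF \<phi>] by metis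
 have c: "continuous_on UNIV \<phi>" "continuous_on UNIV (grad \<phi>)"
  using test_smooth[OF \<phi>] by (auto intro: smooth_fun_continuous continuous_on_grad)
 have sq: "sqint (lebesgue_on \<Omega>) f"
  if "continuous_on UNIV f" "!!x. x \<notin> K ==> f x = 0" for f :: "'a => 'b::euclidean_space"
 proof -
  have "integrable lborel (%x. nsq (f x))"
   by (rule integrable_compact_support[OF _ K(1)]) (use that in \<open>auto intro!: continuous_intros\<close>)
  moreover have "integrable (lebesgue_on \<Omega>) (%x. nsq (f x)) \<longleftrightarrow> integrable lborel (%x. nsq (f x))"
   by (rule lebesgue_on_eq_lborel(2)) (use that K \<Omega> in \<open>auto intro!: borel_measurable_continuous_onI continuous_intros\<close>)
  ultimately show ?thesis
   using borel_measurable_continuous_lebesgue_on[OF that(1)] by (simp add: sqint_def)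
 qed
 show "sqint (lebesgue_on \<Omega>) \<phi>" "sqint (lebesgue_on \<Omega>) (grad \<phi>)"
  using sq[OF c(1) K(3)] sq[OF c(2) K(4)] by auto
qed

section \<open>Functions with zero boundary values\<close>

locale bdomain =
 fixes \<Omega> :: "'a::euclidean_space set"
 assumes open_\<Omega>: "open \<Omega>" and bounded_\<Omega>: "bounded \<Omega>"
begin

abbreviation "M \<equiv> lebesgue_on \<Omega>"

lemma \<Omega>_sets [simp]: "\<Omega> \<in> sets lebesgue"
 using open_\<Omega> by auto

lemma finite_M: "finite_measure M"
proof
 have "\<Omega> \<in> lmeasurable"
  using open_\<Omega> bounded_\<Omega> by (simp add: lmeasurable_open)
 then show "emeasure M (space M) \<noteq> \<infinity>"
  by (auto simp: emeasure_restrict_space fmeasurable_def)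
qed

lemma sqint_bounded:
 fixes f :: "'a => 'b::euclidean_space"
 assumes "f \<in> borel_measurable M" "!!x. x \<in> \<Omega> ==> norm (f x) <= c"
 shows "sqint M f"
proof -
 interpret finite_measure M by (rule finite_M)
 have "integrable M (%x. nsq (f x))"
  by (rule integrable_const_bound[where B="c\<^sup>2"]) (use assms in \<open>auto intro!: power_mono AE_I2\<close>)
 then show ?thesis using assms by (simp add: sqint_def)
qed

lemma sqint_L1: "sqint M f ==> integrable M (f :: 'a => real)"
 using sqint_mult[of M f "%_. 1"] sqint_bounded[of "%_. 1::real" 1] by simp

lemma sqint_L1_inner: "sqint M f ==> integrable M (%x. f x \<bullet> v)"
 using sqint_inner[of M f "%_. v"] sqint_bounded[of "%_. v" "norm v"] by simp

lemma test_sqint: "\<phi> \<in> test_functions \<Omega> ==> sqint M \<phi>" "\<phi> \<in> test_functions \<Omega> ==> sqint M (grad \<phi>)"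
 by (auto intro: sqint_test)

lemma has_weak_grad_iff:
 "has_weak_grad \<Omega> u g \<longleftrightarrow> (\<forall>\<phi>\<in>test_functions \<Omega>. \<forall>b\<in>Basis.
   (LINT x|M. u x * (grad \<phi> x \<bullet> b)) = - (LINT x|M. (g x \<bullet> b) * \<phi> x))"
 unfolding has_weak_grad_def by (simp add: grad_inner_Basis)

lemma weak_grad_unique:
 assumes "has_weak_grad \<Omega> u g" "has_weak_grad \<Omega> u h" "sqint M g" "sqint M h"
 shows "AE x in M. g x = h x"
proof -
 have "AE x in M. (g x - h x) \<bullet> b = 0" if b: "b \<in> Basis" for b
 proof (rule fundamental_lemma[OF open_\<Omega>])
  show "integrable M (%x. (g x - h x) \<bullet> b)" by (intro sqint_L1_inner sqint_diff assms)
  fix \<phi> assume \<phi>: "\<phi> \<in> test_functions \<Omega>"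
  have gi: "integrable M (%x. (g x \<bullet> b) * \<phi> x)" if "sqint M g" for g
   using sqint_inner[OF that, of "%x. \<phi> x *\<^sub>R b"] sqint_dominated[OF test_sqint(1)[OF \<phi>], of "%x. \<phi> x *\<^sub>R b" "norm b"]
    sqint_measurable[OF test_sqint(1)[OF \<phi>]] by (simp add: mult.commute)
  have "(LINT x|M. (g x \<bullet> b) * \<phi> x) = (LINT x|M. (h x \<bullet> b) * \<phi> x)"
   using assms(1,2) b \<phi> unfolding has_weak_grad_iff by fastforce
  then show "(LINT x|M. ((g x - h x) \<bullet> b) * \<phi> x) = 0"
   using gi[OF assms(3)] gi[OF assms(4)] by (simp add: inner_diff_left left_diff_distrib)
 qed
 then have "AE x in M. \<forall>b\<in>Basis. (g x - h x) \<bullet> b = 0"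
  by (simp add: AE_finite_all)
 then show ?thesis
 proof eventually_elim
  case (elim x)
  then have "g x - h x = 0" using euclidean_all_zero_iff by blast
  then show ?case by simp
 qed
qed

lemma has_weak_grad_test: "\<phi> \<in> test_functions \<Omega> ==> has_weak_grad \<Omega> \<phi> (grad \<phi>)"
 unfolding has_weak_grad_iff by (intro ballI test_ibp test_smooth) auto

lemma has_weak_grad_lincomb:
 assumes "has_weak_grad \<Omega> u g" "has_weak_grad \<Omega> v h" "sqint M u" "sqint M v" "sqint M g" "sqint M h"
 shows "has_weak_grad \<Omega> (%x. a * u x + b * v x) (%x. a *\<^sub>R g x + b *\<^sub>R h x)"
 unfolding has_weak_grad_iff
proof (intro ballI)
 fix \<phi> and i :: 'a assume \<phi>: "\<phi> \<in> test_functions \<Omega>" and i: "i \<in> Basis"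
 have s1: "sqint M (%x. grad \<phi> x \<bullet> i)"
  by (rule sqint_dominated[OF test_sqint(2)[OF \<phi>], where c=1])
    (use sqint_measurable[OF test_sqint(2)[OF \<phi>]] Basis_le_norm[OF i] in auto)
 have s2: "sqint M (%x. g x \<bullet> i)" if "sqint M g" for g
  by (rule sqint_dominated[OF that, where c=1])
    (use sqint_measurable[OF that] Basis_le_norm[OF i] in auto)
 note I = sqint_mult[OF assms(3) s1] sqint_mult[OF assms(4) s1]
   sqint_mult[OF s2[OF assms(5)] test_sqint(1)[OF \<phi>]] sqint_mult[OF s2[OF assms(6)] test_sqint(1)[OF \<phi>]]
 have "(LINT x|M. (a * u x + b * v x) * (grad \<phi> x \<bullet> i)) = a * (LINT x|M. u x * (grad \<phi> x \<bullet> i)) + b * (LINT x|M. v x * (grad \<phi> x \<bullet> i))"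
  using I by (simp add: ring_distribs mult.assoc)
 also have "... = - (a * (LINT x|M. (g x \<bullet> i) * \<phi> x) + b * (LINT x|M. (h x \<bullet> i) * \<phi> x))"
  using assms(1,2) \<phi> i unfolding has_weak_grad_iff by simp
 also have "... = - (LINT x|M. ((a *\<^sub>R g x + b *\<^sub>R h x) \<bullet> i) * \<phi> x)"
  using I by (simp add: ring_distribs mult.assoc inner_add_left)
 finally show "(LINT x|M. (a * u x + b * v x) * (grad \<phi> x \<bullet> i)) = - (LINT x|M. ((a *\<^sub>R g x + b *\<^sub>R h x) \<bullet> i) * \<phi> x)" .
qed

lemma has_weak_grad_limit:
 assumes w: "!!n. has_weak_grad \<Omega> (u n) (g n)" and s: "!!n. sqint M (u n)" "!!n. sqint M (g n)" "sqint M v" "sqint M h"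
  and l: "(%n. ndist M (u n) v) ----> 0" "(%n. ndist M (g n) h) ----> 0"
 shows "has_weak_grad \<Omega> v h"
 unfolding has_weak_grad_iff
proof (intro ballI)
 fix \<phi> and i :: 'a assume \<phi>: "\<phi> \<in> test_functions \<Omega>" and i: "i \<in> Basis"
 have s1: "sqint M (%x. grad \<phi> x \<bullet> i)"
  by (rule sqint_dominated[OF test_sqint(2)[OF \<phi>], where c=1])
    (use sqint_measurable[OF test_sqint(2)[OF \<phi>]] Basis_le_norm[OF i] in auto)
 have s2: "sqint M (%x. \<phi> x *\<^sub>R i)"
  by (rule sqint_dominated[OF test_sqint(1)[OF \<phi>], where c=1])
    (use sqint_measurable[OF test_sqint(1)[OF \<phi>]] i in auto)
 have "(%n. LINT x|M. u n x \<bullet> (grad \<phi> x \<bullet> i)) ----> (LINT x|M. v x \<bullet> (grad \<phi> x \<bullet> i))"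
  by (rule inner_tendsto) (use s s1 l in \<open>auto simp: nrm2_def\<close>)
 moreover have "(%n. LINT x|M. g n x \<bullet> (\<phi> x *\<^sub>R i)) ----> (LINT x|M. h x \<bullet> (\<phi> x *\<^sub>R i))"
  by (rule inner_tendsto) (use s s2 l in \<open>auto simp: nrm2_def\<close>)
 then have "(%n. - (LINT x|M. g n x \<bullet> (\<phi> x *\<^sub>R i))) ----> - (LINT x|M. h x \<bullet> (\<phi> x *\<^sub>R i))"
  by (rule tendsto_minus)
 moreover have "(LINT x|M. u n x \<bullet> (grad \<phi> x \<bullet> i)) = - (LINT x|M. g n x \<bullet> (\<phi> x *\<^sub>R i))" for n
  using w[of n] \<phi> i unfolding has_weak_grad_iff by (simp add: mult.commute)
 ultimately have "(LINT x|M. v x \<bullet> (grad \<phi> x \<bullet> i)) = - (LINT x|M. h x \<bullet> (\<phi> x *\<^sub>R i))"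
  using LIMSEQ_unique by simp
 then show "(LINT x|M. v x * (grad \<phi> x \<bullet> i)) = - (LINT x|M. (h x \<bullet> i) * \<phi> x)"
  by (simp add: mult.commute)
qed

lemma weak_grad_props:
 assumes "sqint M g" "has_weak_grad \<Omega> u g"
 shows "sqint M (weak_grad \<Omega> u)" "has_weak_grad \<Omega> u (weak_grad \<Omega> u)" "AE x in M. weak_grad \<Omega> u x = g x"
proof -
 have "weak_grad \<Omega> u \<in> L2 \<Omega> \<and> has_weak_grad \<Omega> u (weak_grad \<Omega> u)"
  unfolding weak_grad_def by (rule someI[of _ g]) (use assms in \<open>simp add: L2_iff\<close>)
 then show 1: "sqint M (weak_grad \<Omega> u)" "has_weak_grad \<Omega> u (weak_grad \<Omega> u)" by (auto simp: L2_iff)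
 show "AE x in M. weak_grad \<Omega> u x = g x"
  by (rule weak_grad_unique[OF 1(2) assms(2) 1(1) assms(1)])
qed

lemma normH1_eq:
 assumes "sqint M g" "has_weak_grad \<Omega> u g"
 shows "normH1 \<Omega> u = sqrt ((nrm2 M u)\<^sup>2 + (nrm2 M g)\<^sup>2)"
proof -
 have "nrm2 M (weak_grad \<Omega> u) = nrm2 M g"
  using weak_grad_props[OF assms] assms(1) by (intro nrm2_cong_AE) (auto dest: sqint_measurable)
 then show ?thesis by (simp add: normH1_def normL2_eq)
qed

text \<open>The pair \<open>(u, g)\<close> is an element of \<open>H\<^sup>1\<^sub>0\<close> together with a chosen representative of its gradient.\<close>

definition H10g :: "('a => real) => ('a => 'a) => bool" where
 "H10g u g \<longleftrightarrow> sqint M u \<and> sqint M g \<and>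
   (\<exists>\<phi>. (\<forall>k::nat. \<phi> k \<in> test_functions \<Omega>) \<and>
     (%k. ndist M (\<phi> k) u) ----> 0 \<and> (%k. ndist M (grad (\<phi> k)) g) ----> 0)"

lemma H10g_sqint: "H10g u g ==> sqint M u" "H10g u g ==> sqint M g"
 by (auto simp: H10g_def)

lemma H10g_obtain:
 assumes "H10g u g"
 obtains \<phi> where "!!k::nat. \<phi> k \<in> test_functions \<Omega>" "(%k. ndist M (\<phi> k) u) ----> 0"
  "(%k. ndist M (grad (\<phi> k)) g) ----> 0"
 using assms unfolding H10g_def by blast

lemma H10g_weak_grad: "H10g u g ==> has_weak_grad \<Omega> u g"
proof -
 assume H: "H10g u g"
 obtain \<phi> where "!!k::nat. \<phi> k \<in> test_functions \<Omega>" "(%k. ndist M (\<phi> k) u) ----> 0"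
  "(%k. ndist M (grad (\<phi> k)) g) ----> 0"
  using H10g_obtain[OF H] by blast
 then show ?thesis
  using has_weak_grad_limit[of \<phi> "%k. grad (\<phi> k)" u g] H10g_sqint[OF H]
  by (simp add: has_weak_grad_test test_sqint)
qed

lemma H10g_test: "\<phi> \<in> test_functions \<Omega> ==> H10g \<phi> (grad \<phi>)"
 unfolding H10g_def by (intro conjI test_sqint exI[of _ "%_. \<phi>"]) (auto simp: nrm2_def)

lemma H10g_cong:
 assumes "H10g u g" "u' \<in> borel_measurable M" "AE x in M. u x = u' x" "g' \<in> borel_measurable M" "AE x in M. g x = g' x"
 shows "H10g u' g'"
proof -
 note s = H10g_sqint[OF assms(1)]
 obtain \<phi> where \<phi>: "!!k::nat. \<phi> k \<in> test_functions \<Omega>" "(%k. ndist M (\<phi> k) u) ----> 0"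
  "(%k. ndist M (grad (\<phi> k)) g) ----> 0"
  using H10g_obtain[OF assms(1)] by blast
 have [measurable]: "u \<in> borel_measurable M" "g \<in> borel_measurable M" "u' \<in> borel_measurable M" "g' \<in> borel_measurable M"
  using s assms by (auto dest: sqint_measurable)
 have [measurable]: "\<phi> k \<in> borel_measurable M" "grad (\<phi> k) \<in> borel_measurable M" for k
  using test_sqint[OF \<phi>(1)[of k]] by (auto dest: sqint_measurable)
 have "ndist M (\<phi> k) u' = ndist M (\<phi> k) u" for k
  by (rule nrm2_cong_AE) (use assms(3) in auto)
 moreover have "ndist M (grad (\<phi> k)) g' = ndist M (grad (\<phi> k)) g" for k
  by (rule nrm2_cong_AE) (use assms(5) in auto)
 ultimately show ?thesis
  using \<phi> sqint_cong_AE[OF s(1) assms(2,3)] sqint_cong_AE[OF s(2) assms(4,5)]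
  unfolding H10g_def by (intro conjI exI[of _ \<phi>]) auto
qed

lemma H10g_lincomb:
 assumes "H10g u g" "H10g v h"
 shows "H10g (%x. a * u x + b * v x) (%x. a *\<^sub>R g x + b *\<^sub>R h x)"
proof -
 note s = H10g_sqint[OF assms(1)] H10g_sqint[OF assms(2)]
 obtain \<phi> where \<phi>: "!!k::nat. \<phi> k \<in> test_functions \<Omega>" "(%k. ndist M (\<phi> k) u) ----> 0"
  "(%k. ndist M (grad (\<phi> k)) g) ----> 0"
  using H10g_obtain[OF assms(1)] by blast
 obtain \<psi> where \<psi>: "!!k::nat. \<psi> k \<in> test_functions \<Omega>" "(%k. ndist M (\<psi> k) v) ----> 0"
  "(%k. ndist M (grad (\<psi> k)) h) ----> 0"
  using H10g_obtain[OF assms(2)] by blast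
 have lim: "(%k. nrm2 M (%x. (a *\<^sub>R p k x + b *\<^sub>R q k x) - (a *\<^sub>R f x + b *\<^sub>R e x))) ----> 0"
  if "!!k. sqint M (p k)" "!!k. sqint M (q k)" "sqint M f" "sqint M e"
   "(%k. ndist M (p k) f) ----> 0" "(%k. ndist M (q k) e) ----> 0"
  for p q :: "nat => 'a => 'b::euclidean_space" and f e
 proof (rule Lim_null_comparison)
  have "nrm2 M (%x. (a *\<^sub>R p k x + b *\<^sub>R q k x) - (a *\<^sub>R f x + b *\<^sub>R e x))
    = nrm2 M (%x. a *\<^sub>R (p k x - f x) + b *\<^sub>R (q k x - e x))" for k
   by (simp add: algebra_simps)
  also have "... k <= nrm2 M (%x. a *\<^sub>R (p k x - f x)) + nrm2 M (%x. b *\<^sub>R (q k x - e x))" for k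
   by (intro nrm2_triangle sqint_scaleR sqint_diff that)
  finally show "eventually (%k. norm (nrm2 M (%x. (a *\<^sub>R p k x + b *\<^sub>R q k x) - (a *\<^sub>R f x + b *\<^sub>R e x)))
    <= \<bar>a\<bar> * ndist M (p k) f + \<bar>b\<bar> * ndist M (q k) e) sequentially"
   by (simp add: nrm2_scaleR)
  have "(%k. \<bar>a\<bar> * ndist M (p k) f + \<bar>b\<bar> * ndist M (q k) e) ----> \<bar>a\<bar> * 0 + \<bar>b\<bar> * 0"
   by (intro tendsto_intros that)
  then show "(%k. \<bar>a\<bar> * ndist M (p k) f + \<bar>b\<bar> * ndist M (q k) e) ----> 0" by simp
 qed
 show ?thesis unfolding H10g_def
 proof (intro conjI exI[of _ "%k x. a * \<phi> k x + b * \<psi> k x"] allI)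
  show "sqint M (%x. a * u x + b * v x)" "sqint M (%x. a *\<^sub>R g x + b *\<^sub>R h x)"
   by (intro sqint_add sqint_cmult sqint_scaleR s)+
  show "(%x. a * \<phi> k x + b * \<psi> k x) \<in> test_functions \<Omega>" for k
   by (intro test_lincomb \<phi> \<psi>)
  show "(%k. nrm2 M (%x. (a * \<phi> k x + b * \<psi> k x) - (a * u x + b * v x))) ----> 0"
   using lim[of \<phi> \<psi> u v] s \<phi> \<psi> by (simp add: test_sqint)
  show "(%k. nrm2 M (%x. grad (%x. a * \<phi> k x + b * \<psi> k x) x - (a *\<^sub>R g x + b *\<^sub>R h x))) ----> 0"
   using lim[of "%k. grad (\<phi> k)" "%k. grad (\<psi> k)" g h] s \<phi> \<psi>
   by (simp add: test_sqint grad_lincomb[OF test_smooth[OF \<phi>(1)] test_smooth[OF \<psi>(1)]])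
 qed
qed

lemma H10g_H10:
 assumes "H10g u g"
 shows "u \<in> H10 \<Omega>"
proof -
 note s = H10g_sqint[OF assms] and w = H10g_weak_grad[OF assms]
 obtain \<phi> where \<phi>: "!!k::nat. \<phi> k \<in> test_functions \<Omega>" "(%k. ndist M (\<phi> k) u) ----> 0"
  "(%k. ndist M (grad (\<phi> k)) g) ----> 0"
  using H10g_obtain[OF assms] by blast
 have "normH1 \<Omega> (%x. u x - \<phi> k x) = sqrt ((ndist M (\<phi> k) u)\<^sup>2 + (ndist M (grad (\<phi> k)) g)\<^sup>2)" for k
 proof -
  have "has_weak_grad \<Omega> (%x. u x - \<phi> k x) (%x. g x - grad (\<phi> k) x)"
   using has_weak_grad_lincomb[OF w has_weak_grad_test[OF \<phi>(1)] s(1) test_sqint(1)[OF \<phi>(1)] s(2) test_sqint(2)[OF \<phi>(1)], of 1 "-1"]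
   by simp
  from normH1_eq[OF sqint_diff[OF s(2) test_sqint(2)[OF \<phi>(1)]] this]
  show ?thesis by (simp add: nrm2_minus_commute)
 qed
 moreover have "(%k. sqrt ((ndist M (\<phi> k) u)\<^sup>2 + (ndist M (grad (\<phi> k)) g)\<^sup>2)) ----> sqrt (0\<^sup>2 + 0\<^sup>2)"
  by (intro tendsto_intros \<phi>)
 ultimately have "(%k. normH1 \<Omega> (%x. u x - \<phi> k x)) ----> 0" by simp
 then show ?thesis
  unfolding H10_def H1_def using s w \<phi>(1) by (auto simp: L2_iff)
qed

lemma H10_H10g:
 assumes "u \<in> H10 \<Omega>"
 shows "H10g u (weak_grad \<Omega> u)"
proof -
 have "\<exists>\<phi>. (\<forall>k::nat. \<phi> k \<in> test_functions \<Omega>) \<and> (%k. normH1 \<Omega> (%x. u x - \<phi> k x)) ----> 0"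
  "\<exists>g. sqint M g \<and> has_weak_grad \<Omega> u g" and u: "sqint M u"
  using assms unfolding H10_def H1_def by (auto simp: L2_iff)
 then obtain \<phi> g where g: "sqint M g" "has_weak_grad \<Omega> u g"
  and \<phi>: "!!k::nat. \<phi> k \<in> test_functions \<Omega>" "(%k. normH1 \<Omega> (%x. u x - \<phi> k x)) ----> 0"
  by blast
 note wg = weak_grad_props[OF g]
 let ?g = "weak_grad \<Omega> u"
 have n: "normH1 \<Omega> (%x. u x - \<phi> k x) = sqrt ((ndist M (\<phi> k) u)\<^sup>2 + (ndist M (grad (\<phi> k)) ?g)\<^sup>2)" for k
 proof -
  have "has_weak_grad \<Omega> (%x. u x - \<phi> k x) (%x. ?g x - grad (\<phi> k) x)"
   using has_weak_grad_lincomb[OF wg(2) has_weak_grad_test[OF \<phi>(1)] u test_sqint(1)[OF \<phi>(1)] wg(1) test_sqint(2)[OF \<phi>(1)], of 1 "-1"]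
   by simp
  from normH1_eq[OF sqint_diff[OF wg(1) test_sqint(2)[OF \<phi>(1)]] this]
  show ?thesis
   by (simp only: nrm2_minus_commute[of M u "\<phi> k"] nrm2_minus_commute[of M ?g "grad (\<phi> k)"])
 qed
 have "(%k. ndist M (\<phi> k) u) ----> 0" "(%k. ndist M (grad (\<phi> k)) ?g) ----> 0"
  by (rule Lim_null_comparison[OF _ \<phi>(2)], rule always_eventually, simp add: n)+
 then show ?thesis unfolding H10g_def using u wg(1) \<phi>(1) by auto
qed

lemma H10g_unique: "H10g u g ==> AE x in M. weak_grad \<Omega> u x = g x"
 by (rule weak_grad_props(3)) (auto intro: H10g_weak_grad H10g_sqint)

lemma H10g_normH1: "H10g u g ==> normH1 \<Omega> u = sqrt ((nrm2 M u)\<^sup>2 + (nrm2 M g)\<^sup>2)"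
 by (rule normH1_eq) (auto intro: H10g_weak_grad H10g_sqint)

text \<open>Membership asks for one sequence of test functions, so a diagonal choice is needed: for
  each n a test function within \<open>1 / Suc n\<close> of the n-th pair, in both
  components.\<close>

lemma H10g_closed:
 assumes H: "!!n::nat. H10g (u n) (g n)" and s: "sqint M v" "sqint M h"
  and l: "(%n. ndist M (u n) v) ----> 0" "(%n. ndist M (g n) h) ----> 0"
 shows "H10g v h"
proof -
 have "\<exists>\<phi>\<in>test_functions \<Omega>. ndist M \<phi> (u n) < 1 / Suc n \<and> ndist M (grad \<phi>) (g n) < 1 / Suc n" for n
 proof -
  obtain \<phi> where \<phi>: "!!k::nat. \<phi> k \<in> test_functions \<Omega>" "(%k. ndist M (\<phi> k) (u n)) ----> 0"
   "(%k. ndist M (grad (\<phi> k)) (g n)) ----> 0"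
   using H10g_obtain[OF H] by blast
  have "eventually (%k. ndist M (\<phi> k) (u n) < 1 / Suc n \<and> ndist M (grad (\<phi> k)) (g n) < 1 / Suc n) sequentially"
   by (intro eventually_conj order_tendstoD(2)[OF \<phi>(2)] order_tendstoD(2)[OF \<phi>(3)]) auto
  then show ?thesis using \<phi>(1) by (auto simp: eventually_sequentially)
 qed
 then obtain \<phi> where \<phi>: "!!n. \<phi> n \<in> test_functions \<Omega>" "!!n. ndist M (\<phi> n) (u n) < 1 / Suc n"
  "!!n. ndist M (grad (\<phi> n)) (g n) < 1 / Suc n"
  by metis
 have lim0: "(%n. 1 / real (Suc n)) ----> 0"
  using LIMSEQ_inverse_real_of_nat by (simp add: inverse_eq_divide)
 have lim: "(%n. ndist M (p n) e) ----> 0"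
  if "!!n. sqint M (p n)" "!!n. sqint M (q n)" "sqint M e" "!!n. ndist M (p n) (q n) < 1 / Suc n"
   "(%n. ndist M (q n) e) ----> 0" for p q :: "nat => 'a => 'b::euclidean_space" and e
 proof (rule Lim_null_comparison)
  show "eventually (%n. norm (ndist M (p n) e) <= 1 / Suc n + ndist M (q n) e) sequentially"
  proof (intro always_eventually allI)
   fix n
   show "norm (ndist M (p n) e) <= 1 / Suc n + ndist M (q n) e"
    using nrm2_triangle_diff[OF that(1)[of n] that(2)[of n] that(3)] that(4)[of n] by simp
  qed
  show "(%n. 1 / Suc n + ndist M (q n) e) ----> 0"
   using tendsto_add[OF lim0 that(5)] by simp
 qed
 show ?thesis unfolding H10g_def
  using lim[of \<phi> u v] lim[of "%n. grad (\<phi> n)" g h] \<phi> l s H10g_sqint[OF H] test_sqint[OF \<phi>(1)] by auto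
qed

lemma H10g_complete:
 assumes H: "!!n::nat. H10g (u n) (g n)"
  and c: "!!e. e > 0 ==> \<exists>N. \<forall>i\<ge>N. \<forall>j\<ge>N. ndist M (u i) (u j) < e"
      "!!e. e > 0 ==> \<exists>N. \<forall>i\<ge>N. \<forall>j\<ge>N. ndist M (g i) (g j) < e"
 obtains v h where "H10g v h" "(%n. ndist M (u n) v) ----> 0" "(%n. ndist M (g n) h) ----> 0"
proof -
 obtain v where v: "sqint M v" "(%n. ndist M (u n) v) ----> 0"
  using sqint_complete[OF H10g_sqint(1)[OF H] c(1)] by blast
 obtain h where h: "sqint M h" "(%n. ndist M (g n) h) ----> 0"
  using sqint_complete[OF H10g_sqint(2)[OF H] c(2)] by blast
 show ?thesis by (rule that[OF H10g_closed[OF H v(1) h(1) v(2) h(2)] v(2) h(2)])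
qed

lemma smooth_bounded_on:
 assumes "smooth_fun p"
 obtains B where "0 <= B" "!!x. x \<in> \<Omega> ==> \<bar>p x\<bar> <= B" "!!x. x \<in> \<Omega> ==> norm (grad p x) <= B"
proof -
 have "compact (closure \<Omega>)" using bounded_\<Omega> by simp
 then have "bounded (p ` closure \<Omega>)" "bounded (grad p ` closure \<Omega>)"
  using assms by (auto intro!: compact_imp_bounded compact_continuous_image smooth_fun_continuous continuous_on_grad)
 then obtain B1 B2 where B: "!!x. x \<in> closure \<Omega> ==> \<bar>p x\<bar> <= B1" "!!x. x \<in> closure \<Omega> ==> norm (grad p x) <= B2"
  unfolding bounded_iff by auto
 show ?thesis
 proof (rule that[of "max 0 (max B1 B2)"])
  fix x assume "x \<in> \<Omega>"
  then have "x \<in> closure \<Omega>" using closure_subset by auto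
  then show "\<bar>p x\<bar> <= max 0 (max B1 B2)" "norm (grad p x) <= max 0 (max B1 B2)"
   using B[of x] by auto
 qed simp
qed

lemma smooth_measurable:
 assumes "smooth_fun p" shows "p \<in> borel_measurable M" "grad p \<in> borel_measurable M"
 using assms by (auto intro!: borel_measurable_continuous_lebesgue_on smooth_fun_continuous continuous_on_grad)

text \<open>This makes the product of an admissible function with a Gaussian weight admissible in
  the weak formulation. The smooth factor needs no boundary condition; it and its gradient are
  bounded because the domain is.\<close>

lemma H10g_mult:
 assumes H: "H10g u g" and p: "smooth_fun p"
 shows "H10g (%x. u x * p x) (%x. p x *\<^sub>R g x + u x *\<^sub>R grad p x)"
proof -
 note s = H10g_sqint[OF H]
 obtain \<phi> where \<phi>: "!!k::nat. \<phi> k \<in> test_functions \<Omega>" "(%k. ndist M (\<phi> k) u) ----> 0"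
  "(%k. ndist M (grad (\<phi> k)) g) ----> 0"
  using H10g_obtain[OF H] by blast
 obtain B where B: "0 <= B" "!!x. x \<in> \<Omega> ==> \<bar>p x\<bar> <= B" "!!x. x \<in> \<Omega> ==> norm (grad p x) <= B"
  using smooth_bounded_on[OF p] by metis
 note pm = smooth_measurable[OF p]
 have pm1: "sqint M (%x. f x * p x)" and pn1: "nrm2 M (%x. f x * p x) <= B * nrm2 M f" if "sqint M f" for f
 proof -
  have ae: "AE x in M. norm (f x * p x) <= B * norm (f x)"
   using B(2) by (intro AE_I2) (simp add: abs_mult mult.commute[of B] mult_left_mono)
  have m: "(%x. f x * p x) \<in> borel_measurable M" using that pm by (auto dest: sqint_measurable)
  show "sqint M (%x. f x * p x)" by (rule sqint_dominated[OF that m ae])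
  show "nrm2 M (%x. f x * p x) <= B * nrm2 M f" by (rule nrm2_dominated[OF that m ae B(1)])
 qed
 have pm2: "sqint M (%x. p x *\<^sub>R f x)" and pn2: "nrm2 M (%x. p x *\<^sub>R f x) <= B * nrm2 M f" if "sqint M f" for f :: "'a => 'a"
 proof -
  have ae: "AE x in M. norm (p x *\<^sub>R f x) <= B * norm (f x)"
   using B(2) by (intro AE_I2) (auto intro!: mult_right_mono)
  have m: "(%x. p x *\<^sub>R f x) \<in> borel_measurable M" using that pm by (auto dest: sqint_measurable)
  show "sqint M (%x. p x *\<^sub>R f x)" by (rule sqint_dominated[OF that m ae])
  show "nrm2 M (%x. p x *\<^sub>R f x) <= B * nrm2 M f" by (rule nrm2_dominated[OF that m ae B(1)])
 qed
 have pm3: "sqint M (%x. f x *\<^sub>R grad p x)" and pn3: "nrm2 M (%x. f x *\<^sub>R grad p x) <= B * nrm2 M f" if "sqint M f" for f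
 proof -
  have ae: "AE x in M. norm (f x *\<^sub>R grad p x) <= B * norm (f x)"
   using B(3) by (intro AE_I2) (auto simp: mult.commute[of B] intro!: mult_left_mono)
  have m: "(%x. f x *\<^sub>R grad p x) \<in> borel_measurable M" using that pm by (auto dest: sqint_measurable)
  show "sqint M (%x. f x *\<^sub>R grad p x)" by (rule sqint_dominated[OF that m ae])
  show "nrm2 M (%x. f x *\<^sub>R grad p x) <= B * nrm2 M f" by (rule nrm2_dominated[OF that m ae B(1)])
 qed
 have d: "sqint M (%x. \<phi> k x - u x)" "sqint M (%x. grad (\<phi> k) x - g x)" for k
  using s test_sqint[OF \<phi>(1)] by (auto intro: sqint_diff)
 show ?thesis unfolding H10g_def
 proof (intro conjI exI[of _ "%k x. \<phi> k x * p x"] allI)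
  show "sqint M (%x. u x * p x)" "sqint M (%x. p x *\<^sub>R g x + u x *\<^sub>R grad p x)"
   by (intro pm1 pm2 pm3 sqint_add s)+
  show "(%x. \<phi> k x * p x) \<in> test_functions \<Omega>" for k by (rule test_mult[OF \<phi>(1) p])
  have "(%k. B * ndist M (\<phi> k) u) ----> 0" using tendsto_mult_left[OF \<phi>(2), of B] by simp
  then show "(%k. nrm2 M (%x. \<phi> k x * p x - u x * p x)) ----> 0"
  proof (rule Lim_null_comparison[rotated], intro always_eventually allI)
   show "norm (nrm2 M (%x. \<phi> k x * p x - u x * p x)) <= B * ndist M (\<phi> k) u" for k
    using pn1[OF d(1)[of k]] by (simp add: left_diff_distrib)
  qed
  have "(%k. B * ndist M (grad (\<phi> k)) g + B * ndist M (\<phi> k) u) ----> B * 0 + B * 0"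
   by (intro tendsto_intros \<phi>)
  then have "(%k. B * ndist M (grad (\<phi> k)) g + B * ndist M (\<phi> k) u) ----> 0" by simp
  then show "(%k. nrm2 M (%x. grad (%x. \<phi> k x * p x) x - (p x *\<^sub>R g x + u x *\<^sub>R grad p x))) ----> 0"
  proof (rule Lim_null_comparison[rotated], intro always_eventually allI)
   fix k
   have "nrm2 M (%x. grad (%x. \<phi> k x * p x) x - (p x *\<^sub>R g x + u x *\<^sub>R grad p x))
     = nrm2 M (%x. p x *\<^sub>R (grad (\<phi> k) x - g x) + (\<phi> k x - u x) *\<^sub>R grad p x)"
    unfolding grad_mult[OF test_smooth[OF \<phi>(1)] p] by (simp add: algebra_simps)
   also have "... <= nrm2 M (%x. p x *\<^sub>R (grad (\<phi> k) x - g x)) + nrm2 M (%x. (\<phi> k x - u x) *\<^sub>R grad p x)"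
    by (intro nrm2_triangle pm2 pm3 d)
   also have "... <= B * ndist M (grad (\<phi> k)) g + B * ndist M (\<phi> k) u"
    by (intro add_mono pn2 pn3 d)
   finally show "norm (nrm2 M (%x. grad (%x. \<phi> k x * p x) x - (p x *\<^sub>R g x + u x *\<^sub>R grad p x)))
     <= B * ndist M (grad (\<phi> k)) g + B * ndist M (\<phi> k) u" by simp
  qed
 qed
qed

end

section \<open>Compact forms\<close>

locale semi_ip =
 fixes V :: "('x => real) set" and ip :: "('x => real) => ('x => real) => real"
 assumes zero: "(%x. 0) \<in> V"
  and lincomb: "u \<in> V ==> v \<in> V ==> (%x. a * u x + b * v x) \<in> V"
  and ip_sym: "u \<in> V ==> v \<in> V ==> ip u v = ip v u"
  and ip_lincomb: "u \<in> V ==> v \<in> V ==> w \<in> V ==> ip (%x. a * u x + b * v x) w = a * ip u w + b * ip v w"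
  and ip_nonneg: "u \<in> V ==> 0 <= ip u u"
begin

lemma diff_in: "u \<in> V ==> v \<in> V ==> (%x. u x - v x) \<in> V"
 using lincomb[of u v 1 "-1"] by simp

lemma cmul_in: "u \<in> V ==> (%x. c * u x) \<in> V"
 using lincomb[of u u c 0] by simp

lemma sum_in: "(!!k. e k \<in> V) ==> (%x. \<Sum>k<N. c k * e k x) \<in> V" for N :: nat
proof (induction N)
 case (Suc N)
 then show ?case using lincomb[of "%x. \<Sum>k<N. c k * e k x" "e N" 1 "c N"] by simp
qed (simp add: zero)

lemma ip_diff: "u \<in> V ==> v \<in> V ==> w \<in> V ==> ip (%x. u x - v x) w = ip u w - ip v w"
 using ip_lincomb[of u v w 1 "-1"] by simp

lemma ip_cmul: "u \<in> V ==> w \<in> V ==> ip (%x. c * u x) w = c * ip u w"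
 using ip_lincomb[of u u w c 0] by simp

lemma ip_zero: "w \<in> V ==> ip (%x. 0) w = 0"
 using ip_cmul[OF zero, of w 0] by simp

lemma ip_zero_right: "w \<in> V ==> ip w (%x. 0) = 0"
 using ip_zero ip_sym[OF zero] by metis

lemma ip_sum: "(!!k. e k \<in> V) ==> w \<in> V ==> ip (%x. \<Sum>k<N. c k * e k x) w = (\<Sum>k<N. c k * ip (e k) w)" for N :: nat
proof (induction N)
 case (Suc N)
 then show ?case
  using ip_lincomb[OF sum_in[where e=e and N=N and c=c] Suc.prems(1)[of N] Suc.prems(2), of 1 "c N"] by simp
qed (simp add: ip_zero)

lemma ip_lincomb_sq:
 assumes "u \<in> V" "v \<in> V"
 shows "ip (%x. a * u x + b * v x) (%x. a * u x + b * v x) = a\<^sup>2 * ip u u + 2 * a * b * ip u v + b\<^sup>2 * ip v v"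
proof -
 have c: "(%x. a * u x + b * v x) \<in> V" by (intro lincomb assms)
 have "ip u (%x. a * u x + b * v x) = a * ip u u + b * ip u v"
  using ip_lincomb[OF assms assms(1)] ip_sym[OF assms] ip_sym[OF assms(1) c] by simp
 moreover have "ip v (%x. a * u x + b * v x) = a * ip u v + b * ip v v"
  using ip_lincomb[OF assms assms(2)] ip_sym[OF assms(2) c] by simp
 ultimately show ?thesis using ip_lincomb[OF assms c]
  by (simp add: power2_eq_square algebra_simps)
qed

lemma ip_diff_sq:
 assumes "u \<in> V" "v \<in> V"
 shows "ip (%x. u x - v x) (%x. u x - v x) = ip u u - 2 * ip u v + ip v v"
 using ip_lincomb_sq[OF assms, of 1 "-1"] by simp

lemma CS: "u \<in> V ==> v \<in> V ==> (ip u v)\<^sup>2 <= ip u u * ip v v"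
proof (rule discriminant_nonneg)
 assume u: "u \<in> V" and v: "v \<in> V"
 show "0 <= ip v v" using v by (rule ip_nonneg)
 fix t
 show "0 <= ip u u + 2 * ip u v * t + ip v v * t\<^sup>2"
  using ip_nonneg[OF lincomb[OF u v, of 1 t]] ip_lincomb_sq[OF u v, of 1 t] by (simp add: mult_ac)
qed

lemma ip_tendsto:
 assumes "!!n::nat. u n \<in> V" "v \<in> V" "w \<in> V" "(%n. ip (%x. u n x - v x) (%x. u n x - v x)) ----> 0"
 shows "(%n. ip (u n) w) ----> ip v w"
proof -
 have "(%n. sqrt (ip (%x. u n x - v x) (%x. u n x - v x) * ip w w)) ----> sqrt (0 * ip w w)"
  by (intro tendsto_intros assms)
 then have l: "(%n. sqrt (ip (%x. u n x - v x) (%x. u n x - v x) * ip w w)) ----> 0" by simp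
 have b: "\<bar>ip (u n) w - ip v w\<bar> <= sqrt (ip (%x. u n x - v x) (%x. u n x - v x) * ip w w)" for n
  using CS[OF diff_in[OF assms(1)[of n] assms(2)] assms(3)] ip_diff[OF assms(1)[of n] assms(2,3)]
  by (intro real_le_rsqrt) simp
 have "(%n. ip (u n) w - ip v w) ----> 0"
  by (rule Lim_null_comparison[OF _ l]) (simp add: b)
 then show ?thesis by (rule LIM_zero_cancel)
qed

lemma ip_tendsto_sq:
 assumes "!!n::nat. u n \<in> V" "v \<in> V" "(%n. ip (%x. u n x - v x) (%x. u n x - v x)) ----> 0"
 shows "(%n. ip (u n) (u n)) ----> ip v v"
proof -
 have "(%n. ip (%x. u n x - v x) (%x. u n x - v x) + 2 * ip (u n) v - ip v v) ----> 0 + 2 * ip v v - ip v v"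
  by (intro tendsto_intros ip_tendsto assms)
 then show ?thesis using ip_diff_sq[OF assms(1,2)] by simp
qed

text \<open>Bessel's identity for an orthonormal sequence some of whose members may be the zero
  function. The last part measures the distance of two residuals and gives the Cauchy property of
  the expansion.\<close>

lemma bessel_residual:
 fixes e :: "nat => 'x => real"
 assumes e: "!!k. e k \<in> V" and v: "v \<in> V"
  and orth: "!!i j. i \<noteq> j ==> ip (e i) (e j) = 0" and nz: "!!i. ip (e i) (e i) = 1 \<or> e i = (%x. 0)"
 defines "r \<equiv> %N x. v x - (\<Sum>k<N. ip v (e k) * e k x)"
 shows "r N \<in> V"
  and "j < N ==> ip (e j) (r N) = 0"
  and "ip (r N) (r N) = ip v v - (\<Sum>k<N. (ip v (e k))\<^sup>2)"
  and "M <= N ==> ip (%x. r M x - r N x) (%x. r M x - r N x) = (\<Sum>k=M..<N. (ip v (e k))\<^sup>2)"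
proof -
 let ?S = "%c (N::nat) x. \<Sum>k<N. c k * e k x"
 have S: "?S c N \<in> V" for c N by (intro sum_in e)
 show rV: "r N \<in> V" for N unfolding r_def by (intro diff_in v S)
 \<comment> \<open>A zero member has the coefficient 0, and any other member has norm 1; in both
   cases the squared norm may be dropped from the product with a coefficient.\<close>
 have self: "c * ip (e j) (e j) = c" if "c = ip w (e j) \<or> c = ip (e j) w" "w \<in> V" for c j w
  using nz[of j] that ip_zero[OF that(2)] ip_zero_right[OF that(2)] by auto
 have eS: "ip (e j) (?S c N) = (if j < N then c j * ip (e j) (e j) else 0)" for c j N
 proof -
  have "ip (e j) (?S c N) = (\<Sum>k<N. c k * ip (e k) (e j))"
   using ip_sum[OF e e[of j]] ip_sym[OF e[of j] S] by simp
  also have "... = (\<Sum>k<N. if k = j then c j * ip (e j) (e j) else 0)"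
   by (intro sum.cong refl) (use orth in auto)
  also have "... = (if j < N then c j * ip (e j) (e j) else 0)" by simp
  finally show ?thesis .
 qed
 have SS: "ip (?S c N) (?S c N) = (\<Sum>k<N. c k * (c k * ip (e k) (e k)))" for c N
  unfolding ip_sum[OF e S] by (intro sum.cong refl) (simp add: eS)
 show "j < N ==> ip (e j) (r N) = 0"
  using ip_diff[OF v S e[of j]] ip_sym[OF e[of j] rV] ip_sym[OF e[of j] S] eS[of j "%k. ip v (e k)" N]
   self[of "ip v (e j)" v j] v
  by (simp add: r_def)
 have vS: "ip v (?S (%k. ip v (e k)) N) = (\<Sum>k<N. (ip v (e k))\<^sup>2)"
 proof -
  have "ip v (?S (%k. ip v (e k)) N) = ip (?S (%k. ip v (e k)) N) v" by (intro ip_sym v S)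
  also have "... = (\<Sum>k<N. ip v (e k) * ip (e k) v)" by (rule ip_sum[OF e v])
  also have "... = (\<Sum>k<N. (ip v (e k))\<^sup>2)"
   using ip_sym[OF v e] by (intro sum.cong refl) (simp add: power2_eq_square)
  finally show ?thesis .
 qed
 have SS': "ip (?S (%k. ip v (e k)) N) (?S (%k. ip v (e k)) N) = (\<Sum>k<N. (ip v (e k))\<^sup>2)"
  unfolding SS by (intro sum.cong refl) (use self v in \<open>auto simp: power2_eq_square\<close>)
 show "ip (r N) (r N) = ip v v - (\<Sum>k<N. (ip v (e k))\<^sup>2)"
  unfolding r_def ip_diff_sq[OF v S] vS SS' by simp
 assume MN: "M <= N"
 \<comment> \<open>Setting the first coefficients to 0 writes the difference of two partial sums as
   a single sum over the full range, to which \<open>SS\<close> applies.\<close>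
 let ?c = "%k. if M <= k then ip v (e k) else 0"
 have split: "(\<Sum>k<N. f k) = (\<Sum>k<M. f k) + (\<Sum>k=M..<N. f k)" for f :: "nat => real"
  using sum.atLeastLessThan_concat[of 0 M N f] MN by (simp add: atLeast0LessThan)
 have eq: "(%x. r M x - r N x) = ?S ?c N"
  unfolding r_def split by auto
 show "ip (%x. r M x - r N x) (%x. r M x - r N x) = (\<Sum>k=M..<N. (ip v (e k))\<^sup>2)"
 proof -
  have "(\<Sum>k<N. ?c k * (?c k * ip (e k) (e k)))
    = (\<Sum>k<M. ?c k * (?c k * ip (e k) (e k))) + (\<Sum>k=M..<N. ?c k * (?c k * ip (e k) (e k)))"
   by (rule split)
  moreover have "(\<Sum>k<M. ?c k * (?c k * ip (e k) (e k))) = 0"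
   by (intro sum.neutral) auto
  moreover have "(\<Sum>k=M..<N. ?c k * (?c k * ip (e k) (e k))) = (\<Sum>k=M..<N. (ip v (e k))\<^sup>2)"
   by (intro sum.cong refl) (use self v in \<open>auto simp: power2_eq_square\<close>)
  ultimately show ?thesis unfolding eq SS by simp
 qed
qed

end

text \<open>A compact form \<open>m\<close> on a Hilbert space with inner product \<open>q\<close>; \<open>V\<close> is not a quotient,
 so \<open>m\<close> and \<open>q\<close> are only semidefinite, with the same null vectors.\<close>

locale compact_form = m: semi_ip V m + q: semi_ip V q
 for V :: "('x => real) set" and m q +
 assumes m_le_q: "u \<in> V ==> m u u <= q u u"
  and null: "u \<in> V ==> m u u = 0 ==> q u u = 0"
  and complete: "!!u. (!!n::nat. u n \<in> V) ==>
    (!!e. e > 0 ==> \<exists>N. \<forall>i\<ge>N. \<forall>j\<ge>N. q (%x. u i x - u j x) (%x. u i x - u j x) < e) ==>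
    \<exists>v\<in>V. (%n. q (%x. u n x - v x) (%x. u n x - v x)) ----> 0"
  and compact: "!!u B. (!!n::nat. u n \<in> V) ==> (!!n. q (u n) (u n) <= B) ==>
    \<exists>r::nat=>nat. strict_mono r \<and> (\<forall>e>0. \<exists>N. \<forall>i\<ge>N. \<forall>j\<ge>N.
     m (%x. u (r i) x - u (r j) x) (%x. u (r i) x - u (r j) x) < e)"
begin

text \<open>One step of the variational construction of eigenvectors: \<open>\<mu>\<close> is the
  supremum of \<open>m\<close> over the unit ball of \<open>q\<close> in the orthogonal complement
  \<open>W\<close> of \<open>E\<close>. A maximising sequence has an \<open>m\<close>-Cauchy
  subsequence by compactness, and the parallelogram identity upgrades this to
  \<open>q\<close>-Cauchy. When the supremum is 0, the zero function serves as a
  placeholder.\<close>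

lemma maximizer:
 fixes E :: "('x => real) set"
 assumes E: "E \<subseteq> V"
 defines "W \<equiv> {w \<in> V. \<forall>e\<in>E. q e w = 0}"
 obtains e \<mu> where "e \<in> W" "0 <= \<mu>" "!!w. w \<in> W ==> m w w <= \<mu> * q w w"
  "!!w. w \<in> W ==> m e w = \<mu> * q e w" "q e e = 1 \<and> 0 < \<mu> \<or> e = (%x. 0) \<and> \<mu> = 0"
proof -
 have WV: "W \<subseteq> V" by (auto simp: W_def)
 have W0: "(%x. 0) \<in> W" using E by (auto simp: W_def m.zero q.ip_zero_right)
 have qEr: "q e (%x. a * u x + b * v x) = a * q e u + b * q e v" if "e \<in> V" "u \<in> V" "v \<in> V" for e u v a b
  using q.ip_lincomb[OF that(2,3,1)] q.ip_sym[OF that(1) q.lincomb[OF that(2,3)]] q.ip_sym[OF that(1,2)] q.ip_sym[OF that(1,3)] by simp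
 have Wlin: "(%x. a * u x + b * v x) \<in> W" if "u \<in> W" "v \<in> W" for u v a b
  using that E by (auto simp: W_def m.lincomb qEr subset_iff)
 define A where "A = (%w. m w w) ` {w \<in> W. q w w <= 1}"
 define \<mu> where "\<mu> = Sup A"
 have bA: "bdd_above A" unfolding A_def
  by (rule bdd_aboveI2[where M=1]) (use m_le_q WV order_trans in blast)
 have A0: "0 \<in> A" unfolding A_def using W0 m.ip_zero[OF m.zero] q.ip_zero[OF m.zero] by force
 have \<mu>0: "0 <= \<mu>" unfolding \<mu>_def by (rule cSup_upper[OF A0 bA])
 have hom: "m w w <= \<mu> * q w w" if w: "w \<in> W" for w
 proof (cases "q w w > 0")
  case True
  define s where "s = 1 / sqrt (q w w)"
  have s: "s\<^sup>2 * q w w = 1" using True by (simp add: s_def power_divide)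
  have wV: "w \<in> V" using w WV by auto
  have sw: "(%x. s * w x) \<in> W" using Wlin[OF w w, of s 0] by simp
  have "q (%x. s * w x) (%x. s * w x) = 1" "m (%x. s * w x) (%x. s * w x) = s\<^sup>2 * m w w"
   using q.ip_lincomb_sq[OF wV wV, of s 0] m.ip_lincomb_sq[OF wV wV, of s 0] s by simp_all
  then have "s\<^sup>2 * m w w \<in> A" unfolding A_def using sw by force
  then have "s\<^sup>2 * m w w <= \<mu>" unfolding \<mu>_def by (rule cSup_upper[OF _ bA])
  then have "s\<^sup>2 * m w w * q w w <= \<mu> * q w w" using True by (intro mult_right_mono) auto
  then show ?thesis using s by (simp add: mult.commute mult.left_commute)
 next
  case False
  then have "q w w = 0" using q.ip_nonneg w WV by fastforce
  then show ?thesis using m_le_q[of w] w WV by auto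
 qed
 show ?thesis
 proof (cases "\<mu> = 0")
  case True
  show ?thesis
  proof (rule that[OF W0, of \<mu>])
   fix w assume w: "w \<in> W"
   show "m w w <= \<mu> * q w w" using hom w .
   show "m (%x. 0) w = \<mu> * q (%x. 0) w"
    using m.ip_zero[of w] q.ip_zero[of w] w WV by auto
  qed (use True in auto)
 next
  case False
  with \<mu>0 have \<mu>: "\<mu> > 0" by simp
  have "\<exists>w\<in>W. q w w <= 1 \<and> \<mu> - \<mu> / Suc n < m w w" for n
  proof -
   have "\<mu> - \<mu> / Suc n < Sup A" unfolding \<mu>_def[symmetric] using \<mu> by simp
   then obtain y where "y \<in> A" "\<mu> - \<mu> / Suc n < y" using less_cSup_iff[OF _ bA] A0 by blast
   then show ?thesis unfolding A_def by auto
  qed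
  then obtain v where v: "!!n. v n \<in> W" "!!n. q (v n) (v n) <= 1" "!!n. \<mu> - \<mu> / Suc n < m (v n) (v n)" by metis
  have vV: "v n \<in> V" for n using v(1) WV by auto
  obtain r :: "nat => nat" where rr: "strict_mono r \<and> (\<forall>e>0. \<exists>N. \<forall>i\<ge>N. \<forall>j\<ge>N.
     m (%x. v (r i) x - v (r j) x) (%x. v (r i) x - v (r j) x) < e)"
   using compact[of v 1, OF vV v(2)] ..
  then have r: "strict_mono r" and rC: "!!e. e > 0 ==> \<exists>N. \<forall>i\<ge>N. \<forall>j\<ge>N.
     m (%x. v (r i) x - v (r j) x) (%x. v (r i) x - v (r j) x) < e"
   by simp_all
  \<comment> \<open>The midpoint of two near-maximisers satisfies \<open>m <= \<mu> * q\<close> too.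
    Since \<open>q\<close> is at most 1 on both of them, the parallelogram identities for
    \<open>m\<close> and \<open>q\<close> leave the \<open>q\<close>-distance bounded by the defects
    and the \<open>m\<close>-distance.\<close>
  have key: "\<mu> * q (%x. v i x - v j x) (%x. v i x - v j x) <= 2 * \<mu> / Suc i + 2 * \<mu> / Suc j
    + m (%x. v i x - v j x) (%x. v i x - v j x)" for i j
  proof -
   let ?w = "%x. (1/2) * v i x + (1/2) * v j x"
   have "?w \<in> W" by (intro Wlin v)
   then have "m ?w ?w <= \<mu> * q ?w ?w" by (rule hom)
   then have k1: "4 * m ?w ?w <= \<mu> * (4 * q ?w ?w)" by simp
   have k2: "4 * m ?w ?w = 2 * m (v i) (v i) + 2 * m (v j) (v j) - m (%x. v i x - v j x) (%x. v i x - v j x)"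
    unfolding m.ip_lincomb_sq[OF vV vV] m.ip_diff_sq[OF vV vV] by (simp add: power2_eq_square)
   have k3: "4 * q ?w ?w = 2 * q (v i) (v i) + 2 * q (v j) (v j) - q (%x. v i x - v j x) (%x. v i x - v j x)"
    unfolding q.ip_lincomb_sq[OF vV vV] q.ip_diff_sq[OF vV vV] by (simp add: power2_eq_square)
   have "\<mu> * (4 * q ?w ?w) <= \<mu> * (4 - q (%x. v i x - v j x) (%x. v i x - v j x))"
    using k3 v(2)[of i] v(2)[of j] \<mu> by (intro mult_left_mono) auto
   then have k4: "\<mu> * (4 * q ?w ?w) <= 4 * \<mu> - \<mu> * q (%x. v i x - v j x) (%x. v i x - v j x)"
    by (simp only: right_diff_distrib mult.commute[of \<mu> 4])
   have k5: "2 * \<mu> / Suc k = 2 * (\<mu> / Suc k)" for k by simp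
   show ?thesis unfolding k5 using v(3)[of i] v(3)[of j] k1 k2 k4 by linarith
  qed
  have "\<exists>N. \<forall>i\<ge>N. \<forall>j\<ge>N. q (%x. v (r i) x - v (r j) x) (%x. v (r i) x - v (r j) x) < e" if e: "e > 0" for e
  proof -
   obtain N where N: "!!i j. i \<ge> N ==> j \<ge> N ==> m (%x. v (r i) x - v (r j) x) (%x. v (r i) x - v (r j) x) < \<mu> * e / 2"
    using rC[of "\<mu> * e / 2"] \<mu> e by auto
   obtain K :: nat where K: "8 / e < real K" using reals_Archimedean2 by blast
   show ?thesis
   proof (intro exI[of _ "max N K"] allI impI)
    fix i j assume i: "max N K <= i" and j: "max N K <= j"
    have "2 * \<mu> / Suc (r k) < \<mu> * e / 4" if "max N K <= k" for k
    proof -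
     have "8 / e < Suc (r k)" using K that seq_suble[OF r, of k] by simp
     then have "8 < e * Suc (r k)" using e by (simp add: field_simps)
     then have "\<mu> * 8 < \<mu> * (e * Suc (r k))" using \<mu> by (rule mult_strict_left_mono)
     then show ?thesis by (simp add: field_simps)
    qed
    from this[OF i] this[OF j] N[of i j] i j key[of "r i" "r j"]
    have "\<mu> * q (%x. v (r i) x - v (r j) x) (%x. v (r i) x - v (r j) x) < \<mu> * e" by simp
    then show "q (%x. v (r i) x - v (r j) x) (%x. v (r i) x - v (r j) x) < e" using \<mu> by simp
   qed
  qed
  then obtain e where e: "e \<in> V" and le: "(%n. q (%x. v (r n) x - e x) (%x. v (r n) x - e x)) ----> 0"
   using complete[of "%n. v (r n)"] vV by blast
  have lm: "(%n. m (%x. v (r n) x - e x) (%x. v (r n) x - e x)) ----> 0"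
   using m_le_q m.ip_nonneg m.diff_in[OF vV e]
   by (intro tendsto_sandwich[OF _ _ tendsto_const le]) auto
  have eW: "e \<in> W"
  proof -
   have "q f e = 0" if f: "f \<in> E" for f
   proof -
    have fV: "f \<in> V" using f E by auto
    have "(%n. q (v (r n)) f) ----> q e f" by (rule q.ip_tendsto[OF vV e fV le])
    moreover have "q (v (r n)) f = 0" for n using v(1)[of "r n"] f q.ip_sym[OF vV fV] by (auto simp: W_def)
    ultimately have "q e f = 0" by (simp add: LIMSEQ_const_iff)
    then show ?thesis using q.ip_sym[OF e fV] by simp
   qed
   then show ?thesis using e by (simp add: W_def)
  qed
  have q1: "q e e <= 1"
   by (rule LIMSEQ_le_const2[OF q.ip_tendsto_sq[OF vV e le]]) (use v(2) in auto)
  have "\<mu> <= m e e"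
  proof (rule LIMSEQ_le[OF _ m.ip_tendsto_sq[OF vV e lm]])
   have "(%n. \<mu> - \<mu> * inverse (real (Suc (r n)))) ----> \<mu> - \<mu> * 0"
    using LIMSEQ_subseq_LIMSEQ[OF LIMSEQ_inverse_real_of_nat r]
    by (intro tendsto_intros) (simp add: comp_def)
   then show "(%n. \<mu> - \<mu> * inverse (real (Suc (r n)))) ----> \<mu>" by simp
   show "\<exists>N. \<forall>n\<ge>N. \<mu> - \<mu> * inverse (real (Suc (r n))) <= m (v (r n)) (v (r n))"
    using v(3) by (auto simp: divide_inverse intro: less_imp_le)
  qed
  moreover have "m e e <= \<mu> * q e e" by (rule hom[OF eW])
  ultimately have "q e e = 1" using q1 \<mu> by (smt (verit) mult_less_cancel_left2)
  moreover have "m e e = \<mu>" using \<open>\<mu> <= m e e\<close> \<open>m e e <= \<mu> * q e e\<close> calculation by simp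
  ultimately have eq: "q e e = 1" "m e e = \<mu>" by auto
  \<comment> \<open>The form \<open>\<mu> * q - m\<close> is nonnegative on \<open>W\<close> and
    vanishes at e. Along the line through e in direction w it is a quadratic without constant term,
    so its mixed coefficient must vanish.\<close>
  have stat: "m e w = \<mu> * q e w" if w: "w \<in> W" for w
  proof -
   have wV: "w \<in> V" using w WV by auto
   have "(\<mu> * q e w - m e w)\<^sup>2 <= 0 * (\<mu> * q w w - m w w)"
   proof (rule discriminant_nonneg)
    show "0 <= \<mu> * q w w - m w w" using hom[OF w] by simp
    fix t
    have "m (%x. 1 * e x + t * w x) (%x. 1 * e x + t * w x) <= \<mu> * q (%x. 1 * e x + t * w x) (%x. 1 * e x + t * w x)"
     by (intro hom Wlin eW w)
    then show "0 <= 0 + 2 * (\<mu> * q e w - m e w) * t + (\<mu> * q w w - m w w) * t\<^sup>2"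
     unfolding m.ip_lincomb_sq[OF e wV] q.ip_lincomb_sq[OF e wV] eq by (simp add: algebra_simps)
   qed
   then show ?thesis by simp
  qed
  show ?thesis by (rule that[OF eW \<mu>0 hom stat]) (use eq \<mu> in auto)
 qed
qed

text \<open>Eigenvectors are chosen recursively by \<open>maximizer\<close> in the complement of the
  earlier ones. The invariant \<open>P\<close> records maximality as well, because the completeness
  proof bounds \<open>m\<close> on the n-th residual by \<open>\<mu> n * q\<close>. The eigenvalue
  relation extends from the complement to all of \<open>V\<close> since the earlier eigenvectors are
  orthogonal to the new one for both forms.\<close>

theorem spectral_q:
 obtains e :: "nat => 'x => real" and \<mu> :: "nat => real" where
  "!!k. e k \<in> V" "!!k. 0 <= \<mu> k" "!!k. \<mu> k <= 1" "!!i j. i \<noteq> j ==> q (e i) (e j) = 0"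
  "!!k. q (e k) (e k) = 1 \<and> 0 < \<mu> k \<or> e k = (%x. 0) \<and> \<mu> k = 0"
  "!!k v. v \<in> V ==> m (e k) v = \<mu> k * q (e k) v"
  "!!v. v \<in> V ==> (%N. q (%x. v x - (\<Sum>k<N. q v (e k) * e k x)) (%x. v x - (\<Sum>k<N. q v (e k) * e k x))) ----> 0"
proof -
 define P where "P f N r \<longleftrightarrow> fst r \<in> V \<and> 0 <= snd r \<and> (\<forall>j<N. q (fst (f j)) (fst r) = 0) \<and>
   (\<forall>v\<in>V. m (fst r) v = snd r * q (fst r) v) \<and>
   (q (fst r) (fst r) = 1 \<and> 0 < snd r \<or> fst r = (%x. 0) \<and> snd r = 0) \<and>
   (\<forall>w\<in>V. (\<forall>j<N. q (fst (f j)) w = 0) \<longrightarrow> m w w <= snd r * q w w)"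
  for f :: "nat => ('x => real) \<times> real" and N :: nat and r
 have "\<exists>f. \<forall>N. P f N (f N)"
 proof (rule dependent_wellorder_choice)
  show "P f N r = P g N r" if "!!y. y < N ==> f y = g y" for r f g N
   using that by (simp add: P_def)
  fix N f assume IH: "!!y. y < N ==> P f y (f y)"
  let ?E = "(%j. fst (f j)) ` {..<N}"
  have E: "?E \<subseteq> V" using IH by (auto simp: P_def)
  have Weq: "{w \<in> V. \<forall>e\<in>?E. q e w = 0} = {w \<in> V. \<forall>j<N. q (fst (f j)) w = 0}" by auto
  show "\<exists>r. P f N r"
  proof (rule maximizer[OF E, unfolded Weq])
  fix e \<mu> assume h: "e \<in> {w \<in> V. \<forall>j<N. q (fst (f j)) w = 0}" "0 <= \<mu>"
   "!!w. w \<in> {w \<in> V. \<forall>j<N. q (fst (f j)) w = 0} ==> m w w <= \<mu> * q w w"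
   "!!w. w \<in> {w \<in> V. \<forall>j<N. q (fst (f j)) w = 0} ==> m e w = \<mu> * q e w"
   "q e e = 1 \<and> 0 < \<mu> \<or> e = (%x. 0) \<and> \<mu> = 0"
  have e: "e \<in> V" "!!j. j < N ==> q (fst (f j)) e = 0" and \<mu>: "0 <= \<mu>"
   "!!w. w \<in> V ==> (\<forall>j<N. q (fst (f j)) w = 0) ==> m w w <= \<mu> * q w w"
   "!!w. w \<in> V ==> (\<forall>j<N. q (fst (f j)) w = 0) ==> m e w = \<mu> * q e w"
   "q e e = 1 \<and> 0 < \<mu> \<or> e = (%x. 0) \<and> \<mu> = 0"
   using h by auto
  have all: "m e v = \<mu> * q e v" if v: "v \<in> V" for v
  proof -
   \<comment> \<open>Padding the finite list with zero functions makes it a sequence, the form in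
     which \<open>bessel_residual\<close> takes its system.\<close>
   define g where "g j = (if j < N then fst (f j) else (%x. 0))" for j
   have gV: "g j \<in> V" for j using IH by (auto simp: g_def P_def m.zero)
   have qo: "q (g i) (g j) = 0" if "i \<noteq> j" for i j
   proof (cases "i < N \<and> j < N")
    case True
    then show ?thesis
    proof (cases "i < j")
     case True then show ?thesis using IH[of j] \<open>i < N \<and> j < N\<close> by (auto simp: g_def P_def)
    next
     case False
     then have "j < i" using that by simp
     then have "q (g j) (g i) = 0" using IH[of i] \<open>i < N \<and> j < N\<close> by (auto simp: g_def P_def)
     then show ?thesis using q.ip_sym[OF gV gV] by metis
    qed
   next
    case False
    then have "g i = (%x. 0) \<or> g j = (%x. 0)" by (auto simp: g_def)
    then show ?thesis using q.ip_zero[OF gV[of j]] q.ip_zero_right[OF gV[of i]] by auto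
   qed
   have qn: "q (g j) (g j) = 1 \<or> g j = (%x. 0)" for j using IH[of j] by (auto simp: g_def P_def)
   define w where "w x = v x - (\<Sum>k<N. q v (g k) * g k x)" for x
   have wV: "w \<in> V" and w0: "!!j. j < N ==> q (g j) w = 0"
    unfolding w_def using q.bessel_residual(1,2)[OF gV v qo qn] by auto
   have "m e w = \<mu> * q e w"
    by (rule \<mu>(3)[OF wV]) (use w0 in \<open>auto simp: g_def\<close>)
   moreover have "q (g j) e = 0" "m (g j) e = 0" if "j < N" for j
    using IH[of j] that e by (auto simp: g_def P_def)
   then have z: "q (%x. \<Sum>k<N. q v (g k) * g k x) e = 0" "m (%x. \<Sum>k<N. q v (g k) * g k x) e = 0"
    unfolding q.ip_sum[OF gV e(1)] m.ip_sum[OF gV e(1)] by auto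
   have "q w e = q v e" "m w e = m v e"
    unfolding w_def using z q.ip_diff[OF v q.sum_in[OF gV] e(1)] m.ip_diff[OF v q.sum_in[OF gV] e(1)] by auto
   ultimately show ?thesis
    using q.ip_sym[OF e(1) wV] q.ip_sym[OF e(1) v] m.ip_sym[OF e(1) wV] m.ip_sym[OF e(1) v] by simp
  qed
  show "\<exists>r. P f N r"
   using e \<mu> all by (intro exI[of _ "(e, \<mu>)"]) (auto simp: P_def)
  qed
 qed
 then obtain f where f: "!!N. P f N (f N)" by blast
 define e where "e k = fst (f k)" for k
 define \<mu> where "\<mu> k = snd (f k)" for k
 have eV: "e k \<in> V" and \<mu>0: "0 <= \<mu> k" and em: "!!v. v \<in> V ==> m (e k) v = \<mu> k * q (e k) v"
  and alt: "q (e k) (e k) = 1 \<and> 0 < \<mu> k \<or> e k = (%x. 0) \<and> \<mu> k = 0"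
  and mx: "!!w. w \<in> V ==> (\<forall>j<k. q (e j) w = 0) ==> m w w <= \<mu> k * q w w" for k
  using f[of k] by (auto simp: P_def e_def \<mu>_def)
 have lt: "q (e i) (e j) = 0" if "i < j" for i j using f[of j] that by (auto simp: P_def e_def)
 have orth: "q (e i) (e j) = 0" if "i \<noteq> j" for i j
  using lt[of i j] lt[of j i] that q.ip_sym[OF eV eV] by (metis nat_neq_iff)
 have \<mu>1: "\<mu> k <= 1" for k
  using alt[of k] em[OF eV, of k k] m_le_q[OF eV, of k] by auto
 have dec: "\<mu> (Suc k) <= \<mu> k" for k
 proof -
  have "m (e (Suc k)) (e (Suc k)) <= \<mu> k * q (e (Suc k)) (e (Suc k))"
   by (rule mx[OF eV]) (auto intro: lt)
  then show ?thesis using alt[of "Suc k"] em[OF eV, of "Suc k" "Suc k"] \<mu>0[of k] by auto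
 qed
 \<comment> \<open>If the eigenvalues stayed above some positive L, the eigenvectors would be
   bounded in \<open>q\<close>, pairwise \<open>m\<close>-orthogonal and of \<open>m\<close>-norm
   squared at least L. No subsequence of them could be \<open>m\<close>-Cauchy, contrary to
   compactness.\<close>
 have lim: "\<mu> ----> 0"
 proof -
  have ds: "decseq \<mu>" using dec by (rule decseq_SucI)
  obtain L where L: "\<mu> ----> L" "!!i. L <= \<mu> i"
   using decseq_convergent[OF ds, of 0] \<mu>0 by auto
  have "L \<ge> 0" using \<mu>0 by (intro LIMSEQ_le_const[OF L(1)]) auto
  moreover have "\<not> L > 0"
  proof
   assume Lp: "L > 0"
   have "q (e k) (e k) <= 1" for k using alt[of k] q.ip_zero[OF m.zero] by auto
   then have "\<exists>r::nat => nat. strict_mono r \<and> (\<forall>d>0. \<exists>N. \<forall>i\<ge>N. \<forall>j\<ge>N.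
     m (%x. e (r i) x - e (r j) x) (%x. e (r i) x - e (r j) x) < d)"
    by (rule compact[of e 1, OF eV])
   then obtain r :: "nat => nat" where "strict_mono r \<and> (\<forall>d>0. \<exists>N. \<forall>i\<ge>N. \<forall>j\<ge>N.
     m (%x. e (r i) x - e (r j) x) (%x. e (r i) x - e (r j) x) < d)" ..
   then have r: "strict_mono r" and c: "!!d. d > 0 ==> \<exists>N. \<forall>i\<ge>N. \<forall>j\<ge>N.
     m (%x. e (r i) x - e (r j) x) (%x. e (r i) x - e (r j) x) < d"
    by simp_all
   obtain N where N: "m (%x. e (r N) x - e (r (Suc N)) x) (%x. e (r N) x - e (r (Suc N)) x) < L"
    using c[OF Lp] by (meson le_refl le_Suc_eq)
   have "r N \<noteq> r (Suc N)" using r by (metis n_not_Suc_n strict_mono_eq)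
   then have "m (e (r N)) (e (r (Suc N))) = 0" using em[OF eV] orth by simp
   moreover have "m (e k) (e k) \<ge> L" for k
    using alt[of k] em[OF eV, of k k] L(2)[of k] Lp by auto
   ultimately show False using N Lp \<open>!!k. L <= m (e k) (e k)\<close>[of "r N"] \<open>!!k. L <= m (e k) (e k)\<close>[of "r (Suc N)"]
    unfolding m.ip_diff_sq[OF eV eV] by simp
  qed
  ultimately show ?thesis using L(1) by simp
 qed
 have conv: "(%N. q (%x. v x - (\<Sum>k<N. q v (e k) * e k x)) (%x. v x - (\<Sum>k<N. q v (e k) * e k x))) ----> 0"
  if v: "v \<in> V" for v
 proof -
  have nz: "q (e i) (e i) = 1 \<or> e i = (%x. 0)" for i using alt[of i] by auto
  define r where "r N x = v x - (\<Sum>k<N. q v (e k) * e k x)" for N x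
  note B = q.bessel_residual[OF eV v orth nz, folded r_def[abs_def]]
  have rV: "r N \<in> V" for N using B(1) by (simp add: r_def[abs_def])
  have r2: "j < N ==> q (e j) (r N) = 0" for j N using B(2) by (simp add: r_def[abs_def])
  have r3: "q (r N) (r N) = q v v - (\<Sum>k<N. (q v (e k))\<^sup>2)" for N using B(3) by (simp add: r_def[abs_def])
  have r4: "M <= N ==> q (%x. r M x - r N x) (%x. r M x - r N x) = (\<Sum>k=M..<N. (q v (e k))\<^sup>2)" for M N
   using B(4) by (simp add: r_def[abs_def])
  have sm: "summable (%k. (q v (e k))\<^sup>2)"
  proof (rule summableI_nonneg_bounded)
   show "(\<Sum>k<n. (q v (e k))\<^sup>2) <= q v v" for n using r3[of n] q.ip_nonneg[OF rV, of n] by simp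
  qed simp
  have cauchy: "\<exists>N. \<forall>i\<ge>N. \<forall>j\<ge>N. q (%x. r i x - r j x) (%x. r i x - r j x) < d" if d: "d > 0" for d
  proof -
   obtain N where N: "!!i j. i \<ge> N ==> norm (\<Sum>k=i..<j. (q v (e k))\<^sup>2) < d"
    using sm[unfolded summable_Cauchy] d by blast
   show ?thesis
   proof (intro exI[of _ N] allI impI)
    fix i j assume ij: "N <= i" "N <= j"
    show "q (%x. r i x - r j x) (%x. r i x - r j x) < d"
    proof (cases "i <= j")
     case True
     then show ?thesis using r4[OF True] N[of i j] ij by simp
    next
     case False
     then have "q (%x. r j x - r i x) (%x. r j x - r i x) < d" using r4[of j i] N[of j i] ij by simp
     then show ?thesis
      using q.ip_diff_sq[OF rV[of i] rV[of j]] q.ip_diff_sq[OF rV[of j] rV[of i]] q.ip_sym[OF rV[of i] rV[of j]] by simp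
    qed
   qed
  qed
  \<comment> \<open>The residuals converge in \<open>q\<close> to some s. Along them
    \<open>m\<close> is at most \<open>\<mu> n * q v v\<close> and tends to 0, so s is a null vector
    of \<open>m\<close> and hence of \<open>q\<close>.\<close>
  obtain s where s: "s \<in> V" and ls: "(%n. q (%x. r n x - s x) (%x. r n x - s x)) ----> 0"
   using complete[of r, OF rV cauchy] by auto
  have lm: "(%n. m (%x. r n x - s x) (%x. r n x - s x)) ----> 0"
   using m_le_q m.ip_nonneg m.diff_in[OF rV s]
   by (intro tendsto_sandwich[OF _ _ tendsto_const ls]) auto
  have "(%n. m (r n) (r n)) ----> 0"
  proof (rule tendsto_sandwich[OF _ _ tendsto_const])
   show "eventually (%n. m (r n) (r n) <= \<mu> n * q v v) sequentially"
   proof (intro always_eventually allI)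
    fix n
    have "m (r n) (r n) <= \<mu> n * q (r n) (r n)" by (rule mx[OF rV]) (use r2 in auto)
    also have "... <= \<mu> n * q v v" using \<mu>0 r3[of n] by (intro mult_left_mono) (auto intro: sum_nonneg)
    finally show "m (r n) (r n) <= \<mu> n * q v v" .
   qed
   show "(%n. \<mu> n * q v v) ----> 0" using tendsto_mult_right[OF lim, of "q v v"] by simp
  qed (use m.ip_nonneg[OF rV] in auto)
  with m.ip_tendsto_sq[OF rV s lm] have "m s s = 0" by (rule LIMSEQ_unique)
  then have "q s s = 0" by (rule null[OF s])
  then have "(%n. q (r n) (r n)) ----> 0" using q.ip_tendsto_sq[OF rV s ls] by simp
  then show ?thesis by (simp add: r_def[abs_def])
 qed
 show ?thesis by (rule that[OF eV \<mu>0 \<mu>1 orth alt em conv])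
qed

text \<open>Rescaling by the inverse square root of \<open>\<mu> k\<close> turns normalisation in
  \<open>q\<close> into normalisation in \<open>m\<close>, and inverts the eigenvalues. For a zero
  eigenvector the value 1 of \<open>\<kappa>\<close> is a harmless default.\<close>

theorem spectral:
 obtains e :: "nat => 'x => real" and \<kappa> :: "nat => real" where
  "!!k. e k \<in> V" "!!k. 1 <= \<kappa> k" "!!i j. i \<noteq> j ==> m (e i) (e j) = 0"
  "!!k. m (e k) (e k) = 1 \<or> e k = (%x. 0)"
  "!!k v. v \<in> V ==> q (e k) v = \<kappa> k * m (e k) v"
  "!!v. v \<in> V ==> (%N. q (%x. v x - (\<Sum>k<N. m v (e k) * e k x)) (%x. v x - (\<Sum>k<N. m v (e k) * e k x))) ----> 0"
proof -
 show ?thesis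
 proof (rule spectral_q)
 fix f :: "nat => 'x => real" and \<mu> :: "nat => real"
 assume f: "!!k. f k \<in> V" "!!k. 0 <= \<mu> k" "!!k. \<mu> k <= 1" "!!i j. i \<noteq> j ==> q (f i) (f j) = 0"
  "!!k. q (f k) (f k) = 1 \<and> 0 < \<mu> k \<or> f k = (%x. 0) \<and> \<mu> k = 0"
  "!!k v. v \<in> V ==> m (f k) v = \<mu> k * q (f k) v"
  "!!v. v \<in> V ==> (%N. q (%x. v x - (\<Sum>k<N. q v (f k) * f k x)) (%x. v x - (\<Sum>k<N. q v (f k) * f k x))) ----> 0"
 define s where "s k = (if \<mu> k = 0 then 0 else 1 / sqrt (\<mu> k))" for k
 define e where "e k x = s k * f k x" for k x
 define \<kappa> where "\<kappa> k = (if \<mu> k = 0 then 1 else 1 / \<mu> k)" for k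
 have eV: "e k \<in> V" for k unfolding e_def by (intro m.cmul_in f)
 have me: "m (e k) v = s k * \<mu> k * q (f k) v" and qe: "q (e k) v = s k * q (f k) v" if "v \<in> V" for k v
  unfolding e_def using that f by (simp_all add: m.ip_cmul q.ip_cmul)
 have s2: "s k * s k * \<mu> k = (if \<mu> k = 0 then 0 else 1)" for k
  using f(2)[of k] by (simp add: s_def)
 show ?thesis
 proof (rule that[of e \<kappa>])
  show "e k \<in> V" for k by (rule eV)
  show "1 <= \<kappa> k" for k using f(2,3)[of k] by (auto simp: \<kappa>_def)
  have qfe: "q (f i) (e j) = s j * q (f i) (f j)" for i j
   using qe[OF f(1), of j i] q.ip_sym[OF eV f(1)] q.ip_sym[OF f(1) f(1)] by metis
  show "m (e i) (e j) = 0" if "i \<noteq> j" for i j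
   using f(4)[OF that] me[OF eV] qfe by simp
  show "m (e k) (e k) = 1 \<or> e k = (%x. 0)" for k
   using f(5)[of k] me[OF eV, of k k] qfe[of k k] s2[of k] by (auto simp: e_def mult_ac)
  show "q (e k) v = \<kappa> k * m (e k) v" if "v \<in> V" for k v
   using f(5)[of k] by (auto simp: me[OF that] qe[OF that] \<kappa>_def s_def)
  fix v assume v: "v \<in> V"
  have "m v (e k) * e k x = q v (f k) * f k x" for k x
  proof -
   have "m v (e k) * e k x = (s k * s k * \<mu> k) * (q v (f k) * f k x)"
    using m.ip_sym[OF v eV] q.ip_sym[OF v f(1)] me[OF v] by (simp add: e_def mult_ac)
   then show ?thesis using s2[of k] f(5)[of k] by auto
  qed
  then show "(%N. q (%x. v x - (\<Sum>k<N. m v (e k) * e k x)) (%x. v x - (\<Sum>k<N. m v (e k) * e k x))) ----> 0"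
   using f(7)[OF v] by simp
 qed
 qed
qed

end

section \<open>Compact embedding\<close>

lemma path_has_derivative:
 assumes "smooth_fun \<phi>"
 shows "((%r. \<phi> (x + r *\<^sub>R v)) has_real_derivative grad \<phi> (x + r *\<^sub>R v) \<bullet> v) (at r)"
proof -
 have "((%r. x + r *\<^sub>R v) has_derivative (%h. h *\<^sub>R v)) (at r)" by (auto intro!: derivative_eq_intros)
 from has_derivative_compose[OF this smooth_fun_has_derivative_grad[OF assms]]
 show ?thesis
  unfolding has_field_derivative_def by (rule has_derivative_eq_rhs) (simp add: fun_eq_iff)
qed

text \<open>Stated for a displacement field so that it covers translations, with
  \<open>\<xi>\<close> constant, as well as dilations about a point, with
  \<open>\<xi> x = x - x0\<close>.\<close>

lemma DERIV_integral_path: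
 fixes \<phi> :: "'a::euclidean_space => real" and W :: "'a => real"
 assumes \<phi>: "\<phi> \<in> test_functions UNIV" and W: "integrable N W"
  and id: "(%x. x) \<in> borel_measurable N" and \<xi>: "\<xi> \<in> borel_measurable N" "!!x. x \<in> space N ==> norm (\<xi> x) <= R"
 shows "((%r. LINT x|N. W x * \<phi> (x + r *\<^sub>R \<xi> x)) has_real_derivative
   (LINT x|N. W x * (grad \<phi> (x + r *\<^sub>R \<xi> x) \<bullet> \<xi> x))) (at r)"
proof -
 obtain B where B: "0 <= B" "!!x. \<bar>\<phi> x\<bar> <= B" "!!x. norm (grad \<phi> x) <= B" using test_bounded[OF \<phi>] by metis
 have [measurable]: "\<phi> \<in> borel_measurable borel" "grad \<phi> \<in> borel_measurable borel" using test_measurable[OF \<phi>] by auto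
 have [measurable]: "W \<in> borel_measurable N" using W by auto
 note [measurable] = id \<xi>(1)
 have gm: "grad \<phi> \<in> borel \<rightarrow>\<^sub>M borel" "\<phi> \<in> borel \<rightarrow>\<^sub>M borel" by measurable
 have m0: "(%x. x + r *\<^sub>R \<xi> x) \<in> N \<rightarrow>\<^sub>M borel" for r by measurable
 have [measurable]: "(%x. \<phi> (x + r *\<^sub>R \<xi> x)) \<in> borel_measurable N" "(%x. grad \<phi> (x + r *\<^sub>R \<xi> x)) \<in> borel_measurable N" for r
  using measurable_compose[OF m0 gm(1)] measurable_compose[OF m0 gm(2)] by auto
 show ?thesis
 proof (rule DERIV_integral[where a="r-1" and b="r+1" and w="%x. \<bar>W x\<bar> * (B * \<bar>R\<bar>)"])
  show "integrable N (%x. W x * \<phi> (x + r *\<^sub>R \<xi> x))" for r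
  proof (rule integrable_dominated)
   show "integrable N (%x. \<bar>W x\<bar> * B)" using W by simp
   show "AE x in N. norm (W x * \<phi> (x + r *\<^sub>R \<xi> x)) <= norm (\<bar>W x\<bar> * B)"
    using B by (intro AE_I2) (simp add: abs_mult mult_left_mono)
  qed measurable
  show "!!r x. ((%r. W x * \<phi> (x + r *\<^sub>R \<xi> x)) has_real_derivative W x * (grad \<phi> (x + r *\<^sub>R \<xi> x) \<bullet> \<xi> x)) (at r)"
   using DERIV_cmult[OF path_has_derivative[OF test_smooth[OF \<phi>]]] by blast
  show "\<bar>W x * (grad \<phi> (x + r *\<^sub>R \<xi> x) \<bullet> \<xi> x)\<bar> <= \<bar>W x\<bar> * (B * \<bar>R\<bar>)" if "x \<in> space N" for r x
  proof -
   have "\<bar>grad \<phi> (x + r *\<^sub>R \<xi> x) \<bullet> \<xi> x\<bar> <= norm (grad \<phi> (x + r *\<^sub>R \<xi> x)) * norm (\<xi> x)"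
    by (rule Cauchy_Schwarz_ineq2)
   also have "... <= B * \<bar>R\<bar>" using B \<xi>(2)[OF that] by (intro mult_mono) auto
   finally show ?thesis by (simp add: abs_mult mult_left_mono)
  qed
  show "integrable N (%x. \<bar>W x\<bar> * (B * \<bar>R\<bar>))" using W by simp
  show "(%x. W x * (grad \<phi> (x + r *\<^sub>R \<xi> x) \<bullet> \<xi> x)) \<in> borel_measurable N" by measurable
 qed auto
qed

lemma lborel_translation:
 fixes f :: "'a::euclidean_space => 'b::euclidean_space"
 assumes "f \<in> borel_measurable borel"
 shows "(LINT x|lborel. f (x + v)) = (LINT x|lborel. f x)"
  "integrable lborel (%x. f (x + v)) \<longleftrightarrow> integrable lborel f"
 using integral_distr[of "(+) v" lborel borel f] integrable_distr_eq[of "(+) v" lborel borel f] assms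
  lborel_distr_plus[of v] by (auto simp: add.commute)

lemma nn_lborel_translation:
 fixes f :: "'a::euclidean_space => ennreal"
 assumes "f \<in> borel_measurable borel"
 shows "(\<integral>\<^sup>+x. f (x + v) \<partial>lborel) = (\<integral>\<^sup>+x. f x \<partial>lborel)"
 using nn_integral_distr[of "(+) v" lborel borel f] assms lborel_distr_plus[of v] by (simp add: add.commute)

lemma sqint_test_lborel:
 assumes "\<phi> \<in> test_functions \<Omega>"
 shows "sqint lborel \<phi>" "sqint lborel (grad \<phi>)"
proof -
 have [measurable]: "\<phi> \<in> borel_measurable borel" "grad \<phi> \<in> borel_measurable borel" using test_measurable[OF assms] by auto
 have "integrable (lebesgue_on UNIV) (%x. nsq (\<phi> x))" "integrable (lebesgue_on UNIV) (%x. nsq (grad \<phi> x))"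
  using sqint_test[OF test_UNIV[OF assms]] by (simp_all add: sqint_def)
 moreover have "integrable (lebesgue_on UNIV) (%x. nsq (\<phi> x)) \<longleftrightarrow> integrable lborel (%x. nsq (\<phi> x))"
  "integrable (lebesgue_on UNIV) (%x. nsq (grad \<phi> x)) \<longleftrightarrow> integrable lborel (%x. nsq (grad \<phi> x))"
  by (rule lebesgue_on_eq_lborel(2); simp)+
 ultimately show "sqint lborel \<phi>" "sqint lborel (grad \<phi>)" by (simp_all only: sqint_def) simp_all
qed

text \<open>With \<open>W\<close> the difference of the translate and \<open>\<phi>\<close>, the
  integral of \<open>W\<close> against the shifted \<open>\<phi>\<close> grows from r = 0 to r = 1
  by exactly the squared norm of \<open>W\<close>. Its derivative is at most the norm of
  \<open>W\<close> times the claimed bound, and one factor cancels.\<close>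

lemma translation_estimate:
 fixes \<phi> :: "'a::euclidean_space => real"
 assumes \<phi>: "\<phi> \<in> test_functions UNIV"
 shows "sqint lborel (%x. \<phi> (x + v) - \<phi> x)"
  "nrm2 lborel (%x. \<phi> (x + v) - \<phi> x) <= norm v * nrm2 lborel (grad \<phi>)"
proof -
 note s = sqint_test_lborel[OF \<phi>]
 have [measurable]: "\<phi> \<in> borel_measurable borel" "grad \<phi> \<in> borel_measurable borel" using test_measurable[OF \<phi>] by auto
 have tr: "sqint lborel (%x. f (x + u))" "nrm2 lborel (%x. f (x + u)) = nrm2 lborel f"
  if [measurable]: "f \<in> borel_measurable borel" and "sqint lborel f" for f :: "'a => 'b::euclidean_space" and u
  using that lborel_translation[of "%x. nsq (f x)" u] by (simp_all add: sqint_def nrm2_def)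
 define W where "W x = \<phi> (x + v) - \<phi> x" for x
 show W: "sqint lborel (%x. \<phi> (x + v) - \<phi> x)" by (intro sqint_diff tr(1) s) measurable
 then have W': "sqint lborel W" by (simp add: W_def[abs_def])
 obtain K where K: "compact K" "!!x. x \<notin> K ==> \<phi> x = 0" using test_obtain[OF \<phi>] by metis
 have "integrable lborel \<phi>"
  by (rule integrable_compact_support[OF _ K]) (auto intro: smooth_fun_continuous test_smooth[OF \<phi>])
 then have Wi: "integrable lborel W" using lborel_translation(2)[of \<phi> v] by (simp add: W_def[abs_def])
 let ?F = "%r. LINT x|lborel. W x * \<phi> (x + r *\<^sub>R v)"
 have D: "(?F has_real_derivative (LINT x|lborel. W x * (grad \<phi> (x + r *\<^sub>R v) \<bullet> v))) (at r)" for r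
  by (rule DERIV_integral_path[OF \<phi> Wi, where R="norm v"]) auto
 have bd: "\<bar>LINT x|lborel. W x * (grad \<phi> (x + r *\<^sub>R v) \<bullet> v)\<bar> <= nrm2 lborel W * (norm v * nrm2 lborel (grad \<phi>))" for r
 proof -
  note t = tr[of "grad \<phi>" "r *\<^sub>R v"]
  have ae: "AE x in lborel. norm (grad \<phi> (x + r *\<^sub>R v) \<bullet> v) <= norm v * norm (grad \<phi> (x + r *\<^sub>R v))"
   using Cauchy_Schwarz_ineq2[of _ v] by (intro AE_I2) (simp only: real_norm_def mult.commute[of "norm v"])
  have g: "sqint lborel (%x. grad \<phi> (x + r *\<^sub>R v) \<bullet> v)"
   by (rule sqint_dominated[OF t(1) _ ae]) (use s in auto)
  have "nrm2 lborel (%x. grad \<phi> (x + r *\<^sub>R v) \<bullet> v) <= norm v * nrm2 lborel (grad \<phi>)"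
   using nrm2_dominated[OF t(1) _ ae] t(2) s by simp
  then have "nrm2 lborel W * nrm2 lborel (%x. grad \<phi> (x + r *\<^sub>R v) \<bullet> v) <= nrm2 lborel W * (norm v * nrm2 lborel (grad \<phi>))"
   by (intro mult_left_mono) auto
  with CS_ineq[OF W' g] show ?thesis by simp
 qed
 have "norm (?F 1 - ?F 0) <= nrm2 lborel W * (norm v * nrm2 lborel (grad \<phi>)) * norm (1 - 0 :: real)"
  by (rule field_differentiable_bound[where S=UNIV, OF _ has_field_derivative_at_within[OF D]]) (use bd in auto)
 moreover have "?F 1 - ?F 0 = (nrm2 lborel W)\<^sup>2"
 proof -
  have "integrable lborel (%x. W x * \<phi> (x + 1 *\<^sub>R v))" "integrable lborel (%x. W x * \<phi> (x + 0 *\<^sub>R v))"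
   using sqint_mult[OF W' tr(1)[of \<phi> v]] sqint_mult[OF W' s(1)] s by auto
  then have "?F 1 - ?F 0 = (LINT x|lborel. W x * \<phi> (x + 1 *\<^sub>R v) - W x * \<phi> (x + 0 *\<^sub>R v))"
   by (rule Bochner_Integration.integral_diff[symmetric])
  also have "... = (LINT x|lborel. nsq (W x))"
   by (intro LINT_cong refl) (simp add: W_def power2_eq_square algebra_simps)
  finally show ?thesis by (simp add: nrm2_sq)
 qed
 ultimately have "nrm2 lborel W * nrm2 lborel W <= nrm2 lborel W * (norm v * nrm2 lborel (grad \<phi>))"
  by (simp add: power2_eq_square)
 then have "nrm2 lborel W <= norm v * nrm2 lborel (grad \<phi>)"
  using nrm2_nonneg[of lborel W] by (cases "nrm2 lborel W = 0") (auto simp: mult_le_cancel_left)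
 then show "nrm2 lborel (%x. \<phi> (x + v) - \<phi> x) <= norm v * nrm2 lborel (grad \<phi>)"
  by (simp add: W_def[abs_def])
qed

text \<open>Substituting y = x + v and exchanging the integrals reduces this to
  \<open>translation_estimate\<close> for each shift v of length at most d.\<close>

lemma near_diagonal_estimate:
 fixes \<phi> :: "'a::euclidean_space => real"
 assumes \<phi>: "\<phi> \<in> test_functions UNIV" and d: "0 <= d"
 shows "(\<integral>\<^sup>+x. \<integral>\<^sup>+y. indicator (cball x d) y * ennreal ((\<phi> y - \<phi> x)\<^sup>2) \<partial>lborel \<partial>lborel)
   <= emeasure lborel (cball (0::'a) d) * ennreal (d\<^sup>2 * (nrm2 lborel (grad \<phi>))\<^sup>2)"
proof -
 have [measurable]: "\<phi> \<in> borel_measurable borel" using test_measurable[OF \<phi>] by auto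
 have [measurable]: "(%p::'a \<times> 'a. \<phi> (fst p + snd p)) \<in> borel_measurable (lborel \<Otimes>\<^sub>M lborel)"
  by (rule measurable_compose[of _ _ borel]) auto
 have [measurable]: "cball (0::'a) d \<in> sets borel" by simp
 have "(\<integral>\<^sup>+x. \<integral>\<^sup>+y. indicator (cball x d) y * ennreal ((\<phi> y - \<phi> x)\<^sup>2) \<partial>lborel \<partial>lborel)
   = (\<integral>\<^sup>+x. \<integral>\<^sup>+v. indicator (cball 0 d) v * ennreal ((\<phi> (x + v) - \<phi> x)\<^sup>2) \<partial>lborel \<partial>lborel)"
 proof (rule nn_integral_cong)
  fix x :: 'a
  have [measurable]: "cball x d \<in> sets borel" by simp
  have "(\<integral>\<^sup>+y. indicator (cball x d) y * ennreal ((\<phi> y - \<phi> x)\<^sup>2) \<partial>lborel)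
   = (\<integral>\<^sup>+v. indicator (cball x d) (v + x) * ennreal ((\<phi> (v + x) - \<phi> x)\<^sup>2) \<partial>lborel)"
   by (rule nn_lborel_translation[symmetric]) measurable
  also have "... = (\<integral>\<^sup>+v. indicator (cball 0 d) v * ennreal ((\<phi> (x + v) - \<phi> x)\<^sup>2) \<partial>lborel)"
   by (intro nn_integral_cong) (auto simp: indicator_def dist_norm add.commute)
  finally show "(\<integral>\<^sup>+y. indicator (cball x d) y * ennreal ((\<phi> y - \<phi> x)\<^sup>2) \<partial>lborel)
   = (\<integral>\<^sup>+v. indicator (cball 0 d) v * ennreal ((\<phi> (x + v) - \<phi> x)\<^sup>2) \<partial>lborel)" .
 qed
 also have "... = (\<integral>\<^sup>+v. \<integral>\<^sup>+x. indicator (cball 0 d) v * ennreal ((\<phi> (x + v) - \<phi> x)\<^sup>2) \<partial>lborel \<partial>lborel)"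
  by (rule pair_sigma_finite.Fubini') (auto simp: pair_sigma_finite_def sigma_finite_lborel case_prod_beta)
 also have "... <= (\<integral>\<^sup>+v. indicator (cball (0::'a) d) v * ennreal (d\<^sup>2 * (nrm2 lborel (grad \<phi>))\<^sup>2) \<partial>lborel)"
 proof (rule nn_integral_mono)
  fix v :: 'a
  have "(\<integral>\<^sup>+x. indicator (cball 0 d) v * ennreal ((\<phi> (x + v) - \<phi> x)\<^sup>2) \<partial>lborel)
   = indicator (cball 0 d) v * (\<integral>\<^sup>+x. ennreal ((\<phi> (x + v) - \<phi> x)\<^sup>2) \<partial>lborel)"
   by (rule nn_integral_cmult) measurable
  also have "(\<integral>\<^sup>+x. ennreal ((\<phi> (x + v) - \<phi> x)\<^sup>2) \<partial>lborel) = ennreal ((nrm2 lborel (%x. \<phi> (x + v) - \<phi> x))\<^sup>2)"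
   using sqint_nn_integral[OF translation_estimate(1)[OF \<phi>, of v]] by simp
  also have "indicator (cball 0 d) v * ... <= indicator (cball 0 d) v * ennreal (d\<^sup>2 * (nrm2 lborel (grad \<phi>))\<^sup>2)"
  proof (cases "v \<in> cball 0 d")
   case True
   then have "nrm2 lborel (%x. \<phi> (x + v) - \<phi> x) <= d * nrm2 lborel (grad \<phi>)"
    using translation_estimate(2)[OF \<phi>, of v] by (simp add: dist_norm) (meson mult_right_mono nrm2_nonneg order_trans)
   then have "(nrm2 lborel (%x. \<phi> (x + v) - \<phi> x))\<^sup>2 <= (d * nrm2 lborel (grad \<phi>))\<^sup>2" by (intro power_mono) auto
   then show ?thesis by (intro mult_left_mono ennreal_leI) (auto simp: power_mult_distrib)
  qed simp
  finally show "(\<integral>\<^sup>+x. indicator (cball 0 d) v * ennreal ((\<phi> (x + v) - \<phi> x)\<^sup>2) \<partial>lborel)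
   <= indicator (cball 0 d) v * ennreal (d\<^sup>2 * (nrm2 lborel (grad \<phi>))\<^sup>2)" .
 qed
 also have "... = emeasure lborel (cball (0::'a) d) * ennreal (d\<^sup>2 * (nrm2 lborel (grad \<phi>))\<^sup>2)"
  by (subst nn_integral_multc) auto
 finally show ?thesis .
qed

section \<open>Decomposition into cubes and Friedrichs' inequality\<close>

definition corner :: "real => 'a::euclidean_space => 'a" where
 "corner h x = (\<Sum>i\<in>Basis. of_int \<lfloor>x \<bullet> i / h\<rfloor> *\<^sub>R i)"

text \<open>Corners are integer points, not scaled by the mesh: for such z and positive h this is
  the half-open cube with lower corner \<open>h *\<^sub>R z\<close> and side h. Half-open cubes
  cover every point exactly once, which makes sums over cells exact.\<close>

definition cell :: "real => 'a::euclidean_space => 'a set" where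
 "cell h z = {x. corner h x = z}"

lemma corner_inner: "i \<in> Basis ==> corner h x \<bullet> i = of_int \<lfloor>x \<bullet> i / h\<rfloor>"
 by (simp add: corner_def inner_sum_left inner_Basis if_distrib sum.delta cong: if_cong)

lemma cell_eq:
 assumes h: "0 < h" and z: "z = corner h y"
 shows "cell h z = {x. \<forall>i\<in>Basis. h * (z \<bullet> i) <= x \<bullet> i \<and> x \<bullet> i < h * (z \<bullet> i) + h}"
proof -
 have "corner h x = z \<longleftrightarrow> (\<forall>i\<in>Basis. h * (z \<bullet> i) <= x \<bullet> i \<and> x \<bullet> i < h * (z \<bullet> i) + h)" for x
 proof -
  have "corner h x = z \<longleftrightarrow> (\<forall>i\<in>Basis. corner h x \<bullet> i = z \<bullet> i)" by (rule euclidean_eq_iff)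
  also have "... \<longleftrightarrow> (\<forall>i\<in>Basis. \<lfloor>x \<bullet> i / h\<rfloor> = \<lfloor>y \<bullet> i / h\<rfloor>)"
   by (intro ball_cong refl) (simp add: z corner_inner)
  also have "... \<longleftrightarrow> (\<forall>i\<in>Basis. h * (z \<bullet> i) <= x \<bullet> i \<and> x \<bullet> i < h * (z \<bullet> i) + h)"
   by (intro ball_cong refl) (use h in \<open>simp add: z corner_inner floor_eq_iff field_simps\<close>)
  finally show ?thesis .
 qed
 then show ?thesis by (simp add: cell_def)
qed

lemma cell_props:
 fixes y :: "'a::euclidean_space"
 assumes h: "0 < h" and z: "z = corner h y"
 shows "cell h z \<in> sets borel" "measure lborel (cell h z) = h ^ DIM('a)" "emeasure lborel (cell h z) < \<infinity>"
  "!!x x'. x \<in> cell h z ==> x' \<in> cell h z ==> x' \<in> cball x (real DIM('a) * h)"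
proof -
 have "cell h z = (\<Inter>i\<in>Basis. {x. h * (z \<bullet> i) <= x \<bullet> i} \<inter> {x. x \<bullet> i < h * (z \<bullet> i) + h})"
  unfolding cell_eq[OF assms] by auto
 moreover have "{x::'a. h * (z \<bullet> i) <= x \<bullet> i} \<in> sets borel" "{x::'a. x \<bullet> i < h * (z \<bullet> i) + h} \<in> sets borel" for i
  by measurable
 ultimately show [measurable]: "cell h z \<in> sets borel" by auto
 let ?a = "h *\<^sub>R z" and ?b = "h *\<^sub>R z + h *\<^sub>R One"
 have sub: "box ?a ?b \<subseteq> cell h z" "cell h z \<subseteq> cbox ?a ?b"
  unfolding cell_eq[OF assms] by (auto simp: mem_box inner_add_left less_imp_le)
 have mb: "emeasure lborel (box ?a ?b) = ennreal (h ^ DIM('a))" "emeasure lborel (cbox ?a ?b) = ennreal (h ^ DIM('a))"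
  using h by (auto simp: emeasure_lborel_box_eq emeasure_lborel_cbox_eq inner_add_left)
 have e: "emeasure lborel (cell h z) = ennreal (h ^ DIM('a))"
  using emeasure_mono[OF sub(1), of lborel] emeasure_mono[OF sub(2), of lborel] mb by simp
 then show "emeasure lborel (cell h z) < \<infinity>" by simp
 show "measure lborel (cell h z) = h ^ DIM('a)" using e h by (simp add: measure_def)
 fix x x' assume x: "x \<in> cell h z" and x': "x' \<in> cell h z"
 have "norm (x - x') <= (\<Sum>i\<in>Basis. \<bar>(x - x') \<bullet> i\<bar>)" by (rule norm_le_l1)
 also have "... <= (\<Sum>i\<in>(Basis::'a set). h)"
  using x x' unfolding cell_eq[OF assms] by (intro sum_mono) (auto simp: inner_diff_left abs_le_iff, fastforce+)
 finally show "x' \<in> cball x (real DIM('a) * h)" by (simp add: dist_norm)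
qed

lemma finite_corners:
 assumes "bounded S" "0 < h"
 shows "finite (corner h ` S)"
proof -
 obtain R where R: "!!x. x \<in> S ==> norm x <= R" using assms(1) bounded_iff by metis
 define K where "K = \<lceil>\<bar>R\<bar> / h\<rceil> + 1"
 let ?F = "Basis \<rightarrow>\<^sub>E {-K..K}"
 have "corner h ` S \<subseteq> (%f. \<Sum>i\<in>Basis. of_int (f i) *\<^sub>R i) ` ?F"
 proof
  fix z assume "z \<in> corner h ` S"
  then obtain x where x: "x \<in> S" "z = corner h x" by auto
  define f where "f = restrict (%i. \<lfloor>x \<bullet> i / h\<rfloor>) Basis"
  have "f i \<in> {-K..K}" if i: "i \<in> Basis" for i
  proof -
   have "\<bar>x \<bullet> i\<bar> <= \<bar>R\<bar>" using Basis_le_norm[OF i, of x] R[OF x(1)] by linarith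
   then have "\<bar>x \<bullet> i / h\<bar> <= \<bar>R\<bar> / h" using assms(2) by (simp add: divide_right_mono)
   then have "\<bar>x \<bullet> i / h\<bar> <= of_int (K - 1)" unfolding K_def by linarith
   then have "of_int (- K) <= x \<bullet> i / h" "x \<bullet> i / h < of_int (K + 1)" by linarith+
   then have "- K <= \<lfloor>x \<bullet> i / h\<rfloor>" "\<lfloor>x \<bullet> i / h\<rfloor> < K + 1"
    by (simp_all only: le_floor_iff floor_less_iff)
   then show ?thesis using i by (simp add: f_def)
  qed
  then have "f \<in> ?F" by (auto simp: f_def)
  moreover have "z = (\<Sum>i\<in>Basis. of_int (f i) *\<^sub>R i)" by (simp add: x(2) corner_def f_def)
  ultimately show "z \<in> (%f. \<Sum>i\<in>Basis. of_int (f i) *\<^sub>R i) ` ?F" by blast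
 qed
 moreover have "finite ?F" by (intro finite_PiE) auto
 ultimately show ?thesis using finite_surj by blast
qed

text \<open>Expanding the square in the double integral over \<open>Q\<close> twice gives the mass
  of \<open>Q\<close> times the mean square, minus the square of the mean, doubled. The right side
  is kept as a nonnegative integral so that the cells can be summed under the integral sign.\<close>

lemma cell_variance:
 fixes \<phi> :: "'a::euclidean_space => real"
 assumes \<phi>: "\<phi> \<in> test_functions UNIV" and Q[measurable]: "Q \<in> sets borel" and fin: "emeasure lborel Q < \<infinity>"
 shows "ennreal (2 * measure lborel Q * (LINT x|lborel. indicator Q x * (\<phi> x)\<^sup>2) - 2 * (LINT x|lborel. indicator Q x * \<phi> x)\<^sup>2)
   = (\<integral>\<^sup>+x. \<integral>\<^sup>+y. indicator Q x * indicator Q y * ennreal ((\<phi> y - \<phi> x)\<^sup>2) \<partial>lborel \<partial>lborel)"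
proof -
 have [measurable]: "\<phi> \<in> borel_measurable borel" using test_measurable[OF \<phi>] by auto
 obtain B where B: "0 <= B" "!!x. \<bar>\<phi> x\<bar> <= B" using test_bounded[OF \<phi>] by metis
 have iQ: "integrable lborel (%x. indicator Q x :: real)" using fin by (intro integrable_real_indicator) auto
 have bi: "integrable lborel (%x. indicator Q x * f x)" if "f \<in> borel_measurable borel" "!!x. \<bar>f x\<bar> <= C" for f :: "'a => real" and C
 proof (rule integrable_dominated)
  show "integrable lborel (%x. indicator Q x * C :: real)" using iQ by simp
  show "AE x in lborel. norm (indicator Q x * f x) <= norm (indicator Q x * C :: real)"
   using that(2) by (intro AE_I2) (auto simp: indicator_def intro: order_trans[OF _ abs_ge_self])
 qed (use that in measurable)
 have i1: "integrable lborel (%x. indicator Q x * \<phi> x)" by (rule bi[OF _ B(2)]) measurable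
 have sqB: "\<bar>(\<phi> x)\<^sup>2\<bar> <= B\<^sup>2" for x using B(2)[of x] by (simp add: power2_le_iff_abs_le B(1))
 have i2: "integrable lborel (%x. indicator Q x * (\<phi> x)\<^sup>2)" by (rule bi[OF _ sqB]) measurable
 define a b \<mu> where "a = (LINT x|lborel. indicator Q x * (\<phi> x)\<^sup>2)" and "b = (LINT x|lborel. indicator Q x * \<phi> x)"
  and "\<mu> = measure lborel Q"
 have mQ: "(LINT x|lborel. indicator Q x) = \<mu>" by (simp add: \<mu>_def)
 have inner: "(\<integral>\<^sup>+y. indicator Q x * indicator Q y * ennreal ((\<phi> y - \<phi> x)\<^sup>2) \<partial>lborel)
   = ennreal (indicator Q x * (a - 2 * b * \<phi> x + \<mu> * (\<phi> x)\<^sup>2))" (is "?L = _") for x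
 proof -
  have e: "indicator Q y * (\<phi> y - \<phi> x)\<^sup>2 = indicator Q y * (\<phi> y)\<^sup>2 - 2 * \<phi> x * (indicator Q y * \<phi> y) + (\<phi> x)\<^sup>2 * indicator Q y" for y
   by (simp add: power2_diff algebra_simps)
  have i: "integrable lborel (%y. indicator Q y * (\<phi> y - \<phi> x)\<^sup>2)" unfolding e using i1 i2 iQ by simp
  have "?L = indicator Q x * (\<integral>\<^sup>+y. indicator Q y * ennreal ((\<phi> y - \<phi> x)\<^sup>2) \<partial>lborel)"
   unfolding mult.assoc by (rule nn_integral_cmult) measurable
  also have "(\<integral>\<^sup>+y. indicator Q y * ennreal ((\<phi> y - \<phi> x)\<^sup>2) \<partial>lborel) = (\<integral>\<^sup>+y. ennreal (indicator Q y * (\<phi> y - \<phi> x)\<^sup>2) \<partial>lborel)"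
   by (intro nn_integral_cong) (auto simp: indicator_def)
  also have "... = ennreal (LINT y|lborel. indicator Q y * (\<phi> y - \<phi> x)\<^sup>2)"
   by (rule nn_integral_eq_integral[OF i]) auto
  also have "(LINT y|lborel. indicator Q y * (\<phi> y - \<phi> x)\<^sup>2) = a - 2 * b * \<phi> x + \<mu> * (\<phi> x)\<^sup>2"
   unfolding e using i1 i2 iQ mQ by (simp add: a_def b_def)
  finally show ?thesis by (auto simp: indicator_def)
 qed
 have e2: "indicator Q x * (a - 2 * b * \<phi> x + \<mu> * (\<phi> x)\<^sup>2) = a * indicator Q x - 2 * b * (indicator Q x * \<phi> x) + \<mu> * (indicator Q x * (\<phi> x)\<^sup>2)" for x
  by (simp add: algebra_simps)
 have i: "integrable lborel (%x. indicator Q x * (a - 2 * b * \<phi> x + \<mu> * (\<phi> x)\<^sup>2))" unfolding e2 using i1 i2 iQ by simp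
 have nn: "0 <= indicator Q x * (a - 2 * b * \<phi> x + \<mu> * (\<phi> x)\<^sup>2)" for x
 proof -
  have "0 <= (LINT y|lborel. indicator Q y * (\<phi> y - \<phi> x)\<^sup>2)" by (intro integral_nonneg_AE) auto
  also have "... = (LINT y|lborel. indicator Q y * (\<phi> y)\<^sup>2 - 2 * \<phi> x * (indicator Q y * \<phi> y) + (\<phi> x)\<^sup>2 * indicator Q y)"
   by (intro LINT_cong refl) (simp add: power2_diff algebra_simps)
  also have "... = a - 2 * b * \<phi> x + \<mu> * (\<phi> x)\<^sup>2" using i1 i2 iQ mQ by (simp add: a_def b_def)
  finally show ?thesis by simp
 qed
 have "(\<integral>\<^sup>+x. \<integral>\<^sup>+y. indicator Q x * indicator Q y * ennreal ((\<phi> y - \<phi> x)\<^sup>2) \<partial>lborel \<partial>lborel)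
   = (\<integral>\<^sup>+x. ennreal (indicator Q x * (a - 2 * b * \<phi> x + \<mu> * (\<phi> x)\<^sup>2)) \<partial>lborel)"
  unfolding inner ..
 also have "... = ennreal (LINT x|lborel. indicator Q x * (a - 2 * b * \<phi> x + \<mu> * (\<phi> x)\<^sup>2))"
  by (rule nn_integral_eq_integral[OF i]) (use nn in auto)
 also have "(LINT x|lborel. indicator Q x * (a - 2 * b * \<phi> x + \<mu> * (\<phi> x)\<^sup>2)) = a * \<mu> - 2 * b * b + \<mu> * a"
  unfolding e2 using i1 i2 iQ mQ by (simp add: a_def[symmetric] b_def[symmetric])
 also have "... = 2 * \<mu> * a - 2 * b\<^sup>2" by (simp add: power2_eq_square)
 finally show ?thesis by (simp add: a_def b_def \<mu>_def)
qed

text \<open>The conversion truncates negative summands at 0, which can only increase the right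
  side.\<close>

lemma ennreal_sum_le: "ennreal (\<Sum>i\<in>I. t i) <= (\<Sum>i\<in>I. ennreal (t i))"
proof -
 have "ennreal (\<Sum>i\<in>I. t i) <= ennreal (\<Sum>i\<in>I. max 0 (t i))"
  by (intro ennreal_leI sum_mono) auto
 also have "... = (\<Sum>i\<in>I. ennreal (max 0 (t i)))" by (simp add: sum_ennreal)
 also have "... = (\<Sum>i\<in>I. ennreal (t i))" by (intro sum.cong refl) (simp add: max_def ennreal_neg)
 finally show ?thesis .
qed

lemma convergent_subsequence_finite:
 fixes a :: "'i => nat => real"
 assumes "finite I" "!!i n. i \<in> I ==> \<bar>a i n\<bar> <= B"
 shows "\<exists>r::nat=>nat. strict_mono r \<and> (\<forall>i\<in>I. convergent (%k. a i (r k)))"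
 using assms
proof (induction I rule: finite_induct)
 case empty
 then show ?case by (intro exI[of _ id]) (auto simp: strict_mono_def)
next
 case (insert j I)
 then obtain r :: "nat => nat" where r: "strict_mono r" "\<forall>i\<in>I. convergent (%k. a i (r k))" by auto
 have "bounded (range (%k. a j (r k)))" using insert.prems unfolding bounded_iff by auto
 then obtain l s where s: "strict_mono (s :: nat => nat)" "((%k. a j (r k)) \<circ> s) ----> l"
  using bounded_imp_convergent_subsequence by blast
 have "convergent (%k. a i ((r \<circ> s) k))" if i: "i \<in> insert j I" for i
 proof (cases "i = j")
  case True then show ?thesis using s(2) by (auto simp: convergent_def comp_def)
 next
  case False
  then obtain l where "(%k. a i (r k)) ----> l" using r(2) i by (auto simp: convergent_def)
  from LIMSEQ_subseq_LIMSEQ[OF this s(1)] show ?thesis by (auto simp: convergent_def comp_def)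
 qed
 moreover have "strict_mono (r \<circ> s)" using r(1) s(1) by (rule strict_mono_o)
 ultimately show ?case by blast
qed

context bdomain
begin

lemma nrm2_test_lborel:
 assumes "\<phi> \<in> test_functions \<Omega>"
 shows "nrm2 lborel \<phi> = nrm2 M \<phi>" "nrm2 lborel (grad \<phi>) = nrm2 M (grad \<phi>)"
proof -
 obtain K where K: "K \<subseteq> \<Omega>" "!!x. x \<notin> K ==> \<phi> x = 0" "!!x. x \<notin> K ==> grad \<phi> x = 0"
  using test_obtain[OF assms] by metis
 have [measurable]: "\<phi> \<in> borel_measurable borel" "grad \<phi> \<in> borel_measurable borel" using test_measurable[OF assms] by auto
 have z: "\<phi> x = 0" "grad \<phi> x = 0" if "x \<notin> \<Omega>" for x using K that by auto
 show "nrm2 lborel \<phi> = nrm2 M \<phi>" unfolding nrm2_def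
  by (subst lebesgue_on_eq_lborel(1)[of _ \<Omega>]) (auto simp: z)
 show "nrm2 lborel (grad \<phi>) = nrm2 M (grad \<phi>)" unfolding nrm2_def
  by (subst lebesgue_on_eq_lborel(1)[of _ \<Omega>]) (auto simp: z)
qed

text \<open>Two points in one cell are at distance at most d = n h, n being the dimension. Hence the
  sum of the variances over all cells is bounded by the near-diagonal double integral. Dividing by
  the cell volume leaves a factor of order h^2 before the gradient term.\<close>

lemma friedrichs_test:
 assumes h: "0 < h" and \<phi>: "\<phi> \<in> test_functions \<Omega>"
 shows "(nrm2 M \<phi>)\<^sup>2 <= (2 * real DIM('a)) ^ DIM('a) * (real DIM('a))\<^sup>2 * h\<^sup>2 / 2 * (nrm2 M (grad \<phi>))\<^sup>2
   + (1 / h ^ DIM('a)) * (\<Sum>z\<in>corner h ` \<Omega>. (LINT x|M. \<phi> x * indicator (cell h z) x)\<^sup>2)"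
proof -
 let ?Z = "corner h ` \<Omega>" and ?n = "real DIM('a)"
 define d where "d = ?n * h"
 define \<kappa> where "\<kappa> = h ^ DIM('a)"
 have d: "0 < d" using h by (simp add: d_def)
 have \<kappa>: "0 < \<kappa>" using h by (simp add: \<kappa>_def)
 have fZ: "finite ?Z" using finite_corners[OF bounded_\<Omega> h] .
 have cb[measurable]: "cell h z \<in> sets borel" and cm: "measure lborel (cell h z) = \<kappa>" and ce: "emeasure lborel (cell h z) < \<infinity>"
  and cd: "!!x x'. x \<in> cell h z ==> x' \<in> cell h z ==> x' \<in> cball x d" if "z \<in> ?Z" for z
  using that cell_props[OF h, of z] by (auto simp: d_def \<kappa>_def)
 obtain K where K: "compact K" "K \<subseteq> \<Omega>" "!!x. x \<notin> K ==> \<phi> x = 0" using test_obtain[OF \<phi>] by metis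
 have off: "\<phi> x = 0" if "x \<notin> \<Omega>" for x using K that by auto
 have [measurable]: "\<phi> \<in> borel_measurable borel" using test_measurable[OF \<phi>] by auto
 define b where "b z = (LINT x|lborel. indicator (cell h z) x * \<phi> x)" for z
 have bM: "b z = (LINT x|M. \<phi> x * indicator (cell h z) x)" if z: "z \<in> ?Z" for z
 proof -
  have [measurable]: "cell h z \<in> sets borel" by (rule cb[OF z])
  show ?thesis unfolding b_def
   by (subst lebesgue_on_eq_lborel(1)[of _ \<Omega>]) (auto simp: off mult.commute)
 qed
 have i2: "integrable lborel (%x. (\<phi> x)\<^sup>2)"
  using sqint_test_lborel(1)[OF \<phi>] by (simp add: sqint_def)
 have i2c: "integrable lborel (%x. indicator (cell h z) x * (\<phi> x)\<^sup>2)" if z: "z \<in> ?Z" for z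
  using integrable_mult_indicator[OF _ i2, of "cell h z"] cb[OF z] by simp
 have tot: "(\<Sum>z\<in>?Z. (LINT x|lborel. indicator (cell h z) x * (\<phi> x)\<^sup>2)) = (nrm2 M \<phi>)\<^sup>2"
 proof -
  have "(\<Sum>z\<in>?Z. (LINT x|lborel. indicator (cell h z) x * (\<phi> x)\<^sup>2)) = (LINT x|lborel. (\<Sum>z\<in>?Z. indicator (cell h z) x * (\<phi> x)\<^sup>2))"
   using i2c by (intro LINT_sum[symmetric]) auto
  also have "... = (LINT x|lborel. (\<phi> x)\<^sup>2)"
  proof (intro LINT_cong refl)
   fix x :: 'a
   show "(\<Sum>z\<in>?Z. indicator (cell h z) x * (\<phi> x)\<^sup>2) = (\<phi> x)\<^sup>2"
   proof (cases "x \<in> \<Omega>")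
    case True
    have "(\<Sum>z\<in>?Z. indicator (cell h z) x * (\<phi> x)\<^sup>2) = (\<Sum>z\<in>?Z. if corner h x = z then (\<phi> x)\<^sup>2 else 0)"
     by (intro sum.cong refl) (simp add: cell_def indicator_def)
    then show ?thesis using True fZ by simp
   qed (simp add: off)
  qed
  also have "... = (nrm2 lborel \<phi>)\<^sup>2" by (simp add: nrm2_sq)
  finally show ?thesis by (simp add: nrm2_test_lborel[OF \<phi>])
 qed
 have "ennreal (2 * \<kappa> * (nrm2 M \<phi>)\<^sup>2 - 2 * (\<Sum>z\<in>?Z. (b z)\<^sup>2))
   = ennreal (\<Sum>z\<in>?Z. 2 * \<kappa> * (LINT x|lborel. indicator (cell h z) x * (\<phi> x)\<^sup>2) - 2 * (b z)\<^sup>2)"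
  by (simp add: sum_subtractf sum_distrib_left[symmetric] tot)
 also have "... <= (\<Sum>z\<in>?Z. ennreal (2 * \<kappa> * (LINT x|lborel. indicator (cell h z) x * (\<phi> x)\<^sup>2) - 2 * (b z)\<^sup>2))"
  by (rule ennreal_sum_le)
 also have "... = (\<Sum>z\<in>?Z. \<integral>\<^sup>+x. \<integral>\<^sup>+y. indicator (cell h z) x * indicator (cell h z) y * ennreal ((\<phi> y - \<phi> x)\<^sup>2) \<partial>lborel \<partial>lborel)"
  by (intro sum.cong refl) (use cell_variance[OF test_UNIV[OF \<phi>] cb ce] cm in \<open>simp add: b_def\<close>)
 also have "... = (\<integral>\<^sup>+x. (\<Sum>z\<in>?Z. \<integral>\<^sup>+y. indicator (cell h z) x * indicator (cell h z) y * ennreal ((\<phi> y - \<phi> x)\<^sup>2) \<partial>lborel) \<partial>lborel)"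
 proof (rule nn_integral_sum[symmetric])
  fix z assume z: "z \<in> ?Z"
  have [measurable]: "cell h z \<in> sets borel" by (rule cb[OF z])
  show "(%x. \<integral>\<^sup>+y. indicator (cell h z) x * indicator (cell h z) y * ennreal ((\<phi> y - \<phi> x)\<^sup>2) \<partial>lborel) \<in> borel_measurable lborel"
   by measurable
 qed
 also have "... = (\<integral>\<^sup>+x. \<integral>\<^sup>+y. (\<Sum>z\<in>?Z. indicator (cell h z) x * indicator (cell h z) y * ennreal ((\<phi> y - \<phi> x)\<^sup>2)) \<partial>lborel \<partial>lborel)"
 proof (intro nn_integral_cong nn_integral_sum[symmetric])
  fix z x assume z: "z \<in> ?Z"
  have [measurable]: "cell h z \<in> sets borel" by (rule cb[OF z])
  show "(%y. indicator (cell h z) x * indicator (cell h z) y * ennreal ((\<phi> y - \<phi> x)\<^sup>2)) \<in> borel_measurable lborel"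
   by measurable
 qed
 also have "... <= (\<integral>\<^sup>+x. \<integral>\<^sup>+y. indicator (cball x d) y * ennreal ((\<phi> y - \<phi> x)\<^sup>2) \<partial>lborel \<partial>lborel)"
 proof (intro nn_integral_mono)
  fix x y :: 'a
  have le: "(\<Sum>z\<in>?Z. indicator (cell h z) x * indicator (cell h z) y :: ennreal) <= indicator (cball x d) y"
  proof -
   have "(\<Sum>z\<in>?Z. indicator (cell h z) x * indicator (cell h z) y :: ennreal) <= (\<Sum>z\<in>?Z. if corner h x = z then indicator (cball x d) y else 0)"
   proof (rule sum_mono)
    fix z assume z: "z \<in> ?Z"
    show "indicator (cell h z) x * indicator (cell h z) y <= (if corner h x = z then indicator (cball x d) y else 0 :: ennreal)"
     using cd[OF z, of x y] by (auto simp: indicator_def cell_def)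
   qed
   also have "... <= indicator (cball x d) y" using fZ by simp
   finally show ?thesis .
  qed
  then show "(\<Sum>z\<in>?Z. indicator (cell h z) x * indicator (cell h z) y * ennreal ((\<phi> y - \<phi> x)\<^sup>2)) <= indicator (cball x d) y * ennreal ((\<phi> y - \<phi> x)\<^sup>2)"
   unfolding sum_distrib_right[symmetric] by (rule mult_right_mono) simp
 qed
 also have "... <= emeasure lborel (cball (0::'a) d) * ennreal (d\<^sup>2 * (nrm2 lborel (grad \<phi>))\<^sup>2)"
  by (rule near_diagonal_estimate[OF test_UNIV[OF \<phi>]]) (use d in simp)
 \<comment> \<open>Enclosing the ball in a cube makes its volume bound an explicit power of d, in
   which the cell volume appears as a factor and cancels.\<close>
 also have "emeasure lborel (cball (0::'a) d) <= emeasure lborel (cbox (- d *\<^sub>R One) (d *\<^sub>R One :: 'a))"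
 proof (rule emeasure_mono)
  show "cball (0::'a) d \<subseteq> cbox (- d *\<^sub>R One) (d *\<^sub>R One)"
  proof
   fix x :: 'a assume "x \<in> cball 0 d"
   then have "\<bar>x \<bullet> i\<bar> <= d" if "i \<in> Basis" for i using Basis_le_norm[OF that, of x] by simp
   then show "x \<in> cbox (- d *\<^sub>R One) (d *\<^sub>R One)" by (auto simp: mem_box abs_le_iff minus_le_iff)
  qed
 qed simp
 also have "emeasure lborel (cbox (- d *\<^sub>R One) (d *\<^sub>R One :: 'a)) = ennreal ((2 * d) ^ DIM('a))"
  using d by (subst emeasure_lborel_cbox) (auto simp: algebra_simps)
 finally have "ennreal (2 * \<kappa> * (nrm2 M \<phi>)\<^sup>2 - 2 * (\<Sum>z\<in>?Z. (b z)\<^sup>2)) <= ennreal ((2 * d) ^ DIM('a)) * ennreal (d\<^sup>2 * (nrm2 lborel (grad \<phi>))\<^sup>2)"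
  by (simp add: mult_right_mono)
 then have "ennreal (2 * \<kappa> * (nrm2 M \<phi>)\<^sup>2 - 2 * (\<Sum>z\<in>?Z. (b z)\<^sup>2)) <= ennreal ((2 * d) ^ DIM('a) * (d\<^sup>2 * (nrm2 M (grad \<phi>))\<^sup>2))"
  using d by (simp add: ennreal_mult nrm2_test_lborel[OF \<phi>])
 then have "2 * \<kappa> * (nrm2 M \<phi>)\<^sup>2 - 2 * (\<Sum>z\<in>?Z. (b z)\<^sup>2) <= (2 * d) ^ DIM('a) * (d\<^sup>2 * (nrm2 M (grad \<phi>))\<^sup>2)"
  by (rule ennreal_le_iff[THEN iffD1, rotated]) (use d in simp)
 moreover have "(2 * d) ^ DIM('a) = (2 * ?n) ^ DIM('a) * \<kappa>"
  by (simp add: d_def \<kappa>_def power_mult_distrib)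
 ultimately have "\<kappa> * (nrm2 M \<phi>)\<^sup>2 <= \<kappa> * ((2 * ?n) ^ DIM('a) * (d\<^sup>2 * (nrm2 M (grad \<phi>))\<^sup>2) / 2 + (1 / \<kappa>) * (\<Sum>z\<in>?Z. (b z)\<^sup>2))"
  using \<kappa> by (simp add: algebra_simps)
 then have "(nrm2 M \<phi>)\<^sup>2 <= (2 * ?n) ^ DIM('a) * (d\<^sup>2 * (nrm2 M (grad \<phi>))\<^sup>2) / 2 + (1 / \<kappa>) * (\<Sum>z\<in>?Z. (b z)\<^sup>2)"
  using \<kappa> by (simp only: mult_le_cancel_left_pos)
 moreover have "(\<Sum>z\<in>?Z. (b z)\<^sup>2) = (\<Sum>z\<in>?Z. (LINT x|M. \<phi> x * indicator (cell h z) x)\<^sup>2)"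
  by (intro sum.cong refl) (simp add: bM)
 ultimately show ?thesis by (simp add: d_def \<kappa>_def power_mult_distrib mult_ac)
qed

lemma indicator_cell_sqint: "0 < h ==> z \<in> corner h ` \<Omega> ==> sqint M (indicator (cell h z) :: 'a => real)"
proof (rule sqint_bounded[where c=1])
 assume "0 < h" "z \<in> corner h ` \<Omega>"
 then have "cell h z \<in> sets borel" using cell_props(1)[of h z] by auto
 then have "(indicator (cell h z) :: 'a => real) \<in> borel_measurable lebesgue"
  by (intro borel_measurable_indicator) simp
 then show "(indicator (cell h z) :: 'a => real) \<in> borel_measurable M" by (rule measurable_restrict_space1)
qed (simp add: indicator_def)

lemma friedrichs:
 assumes \<epsilon>: "0 < \<epsilon>"
 obtains h C where "0 < h" "0 <= C" "finite (corner h ` \<Omega>)"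
  "!!u g. H10g u g ==> (nrm2 M u)\<^sup>2 <= \<epsilon> * (nrm2 M g)\<^sup>2 + C * (\<Sum>z\<in>corner h ` \<Omega>. (LINT x|M. u x * indicator (cell h z) x)\<^sup>2)"
proof -
 define A where "A = (2 * real DIM('a)) ^ DIM('a) * (real DIM('a))\<^sup>2 / 2"
 have A: "0 < A" by (simp add: A_def)
 \<comment> \<open>The gradient coefficient in \<open>friedrichs_test\<close> is \<open>A\<close>
   times the squared mesh; this mesh makes it equal to \<open>\<epsilon>\<close>.\<close>
 define h where "h = sqrt (\<epsilon> / A)"
 have h: "0 < h" using A \<epsilon> by (simp add: h_def)
 have h2: "A * h\<^sup>2 = \<epsilon>" using A \<epsilon> by (simp add: h_def)
 show ?thesis
 proof (rule that[OF h, of "1 / h ^ DIM('a)"])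
  show "0 <= 1 / h ^ DIM('a)" using h by simp
  show "finite (corner h ` \<Omega>)" by (rule finite_corners[OF bounded_\<Omega> h])
  fix u g assume H: "H10g u g"
  note s = H10g_sqint[OF H]
  obtain \<phi> where \<phi>: "!!k::nat. \<phi> k \<in> test_functions \<Omega>" "(%k. ndist M (\<phi> k) u) ----> 0"
   "(%k. ndist M (grad (\<phi> k)) g) ----> 0" using H10g_obtain[OF H] by blast
  show "(nrm2 M u)\<^sup>2 <= \<epsilon> * (nrm2 M g)\<^sup>2 + 1 / h ^ DIM('a) * (\<Sum>z\<in>corner h ` \<Omega>. (LINT x|M. u x * indicator (cell h z) x)\<^sup>2)"
  proof (rule LIMSEQ_le)
   show "(%k. (nrm2 M (\<phi> k))\<^sup>2) ----> (nrm2 M u)\<^sup>2"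
    by (intro tendsto_intros nrm2_tendsto_norm \<phi> s test_sqint)
   have "(%k. LINT x|M. \<phi> k x * indicator (cell h z) x) ----> (LINT x|M. u x * indicator (cell h z) x)" if "z \<in> corner h ` \<Omega>" for z
    using inner_tendsto[OF test_sqint(1)[OF \<phi>(1)] s(1) \<phi>(2), of "%_. indicator (cell h z)" "indicator (cell h z)"]
     indicator_cell_sqint[OF h that] by (simp add: nrm2_def)
   then show "(%k. \<epsilon> * (nrm2 M (grad (\<phi> k)))\<^sup>2 + 1 / h ^ DIM('a) * (\<Sum>z\<in>corner h ` \<Omega>. (LINT x|M. \<phi> k x * indicator (cell h z) x)\<^sup>2))
     ----> \<epsilon> * (nrm2 M g)\<^sup>2 + 1 / h ^ DIM('a) * (\<Sum>z\<in>corner h ` \<Omega>. (LINT x|M. u x * indicator (cell h z) x)\<^sup>2)"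
    by (intro tendsto_intros nrm2_tendsto_norm \<phi> s test_sqint) auto
   show "\<exists>N. \<forall>n\<ge>N. (nrm2 M (\<phi> n))\<^sup>2 <= \<epsilon> * (nrm2 M (grad (\<phi> n)))\<^sup>2 + 1 / h ^ DIM('a) * (\<Sum>z\<in>corner h ` \<Omega>. (LINT x|M. \<phi> n x * indicator (cell h z) x)\<^sup>2)"
   proof (intro exI[of _ 0] allI impI)
    fix n
    have "(2 * real DIM('a)) ^ DIM('a) * (real DIM('a))\<^sup>2 * h\<^sup>2 / 2 = \<epsilon>" using h2 by (simp add: A_def)
    then show "(nrm2 M (\<phi> n))\<^sup>2 <= \<epsilon> * (nrm2 M (grad (\<phi> n)))\<^sup>2 + 1 / h ^ DIM('a) * (\<Sum>z\<in>corner h ` \<Omega>. (LINT x|M. \<phi> n x * indicator (cell h z) x)\<^sup>2)"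
     using friedrichs_test[OF h \<phi>(1)[of n]] by metis
   qed
  qed
 qed
qed

text \<open>Friedrichs' inequality at scale l leaves a fraction \<open>1 / Suc l\<close> of the
  gradient and finitely many cell integrals, which are bounded sequences of reals. A diagonal
  subsequence makes all of them converge for all scales at once.\<close>

lemma rellich:
 assumes H: "!!n::nat. H10g (u n) (g n)" and B: "!!n. (nrm2 M (u n))\<^sup>2 + (nrm2 M (g n))\<^sup>2 <= B"
 shows "\<exists>r::nat=>nat. strict_mono r \<and> (\<forall>e>0. \<exists>N. \<forall>i\<ge>N. \<forall>j\<ge>N. (ndist M (u (r i)) (u (r j)))\<^sup>2 < e)"
proof -
 note s = H10g_sqint[OF H]
 define Q where "Q l h C \<longleftrightarrow> 0 < h \<and> 0 <= C \<and> finite (corner h ` \<Omega>) \<and> (\<forall>u g. H10g u g \<longrightarrow>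
   (nrm2 M u)\<^sup>2 <= 1 / Suc l * (nrm2 M g)\<^sup>2 + C * (\<Sum>z\<in>corner h ` \<Omega>. (LINT x|M. u x * indicator (cell h z) x)\<^sup>2))"
  for l h C
 have "\<exists>h C. Q l h C" for l
 proof (rule friedrichs[of "1 / Suc l"])
  fix h C assume a: "0 < h" "0 <= C" "finite (corner h ` \<Omega>)"
   and F': "!!u g. H10g u g ==> (nrm2 M u)\<^sup>2 <= 1 / Suc l * (nrm2 M g)\<^sup>2 + C * (\<Sum>z\<in>corner h ` \<Omega>. (LINT x|M. u x * indicator (cell h z) x)\<^sup>2)"
  have "Q l h C" unfolding Q_def by (intro conjI allI impI a F')
  then show ?thesis by blast
 qed simp
 then obtain h C where Q: "!!l. Q l (h l) (C l)" by metis
 have h: "!!l. 0 < h l" and C: "!!l. 0 <= C l" and fin: "!!l. finite (corner (h l) ` \<Omega>)"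
  and F: "!!l u g. H10g u g ==> (nrm2 M u)\<^sup>2 <= 1 / Suc l * (nrm2 M g)\<^sup>2
    + C l * (\<Sum>z\<in>corner (h l) ` \<Omega>. (LINT x|M. u x * indicator (cell (h l) z) x)\<^sup>2)"
  using Q unfolding Q_def by blast+
 define Z where "Z l = corner (h l) ` \<Omega>" for l
 define L where "L l z n = (LINT x|M. u n x * indicator (cell (h l) z) x)" for l z n
 \<comment> \<open>Adding 1 gives \<open>c <= c\<^sup>2\<close>, so that a bound c for the squared
   norm of a cell indicator is also a bound for the norm.\<close>
 define c where "c = (measure M \<Omega>) + 1"
 have ic: "sqint M (indicator (cell (h l) z) :: 'a => real)" if "z \<in> Z l" for l z
  using indicator_cell_sqint[OF h] that by (simp add: Z_def)
 interpret fm: finite_measure M by (rule finite_M)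
 have Lb: "\<bar>L l z n\<bar> <= sqrt B * c" if z: "z \<in> Z l" for l z n
 proof -
  have "\<bar>L l z n\<bar> <= nrm2 M (u n) * nrm2 M (indicator (cell (h l) z) :: 'a => real)"
   using CS_ineq[OF s(1)[of n] ic[OF z]] by (simp add: L_def)
  also have "... <= sqrt B * c"
  proof (intro mult_mono)
   show "nrm2 M (u n) <= sqrt B" using B[of n] by (intro real_le_rsqrt) (smt (verit) zero_le_power2)
   have "(LINT x|M. nsq (indicator (cell (h l) z) x :: real)) <= (LINT x|M. 1)"
    using ic[OF z] by (intro integral_mono) (auto simp: sqint_def indicator_def)
   then have "(nrm2 M (indicator (cell (h l) z) :: 'a => real))\<^sup>2 <= c" by (simp add: nrm2_sq c_def)
   also have "c <= c\<^sup>2" using self_le_power[of c 2] by (simp add: c_def)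
   finally show "nrm2 M (indicator (cell (h l) z) :: 'a => real) <= c"
    by (rule power2_le_imp_le) (simp add: c_def)
   show "0 <= sqrt B" using B[of 0] by (smt (verit) real_sqrt_ge_zero zero_le_power2)
  qed simp
  finally show ?thesis .
 qed
 define P where "P l r \<longleftrightarrow> (\<forall>z\<in>Z l. convergent (%k. L l z (r k)))" for l and r :: "nat => nat"
 interpret D: subseqs P
 proof
  fix l and r :: "nat => nat" assume "strict_mono r"
  show "\<exists>r'. strict_mono r' \<and> P l (r \<circ> r')"
  proof -
   have "finite (Z l)" using fin by (simp add: Z_def)
   from convergent_subsequence_finite[OF this, of "%z n. L l z (r n)" "sqrt B * c"] Lb
   show ?thesis by (simp add: P_def comp_def)
  qed
 qed
 define r where "r = D.diagseq"
 have r: "strict_mono r" unfolding r_def by (rule D.subseq_diagseq)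
 have conv: "convergent (%k. L l z (r k))" if z: "z \<in> Z l" for l z
 proof -
  have "P l (D.diagseq \<circ> ((+) (Suc l)))"
  proof (rule D.diagseq_holds)
   fix p q :: "nat => nat" and n assume p: "strict_mono p" and q: "P n q"
   show "P n (q \<circ> p)" unfolding P_def
   proof
    fix z assume "z \<in> Z n"
    then obtain l where "(%k. L n z (q k)) ----> l" using q by (auto simp: P_def convergent_def)
    from LIMSEQ_subseq_LIMSEQ[OF this p] show "convergent (%k. L n z ((q \<circ> p) k))" by (auto simp: convergent_def comp_def)
   qed
  qed
  then obtain a where "(%k. L l z (r (k + Suc l))) ----> a"
   using z by (auto simp: P_def convergent_def r_def comp_def add.commute)
  then have "(%k. L l z (r k)) ----> a" by (rule LIMSEQ_offset)
  then show ?thesis by (auto simp: convergent_def)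
 qed
 have "\<exists>N. \<forall>i\<ge>N. \<forall>j\<ge>N. (ndist M (u (r i)) (u (r j)))\<^sup>2 < e" if e: "e > 0" for e
 proof -
  \<comment> \<open>The scale l pushes the gradient part below e/2, as gradient differences have
    norm at most twice sqrt B. The tolerance d leaves at most e/4 for the finitely many cell
    integrals.\<close>
  obtain l :: nat where l: "8 * (\<bar>B\<bar> + 1) / e < real l" using reals_Archimedean2 by blast
  define d where "d = sqrt (e / (4 * (C l + 1) * (real (card (Z l)) + 1)))"
  have d: "0 < d" using e C[of l] by (simp add: d_def add_nonneg_pos)
  have "\<exists>N. \<forall>i\<ge>N. \<forall>j\<ge>N. \<bar>L l z (r i) - L l z (r j)\<bar> < d" if "z \<in> Z l" for z
  proof -
   have "Cauchy (%k. L l z (r k))" using conv[OF that] by (rule convergent_Cauchy)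
   then show ?thesis using d by (auto simp: Cauchy_def dist_real_def)
  qed
  then obtain N where N: "!!z i j. z \<in> Z l ==> i \<ge> N z ==> j \<ge> N z ==> \<bar>L l z (r i) - L l z (r j)\<bar> < d" by metis
  define N0 where "N0 = (\<Sum>z\<in>Z l. N z)"
  have N0: "N z <= N0" if "z \<in> Z l" for z
   unfolding N0_def using fin[of l] that by (intro member_le_sum) (auto simp: Z_def)
  show ?thesis
  proof (intro exI[of _ N0] allI impI)
   fix i j assume ij: "N0 <= i" "N0 <= j"
   have Hd: "H10g (%x. u (r i) x - u (r j) x) (%x. g (r i) x - g (r j) x)"
    using H10g_lincomb[OF H[of "r i"] H[of "r j"], of 1 "-1"] by simp
   have g4: "(ndist M (g (r i)) (g (r j)))\<^sup>2 <= 4 * B"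
   proof -
    have gb: "nrm2 M (g n) <= sqrt B" for n using B[of n] by (intro real_le_rsqrt) (smt (verit) zero_le_power2)
    have "ndist M (g (r i)) (g (r j)) <= nrm2 M (g (r i)) + nrm2 M (g (r j))"
     using nrm2_triangle_diff[OF s(2) sqint_zero s(2), of "r i" "r j"] nrm2_minus_commute[of M "%x. 0" "g (r j)"] by simp
    also have "... <= 2 * sqrt B" using gb[of "r i"] gb[of "r j"] by simp
    finally have "(ndist M (g (r i)) (g (r j)))\<^sup>2 <= (2 * sqrt B)\<^sup>2" by (intro power_mono) auto
    also have "... = 4 * B" using B[of 0] by (simp add: power_mult_distrib) (smt (verit) zero_le_power2)
    finally show ?thesis .
   qed
   have B0: "0 <= B" using B[of 0] by (smt (verit) zero_le_power2)
   have t1: "1 / Suc l * (ndist M (g (r i)) (g (r j)))\<^sup>2 <= e / 2"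
   proof -
    have "8 * (\<bar>B\<bar> + 1) < e * real l" using l e by (simp add: field_simps)
    then have "8 * B <= e * Suc l" using B0 e by (simp add: algebra_simps)
    then have "1 / Suc l * (4 * B) <= e / 2" by (simp add: field_simps)
    moreover have "1 / Suc l * (ndist M (g (r i)) (g (r j)))\<^sup>2 <= 1 / Suc l * (4 * B)"
     using g4 by (intro mult_left_mono) auto
    ultimately show ?thesis by linarith
   qed
   have t2: "C l * (\<Sum>z\<in>Z l. (LINT x|M. (u (r i) x - u (r j) x) * indicator (cell (h l) z) x)\<^sup>2) <= e / 4"
   proof -
    have "(\<Sum>z\<in>Z l. (LINT x|M. (u (r i) x - u (r j) x) * indicator (cell (h l) z) x)\<^sup>2) <= (\<Sum>z\<in>Z l. d\<^sup>2)"
    proof (rule sum_mono)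
     fix z assume z: "z \<in> Z l"
     have "(LINT x|M. (u (r i) x - u (r j) x) * indicator (cell (h l) z) x) = L l z (r i) - L l z (r j)"
      unfolding L_def left_diff_distrib by (intro Bochner_Integration.integral_diff sqint_mult s ic z)
     moreover have "\<bar>L l z (r i) - L l z (r j)\<bar> < d" using N[OF z] N0[OF z] ij by auto
     ultimately show "(LINT x|M. (u (r i) x - u (r j) x) * indicator (cell (h l) z) x)\<^sup>2 <= d\<^sup>2"
      using d by (simp add: abs_le_square_iff[symmetric])
    qed
    also have "... <= (real (card (Z l)) + 1) * d\<^sup>2" by (simp add: algebra_simps)
    finally have "C l * (\<Sum>z\<in>Z l. (LINT x|M. (u (r i) x - u (r j) x) * indicator (cell (h l) z) x)\<^sup>2) <= (C l + 1) * ((real (card (Z l)) + 1) * d\<^sup>2)"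
     using C[of l] by (intro mult_mono) (auto intro!: sum_nonneg)
    also have "d\<^sup>2 = e / (4 * (C l + 1) * (real (card (Z l)) + 1))" using e C[of l] by (simp add: d_def)
    also have "(C l + 1) * ((real (card (Z l)) + 1) * (e / (4 * (C l + 1) * (real (card (Z l)) + 1)))) = e / 4"
    proof -
     have "C l + 1 \<noteq> 0" "real (card (Z l)) + 1 \<noteq> 0" using C[of l] by linarith+
     then show ?thesis by (simp add: divide_simps)
    qed
    finally show ?thesis .
   qed
   have "(ndist M (u (r i)) (u (r j)))\<^sup>2 <= e / 2 + e / 4"
    using F[OF Hd, of l] t1 t2 unfolding Z_def by linarith
   also have "... < e" using e by simp
   finally show "(ndist M (u (r i)) (u (r j)))\<^sup>2 < e" .
  qed
 qed
 then show ?thesis using r by blast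
qed

definition m_form :: "('a => real) => ('a => real) => real" where
 "m_form u v = (LINT x|M. u x * v x)"

definition a_form :: "('a => real) => ('a => real) => real" where
 "a_form u v = (LINT x|M. weak_grad \<Omega> u x \<bullet> weak_grad \<Omega> v x)"

text \<open>The full H1 product is taken instead of its gradient part: it dominates
  \<open>m_form\<close> without a Poincare inequality, and its eigenvalues are the Dirichlet
  eigenvalues shifted by one.\<close>

definition q_form :: "('a => real) => ('a => real) => real" where
 "q_form u v = m_form u v + a_form u v"

lemma a_form_eq:
 assumes "H10g u g" "H10g v h"
 shows "a_form u v = (LINT x|M. g x \<bullet> h x)"
 unfolding a_form_def
proof (rule integral_cong_AE)
 have "u \<in> H10 \<Omega>" "v \<in> H10 \<Omega>" using assms by (auto intro: H10g_H10)
 then have "sqint M (weak_grad \<Omega> u)" "sqint M (weak_grad \<Omega> v)" by (auto dest: H10_H10g H10g_sqint)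
 moreover have "sqint M g" "sqint M h" using assms by (auto dest: H10g_sqint)
 ultimately have [measurable]: "weak_grad \<Omega> u \<in> borel_measurable M" "weak_grad \<Omega> v \<in> borel_measurable M"
  "g \<in> borel_measurable M" "h \<in> borel_measurable M" by (auto dest: sqint_measurable)
 show "(%x. weak_grad \<Omega> u x \<bullet> weak_grad \<Omega> v x) \<in> borel_measurable M" "(%x. g x \<bullet> h x) \<in> borel_measurable M" by measurable
 show "AE x in M. weak_grad \<Omega> u x \<bullet> weak_grad \<Omega> v x = g x \<bullet> h x"
  using H10g_unique[OF assms(1)] H10g_unique[OF assms(2)] by eventually_elim simp
qed

lemma H10_lincomb: "u \<in> H10 \<Omega> ==> v \<in> H10 \<Omega> ==> (%x. a * u x + b * v x) \<in> H10 \<Omega>"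
 by (rule H10g_H10[OF H10g_lincomb[OF H10_H10g H10_H10g]])

lemma H10_zero: "(%x. 0) \<in> H10 \<Omega>"
 using H10g_test[OF test_zero] by (rule H10g_H10)

lemma H10_sqint: "u \<in> H10 \<Omega> ==> sqint M u" "u \<in> H10 \<Omega> ==> sqint M (weak_grad \<Omega> u)"
 by (auto dest: H10_H10g H10g_sqint)

lemma m_form_self: "m_form u u = (nrm2 M u)\<^sup>2"
 unfolding m_form_def nrm2_sq by (simp add: power2_eq_square)

lemma q_form_self: "H10g u g ==> q_form u u = (nrm2 M u)\<^sup>2 + (nrm2 M g)\<^sup>2"
 by (simp add: q_form_def m_form_self a_form_eq nrm2_sq_inner)

lemma normH1_sq: "u \<in> H10 \<Omega> ==> (normH1 \<Omega> u)\<^sup>2 = q_form u u"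
 using H10g_normH1[OF H10_H10g] q_form_self[OF H10_H10g] by simp

sublocale CF: compact_form "H10 \<Omega>" m_form q_form
proof
 show "(%x. 0) \<in> H10 \<Omega>" by (rule H10_zero)
 show "(%x. a * u x + b * v x) \<in> H10 \<Omega>" if "u \<in> H10 \<Omega>" "v \<in> H10 \<Omega>" for u v a b
  by (rule H10_lincomb[OF that])
 show ms: "m_form u v = m_form v u" for u v by (simp add: m_form_def mult.commute)
 show "q_form u v = q_form v u" for u v by (simp add: q_form_def ms a_form_def inner_commute)
 show ml: "m_form (%x. a * u x + b * v x) w = a * m_form u w + b * m_form v w"
  if "u \<in> H10 \<Omega>" "v \<in> H10 \<Omega>" "w \<in> H10 \<Omega>" for u v w a b
  using sqint_mult[OF H10_sqint(1)[OF that(1)] H10_sqint(1)[OF that(3)]] sqint_mult[OF H10_sqint(1)[OF that(2)] H10_sqint(1)[OF that(3)]]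
  by (simp add: m_form_def ring_distribs mult.assoc)
 show "q_form (%x. a * u x + b * v x) w = a * q_form u w + b * q_form v w"
  if "u \<in> H10 \<Omega>" "v \<in> H10 \<Omega>" "w \<in> H10 \<Omega>" for u v w a b
 proof -
  have "a_form (%x. a * u x + b * v x) w = (LINT x|M. (a *\<^sub>R weak_grad \<Omega> u x + b *\<^sub>R weak_grad \<Omega> v x) \<bullet> weak_grad \<Omega> w x)"
   by (intro a_form_eq H10g_lincomb H10_H10g that)
  also have "... = a * a_form u w + b * a_form v w"
   using sqint_inner[OF H10_sqint(2)[OF that(1)] H10_sqint(2)[OF that(3)]] sqint_inner[OF H10_sqint(2)[OF that(2)] H10_sqint(2)[OF that(3)]]
   by (simp add: a_form_def inner_add_left)
  finally show ?thesis using ml[OF that] by (simp add: q_form_def algebra_simps)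
 qed
 show "0 <= m_form u u" for u by (simp add: m_form_self)
 show "0 <= q_form u u" if "u \<in> H10 \<Omega>" for u using q_form_self[OF H10_H10g[OF that]] by simp
 show "m_form u u <= q_form u u" if "u \<in> H10 \<Omega>" for u using q_form_self[OF H10_H10g[OF that]] by (simp add: m_form_self)
 show "q_form u u = 0" if u: "u \<in> H10 \<Omega>" and 0: "m_form u u = 0" for u
 proof -
  note Hu = H10_H10g[OF u]
  have n0: "nrm2 M u = 0" using 0 by (simp add: m_form_self)
  then have "AE x in M. u x = 0" using nrm2_eq_0_iff[OF H10_sqint(1)[OF u]] by simp
  \<comment> \<open>After changing u on a null set, the zero function has both
    \<open>weak_grad \<Omega> u\<close> and 0 as weak gradients, and these agree almost
    everywhere.\<close>
  then have "H10g (%x. 0) (weak_grad \<Omega> u)"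
   by (intro H10g_cong[OF Hu]) (use sqint_measurable[OF H10_sqint(2)[OF u]] in auto)
  moreover have "H10g (%x. 0) (%x. 0)"
   using H10g_lincomb[OF Hu Hu, of 0 0] by simp
  ultimately have "AE x in M. weak_grad \<Omega> u x = 0"
   by (rule weak_grad_unique[OF H10g_weak_grad H10g_weak_grad]) (rule H10_sqint[OF u] sqint_zero)+
  then have "nrm2 M (weak_grad \<Omega> u) = 0" using nrm2_eq_0_iff[OF H10_sqint(2)[OF u]] by simp
  then show ?thesis using q_form_self[OF Hu] n0 by simp
 qed
 have qd: "q_form (%x. u x - v x) (%x. u x - v x) = (ndist M u v)\<^sup>2 + (ndist M g h)\<^sup>2"
  if "H10g u g" "H10g v h" for u v g h
  using H10g_lincomb[OF that, of 1 "-1"] by (intro q_form_self) simp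
 show "\<exists>v\<in>H10 \<Omega>. (%n. q_form (%x. u n x - v x) (%x. u n x - v x)) ----> 0"
  if u: "!!n::nat. u n \<in> H10 \<Omega>" and c: "!!e. e > 0 ==> \<exists>N. \<forall>i\<ge>N. \<forall>j\<ge>N. q_form (%x. u i x - u j x) (%x. u i x - u j x) < e" for u
 proof -
  note Hu = H10_H10g[OF u]
  have lt: "\<bar>x\<bar> < e" if "x\<^sup>2 + y\<^sup>2 < e\<^sup>2" "0 < e" for x y e :: real
  proof -
   have "x\<^sup>2 < e\<^sup>2" using that(1) zero_le_power2[of y] by linarith
   then show ?thesis using that(2) power2_less_imp_less[of "\<bar>x\<bar>" e] by simp
  qed
  have c1: "\<exists>N. \<forall>i\<ge>N. \<forall>j\<ge>N. ndist M (u i) (u j) < e" if e: "e > 0" for e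
  proof -
   obtain N where N: "!!i j. i \<ge> N ==> j \<ge> N ==> q_form (%x. u i x - u j x) (%x. u i x - u j x) < e\<^sup>2"
    using c[of "e\<^sup>2"] e by auto
   show ?thesis
   proof (intro exI[of _ N] allI impI)
    fix i j assume "N <= i" "N <= j"
    from lt[OF N[OF this, unfolded qd[OF Hu Hu]] e] show "ndist M (u i) (u j) < e" by simp
   qed
  qed
  have c2: "\<exists>N. \<forall>i\<ge>N. \<forall>j\<ge>N. ndist M (weak_grad \<Omega> (u i)) (weak_grad \<Omega> (u j)) < e" if e: "e > 0" for e
  proof -
   obtain N where N: "!!i j. i \<ge> N ==> j \<ge> N ==> q_form (%x. u i x - u j x) (%x. u i x - u j x) < e\<^sup>2"
    using c[of "e\<^sup>2"] e by auto
   show ?thesis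
   proof (intro exI[of _ N] allI impI)
    fix i j assume "N <= i" "N <= j"
    from N[OF this] have "(ndist M (weak_grad \<Omega> (u i)) (weak_grad \<Omega> (u j)))\<^sup>2 + (ndist M (u i) (u j))\<^sup>2 < e\<^sup>2"
     unfolding qd[OF Hu Hu] by simp
    from lt[OF this e] show "ndist M (weak_grad \<Omega> (u i)) (weak_grad \<Omega> (u j)) < e" by simp
   qed
  qed
  obtain v h where v: "H10g v h" "(%n. ndist M (u n) v) ----> 0" "(%n. ndist M (weak_grad \<Omega> (u n)) h) ----> 0"
   by (rule H10g_complete[OF Hu c1 c2])
  have "(%n. (ndist M (u n) v)\<^sup>2 + (ndist M (weak_grad \<Omega> (u n)) h)\<^sup>2) ----> 0\<^sup>2 + 0\<^sup>2"
   by (intro tendsto_intros v)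
  then show ?thesis unfolding qd[OF Hu v(1), symmetric] using H10g_H10[OF v(1)] by auto
 qed
 show "\<exists>r::nat=>nat. strict_mono r \<and> (\<forall>e>0. \<exists>N. \<forall>i\<ge>N. \<forall>j\<ge>N. m_form (%x. u (r i) x - u (r j) x) (%x. u (r i) x - u (r j) x) < e)"
  if u: "!!n::nat. u n \<in> H10 \<Omega>" and B: "!!n. q_form (u n) (u n) <= B" for u B
  unfolding m_form_self by (rule rellich[OF H10_H10g[OF u]]) (use B q_form_self[OF H10_H10g[OF u]] in simp)
qed

end

section \<open>Gaussian weights on star-shaped domains\<close>

lemma lborel_dilation:
 fixes f :: "'a::euclidean_space => real"
 assumes [measurable]: "f \<in> borel_measurable borel" and s: "0 < s"
 shows "(LINT x|lborel. f (a + s *\<^sub>R (x - a))) = (LINT x|lborel. f x) / s ^ DIM('a)"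
proof -
 define t where "t = a - s *\<^sub>R a"
 have "(LINT x|lborel. f x) = integral\<^sup>L (density (distr lborel borel (%x. t + s *\<^sub>R x)) (%_. ennreal (\<bar>s\<bar>^DIM('a)))) f"
  using lborel_affine[of s t] s by (simp add: ennreal_power)
 also have "... = (LINT x|distr lborel borel (%x. t + s *\<^sub>R x). \<bar>s\<bar>^DIM('a) *\<^sub>R f x)"
  by (rule integral_density) auto
 also have "... = (LINT x|lborel. \<bar>s\<bar>^DIM('a) *\<^sub>R f (t + s *\<^sub>R x))"
  by (rule integral_distr) auto
 also have "... = s^DIM('a) * (LINT x|lborel. f (a + s *\<^sub>R (x - a)))"
  using s by (simp add: t_def algebra_simps)
 finally show ?thesis using s by simp
qed

context bdomain
begin

lemma sqint_smooth:
 fixes f :: "'a => 'b::euclidean_space"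
 assumes "sqint M f" "smooth_fun w" shows "sqint M (%x. w x *\<^sub>R f x)"
proof -
 obtain B where "0 <= B" "!!x. x \<in> \<Omega> ==> \<bar>w x\<bar> <= B" using smooth_bounded_on[OF assms(2)] by metis
 then show ?thesis using sqint_bounded_mult[OF assms(1) smooth_measurable(1)[OF assms(2)], of B] by simp
qed

lemma sqint_smooth_real: "sqint M f ==> smooth_fun w ==> sqint M (%x. w x * f x)" for f :: "'a => real"
 using sqint_smooth[of f w] by simp

lemma H10g_ibp:
 assumes u: "H10g u g" and v: "H10g v h"
 shows "(LINT x|M. u x * (h x \<bullet> b)) = - (LINT x|M. (g x \<bullet> b) * v x)"
proof -
 note su = H10g_sqint[OF u] and sv = H10g_sqint[OF v]
 obtain \<phi> where \<phi>: "!!k::nat. \<phi> k \<in> test_functions \<Omega>" "(%k. ndist M (\<phi> k) v) ----> 0"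
  "(%k. ndist M (grad (\<phi> k)) h) ----> 0" using H10g_obtain[OF v] by blast
 have basis: "(LINT x|M. u x * (h x \<bullet> i)) = - (LINT x|M. (g x \<bullet> i) * v x)" if i: "i \<in> Basis" for i
 proof -
  have sui: "sqint M (%x. u x *\<^sub>R i)" 
   by (rule sqint_dominated[OF su(1), where c="norm i"]) (use sqint_measurable[OF su(1)] in auto)
  have sgi: "sqint M (%x. g x \<bullet> i)"
   by (rule sqint_dominated[OF su(2), where c="1"]) (use sqint_measurable[OF su(2)] Basis_le_norm[OF i] in auto)
  have "(%k. LINT x|M. u x *\<^sub>R i \<bullet> grad (\<phi> k) x) ----> (LINT x|M. u x *\<^sub>R i \<bullet> h x)"
   by (rule inner_tendsto) (use sui sv \<phi> in \<open>auto simp: nrm2_def test_sqint\<close>)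
  moreover have "(%k. LINT x|M. (g x \<bullet> i) \<bullet> \<phi> k x) ----> (LINT x|M. (g x \<bullet> i) \<bullet> v x)"
   by (rule inner_tendsto) (use sgi sv \<phi> in \<open>auto simp: nrm2_def test_sqint\<close>)
  then have "(%k. - (LINT x|M. (g x \<bullet> i) \<bullet> \<phi> k x)) ----> - (LINT x|M. (g x \<bullet> i) \<bullet> v x)" by (rule tendsto_minus)
  moreover have "(LINT x|M. u x *\<^sub>R i \<bullet> grad (\<phi> k) x) = - (LINT x|M. (g x \<bullet> i) \<bullet> \<phi> k x)" for k
   using H10g_weak_grad[OF u] \<phi>(1) i unfolding has_weak_grad_iff by (simp add: inner_commute)
  ultimately have "(LINT x|M. u x *\<^sub>R i \<bullet> h x) = - (LINT x|M. (g x \<bullet> i) \<bullet> v x)"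
   using LIMSEQ_unique by simp
  then show ?thesis by (simp add: inner_commute)
 qed
 have e: "f x \<bullet> b = (\<Sum>i\<in>Basis. (b \<bullet> i) * (f x \<bullet> i))" for f :: "'a => 'a" and x
  by (subst euclidean_inner) (simp add: mult.commute)
 have sc: "sqint M (%x. f x \<bullet> i)" if "sqint M f" "i \<in> Basis" for f :: "'a => 'a" and i
  by (rule sqint_dominated[OF that(1), where c="1"]) (use sqint_measurable[OF that(1)] Basis_le_norm[OF that(2)] in auto)
 have "(LINT x|M. u x * (h x \<bullet> b)) = (LINT x|M. (\<Sum>i\<in>Basis. (b \<bullet> i) * (u x * (h x \<bullet> i))))"
  by (subst e) (simp add: sum_distrib_left mult_ac)
 also have "... = (\<Sum>i\<in>Basis. (b \<bullet> i) * (LINT x|M. u x * (h x \<bullet> i)))"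
  using sqint_mult[OF su(1) sc[OF sv(2)]] by (simp add: LINT_sum)
 also have "... = - (\<Sum>i\<in>Basis. (b \<bullet> i) * (LINT x|M. (g x \<bullet> i) * v x))"
  by (simp add: basis sum_negf)
 also have "(\<Sum>i\<in>Basis. (b \<bullet> i) * (LINT x|M. (g x \<bullet> i) * v x)) = (LINT x|M. (\<Sum>i\<in>Basis. (b \<bullet> i) * ((g x \<bullet> i) * v x)))"
  using sqint_mult[OF sc[OF su(2)] sv(1)] by (simp add: LINT_sum)
 also have "... = (LINT x|M. (g x \<bullet> b) * v x)"
  by (subst e) (simp add: sum_distrib_right sum_distrib_left mult_ac)
 finally show ?thesis .
qed

text \<open>Integration by parts of u against the product of u and \<open>\<psi>\<close>: the same
  integral of u times its derivative appears on both sides, whence the factor 2.\<close>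

lemma H10g_square_ibp:
 assumes u: "H10g u g" and \<psi>: "smooth_fun \<psi>"
 shows "2 * (LINT x|M. u x * (g x \<bullet> b) * \<psi> x) = - (LINT x|M. (u x)\<^sup>2 * (grad \<psi> x \<bullet> b))"
proof -
 note su = H10g_sqint[OF u]
 obtain B where B: "0 <= B" "!!x. x \<in> \<Omega> ==> \<bar>\<psi> x\<bar> <= B" "!!x. x \<in> \<Omega> ==> norm (grad \<psi> x) <= B"
  using smooth_bounded_on[OF \<psi>] by metis
 note pm = smooth_measurable[OF \<psi>] and um = sqint_measurable[OF su(1)] and gm = sqint_measurable[OF su(2)]
 have s1: "sqint M (%x. g x \<bullet> b)"
 proof (rule sqint_dominated[OF su(2), where c="norm b"])
  show "AE x in M. norm (g x \<bullet> b) <= norm b * norm (g x)"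
   using Cauchy_Schwarz_ineq2[of _ b] by (intro AE_I2) (simp only: real_norm_def mult.commute[of "norm b"])
 qed (use gm in auto)
 have s2: "sqint M (%x. u x * \<psi> x)" using sqint_smooth_real[OF su(1) \<psi>] by (simp add: mult.commute)
 have s3: "sqint M (%x. u x * (grad \<psi> x \<bullet> b))"
 proof (rule sqint_dominated[OF su(1), where c="B * norm b"])
  show "AE x in M. norm (u x * (grad \<psi> x \<bullet> b)) <= B * norm b * norm (u x)"
  proof (rule AE_I2)
   fix x assume "x \<in> space M"
   then have "\<bar>grad \<psi> x \<bullet> b\<bar> <= B * norm b"
    using Cauchy_Schwarz_ineq2[of "grad \<psi> x" b] mult_right_mono[OF B(3)[of x] norm_ge_zero[of b]] by simp
   then show "norm (u x * (grad \<psi> x \<bullet> b)) <= B * norm b * norm (u x)"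
    by (simp add: abs_mult mult_left_mono mult.commute[of "B * norm b"])
  qed
 qed (use um pm in auto)
 have i1: "integrable M (%x. u x * (g x \<bullet> b) * \<psi> x)" using sqint_mult[OF s2 s1] by (simp add: mult_ac)
 have i2: "integrable M (%x. (u x)\<^sup>2 * (grad \<psi> x \<bullet> b))" using sqint_mult[OF su(1) s3] by (simp add: mult_ac power2_eq_square)
 have "(LINT x|M. u x * ((\<psi> x *\<^sub>R g x + u x *\<^sub>R grad \<psi> x) \<bullet> b)) = - (LINT x|M. (g x \<bullet> b) * (u x * \<psi> x))"
  by (rule H10g_ibp[OF u H10g_mult[OF u \<psi>]])
 moreover have "(LINT x|M. u x * ((\<psi> x *\<^sub>R g x + u x *\<^sub>R grad \<psi> x) \<bullet> b)) =
   (LINT x|M. u x * (g x \<bullet> b) * \<psi> x) + (LINT x|M. (u x)\<^sup>2 * (grad \<psi> x \<bullet> b))"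
  using i1 i2 by (subst Bochner_Integration.integral_add[symmetric]) (auto simp: inner_add_left algebra_simps power2_eq_square)
 moreover have "(LINT x|M. (g x \<bullet> b) * (u x * \<psi> x)) = (LINT x|M. u x * (g x \<bullet> b) * \<psi> x)"
  by (simp add: mult_ac)
 ultimately show ?thesis by simp
qed

end

locale star_domain = bdomain +
 fixes x0 :: 'a and R :: real
 assumes star: "x \<in> \<Omega> ==> 0 <= s ==> s <= 1 ==> x0 + s *\<^sub>R (x - x0) \<in> \<Omega>"
  and R_bound: "x \<in> \<Omega> ==> norm (x - x0) <= R" and R_pos: "0 < R"
begin

text \<open>With \<open>\<Gamma>\<close> decreasing at unit speed this is the backward heat kernel
  at x0 without its normalising power of \<open>\<Gamma>\<close>. The omitted power reappears as the
  term with \<open>DIM('a) / (2 * \<Gamma>)\<close> in the derivative of the weighted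
  energy.\<close>

definition gauss :: "real => 'a => real" where
 "gauss \<Gamma> x = exp (- (1 / (4 * \<Gamma>)) * nsq (x - x0))"

lemma gauss_pos: "0 < gauss \<Gamma> x" by (simp add: gauss_def)

lemma gauss_le_1: "0 < \<Gamma> ==> gauss \<Gamma> x <= 1" by (simp add: gauss_def)

lemma smooth_gauss: "smooth_fun (gauss \<Gamma>)"
 unfolding gauss_def[abs_def] by (intro smooth_fun_exp smooth_fun_mult smooth_fun_const smooth_fun_norm_sq)

lemma grad_gauss: "grad (gauss \<Gamma>) x = (- (gauss \<Gamma> x / (2 * \<Gamma>))) *\<^sub>R (x - x0)"
proof (rule grad_eqI)
 have "((%x. exp (c * ((x - x0) \<bullet> (x - x0)))) has_derivative
   (%h. exp (c * ((x - x0) \<bullet> (x - x0))) * (c * (2 * ((x - x0) \<bullet> h))))) (at x)" for c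
  by (auto intro!: derivative_eq_intros simp: inner_commute)
 from this[of "- (1 / (4 * \<Gamma>))"] show "(gauss \<Gamma> has_derivative (%h. (- (gauss \<Gamma> x / (2 * \<Gamma>))) *\<^sub>R (x - x0) \<bullet> h)) (at x)"
  unfolding gauss_def[abs_def] power2_norm_eq_inner
  by (rule has_derivative_eq_rhs) (cases "\<Gamma> = 0"; simp add: fun_eq_iff)
qed

lemma gauss_measurable [measurable]: "gauss \<Gamma> \<in> borel_measurable borel" "gauss \<Gamma> \<in> borel_measurable M"
 using smooth_gauss smooth_measurable[OF smooth_gauss]
 by (auto intro!: borel_measurable_continuous_onI smooth_fun_continuous)

lemma id_measurable [measurable]: "(%x. x) \<in> borel_measurable M"
 by (rule borel_measurable_continuous_lebesgue_on) (rule continuous_on_id)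

lemma sqint_radial: "sqint M g ==> sqint M (%x. (x - x0) \<bullet> g x)"
proof (rule sqint_dominated[where c=R])
 assume g: "sqint M g"
 have [measurable]: "g \<in> borel_measurable M" using g by (rule sqint_measurable)
 show "(%x. (x - x0) \<bullet> g x) \<in> borel_measurable M" by measurable
 show "AE x in M. norm ((x - x0) \<bullet> g x) <= R * norm (g x)"
  using R_bound by (intro AE_I2) (auto intro: order_trans[OF Cauchy_Schwarz_ineq2 mult_right_mono])
qed

lemma integrable_gauss:
 assumes "integrable M f" "0 < \<Gamma>" shows "integrable M (%x. f x * gauss \<Gamma> x)"
proof (rule integrable_dominated[OF assms(1)])
 have [measurable]: "f \<in> borel_measurable M" using assms(1) by auto
 show "(%x. f x * gauss \<Gamma> x) \<in> borel_measurable M" by measurable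
 show "AE x in M. norm (f x * gauss \<Gamma> x) <= norm (f x)"
  using gauss_le_1[OF assms(2)] gauss_pos by (intro AE_I2) (simp add: abs_mult abs_of_pos mult_left_le)
qed

lemma integrable_normsq_bounded:
 assumes "sqint M f" "w \<in> borel_measurable M" "!!x. x \<in> \<Omega> ==> \<bar>w x\<bar> <= c"
 shows "integrable M (%x. nsq (f x) * w x)"
proof (rule integrable_dominated)
 show "integrable M (%x. nsq (f x) * c)" using sqint_integrable[OF assms(1)] by simp
 show "(%x. nsq (f x) * w x) \<in> borel_measurable M" using assms(2) sqint_measurable[OF assms(1)] by measurable
 show "AE x in M. norm (nsq (f x) * w x) <= norm (nsq (f x) * c)"
 proof (rule AE_I2)
  fix x assume "x \<in> space M"
  then have "\<bar>w x\<bar> <= \<bar>c\<bar>" using assms(3)[of x] by simp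
  then show "norm (nsq (f x) * w x) <= norm (nsq (f x) * c)" by (simp add: abs_mult mult_left_mono)
 qed
qed

lemma integrable_normsq_radial:
 assumes "sqint M f" "0 < \<Gamma>"
 shows "integrable M (%x. nsq (f x) * nsq (x - x0) * gauss \<Gamma> x)"
  "integrable M (%x. nsq (f x) * gauss \<Gamma> x)"
proof -
 have "integrable M (%x. nsq (f x) * nsq (x - x0))"
  by (rule integrable_normsq_bounded[OF assms(1), where c="R\<^sup>2"]) (use R_bound in \<open>auto intro!: power_mono\<close>)
 then show "integrable M (%x. nsq (f x) * nsq (x - x0) * gauss \<Gamma> x)" by (rule integrable_gauss[OF _ assms(2)])
 show "integrable M (%x. nsq (f x) * gauss \<Gamma> x)"
  by (rule integrable_gauss[OF sqint_integrable[OF assms(1)] assms(2)])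
qed

definition weak_laplacian :: "('a => real) => ('a => 'a) => ('a => real) => bool" where
 "weak_laplacian u g l \<longleftrightarrow> H10g u g \<and> sqint M l \<and>
   (\<forall>v h. H10g v h \<longrightarrow> (LINT x|M. g x \<bullet> h x) = - (LINT x|M. l x * v x))"

text \<open>The generator of the drift diffusion that is symmetric for the Gaussian weight.\<close>

definition drift :: "real => ('a => 'a) => ('a => real) => 'a => real" where
 "drift \<Gamma> g l x = l x - ((x - x0) \<bullet> g x) / (2 * \<Gamma>)"

lemma sqint_drift: "sqint M g ==> sqint M l ==> sqint M (drift \<Gamma> g l)"
proof -
 assume "sqint M g" "sqint M l"
 then have "sqint M (%x. l x - (1 / (2 * \<Gamma>)) * ((x - x0) \<bullet> g x))"
  by (intro sqint_diff sqint_cmult sqint_radial)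
 then show ?thesis by (simp add: drift_def[abs_def])
qed

text \<open>Testing the weak equation with v times the weight brings in the gradient of the
  Gaussian; it is radial and proportional to the weight, and so becomes the drift term.\<close>

lemma drift_symmetric:
 assumes W: "weak_laplacian u g l" and v: "H10g v h" and \<Gamma>: "0 < \<Gamma>"
 shows "(LINT x|M. (g x \<bullet> h x) * gauss \<Gamma> x) = - (LINT x|M. drift \<Gamma> g l x * v x * gauss \<Gamma> x)"
proof -
 have u: "H10g u g" and l: "sqint M l" and wl: "!!v h. H10g v h ==> (LINT x|M. g x \<bullet> h x) = - (LINT x|M. l x * v x)"
  using W by (auto simp: weak_laplacian_def)
 note su = H10g_sqint[OF u] and sv = H10g_sqint[OF v]
 have i1: "integrable M (%x. (g x \<bullet> h x) * gauss \<Gamma> x)" by (intro integrable_gauss sqint_inner su sv \<Gamma>)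
 have i2: "integrable M (%x. ((x - x0) \<bullet> g x) * v x * gauss \<Gamma> x)" by (intro integrable_gauss sqint_mult sqint_radial su sv \<Gamma>)
 have i3: "integrable M (%x. l x * v x * gauss \<Gamma> x)" by (intro integrable_gauss sqint_mult l sv \<Gamma>)
 have "(LINT x|M. g x \<bullet> (gauss \<Gamma> x *\<^sub>R h x + v x *\<^sub>R grad (gauss \<Gamma>) x)) = - (LINT x|M. l x * (v x * gauss \<Gamma> x))"
  by (rule wl[OF H10g_mult[OF v smooth_gauss]])
 moreover have "g x \<bullet> (gauss \<Gamma> x *\<^sub>R h x + v x *\<^sub>R grad (gauss \<Gamma>) x)
   = (g x \<bullet> h x) * gauss \<Gamma> x - (1 / (2 * \<Gamma>)) * (((x - x0) \<bullet> g x) * v x * gauss \<Gamma> x)" for x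
  by (simp add: grad_gauss inner_add_right inner_commute algebra_simps)
 ultimately have "(LINT x|M. (g x \<bullet> h x) * gauss \<Gamma> x) - (1 / (2 * \<Gamma>)) * (LINT x|M. ((x - x0) \<bullet> g x) * v x * gauss \<Gamma> x)
   = - (LINT x|M. l x * v x * gauss \<Gamma> x)"
  using i1 i2 by (simp add: mult_ac)
 moreover have "(LINT x|M. drift \<Gamma> g l x * v x * gauss \<Gamma> x) = (LINT x|M. l x * v x * gauss \<Gamma> x - (1 / (2 * \<Gamma>)) * (((x - x0) \<bullet> g x) * v x * gauss \<Gamma> x))"
  by (intro LINT_cong refl) (simp add: drift_def left_diff_distrib)
 ultimately show ?thesis using i2 i3 by simp
qed

text \<open>The divergence theorem for the field (x - x0) times the weight, coordinate by coordinate
  through \<open>H10g_square_ibp\<close>. The divergence is the dimension minus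
  \<open>nsq (x - x0) / (2 * \<Gamma>)\<close>, times the weight.\<close>

lemma radial_ibp:
 assumes u: "H10g u g" and \<Gamma>: "0 < \<Gamma>"
 shows "2 * (LINT x|M. u x * ((x - x0) \<bullet> g x) * gauss \<Gamma> x)
  = - (real DIM('a) * (LINT x|M. (u x)\<^sup>2 * gauss \<Gamma> x)) + (1 / (2 * \<Gamma>)) * (LINT x|M. (u x)\<^sup>2 * nsq (x - x0) * gauss \<Gamma> x)"
proof -
 note su = H10g_sqint[OF u]
 define \<psi> where "\<psi> b x = ((x - x0) \<bullet> b) * gauss \<Gamma> x" for b x
 have lin: "smooth_fun (%x. (x - x0) \<bullet> b)" for b
 proof -
  have "smooth_fun (%x. x \<bullet> b + (- (x0 \<bullet> b)))"
   by (intro smooth_fun_add smooth_fun_const smooth_fun_linear bounded_linear_inner_left)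
  then show ?thesis by (simp add: inner_diff_left)
 qed
 have sm: "smooth_fun (\<psi> b)" for b unfolding \<psi>_def[abs_def] by (intro smooth_fun_mult lin smooth_gauss)
 have gl: "grad (%x. (x - x0) \<bullet> b) x = b" for b x
  by (rule grad_eqI) (auto intro!: derivative_eq_intros simp: inner_commute)
 have gp: "grad (\<psi> b) x \<bullet> b = (b \<bullet> b) * gauss \<Gamma> x - (1 / (2 * \<Gamma>)) * (((x - x0) \<bullet> b)\<^sup>2 * gauss \<Gamma> x)" for b x
  unfolding \<psi>_def[abs_def] grad_mult[OF lin smooth_gauss] gl grad_gauss inner_add_left inner_scaleR_left
  by (simp add: power2_eq_square mult_ac)
 have eq: "2 * (LINT x|M. u x * (g x \<bullet> b) * \<psi> b x) = - (LINT x|M. (u x)\<^sup>2 * (grad (\<psi> b) x \<bullet> b))" for b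
  by (rule H10g_square_ibp[OF u sm])
 have sb: "sqint M (%x. ((x - x0) \<bullet> b) *\<^sub>R (g x \<bullet> b))" if "b \<in> Basis" for b
 proof -
  have "sqint M (%x. g x \<bullet> b)"
   by (rule sqint_dominated[OF su(2), where c=1]) (use sqint_measurable[OF su(2)] Basis_le_norm[OF that] in auto)
  then show ?thesis by (rule sqint_smooth[OF _ lin])
 qed
 have i1: "integrable M (%x. u x * (g x \<bullet> b) * \<psi> b x)" if "b \<in> Basis" for b
  using integrable_gauss[OF sqint_mult[OF su(1) sb[OF that, simplified]] \<Gamma>] by (simp add: \<psi>_def mult_ac)
 have um: "u \<in> borel_measurable M" by (rule sqint_measurable[OF su(1)])
 have iq: "integrable M (%x. (u x)\<^sup>2 * gauss \<Gamma> x)" "integrable M (%x. (u x)\<^sup>2 * nsq (x - x0) * gauss \<Gamma> x)"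
  using integrable_normsq_radial[OF su(1) \<Gamma>] by simp_all
 have ib: "integrable M (%x. (u x)\<^sup>2 * (((x - x0) \<bullet> b)\<^sup>2 * gauss \<Gamma> x))" if "b \<in> Basis" for b
 proof (rule integrable_dominated[OF iq(2)])
  show "(%x. (u x)\<^sup>2 * (((x - x0) \<bullet> b)\<^sup>2 * gauss \<Gamma> x)) \<in> borel_measurable M" using um by measurable
  show "AE x in M. norm ((u x)\<^sup>2 * (((x - x0) \<bullet> b)\<^sup>2 * gauss \<Gamma> x)) <= norm ((u x)\<^sup>2 * nsq (x - x0) * gauss \<Gamma> x)"
  proof (rule AE_I2)
   fix x
   have "((x - x0) \<bullet> b)\<^sup>2 <= nsq (x - x0)" using Basis_le_norm[OF that, of "x - x0"]
    by (simp add: abs_le_square_iff[symmetric])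
   then show "norm ((u x)\<^sup>2 * (((x - x0) \<bullet> b)\<^sup>2 * gauss \<Gamma> x)) <= norm ((u x)\<^sup>2 * nsq (x - x0) * gauss \<Gamma> x)"
    using gauss_pos[of \<Gamma> x] by (simp add: abs_mult mult.assoc mult_left_mono mult_right_mono)
  qed
 qed
 have i2: "integrable M (%x. (u x)\<^sup>2 * (grad (\<psi> b) x \<bullet> b))" if "b \<in> Basis" for b
  unfolding gp using ib[OF that] iq(1) by (simp add: right_diff_distrib mult.left_commute[of "(u _)\<^sup>2"])
 have "2 * (LINT x|M. u x * ((x - x0) \<bullet> g x) * gauss \<Gamma> x) = 2 * (LINT x|M. (\<Sum>b\<in>Basis. u x * (g x \<bullet> b) * \<psi> b x))"
  by (subst euclidean_inner) (simp add: \<psi>_def sum_distrib_left sum_distrib_right mult_ac)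
 also have "... = (\<Sum>b\<in>Basis. 2 * (LINT x|M. u x * (g x \<bullet> b) * \<psi> b x))"
  using i1 by (simp add: LINT_sum sum_distrib_left)
 also have "... = - (\<Sum>b\<in>Basis. (LINT x|M. (u x)\<^sup>2 * (grad (\<psi> b) x \<bullet> b)))" by (simp add: eq sum_negf)
 also have "(\<Sum>b\<in>Basis. (LINT x|M. (u x)\<^sup>2 * (grad (\<psi> b) x \<bullet> b))) = (LINT x|M. (\<Sum>b\<in>Basis. (u x)\<^sup>2 * (grad (\<psi> b) x \<bullet> b)))"
  using i2 by (simp add: LINT_sum)
 also have "... = (LINT x|M. real DIM('a) * ((u x)\<^sup>2 * gauss \<Gamma> x) - (1 / (2 * \<Gamma>)) * ((u x)\<^sup>2 * nsq (x - x0) * gauss \<Gamma> x))"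
 proof (intro LINT_cong refl)
  fix x
  have "(\<Sum>b\<in>Basis. (u x)\<^sup>2 * (grad (\<psi> b) x \<bullet> b)) = (u x)\<^sup>2 * (\<Sum>b\<in>Basis. (b \<bullet> b) * gauss \<Gamma> x - (1 / (2 * \<Gamma>)) * (((x - x0) \<bullet> b)\<^sup>2 * gauss \<Gamma> x))"
   by (simp only: gp sum_distrib_left)
  also have "(\<Sum>b\<in>Basis. (b \<bullet> b) * gauss \<Gamma> x - (1 / (2 * \<Gamma>)) * (((x - x0) \<bullet> b)\<^sup>2 * gauss \<Gamma> x))
    = real DIM('a) * gauss \<Gamma> x - (1 / (2 * \<Gamma>)) * ((\<Sum>b\<in>Basis. ((x - x0) \<bullet> b)\<^sup>2) * gauss \<Gamma> x)"
   by (simp add: sum_subtractf sum_distrib_left sum_distrib_right)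
  also have "(\<Sum>b\<in>Basis. ((x - x0) \<bullet> b)\<^sup>2) = nsq (x - x0)"
   unfolding power2_norm_eq_inner euclidean_inner[of "x - x0" "x - x0"] by (simp only: power2_eq_square)
  finally show "(\<Sum>b\<in>Basis. (u x)\<^sup>2 * (grad (\<psi> b) x \<bullet> b)) = real DIM('a) * ((u x)\<^sup>2 * gauss \<Gamma> x) - (1 / (2 * \<Gamma>)) * ((u x)\<^sup>2 * nsq (x - x0) * gauss \<Gamma> x)"
   by (simp add: algebra_simps)
 qed
 also have "... = real DIM('a) * (LINT x|M. (u x)\<^sup>2 * gauss \<Gamma> x) - (1 / (2 * \<Gamma>)) * (LINT x|M. (u x)\<^sup>2 * nsq (x - x0) * gauss \<Gamma> x)"
  using iq by simp
 finally show ?thesis by simp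
qed

text \<open>Bounds the weighted second moment about x0 by the weighted gradient energy and mass, so
  that a small h D leaves little mass outside a ball. It follows by expanding a weighted square and
  replacing the cross term by \<open>radial_ibp\<close>.\<close>

lemma localisation:
 assumes u: "H10g u g" and h: "0 < h"
 shows "(LINT x|M. (u x)\<^sup>2 * nsq (x - x0) * gauss h x) / (8 * h)
   <= 2 * h * (LINT x|M. nsq (g x) * gauss h x) + real DIM('a) / 2 * (LINT x|M. (u x)\<^sup>2 * gauss h x)"
proof -
 note su = H10g_sqint[OF u]
 have iq: "integrable M (%x. (u x)\<^sup>2 * gauss h x)" "integrable M (%x. (u x)\<^sup>2 * nsq (x - x0) * gauss h x)"
  "integrable M (%x. nsq (g x) * gauss h x)"
  using integrable_normsq_radial[OF su(1) h] integrable_normsq_radial[OF su(2) h] by simp_all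
 have ix: "integrable M (%x. u x * ((x - x0) \<bullet> g x) * gauss h x)" by (intro integrable_gauss sqint_mult sqint_radial su h)
 \<comment> \<open>For a coefficient c in place of 1/(4h), the second moment finally has the factor
   c^2 - c/(2h). The choice made here minimises it, with value -1/(16 h^2).\<close>
 have "0 <= (LINT x|M. nsq (g x - (u x / (4 * h)) *\<^sub>R (x - x0)) * gauss h x)"
  by (intro integral_nonneg_AE AE_I2 mult_nonneg_nonneg) (auto intro: less_imp_le gauss_pos)
 also have "... = (LINT x|M. nsq (g x) * gauss h x - (1 / (2 * h)) * (u x * ((x - x0) \<bullet> g x) * gauss h x)
   + (1 / (16 * h\<^sup>2)) * ((u x)\<^sup>2 * nsq (x - x0) * gauss h x))"
 proof (intro LINT_cong refl)
  fix x
  have exp: "nsq (a - c *\<^sub>R y) = nsq a - 2 * c * (y \<bullet> a) + c\<^sup>2 * nsq y" for a y :: 'a and c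
   unfolding power2_norm_eq_inner by (simp add: inner_diff_left inner_diff_right inner_commute power2_eq_square algebra_simps)
  have "nsq (g x - (u x / (4 * h)) *\<^sub>R (x - x0)) = nsq (g x) - 2 * (u x / (4 * h)) * ((x - x0) \<bullet> g x) + (u x / (4 * h))\<^sup>2 * nsq (x - x0)"
   by (rule exp)
  also have "... = nsq (g x) - (1 / (2 * h)) * (u x * ((x - x0) \<bullet> g x)) + (1 / (16 * h\<^sup>2)) * ((u x)\<^sup>2 * nsq (x - x0))"
   by (simp add: power_divide power_mult_distrib)
  finally show "nsq (g x - (u x / (4 * h)) *\<^sub>R (x - x0)) * gauss h x = nsq (g x) * gauss h x - (1 / (2 * h)) * (u x * ((x - x0) \<bullet> g x) * gauss h x)
   + (1 / (16 * h\<^sup>2)) * ((u x)\<^sup>2 * nsq (x - x0) * gauss h x)" by (simp only: distrib_right left_diff_distrib mult.assoc)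
 qed
 also have "... = (LINT x|M. nsq (g x) * gauss h x) - (1 / (2 * h)) * (LINT x|M. u x * ((x - x0) \<bullet> g x) * gauss h x)
   + (1 / (16 * h\<^sup>2)) * (LINT x|M. (u x)\<^sup>2 * nsq (x - x0) * gauss h x)"
  using iq ix by simp
 finally have *: "0 <= (LINT x|M. nsq (g x) * gauss h x) - (1 / (2 * h)) * (LINT x|M. u x * ((x - x0) \<bullet> g x) * gauss h x)
   + (1 / (16 * h\<^sup>2)) * (LINT x|M. (u x)\<^sup>2 * nsq (x - x0) * gauss h x)" .
 define D H X Y where "D = (LINT x|M. nsq (g x) * gauss h x)" and "H = (LINT x|M. (u x)\<^sup>2 * gauss h x)"
  and "X = (LINT x|M. (u x)\<^sup>2 * nsq (x - x0) * gauss h x)" and "Y = (LINT x|M. u x * ((x - x0) \<bullet> g x) * gauss h x)"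
 have Y: "2 * Y = - (real DIM('a) * H) + (1 / (2 * h)) * X" using radial_ibp[OF u h] by (simp add: Y_def H_def X_def)
 have "0 <= D - (1 / (2 * h)) * Y + (1 / (16 * h\<^sup>2)) * X" using * by (simp add: D_def X_def Y_def)
 then have "0 <= 2 * h * (D - (1 / (2 * h)) * Y + (1 / (16 * h\<^sup>2)) * X)" using h by (intro mult_nonneg_nonneg) auto
 also have "... = 2 * h * D - Y + X / (8 * h)" using h by (simp add: field_simps power2_eq_square)
 also have "... = 2 * h * D + real DIM('a) / 2 * H - X / (8 * h)"
 proof -
  have "(1 / (2 * h)) * X = 4 * (X / (8 * h))" using h by simp
  then show ?thesis using Y by simp
 qed
 finally show ?thesis by (simp add: D_def H_def X_def)
qed

section \<open>Dilations about the centre and the Pohozaev inequality\<close>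

lemma dilation_test:
 assumes \<phi>: "\<phi> \<in> test_functions \<Omega>" and s: "1 <= s"
 shows "(%x. \<phi> (x0 + s *\<^sub>R (x - x0))) \<in> test_functions \<Omega>"
  "grad (%x. \<phi> (x0 + s *\<^sub>R (x - x0))) x = s *\<^sub>R grad \<phi> (x0 + s *\<^sub>R (x - x0))"
proof -
 obtain K where K: "compact K" "K \<subseteq> \<Omega>" "!!x. x \<notin> K ==> \<phi> x = 0" using test_obtain[OF \<phi>] by metis
 have eq: "x0 + s *\<^sub>R (x - x0) = s *\<^sub>R x + (x0 - s *\<^sub>R x0)" for x by (simp add: algebra_simps)
 have sm: "smooth_fun (%x. \<phi> (x0 + s *\<^sub>R (x - x0)))"
  unfolding eq by (rule smooth_fun_affine[OF _ test_smooth[OF \<phi>]]) (rule bounded_linear_scaleR_right)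
 \<comment> \<open>The support of the dilated function is the image of \<open>K\<close> under the
   inverse dilation. Its factor 1/s is at most 1, so star-shapedness keeps the image inside the
   domain.\<close>
 let ?f = "%y. x0 + (1/s) *\<^sub>R (y - x0)"
 have "compact (?f ` K)" by (intro compact_continuous_image K continuous_intros)
 moreover have "?f ` K \<subseteq> \<Omega>" using K(2) star[of _ "1/s"] s by auto
 moreover have "\<phi> (x0 + s *\<^sub>R (x - x0)) = 0" if "x \<notin> ?f ` K" for x
 proof (rule K(3), rule notI)
  assume "x0 + s *\<^sub>R (x - x0) \<in> K"
  moreover have "?f (x0 + s *\<^sub>R (x - x0)) = x" using s by simp
  ultimately have "x \<in> ?f ` K" by (metis image_eqI)
  with that show False by simp
 qed
 ultimately show "(%x. \<phi> (x0 + s *\<^sub>R (x - x0))) \<in> test_functions \<Omega>"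
  unfolding test_functions_iff using sm by blast
 have "((%x. x0 + s *\<^sub>R (x - x0)) has_derivative (%h. s *\<^sub>R h)) (at x)"
  by (auto intro!: derivative_eq_intros)
 from has_derivative_compose[OF this smooth_fun_has_derivative_grad[OF test_smooth[OF \<phi>]]]
 show "grad (%x. \<phi> (x0 + s *\<^sub>R (x - x0))) x = s *\<^sub>R grad \<phi> (x0 + s *\<^sub>R (x - x0))"
  by (intro grad_eqI) simp
qed

text \<open>The bound is of first order in s - 1 and sees the test function only through its
  gradient norm, so it survives the approximation of an arbitrary member of \<open>H10\<close>.
  Dilating the gradient does not increase its norm, by the change of variables.\<close>

lemma dilation_estimate:
 assumes \<phi>: "\<phi> \<in> test_functions \<Omega>" and W: "sqint M W" and s: "1 <= s"
 shows "\<bar>(LINT x|M. W x * \<phi> (x0 + s *\<^sub>R (x - x0))) - (LINT x|M. W x * \<phi> x)\<bar> <= (s - 1) * (nrm2 M W * (R * nrm2 M (grad \<phi>)))"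
proof -
 let ?F = "%r. LINT x|M. W x * \<phi> (x + r *\<^sub>R (x - x0))"
 have [measurable]: "\<phi> \<in> borel_measurable borel" "grad \<phi> \<in> borel_measurable borel" using test_measurable[OF \<phi>] by auto
 have D: "(?F has_real_derivative (LINT x|M. W x * (grad \<phi> (x + r *\<^sub>R (x - x0)) \<bullet> (x - x0)))) (at r)" for r
  by (rule DERIV_integral_path[OF test_UNIV[OF \<phi>] sqint_L1[OF W] id_measurable, where R=R]) (use R_bound in auto)
 have bd: "\<bar>LINT x|M. W x * (grad \<phi> (x + r *\<^sub>R (x - x0)) \<bullet> (x - x0))\<bar> <= nrm2 M W * (R * nrm2 M (grad \<phi>))" if r: "0 <= r" for r
 proof -
  define G where "G x = grad \<phi> (x0 + (1 + r) *\<^sub>R (x - x0))" for x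
  have Gx: "grad \<phi> (x + r *\<^sub>R (x - x0)) = G x" for x by (simp add: G_def algebra_simps)
  have Gt: "G x = (1 / (1 + r)) *\<^sub>R grad (%x. \<phi> (x0 + (1 + r) *\<^sub>R (x - x0))) x" for x
   using dilation_test(2)[OF \<phi>, of "1 + r"] r by (simp add: G_def)
  note t = dilation_test(1)[OF \<phi>, of "1 + r"]
  have sG: "sqint M G" unfolding Gt[abs_def] by (intro sqint_scaleR test_sqint(2) t) (use r in simp)
  have "(nrm2 M G)\<^sup>2 = (nrm2 lborel G)\<^sup>2"
   unfolding Gt[abs_def] nrm2_scaleR using nrm2_test_lborel(2)[OF t] r by simp
  also have "... = (LINT x|lborel. nsq (grad \<phi> x)) / (1 + r) ^ DIM('a)"
   unfolding nrm2_sq G_def by (rule lborel_dilation) (use r in auto)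
  also have "... <= (LINT x|lborel. nsq (grad \<phi> x)) / 1"
   using r by (intro divide_left_mono) (auto intro!: one_le_power)
  also have "... = (nrm2 M (grad \<phi>))\<^sup>2" using nrm2_test_lborel(2)[OF \<phi>] by (simp add: nrm2_sq[symmetric])
  finally have nG: "nrm2 M G <= nrm2 M (grad \<phi>)" by (rule power2_le_imp_le) simp
  have sr: "sqint M (%x. (x - x0) \<bullet> G x)" by (rule sqint_radial[OF sG])
  have "nrm2 M (%x. (x - x0) \<bullet> G x) <= R * nrm2 M G"
  proof (rule nrm2_dominated[OF sG sqint_measurable[OF sr]])
   show "AE x in M. norm ((x - x0) \<bullet> G x) <= R * norm (G x)"
    using R_bound by (intro AE_I2) (auto intro: order_trans[OF Cauchy_Schwarz_ineq2 mult_right_mono])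
  qed (use R_pos in simp)
  also have "... <= R * nrm2 M (grad \<phi>)" using nG R_pos by (intro mult_left_mono) auto
  finally have "nrm2 M W * nrm2 M (%x. (x - x0) \<bullet> G x) <= nrm2 M W * (R * nrm2 M (grad \<phi>))" by (intro mult_left_mono) auto
  then show ?thesis using CS_ineq[OF W sr] by (simp add: Gx inner_commute)
 qed
 have "norm (?F (s - 1) - ?F 0) <= nrm2 M W * (R * nrm2 M (grad \<phi>)) * norm (s - 1 - 0)"
  by (rule field_differentiable_bound[where S="{0..s-1}", OF _ has_field_derivative_at_within[OF D]]) (use bd s in auto)
 moreover have "x + (s - 1) *\<^sub>R (x - x0) = x0 + s *\<^sub>R (x - x0)" for x by (simp add: algebra_simps)
 ultimately show ?thesis using s by (simp add: mult_ac)
qed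

end

context star_domain
begin

lemma weighted_normsq_tendsto:
 fixes f :: "nat => 'a => 'b::euclidean_space"
 assumes f: "!!n. sqint M (f n)" "sqint M f'" "(%n. ndist M (f n) f') ----> 0" and w: "smooth_fun w"
 shows "(%n. LINT x|M. nsq (f n x) * w x) ----> (LINT x|M. nsq (f' x) * w x)"
proof -
 obtain B where B: "0 <= B" "!!x. x \<in> \<Omega> ==> \<bar>w x\<bar> <= B" using smooth_bounded_on[OF w] by metis
 have d: "sqint M (%x. f n x - f' x)" for n by (intro sqint_diff f)
 have "(%n. nrm2 M (%x. w x *\<^sub>R f n x - w x *\<^sub>R f' x)) ----> 0"
 proof (rule Lim_null_comparison)
  show "eventually (%n. norm (nrm2 M (%x. w x *\<^sub>R f n x - w x *\<^sub>R f' x)) <= B * ndist M (f n) f') sequentially"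
  proof (intro always_eventually allI)
   fix n
   have "nrm2 M (%x. w x *\<^sub>R (f n x - f' x)) <= B * ndist M (f n) f'"
    by (rule nrm2_dominated[OF d sqint_measurable[OF sqint_smooth[OF d w]]])
      (use B in \<open>auto intro!: AE_I2 mult_right_mono\<close>)
   then show "norm (nrm2 M (%x. w x *\<^sub>R f n x - w x *\<^sub>R f' x)) <= B * ndist M (f n) f'"
    by (simp add: scaleR_diff_right)
  qed
  show "(%n. B * ndist M (f n) f') ----> 0" using tendsto_mult_left[OF f(3), of B] by simp
 qed
 then have "(%n. LINT x|M. (w x *\<^sub>R f n x) \<bullet> f n x) ----> (LINT x|M. (w x *\<^sub>R f' x) \<bullet> f' x)"
  by (intro inner_tendsto sqint_smooth f w)
 then show ?thesis by (simp add: power2_norm_eq_inner mult.commute)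
qed

text \<open>The weighted Dirichlet energy is convex and lies above its tangent at u;
  \<open>drift_symmetric\<close> evaluates the tangent. Every admissible competitor v therefore
  gives an inequality without boundary terms.\<close>

lemma dirichlet_convexity:
 assumes W: "weak_laplacian u g l" and v: "H10g v h" and \<Gamma>: "0 < \<Gamma>"
 shows "(LINT x|M. nsq (h x) * gauss \<Gamma> x) - (LINT x|M. nsq (g x) * gauss \<Gamma> x)
  \<ge> - 2 * (LINT x|M. drift \<Gamma> g l x * (v x - u x) * gauss \<Gamma> x)"
proof -
 have u: "H10g u g" using W by (simp add: weak_laplacian_def)
 note su = H10g_sqint[OF u] and sv = H10g_sqint[OF v]
 have d: "H10g (%x. v x - u x) (%x. h x - g x)" using H10g_lincomb[OF v u, of 1 "-1"] by simp
 have i: "integrable M (%x. nsq (h x) * gauss \<Gamma> x)" "integrable M (%x. nsq (g x) * gauss \<Gamma> x)"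
  "integrable M (%x. nsq (h x - g x) * gauss \<Gamma> x)" "integrable M (%x. (g x \<bullet> (h x - g x)) * gauss \<Gamma> x)"
  by (intro integrable_normsq_radial(2) integrable_gauss sqint_inner sqint_diff su sv \<Gamma>)+
 have "0 <= (LINT x|M. nsq (h x - g x) * gauss \<Gamma> x)"
  by (intro integral_nonneg_AE AE_I2 mult_nonneg_nonneg) (auto intro: less_imp_le gauss_pos)
 also have "... = (LINT x|M. nsq (h x) * gauss \<Gamma> x - nsq (g x) * gauss \<Gamma> x - 2 * ((g x \<bullet> (h x - g x)) * gauss \<Gamma> x))"
  unfolding power2_norm_eq_inner
  by (intro LINT_cong refl) (simp add: inner_diff_left inner_diff_right inner_commute algebra_simps)
 also have "... = (LINT x|M. nsq (h x) * gauss \<Gamma> x) - (LINT x|M. nsq (g x) * gauss \<Gamma> x) - 2 * (LINT x|M. (g x \<bullet> (h x - g x)) * gauss \<Gamma> x)"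
  using i by simp
 finally show ?thesis using drift_symmetric[OF W d \<Gamma>] by simp
qed

text \<open>Comparing \<open>u\<close> with its dilations \<open>u (x0 + s (x - x0))\<close> for \<open>s > 1\<close>,
 which star-shapedness keeps in \<open>H\<^sup>1\<^sub>0\<close>, replaces the sign of the boundary integral, so no regularity up to the
 boundary is needed.\<close>

lemma pohozaev:
 assumes WL: "weak_laplacian u g l" and \<Gamma>: "0 < \<Gamma>"
 shows "- ((1 - real DIM('a) / 2) * (LINT x|M. nsq (g x) * gauss \<Gamma> x)
   + (LINT x|M. nsq (g x) * nsq (x - x0) * gauss \<Gamma> x) / (4 * \<Gamma>))
  <= (LINT x|M. drift \<Gamma> g l x * ((x - x0) \<bullet> g x) * gauss \<Gamma> x)"
proof -
 have u: "H10g u g" and l: "sqint M l" using WL by (auto simp: weak_laplacian_def)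
 note su = H10g_sqint[OF u]
 define W where "W x = drift \<Gamma> g l x * gauss \<Gamma> x" for x
 have sW: "sqint M W"
  using sqint_smooth_real[OF sqint_drift[OF su(2) l] smooth_gauss, of \<Gamma> \<Gamma>] by (simp add: W_def[abs_def] mult.commute)
 \<comment> \<open>Powers of the weight: undoing a dilation by s in the variables turns the Gaussian
   into its power 1/s^2.\<close>
 define E where "E \<rho> x = exp (- \<rho> * (nsq (x - x0) / (4 * \<Gamma>)))" for \<rho> x
 have E1: "E 1 = gauss \<Gamma>" by (simp add: E_def gauss_def fun_eq_iff)
 have sE: "smooth_fun (E \<rho>)" for \<rho>
 proof -
  have "smooth_fun (%x. exp (- \<rho> / (4 * \<Gamma>) * nsq (x - x0)))"
   by (intro smooth_fun_exp smooth_fun_mult smooth_fun_const smooth_fun_norm_sq)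
  then show ?thesis by (simp add: E_def[abs_def])
 qed
 have Em[measurable]: "E \<rho> \<in> borel_measurable borel" for \<rho>
  by (intro borel_measurable_continuous_onI smooth_fun_continuous sE)
 have EmM: "E \<rho> \<in> borel_measurable M" for \<rho> by (rule smooth_measurable(1)[OF sE])
 have El: "0 <= E \<rho> x" "E \<rho> x <= 1" if "0 <= \<rho>" for \<rho> x using that \<Gamma> by (auto simp: E_def)
 define F where "F \<rho> = (LINT x|M. nsq (g x) * E \<rho> x)" for \<rho>
 define Xg where "Xg = (LINT x|M. nsq (g x) * nsq (x - x0) * gauss \<Gamma> x)"
 define n where "n = DIM('a)"
 define C where "C = nrm2 M W * R"
 define T where "T s \<phi> = (LINT x|M. W x * \<phi> (x0 + s *\<^sub>R (x - x0))) - (LINT x|M. W x * \<phi> x)" for s and \<phi> :: "'a => real"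
 obtain \<phi> where \<phi>: "!!k::nat. \<phi> k \<in> test_functions \<Omega>" "(%k. ndist M (\<phi> k) u) ----> 0"
  "(%k. ndist M (grad (\<phi> k)) g) ----> 0" using H10g_obtain[OF u] by blast
 have Fd: "(F has_real_derivative - (Xg / (4 * \<Gamma>))) (at 1)"
 proof -
  have "((%\<rho>. LINT x|M. nsq (g x) * E \<rho> x) has_real_derivative
    (LINT x|M. nsq (g x) * (E 1 x * (- (nsq (x - x0) / (4 * \<Gamma>)))))) (at 1)"
  proof (rule DERIV_integral[where a=0 and b=2 and w="%x. nsq (g x) * (R\<^sup>2 / (4 * \<Gamma>))" and f'="%\<rho> x. nsq (g x) * (E \<rho> x * (- (nsq (x - x0) / (4 * \<Gamma>))))"])
   show "integrable M (%x. nsq (g x) * E \<rho> x)" if "0 < \<rho>" for \<rho>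
    by (rule integrable_normsq_bounded[OF su(2) EmM, where c=1]) (use El that in \<open>auto simp: abs_of_nonneg\<close>)
   show "((%\<rho>. nsq (g x) * E \<rho> x) has_real_derivative nsq (g x) * (E \<rho> x * (- (nsq (x - x0) / (4 * \<Gamma>))))) (at \<rho>)" for \<rho> x
   proof -
    have "((%\<rho>. k * exp (- \<rho> * y)) has_real_derivative k * (exp (- \<rho> * y) * (- y))) (at \<rho>)" for k y :: real
     by (auto intro!: derivative_eq_intros)
    then show ?thesis unfolding E_def .
   qed
   show "\<bar>nsq (g x) * (E \<rho> x * (- (nsq (x - x0) / (4 * \<Gamma>))))\<bar> <= nsq (g x) * (R\<^sup>2 / (4 * \<Gamma>))"
    if "0 < \<rho>" "x \<in> space M" for \<rho> x
   proof -
    have "nsq (x - x0) / (4 * \<Gamma>) <= R\<^sup>2 / (4 * \<Gamma>)"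
     using R_bound[of x] that \<Gamma> by (intro divide_right_mono power_mono) auto
    then have "E \<rho> x * (nsq (x - x0) / (4 * \<Gamma>)) <= 1 * (R\<^sup>2 / (4 * \<Gamma>))"
     using El[of \<rho> x] that \<Gamma> by (intro mult_mono) auto
    from mult_left_mono[OF this zero_le_power2[of "norm (g x)"]]
    show ?thesis using El(1)[of \<rho> x] that \<Gamma> by (simp add: abs_mult)
   qed
   show "integrable M (%x. nsq (g x) * (R\<^sup>2 / (4 * \<Gamma>)))" using sqint_integrable[OF su(2)] by simp
   show "(%x. nsq (g x) * (E 1 x * (- (nsq (x - x0) / (4 * \<Gamma>))))) \<in> borel_measurable M"
    using EmM sqint_measurable[OF su(2)] by measurable
  qed auto
  moreover have "(LINT x|M. nsq (g x) * (E 1 x * (- (nsq (x - x0) / (4 * \<Gamma>)))))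
    = (LINT x|M. (- (1 / (4 * \<Gamma>))) * (nsq (g x) * nsq (x - x0) * gauss \<Gamma> x))"
   by (intro LINT_cong refl) (simp add: E1)
  ultimately show ?thesis using \<Gamma> by (simp add: F_def[abs_def] Xg_def)
 qed
 have F1: "F 1 = (LINT x|M. nsq (g x) * gauss \<Gamma> x)" by (simp add: F_def E1)
 \<comment> \<open>This is the weighted Dirichlet energy of the dilated u, written after the change
   of variables. The factor s^2 comes from the gradient, the power s^n from the volume
   element.\<close>
 define Q where "Q s = s\<^sup>2 / s ^ n * F (1 / s\<^sup>2)" for s
 have Q1: "Q 1 = F 1" by (simp add: Q_def)
 have Qd: "(Q has_real_derivative ((2 - real n) * F 1 + Xg / (2 * \<Gamma>))) (at 1)"
 proof -
  have "((%s::real. 1 / s\<^sup>2) has_real_derivative - 2) (at 1)"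
   by (auto intro!: derivative_eq_intros)
  then have d1: "((%s. F (1 / s\<^sup>2)) has_real_derivative (- (Xg / (4 * \<Gamma>))) * (- 2)) (at 1)"
   using Fd by (intro DERIV_chain2[of F]) simp_all
  have d2: "((%s::real. s\<^sup>2 / s ^ n) has_real_derivative (2 - real n)) (at 1)"
   by (auto intro!: derivative_eq_intros)
  from DERIV_mult[OF d2 d1] show ?thesis
   unfolding Q_def[abs_def] by (rule DERIV_cong) (simp add: field_simps)
 qed
 have Qtest: "(LINT x|M. nsq (grad (%x. \<psi> (x0 + s *\<^sub>R (x - x0))) x) * gauss \<Gamma> x)
   = s\<^sup>2 / s ^ n * (LINT x|M. nsq (grad \<psi> x) * E (1 / s\<^sup>2) x)"
  if \<psi>: "\<psi> \<in> test_functions \<Omega>" and s: "1 < s" for \<psi> s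
 proof -
  have [measurable]: "grad \<psi> \<in> borel_measurable borel" using test_measurable[OF \<psi>] by auto
  let ?\<psi> = "%x. \<psi> (x0 + s *\<^sub>R (x - x0))"
  have t: "?\<psi> \<in> test_functions \<Omega>" by (rule dilation_test(1)[OF \<psi>]) (use s in simp)
  have gt: "grad ?\<psi> x = s *\<^sub>R grad \<psi> (x0 + s *\<^sub>R (x - x0))" for x by (rule dilation_test(2)[OF \<psi>]) (use s in simp)
  have [measurable]: "grad ?\<psi> \<in> borel_measurable borel" using test_measurable[OF t] by auto
  have z: "grad f x = 0" if "x \<notin> \<Omega>" "f \<in> test_functions \<Omega>" for x f using test_obtain[OF that(2)] that(1) by (metis subsetD)
  have "(LINT x|M. nsq (grad ?\<psi> x) * gauss \<Gamma> x) = (LINT x|lborel. nsq (grad ?\<psi> x) * gauss \<Gamma> x)"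
   by (rule lebesgue_on_eq_lborel) (auto simp: z[OF _ t])
  also have "... = (LINT x|lborel. s\<^sup>2 * (nsq (grad \<psi> (x0 + s *\<^sub>R (x - x0))) * E (1 / s\<^sup>2) (x0 + s *\<^sub>R (x - x0))))"
   using s by (intro LINT_cong refl) (simp add: gt E_def gauss_def power_mult_distrib)
  also have "... = s\<^sup>2 * ((LINT x|lborel. nsq (grad \<psi> x) * E (1 / s\<^sup>2) x) / s ^ DIM('a))"
   using s by (subst integral_mult_right_zero, subst lborel_dilation[of "%x. nsq (grad \<psi> x) * E (1 / s\<^sup>2) x"]) auto
  also have "(LINT x|lborel. nsq (grad \<psi> x) * E (1 / s\<^sup>2) x) = (LINT x|M. nsq (grad \<psi> x) * E (1 / s\<^sup>2) x)"
   by (rule lebesgue_on_eq_lborel(1)[symmetric]) (auto simp: z[OF _ \<psi>])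
  finally show ?thesis by (simp add: n_def)
 qed
 have dil: "sqint M (%x. \<psi> (x0 + s *\<^sub>R (x - x0)))" if "\<psi> \<in> test_functions \<Omega>" "1 <= s" for \<psi> s
  by (rule test_sqint(1)[OF dilation_test(1)[OF that]])
 \<comment> \<open>The dilation increment of u itself is not known to be differentiable in s. It is
   replaced by that of a fixed test function \<open>\<phi> J\<close>, with an error of order s - 1
   times the gradient distance, uniformly along the approximation j.\<close>
 have key: "Q s - Q 1 \<ge> - 2 * T s (\<phi> J) - 2 * ((s - 1) * (C * ndist M (grad (\<phi> J)) g))" if s: "1 < s" for s J
 proof (rule LIMSEQ_le)
  have "(%j. LINT x|M. nsq (grad (\<phi> j) x) * E (1 / s\<^sup>2) x) ----> F (1 / s\<^sup>2)"
   unfolding F_def by (rule weighted_normsq_tendsto) (use su \<phi> sE in \<open>auto simp: test_sqint\<close>)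
  then show "(%j. s\<^sup>2 / s ^ n * (LINT x|M. nsq (grad (\<phi> j) x) * E (1 / s\<^sup>2) x) - Q 1) ----> Q s - Q 1"
   unfolding Q_def[of s] by (intro tendsto_intros)
  have c1: "(%j. ndist M (grad (\<phi> j)) (grad (\<phi> J))) ----> ndist M g (grad (\<phi> J))"
  proof (rule nrm2_tendsto_norm)
   show "(%j. nrm2 M (%x. grad (\<phi> j) x - grad (\<phi> J) x - (g x - grad (\<phi> J) x))) ----> 0" using \<phi>(3) by simp
  qed (intro sqint_diff test_sqint \<phi> su)+
  have c2: "(%j. LINT x|M. W x * \<phi> j x) ----> (LINT x|M. W x * u x)"
   using inner_tendsto[OF _ sW _ test_sqint(1)[OF \<phi>(1)] su(1) \<phi>(2), of "%_. W"] sW by (simp add: nrm2_def)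
  have "(%j. - 2 * (T s (\<phi> J) + (s - 1) * (C * ndist M (grad (\<phi> j)) (grad (\<phi> J))) + ((LINT x|M. W x * \<phi> j x) - (LINT x|M. W x * u x))))
    ----> - 2 * (T s (\<phi> J) + (s - 1) * (C * ndist M g (grad (\<phi> J))) + ((LINT x|M. W x * u x) - (LINT x|M. W x * u x)))"
   by (intro tendsto_intros c1 c2)
  then show "(%j. - 2 * (T s (\<phi> J) + (s - 1) * (C * ndist M (grad (\<phi> j)) (grad (\<phi> J))) + ((LINT x|M. W x * \<phi> j x) - (LINT x|M. W x * u x))))
    ----> - 2 * T s (\<phi> J) - 2 * ((s - 1) * (C * ndist M (grad (\<phi> J)) g))"
   by (simp add: nrm2_minus_commute[of M g])
  show "\<exists>N. \<forall>j\<ge>N. - 2 * (T s (\<phi> J) + (s - 1) * (C * ndist M (grad (\<phi> j)) (grad (\<phi> J))) + ((LINT x|M. W x * \<phi> j x) - (LINT x|M. W x * u x)))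
   <= s\<^sup>2 / s ^ n * (LINT x|M. nsq (grad (\<phi> j) x) * E (1 / s\<^sup>2) x) - Q 1"
  proof (intro exI[of _ 0] allI impI)
   fix j
   let ?d = "%x. \<phi> j (x0 + s *\<^sub>R (x - x0))"
   have td: "?d \<in> test_functions \<Omega>" by (rule dilation_test(1)[OF \<phi>(1)]) (use s in simp)
   note i = sqint_mult[OF sW test_sqint(1)[OF \<phi>(1)]] sqint_mult[OF sW dil[OF \<phi>(1)]] sqint_mult[OF sW su(1)]
   have tdiff: "(%x. \<phi> j x - \<phi> J x) \<in> test_functions \<Omega>" using test_lincomb[OF \<phi>(1)[of j] \<phi>(1)[of J], of 1 "-1"] by simp
   have gdiff: "grad (%x. \<phi> j x - \<phi> J x) = (%x. grad (\<phi> j) x - grad (\<phi> J) x)"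
    using grad_lincomb[OF test_smooth[OF \<phi>(1)[of j]] test_smooth[OF \<phi>(1)[of J]], of 1 "-1"] by (simp add: fun_eq_iff)
   have "T s (\<phi> j) - T s (\<phi> J) = T s (%x. \<phi> j x - \<phi> J x)"
    using i s by (simp add: T_def right_diff_distrib)
   also have "\<bar>...\<bar> <= (s - 1) * (nrm2 M W * (R * nrm2 M (grad (%x. \<phi> j x - \<phi> J x))))"
    unfolding T_def by (rule dilation_estimate[OF tdiff sW]) (use s in simp)
   also have "... = (s - 1) * (C * ndist M (grad (\<phi> j)) (grad (\<phi> J)))" by (simp add: gdiff C_def)
   finally have tb: "T s (\<phi> j) <= T s (\<phi> J) + (s - 1) * (C * ndist M (grad (\<phi> j)) (grad (\<phi> J)))" by linarith
   have "(LINT x|M. drift \<Gamma> g l x * (?d x - u x) * gauss \<Gamma> x) = (LINT x|M. W x * ?d x - W x * u x)"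
    by (intro LINT_cong refl) (simp add: W_def algebra_simps)
   also have "... = T s (\<phi> j) + ((LINT x|M. W x * \<phi> j x) - (LINT x|M. W x * u x))"
    using i s by (simp add: T_def)
   finally have e: "(LINT x|M. drift \<Gamma> g l x * (?d x - u x) * gauss \<Gamma> x) = T s (\<phi> j) + ((LINT x|M. W x * \<phi> j x) - (LINT x|M. W x * u x))" .
   have lin: "- 2 * (a + z + c) <= q" if "b <= a + z" "- 2 * (b + c) <= q" for a b c z q :: real
    using that by (simp add: algebra_simps)
   from lin[OF tb dirichlet_convexity[OF WL H10g_test[OF td] \<Gamma>, unfolded Qtest[OF \<phi>(1) s] e]]
   show "- 2 * (T s (\<phi> J) + (s - 1) * (C * ndist M (grad (\<phi> j)) (grad (\<phi> J))) + ((LINT x|M. W x * \<phi> j x) - (LINT x|M. W x * u x)))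
   <= s\<^sup>2 / s ^ n * (LINT x|M. nsq (grad (\<phi> j) x) * E (1 / s\<^sup>2) x) - Q 1"
    unfolding Q1 F1 .
  qed
 qed
 \<comment> \<open>Only s > 1 is admissible, so the quotient inequality passes to a one-sided limit
   at 1; the two-sided derivatives of \<open>Q\<close> and of the increment of
   \<open>\<phi> J\<close> provide its values.\<close>
 have lim1: "(2 - real n) * F 1 + Xg / (2 * \<Gamma>) \<ge> - 2 * (LINT x|M. W x * (grad (\<phi> J) x \<bullet> (x - x0))) - 2 * (C * ndist M (grad (\<phi> J)) g)" for J
 proof (rule tendsto_le)
  show "at_right (1::real) \<noteq> bot" by simp
  have "((%s. (Q s - Q 1) / (s - 1)) \<longlongrightarrow> (2 - real n) * F 1 + Xg / (2 * \<Gamma>)) (at 1)"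
   using Qd by (simp add: has_field_derivative_iff)
  then show "((%s. (Q s - Q 1) / (s - 1)) \<longlongrightarrow> (2 - real n) * F 1 + Xg / (2 * \<Gamma>)) (at_right 1)"
   by (rule filterlim_mono) (auto intro: at_le)
  let ?f = "%r. LINT x|M. W x * \<phi> J (x + r *\<^sub>R (x - x0))"
  have D: "(?f has_real_derivative (LINT x|M. W x * (grad (\<phi> J) (x + r *\<^sub>R (x - x0)) \<bullet> (x - x0)))) (at r)" for r
   by (rule DERIV_integral_path[OF test_UNIV[OF \<phi>(1)] sqint_L1[OF sW] id_measurable, where R=R]) (use R_bound in auto)
  have "((%s. ?f (s - 1)) has_real_derivative (LINT x|M. W x * (grad (\<phi> J) (x + 0 *\<^sub>R (x - x0)) \<bullet> (x - x0))) * 1) (at 1)"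
   by (rule DERIV_chain2[of ?f]) (use D[of 0] in \<open>auto intro!: derivative_eq_intros\<close>)
  moreover have "x + (s - 1) *\<^sub>R (x - x0) = x0 + s *\<^sub>R (x - x0)" for x s by (simp add: algebra_simps)
  ultimately have "((%s. T s (\<phi> J) / (s - 1)) \<longlongrightarrow> (LINT x|M. W x * (grad (\<phi> J) x \<bullet> (x - x0)))) (at 1)"
   by (simp add: has_field_derivative_iff T_def)
  then have "((%s. T s (\<phi> J) / (s - 1)) \<longlongrightarrow> (LINT x|M. W x * (grad (\<phi> J) x \<bullet> (x - x0)))) (at_right 1)"
   by (rule filterlim_mono) (auto intro: at_le)
  then show "((%s. - 2 * (T s (\<phi> J) / (s - 1)) - 2 * (C * ndist M (grad (\<phi> J)) g)) \<longlongrightarrow>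
    - 2 * (LINT x|M. W x * (grad (\<phi> J) x \<bullet> (x - x0))) - 2 * (C * ndist M (grad (\<phi> J)) g)) (at_right 1)"
   by (intro tendsto_intros)
  show "eventually (%s. - 2 * (T s (\<phi> J) / (s - 1)) - 2 * (C * ndist M (grad (\<phi> J)) g) <= (Q s - Q 1) / (s - 1)) (at_right 1)"
   unfolding eventually_at_filter
  proof (intro always_eventually allI impI)
   fix s :: real assume "s \<noteq> 1" and s: "s \<in> {1<..}"
   have "(- 2 * T s (\<phi> J) - 2 * ((s - 1) * (C * ndist M (grad (\<phi> J)) g))) / (s - 1) <= (Q s - Q 1) / (s - 1)"
    using s by (intro divide_right_mono key) auto
   moreover have "(- 2 * T s (\<phi> J) - 2 * ((s - 1) * (C * ndist M (grad (\<phi> J)) g))) / (s - 1)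
     = - 2 * (T s (\<phi> J) / (s - 1)) - 2 * (C * ndist M (grad (\<phi> J)) g)"
    using \<open>s \<noteq> 1\<close> by (simp add: diff_divide_distrib)
   ultimately show "- 2 * (T s (\<phi> J) / (s - 1)) - 2 * (C * ndist M (grad (\<phi> J)) g) <= (Q s - Q 1) / (s - 1)" by simp
  qed
 qed
 \<comment> \<open>Letting J tend to infinity after s removes the approximation error.\<close>
 have "(2 - real n) * F 1 + Xg / (2 * \<Gamma>) \<ge> - 2 * (LINT x|M. W x * ((x - x0) \<bullet> g x)) - 2 * (C * 0)"
 proof (rule LIMSEQ_le_const2)
  have "(%J. LINT x|M. W x \<bullet> ((x - x0) \<bullet> grad (\<phi> J) x)) ----> (LINT x|M. W x \<bullet> ((x - x0) \<bullet> g x))"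
  proof (rule inner_tendsto[OF sW sW _ sqint_radial[OF test_sqint(2)[OF \<phi>(1)]] sqint_radial[OF su(2)]])
   show "(%J. nrm2 M (%x. (x - x0) \<bullet> grad (\<phi> J) x - (x - x0) \<bullet> g x)) ----> 0"
   proof (rule Lim_null_comparison)
    show "(%J. R * ndist M (grad (\<phi> J)) g) ----> 0" using tendsto_mult_left[OF \<phi>(3), of R] by simp
    show "eventually (%J. norm (nrm2 M (%x. (x - x0) \<bullet> grad (\<phi> J) x - (x - x0) \<bullet> g x)) <= R * ndist M (grad (\<phi> J)) g) sequentially"
    proof (intro always_eventually allI)
     fix J
     have d: "sqint M (%x. grad (\<phi> J) x - g x)" by (intro sqint_diff test_sqint \<phi> su)
     have "nrm2 M (%x. (x - x0) \<bullet> (grad (\<phi> J) x - g x)) <= R * ndist M (grad (\<phi> J)) g"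
      by (rule nrm2_dominated[OF d sqint_measurable[OF sqint_radial[OF d]]])
        (use R_bound R_pos in \<open>auto intro!: AE_I2 intro: order_trans[OF Cauchy_Schwarz_ineq2 mult_right_mono]\<close>)
     then show "norm (nrm2 M (%x. (x - x0) \<bullet> grad (\<phi> J) x - (x - x0) \<bullet> g x)) <= R * ndist M (grad (\<phi> J)) g"
      by (simp add: inner_diff_right)
    qed
   qed
  qed (simp add: nrm2_def)
  then have "(%J. LINT x|M. W x * (grad (\<phi> J) x \<bullet> (x - x0))) ----> (LINT x|M. W x * ((x - x0) \<bullet> g x))"
   by (simp only: inner_real_def inner_commute[of "grad _ _"])
  then show "(%J. - 2 * (LINT x|M. W x * (grad (\<phi> J) x \<bullet> (x - x0))) - 2 * (C * ndist M (grad (\<phi> J)) g))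
    ----> - 2 * (LINT x|M. W x * ((x - x0) \<bullet> g x)) - 2 * (C * 0)"
   by (intro tendsto_intros \<phi>)
  show "\<exists>N. \<forall>J\<ge>N. - 2 * (LINT x|M. W x * (grad (\<phi> J) x \<bullet> (x - x0))) - 2 * (C * ndist M (grad (\<phi> J)) g) <= (2 - real n) * F 1 + Xg / (2 * \<Gamma>)"
   using lim1 by blast
 qed
 moreover have "(LINT x|M. W x * ((x - x0) \<bullet> g x)) = (LINT x|M. drift \<Gamma> g l x * ((x - x0) \<bullet> g x) * gauss \<Gamma> x)"
  by (intro LINT_cong refl) (simp add: W_def mult_ac)
 moreover have "(2 - real n) * F 1 + Xg / (2 * \<Gamma>) = 2 * ((1 - real n / 2) * F 1 + Xg / (4 * \<Gamma>))"
  by (simp add: field_simps)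
 moreover have "- k <= p" if "- 2 * w - 2 * (c * 0) <= q" "w = p" "q = 2 * k" for c k p q w :: real
  using that by simp
 ultimately show ?thesis unfolding F1[symmetric] Xg_def[symmetric] n_def[symmetric] by blast
qed

text \<open>The functions f k may be real or vector valued, so that one statement differentiates
  both the weighted energy of a finite heat flow and that of its gradient. The second term comes
  from the time dependence of the weight.\<close>

lemma weighted_normsq_deriv:
 fixes f :: "nat => 'a => 'b::euclidean_space" and c lam :: "nat => real" and N :: nat
 assumes f: "!!k. sqint M (f k)" and t0: "t0 < Tb"
 defines "F \<equiv> %t x. \<Sum>k<N. (c k * exp (- lam k * t)) *\<^sub>R f k x"
  and "F' \<equiv> %t x. \<Sum>k<N. (- lam k * (c k * exp (- lam k * t))) *\<^sub>R f k x"
 shows "((%t. LINT x|M. nsq (F t x) * gauss (Tb - t) x) has_real_derivative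
   (2 * (LINT x|M. (F t0 x \<bullet> F' t0 x) * gauss (Tb - t0) x)
    - (LINT x|M. nsq (F t0 x) * nsq (x - x0) * gauss (Tb - t0) x) / (4 * (Tb - t0)\<^sup>2))) (at t0)"
proof -
 define a where "a = t0 - 1"
 \<comment> \<open>Stopping halfway to \<open>Tb\<close> keeps the width of the Gaussian at least
   \<open>\<gamma>\<close>, so that the derivative of the weight is bounded uniformly.\<close>
 define b where "b = min (t0 + 1) ((t0 + Tb) / 2)"
 define \<gamma> where "\<gamma> = (Tb - t0) / 2"
 have ab: "a < t0" "t0 < b" using t0 by (auto simp: a_def b_def)
 have \<gamma>: "0 < \<gamma>" using t0 by (simp add: \<gamma>_def)
 have tb: "\<gamma> <= Tb - t" "\<bar>t\<bar> <= \<bar>t0\<bar> + 1" if "a < t" "t < b" for t using that by (auto simp: a_def b_def \<gamma>_def)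
 define A where "A k = \<bar>c k\<bar> * exp (\<bar>lam k\<bar> * (\<bar>t0\<bar> + 1))" for k
 have A: "\<bar>c k * exp (- lam k * t)\<bar> <= A k" if "\<bar>t\<bar> <= \<bar>t0\<bar> + 1" for k t
 proof -
  have "- lam k * t <= \<bar>lam k\<bar> * \<bar>t\<bar>" by (metis abs_ge_minus_self abs_mult minus_mult_left)
  also have "... <= \<bar>lam k\<bar> * (\<bar>t0\<bar> + 1)" using that by (intro mult_left_mono) auto
  finally show ?thesis by (simp add: A_def abs_mult mult_left_mono)
 qed
 define S where "S x = (\<Sum>k<N. A k * norm (f k x))" for x
 define S' where "S' x = (\<Sum>k<N. \<bar>lam k\<bar> * A k * norm (f k x))" for x
 have fn: "sqint M (%x. norm (f k x))" for k
  by (rule sqint_dominated[OF f, where c=1]) (use sqint_measurable[OF f] in auto)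
 have sS: "sqint M S" "sqint M S'" unfolding S_def S'_def by (intro sqint_sum sqint_cmult fn finite_lessThan)+
 have sF: "sqint M (F t)" "sqint M (F' t)" for t unfolding F_def F'_def by (intro sqint_sum sqint_scaleR f finite_lessThan)+
 have bF: "norm (F t x) <= S x" "norm (F' t x) <= S' x" if t: "\<bar>t\<bar> <= \<bar>t0\<bar> + 1" for t x
 proof -
  show "norm (F t x) <= S x" unfolding F_def S_def
   by (rule order_trans[OF norm_sum sum_mono]) (use A[OF t] in \<open>auto intro!: mult_right_mono\<close>)
  show "norm (F' t x) <= S' x" unfolding F'_def S'_def
  proof (rule order_trans[OF norm_sum sum_mono])
   fix k
   have "\<bar>lam k\<bar> * \<bar>c k * exp (- lam k * t)\<bar> * norm (f k x) <= \<bar>lam k\<bar> * A k * norm (f k x)"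
    using A[OF t, of k] by (intro mult_right_mono mult_left_mono) auto
   then show "norm ((- lam k * (c k * exp (- lam k * t))) *\<^sub>R f k x) <= \<bar>lam k\<bar> * A k * norm (f k x)"
    by (simp add: abs_mult)
  qed
 qed
 let ?f' = "%t x. 2 * ((F t x \<bullet> F' t x) * gauss (Tb - t) x) - (1 / (4 * (Tb - t)\<^sup>2)) * (nsq (F t x) * nsq (x - x0) * gauss (Tb - t) x)"
 have Fd: "((%t. F t x) has_vector_derivative F' t x) (at t)" for t x
  unfolding F_def F'_def by (auto intro!: derivative_eq_intros simp: has_vector_derivative_def scaleR_sum_right fun_eq_iff intro!: sum.cong)
 have "((%t. LINT x|M. nsq (F t x) * gauss (Tb - t) x) has_real_derivative (LINT x|M. ?f' t0 x)) (at t0)"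
 proof (rule DERIV_integral[OF ab, where w="%x. 2 * (S x * S' x) + (1 / (4 * \<gamma>\<^sup>2)) * (nsq (S x) * R\<^sup>2)"])
  show "integrable M (%x. nsq (F t x) * gauss (Tb - t) x)" if "a < t" "t < b" for t
   by (rule integrable_normsq_radial(2)[OF sF(1)]) (use tb[OF that] \<gamma> in simp)
  show "((%t. nsq (F t x) * gauss (Tb - t) x) has_real_derivative ?f' t x) (at t)" if t: "a < t" "t < b" for t x
  proof -
   have pos: "Tb - t > 0" using tb[OF t] \<gamma> by simp
   have "((%t. F t x \<bullet> F t x) has_real_derivative (F t x \<bullet> F' t x + F' t x \<bullet> F t x)) (at t)"
    unfolding has_real_derivative_iff_has_vector_derivative
    by (rule bounded_bilinear.has_vector_derivative[OF bounded_bilinear_inner Fd Fd])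
   then have d1: "((%t. nsq (F t x)) has_real_derivative 2 * (F t x \<bullet> F' t x)) (at t)"
    by (simp add: power2_norm_eq_inner inner_commute)
   have d2: "((%t. gauss (Tb - t) x) has_real_derivative gauss (Tb - t) x * (- (nsq (x - x0) / (4 * (Tb - t)\<^sup>2)))) (at t)"
   proof -
    have "((%t. Tb - t) has_real_derivative - 1) (at t)" by (auto intro!: derivative_eq_intros)
    from DERIV_cmult[OF DERIV_inverse_fun[OF this], of "1/4"] pos
    have "((%t. 1 / (4 * (Tb - t))) has_real_derivative 1 / (4 * (Tb - t)\<^sup>2)) (at t)"
     by (simp add: inverse_eq_divide power2_eq_square)
    from DERIV_chain2[OF DERIV_exp DERIV_cmult_right[OF DERIV_minus[OF this], of "nsq (x - x0)"]]
    show ?thesis unfolding gauss_def by (rule DERIV_cong) simp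
   qed
   from DERIV_mult[OF d1 d2] show ?thesis by (rule DERIV_cong) (simp add: field_simps)
  qed
  show "\<bar>?f' t x\<bar> <= 2 * (S x * S' x) + (1 / (4 * \<gamma>\<^sup>2)) * (nsq (S x) * R\<^sup>2)" if t: "a < t" "t < b" and x: "x \<in> space M" for t x
  proof -
   note bt = bF[OF tb(2)[OF t], of x]
   have pos: "Tb - t > 0" using tb[OF t] \<gamma> by simp
   have gl: "0 <= gauss (Tb - t) x" "gauss (Tb - t) x <= 1" using gauss_pos[of "Tb - t" x] gauss_le_1[OF pos] by (auto intro: less_imp_le)
   have S0: "0 <= S x" "0 <= S' x" using bt norm_ge_zero order_trans by blast+
   have "\<bar>F t x \<bullet> F' t x\<bar> <= S x * S' x"
    by (rule order_trans[OF Cauchy_Schwarz_ineq2 mult_mono]) (use bt S0 in auto)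
   then have 1: "\<bar>(F t x \<bullet> F' t x) * gauss (Tb - t) x\<bar> <= S x * S' x * 1"
    unfolding abs_mult using gl S0 by (intro mult_mono) auto
   have "nsq (F t x) * nsq (x - x0) * gauss (Tb - t) x <= nsq (S x) * R\<^sup>2 * 1"
    using gl bt S0 R_bound[of x] x by (intro mult_mono power_mono) auto
   moreover have "1 / (4 * (Tb - t)\<^sup>2) <= 1 / (4 * \<gamma>\<^sup>2)"
    using tb(1)[OF t] \<gamma> by (intro divide_left_mono mult_left_mono power_mono mult_pos_pos) auto
   ultimately have 2: "(1 / (4 * (Tb - t)\<^sup>2)) * (nsq (F t x) * nsq (x - x0) * gauss (Tb - t) x) <= (1 / (4 * \<gamma>\<^sup>2)) * (nsq (S x) * R\<^sup>2 * 1)"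
    using gl by (intro mult_mono[of _ "1 / (4 * \<gamma>\<^sup>2)" _ "nsq (S x) * R\<^sup>2 * 1"]) (simp_all add: mult_nonneg_nonneg)
   have 3: "0 <= (1 / (4 * (Tb - t)\<^sup>2)) * (nsq (F t x) * nsq (x - x0) * gauss (Tb - t) x)"
    using gl by (intro mult_nonneg_nonneg) auto
   show ?thesis using 1 2 3 by linarith
  qed
  show "integrable M (%x. 2 * (S x * S' x) + (1 / (4 * \<gamma>\<^sup>2)) * (nsq (S x) * R\<^sup>2))"
   using sqint_mult[OF sS] sqint_integrable[OF sS(1)] by simp
  show "?f' t0 \<in> borel_measurable M"
   using sqint_measurable[OF sF(1)[of t0]] sqint_measurable[OF sF(2)[of t0]] by measurable
 qed
 moreover have "(LINT x|M. ?f' t0 x) = 2 * (LINT x|M. (F t0 x \<bullet> F' t0 x) * gauss (Tb - t0) x)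
    - (LINT x|M. nsq (F t0 x) * nsq (x - x0) * gauss (Tb - t0) x) / (4 * (Tb - t0)\<^sup>2)"
  using integrable_gauss[OF sqint_inner[OF sF(1)[of t0] sF(2)[of t0]], of "Tb - t0"] integrable_normsq_radial(1)[OF sF(1)[of t0], of "Tb - t0"] t0
  by simp
 ultimately show ?thesis by simp
qed

end

section \<open>Frequency function and observability\<close>

lemma (in bdomain) H10g_sum:
 fixes N :: nat
 assumes "!!k. H10g (e k) (g k)"
 shows "H10g (%x. \<Sum>k<N. a k * e k x) (%x. \<Sum>k<N. a k *\<^sub>R g k x)"
proof (induction N)
 case 0
 show ?case using H10g_lincomb[OF assms[of 0] assms[of 0], of 0 0] by simp
next
 case (Suc N)
 show ?case using H10g_lincomb[OF Suc assms[of N], of 1 "a N"] by simp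
qed

context star_domain
begin

text \<open>Along a heat flow with \<open>\<Gamma>' = -1\<close>, \<open>H'\<close> and \<open>D'\<close> are time derivatives, and the second bound says that the
 frequency \<open>\<Gamma> D / H\<close> is nonincreasing.\<close>

lemma frequency_inequality:
 assumes WL: "weak_laplacian u g l" and dl: "H10g l dl" and \<Gamma>: "0 < \<Gamma>"
 defines "H \<equiv> LINT x|M. nsq (u x) * gauss \<Gamma> x" and "D \<equiv> LINT x|M. nsq (g x) * gauss \<Gamma> x"
  and "H' \<equiv> 2 * (LINT x|M. (u x \<bullet> l x) * gauss \<Gamma> x) - (LINT x|M. nsq (u x) * nsq (x - x0) * gauss \<Gamma> x) / (4 * \<Gamma>\<^sup>2)"
  and "D' \<equiv> 2 * (LINT x|M. (g x \<bullet> dl x) * gauss \<Gamma> x) - (LINT x|M. nsq (g x) * nsq (x - x0) * gauss \<Gamma> x) / (4 * \<Gamma>\<^sup>2)"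
 shows "H' = - 2 * D - real DIM('a) / (2 * \<Gamma>) * H" "\<Gamma> * (D' * H - D * H') <= D * H"
proof -
 have u: "H10g u g" and l: "sqint M l" using WL by (auto simp: weak_laplacian_def)
 note su = H10g_sqint[OF u]
 define w where "w = drift \<Gamma> g l"
 have sw: "sqint M w" unfolding w_def by (rule sqint_drift[OF su(2) l])
 have sr: "sqint M (%x. (x - x0) \<bullet> g x)" by (rule sqint_radial[OF su(2)])
 define Xu Xg S P n where "Xu = (LINT x|M. nsq (u x) * nsq (x - x0) * gauss \<Gamma> x)"
  and "Xg = (LINT x|M. nsq (g x) * nsq (x - x0) * gauss \<Gamma> x)"
  and "S = (LINT x|M. nsq (w x) * gauss \<Gamma> x)" and "P = (LINT x|M. w x * ((x - x0) \<bullet> g x) * gauss \<Gamma> x)"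
  and "n = real DIM('a)"
 have H0: "0 <= H" unfolding H_def by (intro integral_nonneg_AE AE_I2 mult_nonneg_nonneg) (auto intro: less_imp_le gauss_pos)
 have Dw: "D = - (LINT x|M. w x * u x * gauss \<Gamma> x)"
  using drift_symmetric[OF WL u \<Gamma>] by (simp add: D_def w_def power2_norm_eq_inner)
 \<comment> \<open>Writing the Laplacian as the drift operator plus its radial part separates what
   Cauchy-Schwarz handles from what the radial identities handle.\<close>
 have lw: "l x = w x + (1 / (2 * \<Gamma>)) * ((x - x0) \<bullet> g x)" for x by (simp add: w_def drift_def)
 have Y: "2 * (LINT x|M. u x * ((x - x0) \<bullet> g x) * gauss \<Gamma> x) = - (n * H) + (1 / (2 * \<Gamma>)) * Xu"
  using radial_ibp[OF u \<Gamma>] by (simp add: H_def Xu_def n_def)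
 have i1: "integrable M (%x. w x * u x * gauss \<Gamma> x)" "integrable M (%x. u x * ((x - x0) \<bullet> g x) * gauss \<Gamma> x)"
  "integrable M (%x. nsq (w x) * gauss \<Gamma> x)" "integrable M (%x. w x * ((x - x0) \<bullet> g x) * gauss \<Gamma> x)"
  by (intro integrable_gauss sqint_mult sqint_integrable sw su sr \<Gamma>)+
 have "(LINT x|M. (u x \<bullet> l x) * gauss \<Gamma> x) = (LINT x|M. w x * u x * gauss \<Gamma> x + (1 / (2 * \<Gamma>)) * (u x * ((x - x0) \<bullet> g x) * gauss \<Gamma> x))"
  unfolding lw by (intro LINT_cong refl) (simp add: ring_distribs mult_ac)
 also have "... = - D + (1 / (2 * \<Gamma>)) * (LINT x|M. u x * ((x - x0) \<bullet> g x) * gauss \<Gamma> x)"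
  using i1 by (simp add: Dw)
 finally have "H' = - 2 * D + (1 / (2 * \<Gamma>)) * (2 * (LINT x|M. u x * ((x - x0) \<bullet> g x) * gauss \<Gamma> x)) - Xu / (4 * \<Gamma>\<^sup>2)"
  by (simp add: H'_def Xu_def)
 also have "... = - 2 * D - n / (2 * \<Gamma>) * H"
  unfolding Y using \<Gamma> by (simp add: field_simps power2_eq_square)
 finally have H': "H' = - 2 * D - n / (2 * \<Gamma>) * H" .
 then show "H' = - 2 * D - real DIM('a) / (2 * \<Gamma>) * H" by (simp add: n_def)
 have "(LINT x|M. (g x \<bullet> dl x) * gauss \<Gamma> x) = - (LINT x|M. w x * l x * gauss \<Gamma> x)"
  using drift_symmetric[OF WL dl \<Gamma>] by (simp add: w_def)
 also have "(LINT x|M. w x * l x * gauss \<Gamma> x) = (LINT x|M. nsq (w x) * gauss \<Gamma> x + (1 / (2 * \<Gamma>)) * (w x * ((x - x0) \<bullet> g x) * gauss \<Gamma> x))"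
  unfolding lw by (intro LINT_cong refl) (simp add: ring_distribs mult_ac power2_eq_square)
 also have "... = S + (1 / (2 * \<Gamma>)) * P" using i1 by (simp add: S_def P_def)
 finally have D': "D' = - 2 * S - (1 / \<Gamma>) * P - Xg / (4 * \<Gamma>\<^sup>2)" by (simp add: D'_def Xg_def)
 \<comment> \<open>The second moment of the gradient in this bound cancels exactly the one in
   \<open>D'\<close>.\<close>
 have "- ((1 - n / 2) * D + Xg / (4 * \<Gamma>)) <= P"
  using pohozaev[OF WL \<Gamma>] by (simp add: P_def D_def Xg_def n_def w_def)
 then have "- (1 / \<Gamma>) * P <= (1 / \<Gamma>) * ((1 - n / 2) * D + Xg / (4 * \<Gamma>))"
  using \<Gamma> by (simp add: field_simps)
 also have "... = (1 / \<Gamma>) * ((1 - n / 2) * D) + Xg / (4 * \<Gamma>\<^sup>2)" using \<Gamma> by (simp add: field_simps power2_eq_square)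
 finally have D'le: "D' <= - 2 * S + (1 / \<Gamma>) * ((1 - n / 2) * D)" unfolding D' by simp
 \<comment> \<open>The square root of the weight, which is the Gaussian of twice the width,
   distributes it over the two factors in Cauchy-Schwarz.\<close>
 define q where "q = gauss (2 * \<Gamma>)"
 have qq: "q x * q x = gauss \<Gamma> x" for x by (simp add: q_def gauss_def exp_add[symmetric])
 have "(LINT x|M. (q x * w x) \<bullet> (q x * u x))\<^sup>2 <= (LINT x|M. nsq (q x * w x)) * (LINT x|M. nsq (q x * u x))"
  by (rule CS_sq) (auto intro!: sqint_smooth_real sw su simp: q_def smooth_gauss)
 moreover have q3: "(q x * w x) \<bullet> (q x * u x) = w x * u x * gauss \<Gamma> x" "nsq (q x * w x) = nsq (w x) * gauss \<Gamma> x"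
  "nsq (q x * u x) = nsq (u x) * gauss \<Gamma> x" for x
  by (simp_all add: qq[symmetric] power2_eq_square mult_ac)
 ultimately have CS: "D\<^sup>2 <= S * H" unfolding q3 Dw S_def H_def by (simp only: power2_minus)
 \<comment> \<open>The dimension cancels between the two derivatives. Besides
   \<open>D * H / \<Gamma>\<close> there remains \<open>- 2 * (S * H - D\<^sup>2)\<close>, which is
   nonpositive by \<open>CS\<close>.\<close>
 have "D' * H <= (- 2 * S + (1 / \<Gamma>) * ((1 - n / 2) * D)) * H" using D'le H0 by (rule mult_right_mono)
 moreover have "D' * H - D * (- 2 * D - n / 2 * i * H) <= - 2 * (S * H) + 2 * D\<^sup>2 + i * (D * H)"
  if "D' * H <= (- 2 * S + i * ((1 - n / 2) * D)) * H" for i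
  using that by (simp add: algebra_simps power2_eq_square)
 moreover have "n / (2 * \<Gamma>) = n / 2 * (1 / \<Gamma>)" by simp
 ultimately have "D' * H - D * H' <= - 2 * (S * H) + 2 * D\<^sup>2 + (1 / \<Gamma>) * (D * H)"
  unfolding H' by metis
 also have "... <= (1 / \<Gamma>) * (D * H)" using CS by simp
 finally show "\<Gamma> * (D' * H - D * H') <= D * H" using \<Gamma> by (simp add: field_simps)
qed

end

section \<open>Finite sums of eigenfunctions\<close>

locale heat_sum = star_domain +
 fixes N :: nat and e :: "nat => 'a => real" and g :: "nat => 'a => 'a" and lam c :: "nat => real"
 assumes e: "H10g (e k) (g k)" and eig: "H10g v h ==> (LINT x|M. g k x \<bullet> h x) = lam k * (LINT x|M. e k x * v x)"
  and orth: "i \<noteq> j ==> m_form (e i) (e j) = 0" and lam: "0 <= lam k"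
begin

text \<open>\<open>V\<close> is at once the time derivative and the weak Laplacian of
  \<open>U\<close>, while \<open>G\<close> and \<open>dG\<close> are the gradients of
  \<open>U\<close> and \<open>V\<close>. That \<open>V\<close> is again in \<open>H10\<close> is
  what lets \<open>frequency_inequality\<close> test with it.\<close>

definition "U t x = (\<Sum>k<N. (c k * exp (- lam k * t)) * e k x)"
definition "G t x = (\<Sum>k<N. (c k * exp (- lam k * t)) *\<^sub>R g k x)"
definition "V t x = (\<Sum>k<N. (- lam k * (c k * exp (- lam k * t))) * e k x)"
definition "dG t x = (\<Sum>k<N. (- lam k * (c k * exp (- lam k * t))) *\<^sub>R g k x)"

lemma UG: "H10g (U t) (G t)"
 unfolding U_def[abs_def] G_def[abs_def] by (rule H10g_sum[OF e])

lemma VG: "H10g (V t) (dG t)"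
 unfolding V_def[abs_def] dG_def[abs_def] by (rule H10g_sum[OF e])

lemma weak_laplacian_U: "weak_laplacian (U t) (G t) (V t)"
 unfolding weak_laplacian_def
proof (intro conjI allI impI)
 show "H10g (U t) (G t)" by (rule UG)
 show "sqint M (V t)" by (rule H10g_sqint(1)[OF VG])
 fix v h assume v: "H10g v h"
 note sv = H10g_sqint[OF v] and se = H10g_sqint[OF e]
 have "(LINT x|M. G t x \<bullet> h x) = (LINT x|M. (\<Sum>k<N. (c k * exp (- lam k * t)) * (g k x \<bullet> h x)))"
  by (simp add: G_def inner_sum_left)
 also have "... = (\<Sum>k<N. (c k * exp (- lam k * t)) * (lam k * (LINT x|M. e k x * v x)))"
  using sqint_inner[OF se(2) sv(2)] by (simp add: LINT_sum eig[OF v])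
 also have "... = - (\<Sum>k<N. (- lam k * (c k * exp (- lam k * t))) * (LINT x|M. e k x * v x))"
  by (simp add: sum_negf mult_ac)
 also have "(\<Sum>k<N. (- lam k * (c k * exp (- lam k * t))) * (LINT x|M. e k x * v x)) = (LINT x|M. (\<Sum>k<N. (- lam k * (c k * exp (- lam k * t))) * (e k x * v x)))"
  using sqint_mult[OF se(1) sv(1)] by (subst LINT_sum) auto
 also have "... = (LINT x|M. V t x * v x)" by (simp add: V_def sum_distrib_right mult.assoc)
 finally show "(LINT x|M. G t x \<bullet> h x) = - (LINT x|M. V t x * v x)" .
qed

lemma nrm2_U: "(nrm2 M (U t))\<^sup>2 = (\<Sum>k<N. (c k * exp (- lam k * t))\<^sup>2 * m_form (e k) (e k))"
proof -
 have eV: "e k \<in> H10 \<Omega>" for k using e by (rule H10g_H10)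
 have UV: "U t \<in> H10 \<Omega>" using UG by (rule H10g_H10)
 let ?a = "%k. c k * exp (- lam k * t)"
 have eU: "m_form (e j) (U t) = (if j < N then ?a j * m_form (e j) (e j) else 0)" for j
 proof -
  have "m_form (e j) (U t) = m_form (U t) (e j)" by (simp add: m_form_def mult.commute)
  also have "... = (\<Sum>k<N. ?a k * m_form (e k) (e j))" unfolding U_def[abs_def] by (rule CF.m.ip_sum[OF eV eV])
  also have "... = (\<Sum>k<N. if k = j then ?a j * m_form (e j) (e j) else 0)"
   by (intro sum.cong refl) (use orth in auto)
  also have "... = (if j < N then ?a j * m_form (e j) (e j) else 0)" by simp
  finally show ?thesis .
 qed
 have "(nrm2 M (U t))\<^sup>2 = m_form (U t) (U t)" by (simp add: m_form_self)
 also have "... = (\<Sum>k<N. ?a k * m_form (e k) (U t))"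
  using CF.m.ip_sum[where c="?a" and N=N, OF eV UV] by (simp add: U_def[abs_def])
 also have "... = (\<Sum>k<N. (?a k)\<^sup>2 * m_form (e k) (e k))" by (simp add: eU power2_eq_square mult_ac)
 finally show ?thesis .
qed

lemma nrm2_U_antimono: "s <= t ==> (nrm2 M (U t))\<^sup>2 <= (nrm2 M (U s))\<^sup>2"
 unfolding nrm2_U
proof (intro sum_mono mult_right_mono)
 fix k assume "s <= t"
 then have "exp (- lam k * t) <= exp (- lam k * s)" using lam[of k] by (simp add: mult_left_mono)
 then show "(c k * exp (- lam k * t))\<^sup>2 <= (c k * exp (- lam k * s))\<^sup>2"
  unfolding power_mult_distrib by (intro mult_left_mono power_mono) auto
qed (simp add: m_form_self)

context
 fixes T h :: real
 assumes T: "0 < T" and h: "0 < h" and nz: "nrm2 M (U T) \<noteq> 0"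
begin

definition "H t = (LINT x|M. nsq (U t x) * gauss (T + h - t) x)"
definition "D t = (LINT x|M. nsq (G t x) * gauss (T + h - t) x)"

lemma H_bounds:
 assumes t: "t <= T"
 shows "H t <= (nrm2 M (U t))\<^sup>2" "exp (- (R\<^sup>2 / (4 * (T + h - t)))) * (nrm2 M (U t))\<^sup>2 <= H t" "0 < H t"
proof -
 have \<Gamma>: "0 < T + h - t" using t h by simp
 note sU = H10g_sqint(1)[OF UG, of t]
 have i: "integrable M (%x. nsq (U t x) * gauss (T + h - t) x)" by (rule integrable_normsq_radial(2)[OF sU \<Gamma>])
 show "H t <= (nrm2 M (U t))\<^sup>2" unfolding H_def nrm2_sq
  by (rule integral_mono[OF i sqint_integrable[OF sU]]) (use gauss_le_1[OF \<Gamma>] in \<open>auto intro: mult_left_le\<close>)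
 have "(LINT x|M. exp (- (R\<^sup>2 / (4 * (T + h - t)))) * nsq (U t x)) <= H t" unfolding H_def
 proof (rule integral_mono[OF _ i])
  show "integrable M (%x. exp (- (R\<^sup>2 / (4 * (T + h - t)))) * nsq (U t x))" using sqint_integrable[OF sU] by simp
  fix x assume "x \<in> space M"
  then have "nsq (x - x0) / (4 * (T + h - t)) <= R\<^sup>2 / (4 * (T + h - t))"
   using R_bound[of x] \<Gamma> by (intro divide_right_mono power_mono) auto
  then have "exp (- (R\<^sup>2 / (4 * (T + h - t)))) <= gauss (T + h - t) x" by (simp add: gauss_def)
  from mult_left_mono[OF this zero_le_power2[of "norm (U t x)"]]
  show "exp (- (R\<^sup>2 / (4 * (T + h - t)))) * nsq (U t x) <= nsq (U t x) * gauss (T + h - t) x"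
   by (simp only: mult.commute[of "exp _"])
 qed
 then show le: "exp (- (R\<^sup>2 / (4 * (T + h - t)))) * (nrm2 M (U t))\<^sup>2 <= H t" by (simp add: nrm2_sq)
 have "0 < (nrm2 M (U T))\<^sup>2" using nz by simp
 also have "... <= (nrm2 M (U t))\<^sup>2" by (rule nrm2_U_antimono[OF t])
 finally show "0 < H t" using le by (meson exp_gt_zero less_le_trans mult_pos_pos)
qed

text \<open>The frequency K is nonincreasing, so K T is its smallest value. The logarithmic
  derivative of H is \<open>- 2 * K t / \<Gamma> t\<close> minus a nonnegative dimensional term,
  hence at most \<open>- 2 * K T / \<Gamma> t\<close>. Integrating from 0 to T gives the
  claim.\<close>

lemma frequency_bound: "2 * (h * D T / H T) * ln ((T + h) / h) <= ln (H 0 / H T)"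
proof -
 define n where "n = real DIM('a)"
 define \<Gamma> where "\<Gamma> t = T + h - t" for t
 have \<Gamma>: "0 < \<Gamma> t" if "t <= T" for t using that h by (simp add: \<Gamma>_def)
 define H' where "H' t = 2 * (LINT x|M. (U t x \<bullet> V t x) * gauss (\<Gamma> t) x) - (LINT x|M. nsq (U t x) * nsq (x - x0) * gauss (\<Gamma> t) x) / (4 * (\<Gamma> t)\<^sup>2)" for t
 define D' where "D' t = 2 * (LINT x|M. (G t x \<bullet> dG t x) * gauss (\<Gamma> t) x) - (LINT x|M. nsq (G t x) * nsq (x - x0) * gauss (\<Gamma> t) x) / (4 * (\<Gamma> t)\<^sup>2)" for t
 have dH: "(H has_real_derivative H' t) (at t)" if "t <= T" for t
  using weighted_normsq_deriv[OF H10g_sqint(1)[OF e], where ?t0.0=t and Tb="T + h" and N=N and c=c and lam=lam] that h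
  by (simp add: H_def[abs_def] H'_def U_def V_def \<Gamma>_def)
 have dD: "(D has_real_derivative D' t) (at t)" if "t <= T" for t
  using weighted_normsq_deriv[OF H10g_sqint(2)[OF e], where ?t0.0=t and Tb="T + h" and N=N and c=c and lam=lam] that h
  by (simp add: D_def[abs_def] D'_def G_def dG_def \<Gamma>_def)
 have H': "H' t = - 2 * D t - n / (2 * \<Gamma> t) * H t" and D': "\<Gamma> t * (D' t * H t - D t * H' t) <= D t * H t" if "t <= T" for t
  using frequency_inequality[OF weak_laplacian_U VG \<Gamma>[OF that]] by (simp_all add: H_def D_def H'_def D'_def \<Gamma>_def n_def)
 define K where "K t = \<Gamma> t * (D t / H t)" for t
 have dG: "(\<Gamma> has_real_derivative - 1) (at t)" for t unfolding \<Gamma>_def by (auto intro!: derivative_eq_intros)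
 have Kmono: "K T <= K t" if t: "0 <= t" "t <= T" for t
 proof (rule DERIV_nonpos_imp_nonincreasing[where f=K, OF t(2)])
  fix s assume s: "t <= s" "s <= T"
  have Hp: "0 < H s" by (rule H_bounds(3)[OF s(2)])
  have "(K has_real_derivative - 1 * (D s / H s) + (D' s * H s - D s * H' s) / (H s * H s) * \<Gamma> s) (at s)"
   unfolding K_def[abs_def] by (intro DERIV_mult dG DERIV_divide dD dH s) (use Hp in simp)
  moreover have "- 1 * (D s / H s) + (D' s * H s - D s * H' s) / (H s * H s) * \<Gamma> s <= 0"
  proof -
   have "(\<Gamma> s * (D' s * H s - D s * H' s)) / (H s * H s) <= (D s * H s) / (H s * H s)"
    using Hp by (intro divide_right_mono D' s) auto
   then show ?thesis using Hp by (simp add: mult.commute)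
  qed
  ultimately show "\<exists>y. (K has_real_derivative y) (at s) \<and> y <= 0" by blast
 qed
 define \<Phi> where "\<Phi> t = ln (H t) - 2 * K T * ln (\<Gamma> t)" for t
 have "\<Phi> T <= \<Phi> 0"
 proof (rule DERIV_nonpos_imp_nonincreasing[where f=\<Phi> and a=0 and b=T])
  fix s assume s: "0 <= s" "s <= T"
  have Hp: "0 < H s" by (rule H_bounds(3)[OF s(2)])
  note Gp = \<Gamma>[OF s(2)]
  have "(\<Phi> has_real_derivative (1 / H s * H' s - 2 * K T * (1 / \<Gamma> s * - 1))) (at s)"
   unfolding \<Phi>_def[abs_def]
   by (intro DERIV_diff DERIV_cmult DERIV_chain2[OF DERIV_ln_divide] dH dG s) (use Hp Gp in auto)
  moreover have "1 / H s * H' s - 2 * K T * (1 / \<Gamma> s * - 1) <= 0"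
  proof -
   have "1 / H s * H' s = - 2 * (D s / H s) - n / (2 * \<Gamma> s)"
    unfolding H'[OF s(2)] using Hp by (simp add: field_simps)
   moreover have "K T / \<Gamma> s <= D s / H s"
    using Kmono[OF s] Gp by (simp add: K_def[of s] pos_divide_le_eq mult.commute)
   moreover have "0 <= n / (2 * \<Gamma> s)" using Gp by (simp add: n_def)
   ultimately show ?thesis by simp
  qed
  ultimately show "\<exists>y. (\<Phi> has_real_derivative y) (at s) \<and> y <= 0" by blast
 qed (use T in simp)
 moreover have "K T = h * D T / H T" by (simp add: K_def \<Gamma>_def)
 moreover have "ln ((T + h) / h) = ln (\<Gamma> 0) - ln (\<Gamma> T)" using T h by (simp add: \<Gamma>_def ln_div)
 moreover have "ln (H 0 / H T) = ln (H 0) - ln (H T)" using H_bounds(3)[of 0] H_bounds(3)[of T] T by (simp add: ln_div)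
 ultimately have "2 * K T * (ln (\<Gamma> 0) - ln (\<Gamma> T)) <= ln (H 0) - ln (H T)"
  unfolding \<Phi>_def by (simp add: right_diff_distrib)
 then show ?thesis
  using \<open>K T = h * D T / H T\<close> \<open>ln ((T + h) / h) = ln (\<Gamma> 0) - ln (\<Gamma> T)\<close> \<open>ln (H 0 / H T) = ln (H 0) - ln (H T)\<close> by (simp only:)
qed

end

text \<open>The width \<open>h\<close> of the final Gaussian is small enough that half of the weighted mass of \<open>U T\<close> lies in the ball.\<close>

lemma interpolation:
 assumes r: "0 < r" and T: "0 < T" and E: "0 <= E"
 shows "(nrm2 M (U T))\<^sup>2 <= exp (- E) * (nrm2 M (U 0))\<^sup>2
   + 2 * exp (4 * real DIM('a) * R\<^sup>2 / r\<^sup>2) * exp ((R\<^sup>2 * exp (max 1 (16 * R\<^sup>2 / r\<^sup>2)) / 4) / T + 16 * R\<^sup>2 / r\<^sup>2 * E)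
    * (LINT x|M. indicator (ball x0 r) x * (U T x)\<^sup>2)"
proof -
 define a b \<beta> where "a = (nrm2 M (U T))\<^sup>2" and "b = (nrm2 M (U 0))\<^sup>2" and "\<beta> = (LINT x|M. indicator (ball x0 r) x * (U T x)\<^sup>2)"
 define n where "n = real DIM('a)"
 have n: "1 <= n" using DIM_positive[where 'a='a] by (simp add: n_def)
 define \<gamma> where "\<gamma> = 16 * R\<^sup>2 / r\<^sup>2"
 define L where "L = max 1 \<gamma>"
 have L: "1 <= L" "\<gamma> <= L" by (auto simp: L_def)
 have \<beta>0: "0 <= \<beta>" unfolding \<beta>_def by (intro integral_nonneg_AE) auto
 show ?thesis
 \<comment> \<open>E is a free trade-off parameter. In the second case the energy ratio is below exp
   E, so its logarithm K is at most E; there also a is positive, which the frequency function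
   needs.\<close>
 proof (cases "a <= exp (- E) * b")
  case True
  have "0 <= 2 * exp (4 * real DIM('a) * R\<^sup>2 / r\<^sup>2) * exp ((R\<^sup>2 * exp (max 1 (16 * R\<^sup>2 / r\<^sup>2)) / 4) / T + 16 * R\<^sup>2 / r\<^sup>2 * E) * \<beta>"
   using \<beta>0 by simp
  then show ?thesis using True unfolding a_def b_def \<beta>_def by linarith
 next
  case False
  have ab: "a <= b" unfolding a_def b_def by (rule nrm2_U_antimono) (use T in simp)
  have b0: "0 <= b" by (simp add: b_def)
  have a0: "0 < a"
  proof (rule ccontr)
   assume "\<not> 0 < a"
   then have "a = 0" by (simp add: a_def)
   then show False using False b0 by simp
  qed
  then have nz: "nrm2 M (U T) \<noteq> 0" by (auto simp: a_def)
  define K where "K = ln (b / a)"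
  have K0: "0 <= K" using ab a0 by (simp add: K_def)
  have KE: "K <= E"
  proof -
   have "exp (- E) * b < a" using False by simp
   then have "b / a < exp E" using a0 by (simp add: exp_minus field_simps)
   then have "ln (b / a) < ln (exp E)" using a0 ab by (subst ln_less_cancel_iff) auto
   then show ?thesis by (simp add: K_def)
  qed
  \<comment> \<open>Each summand of 1/h serves one smallness condition. The first makes
    \<open>ln ((T + h) / h)\<close> at least L, the second absorbs the logarithm K of the energy
    ratio, the third the dimensional term of \<open>localisation\<close>.\<close>
  define h where "h = 1 / (exp L / T + 64 * K / r\<^sup>2 + 16 * n / r\<^sup>2)"
  have den: "0 < exp L / T + 64 * K / r\<^sup>2 + 16 * n / r\<^sup>2"
   using T K0 n r by (intro add_pos_nonneg) auto
  have h: "0 < h" using den by (simp add: h_def)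
  have ih: "1 / h = exp L / T + 64 * K / r\<^sup>2 + 16 * n / r\<^sup>2" by (simp add: h_def)
  have p: "0 <= exp L / T" "0 <= 64 * K / r\<^sup>2" "0 <= 16 * n / r\<^sup>2" using T K0 n by auto
  have c1: "h * (exp L / T) <= 1" and c2: "h * (64 * K / r\<^sup>2) <= 1" and c3: "h * (16 * n / r\<^sup>2) <= 1"
  proof -
   have "h * (1 / h) = 1" using h by simp
   then have "h * (exp L / T) + h * (64 * K / r\<^sup>2) + h * (16 * n / r\<^sup>2) = 1" unfolding ih by (simp add: distrib_left)
   moreover have "0 <= h * (exp L / T)" "0 <= h * (64 * K / r\<^sup>2)" "0 <= h * (16 * n / r\<^sup>2)"
    by (rule mult_nonneg_nonneg[OF less_imp_le[OF h]], rule p)+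
   ultimately show "h * (exp L / T) <= 1" "h * (64 * K / r\<^sup>2) <= 1" "h * (16 * n / r\<^sup>2) <= 1" by linarith+
  qed
  define HT where "HT = (LINT x|M. nsq (U T x) * gauss h x)"
  define DT where "DT = (LINT x|M. nsq (G T x) * gauss h x)"
  have HT: "H T h T = HT" "D T h T = DT" by (simp_all add: H_def[OF T h nz] D_def[OF T h nz] HT_def DT_def)
  note Hb = H_bounds[OF T h nz]
  have HTp: "0 < HT" using Hb(3)[of T] HT by simp
  have HTl: "exp (- (R\<^sup>2 / (4 * h))) * a <= HT" using Hb(2)[of T] HT by (simp add: a_def)
  have H0u: "H T h 0 <= b" and H0p: "0 < H T h 0" using Hb(1)[of 0] Hb(3)[of 0] T by (auto simp: b_def)
  have DT0: "0 <= DT" unfolding DT_def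
   by (intro integral_nonneg_AE AE_I2 mult_nonneg_nonneg) (auto intro: less_imp_le gauss_pos)
  define A where "A = 2 * (h * DT / HT)"
  have A0: "0 <= A" using DT0 HTp h by (simp add: A_def)
  have "A * L <= A * ln ((T + h) / h)"
  proof (rule mult_left_mono[OF _ A0])
   have "h * exp L <= T" using c1 T by (simp add: field_simps)
   then have "exp L <= (T + h) / h" using h by (simp add: field_simps)
   then show "L <= ln ((T + h) / h)" using T h by (subst ln_ge_iff) auto
  qed
  also have "... <= ln (H T h 0 / HT)" using frequency_bound[OF T h nz] by (simp add: A_def HT)
  also have "... <= ln (b / (exp (- (R\<^sup>2 / (4 * h))) * a))"
  proof (subst ln_le_cancel_iff)
   show "0 < H T h 0 / HT" using H0p HTp by simp
   show "0 < b / (exp (- (R\<^sup>2 / (4 * h))) * a)" using a0 ab by simp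
   show "H T h 0 / HT <= b / (exp (- (R\<^sup>2 / (4 * h))) * a)"
    using H0u HTl H0p a0 b0 by (intro frac_le) auto
  qed
  also have "... = K + R\<^sup>2 / (4 * h)" using a0 ab by (simp add: K_def ln_div ln_mult)
  finally have AL: "A * L <= K + R\<^sup>2 / (4 * h)" .
  \<comment> \<open>The bound on A L still contains \<open>R\<^sup>2 / (4 * h)\<close>, the price of
    comparing the weighted and unweighted energies. Multiplied by \<open>8 * h / r\<^sup>2\<close>
    it becomes \<open>\<gamma> / 8\<close>, which is harmless because L is at least
    \<open>\<gamma>\<close>.\<close>
  have small: "8 * h / r\<^sup>2 * A <= 1 / 4"
  proof -
   have "8 * h / r\<^sup>2 * (A * L) <= 8 * h / r\<^sup>2 * (K + R\<^sup>2 / (4 * h))"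
    using AL h by (intro mult_left_mono) auto
   also have "... = h * (64 * K / r\<^sup>2) / 8 + \<gamma> / 8" using h r by (simp add: \<gamma>_def field_simps)
   also have "... <= 1 / 8 + L / 8" using c2 L by (intro add_mono divide_right_mono) auto
   also have "... <= L / 4" using L by simp
   finally have "8 * h / r\<^sup>2 * A * L <= 1 / 4 * L" by (simp add: mult.assoc)
   then show ?thesis by (rule mult_right_le_imp_le) (use L in simp)
  qed
  have "8 * h / r\<^sup>2 * (n / 2) = h * (16 * n / r\<^sup>2) / 4" by simp
  also have "... <= 1 / 4" using c3 by (intro divide_right_mono) auto
  finally have small2: "8 * h / r\<^sup>2 * (n / 2) <= 1 / 4" .
  note sU = H10g_sqint(1)[OF UG, of T]
  define HB where "HB = (LINT x|M. indicator (ball x0 r) x * (nsq (U T x) * gauss h x))"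
  have iH: "integrable M (%x. nsq (U T x) * gauss h x)" by (rule integrable_normsq_radial(2)[OF sU h])
  have bM: "(indicator (ball x0 r) :: 'a => real) \<in> borel_measurable M"
   by (intro borel_measurable_indicator' measurable_restrict_space1) auto
  have iB: "integrable M (%x. indicator (ball x0 r) x * (nsq (U T x) * gauss h x))"
   by (rule integrable_dominated[OF iH])
     (use bM iH in \<open>auto simp: indicator_def intro!: AE_I2 borel_measurable_times\<close>)
  have "r\<^sup>2 * (HT - HB) = (LINT x|M. r\<^sup>2 * (nsq (U T x) * gauss h x - indicator (ball x0 r) x * (nsq (U T x) * gauss h x)))"
   using iH iB by (simp add: HT_def HB_def)
  also have "... <= (LINT x|M. (U T x)\<^sup>2 * nsq (x - x0) * gauss h x)"
  proof (rule integral_mono)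
   show "integrable M (%x. r\<^sup>2 * (nsq (U T x) * gauss h x - indicator (ball x0 r) x * (nsq (U T x) * gauss h x)))"
    using iH iB by simp
   show "integrable M (%x. (U T x)\<^sup>2 * nsq (x - x0) * gauss h x)"
    using integrable_normsq_radial(1)[OF sU h] by simp
   fix x
   have gp: "0 <= gauss h x" using gauss_pos[of h x] by simp
   show "r\<^sup>2 * (nsq (U T x) * gauss h x - indicator (ball x0 r) x * (nsq (U T x) * gauss h x)) <= (U T x)\<^sup>2 * nsq (x - x0) * gauss h x"
   proof (cases "x \<in> ball x0 r")
    case True then show ?thesis using gp by simp
   next
    case False
    then have "r\<^sup>2 <= nsq (x - x0)" using r by (intro power_mono) (auto simp: dist_norm norm_minus_commute)
    then have "(U T x)\<^sup>2 * r\<^sup>2 * gauss h x <= (U T x)\<^sup>2 * nsq (x - x0) * gauss h x" using gp by (intro mult_right_mono mult_left_mono) auto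
    then show ?thesis using False by (simp add: mult_ac)
   qed
  qed
  also have "... <= 8 * h * (2 * h * DT + n / 2 * HT)"
   using localisation[OF UG h, of T] h by (simp add: pos_divide_le_eq DT_def HT_def n_def mult.commute)
  also have "... = 8 * h * (A + n / 2) * HT" using HTp by (simp add: A_def field_simps)
  finally have "r\<^sup>2 * (HT - HB) <= 8 * h * (A + n / 2) * HT" .
  then have "HT - HB <= (8 * h * (A + n / 2) * HT) / r\<^sup>2" using r by (simp add: pos_le_divide_eq mult.commute)
  also have "... = (8 * h / r\<^sup>2 * A + 8 * h / r\<^sup>2 * (n / 2)) * HT"
   unfolding distrib_left[symmetric] by simp
  also have "... <= (1 / 4 + 1 / 4) * HT" using small small2 HTp by (intro mult_right_mono add_mono) auto
  finally have HTB: "HT <= 2 * HB" by simp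
  have HB\<beta>: "HB <= \<beta>" unfolding HB_def \<beta>_def
  proof (rule integral_mono[OF iB])
   show "integrable M (%x. indicator (ball x0 r) x * (U T x)\<^sup>2)"
    by (rule integrable_dominated[OF sqint_integrable[OF sU]])
      (use bM sqint_measurable[OF sU] in \<open>auto simp: indicator_def intro!: AE_I2 borel_measurable_times borel_measurable_power\<close>)
   show "indicator (ball x0 r) x * (nsq (U T x) * gauss h x) <= indicator (ball x0 r) x * (U T x)\<^sup>2" for x
    using gauss_le_1[OF h, of x] by (auto simp: indicator_def intro: mult_left_le)
  qed
  have "a <= exp (R\<^sup>2 / (4 * h)) * HT"
  proof -
   have "exp (R\<^sup>2 / (4 * h)) * (exp (- (R\<^sup>2 / (4 * h))) * a) <= exp (R\<^sup>2 / (4 * h)) * HT" using HTl by (intro mult_left_mono) auto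
   then show ?thesis by (simp add: mult.assoc[symmetric] exp_add[symmetric])
  qed
  also have "... <= exp (R\<^sup>2 / (4 * h)) * (2 * \<beta>)" using HTB HB\<beta> by (intro mult_left_mono) auto
  also have "R\<^sup>2 / (4 * h) = R\<^sup>2 / 4 * (1 / h)" by simp
  \<comment> \<open>The part of 1/h proportional to K contributes exactly
    \<open>\<gamma> * K\<close>: this is where the rate \<open>16 * R\<^sup>2 / r\<^sup>2\<close>
    comes from.\<close>
  also have "... = (R\<^sup>2 * exp L / 4) / T + \<gamma> * K + 4 * n * R\<^sup>2 / r\<^sup>2" unfolding ih by (simp add: \<gamma>_def field_simps)
  also have "exp ((R\<^sup>2 * exp L / 4) / T + \<gamma> * K + 4 * n * R\<^sup>2 / r\<^sup>2) * (2 * \<beta>)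
    <= exp ((R\<^sup>2 * exp L / 4) / T + \<gamma> * E + 4 * n * R\<^sup>2 / r\<^sup>2) * (2 * \<beta>)"
   using KE \<beta>0 r by (intro mult_right_mono) (auto simp: \<gamma>_def intro!: divide_right_mono mult_left_mono)
  also have "... = 2 * exp (4 * n * R\<^sup>2 / r\<^sup>2) * exp ((R\<^sup>2 * exp L / 4) / T + \<gamma> * E) * \<beta>"
   by (simp add: exp_add mult_ac)
  finally have "a <= exp (- E) * b + 2 * exp (4 * n * R\<^sup>2 / r\<^sup>2) * exp ((R\<^sup>2 * exp L / 4) / T + \<gamma> * E) * \<beta>"
   using b0 by (smt (verit) exp_ge_zero mult_nonneg_nonneg)
  then show ?thesis unfolding a_def b_def \<beta>_def n_def L_def \<gamma>_def .
 qed
qed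

end

context star_domain
begin

text \<open>The telescoping runs over the times \<open>T q\<^sup>m\<close> with \<open>q\<close> = \<open>obs_ratio\<close>; two consecutive ones differ by twice \<open>obs_gap\<close>.
 Interpolation is used with \<open>E\<close> = \<open>obs_exp / obs_gap\<close>, and \<open>q\<close> is chosen such that the factor \<open>exp (- E)\<close>
 is absorbed in the quotient of consecutive weights.\<close>

definition obs_rate :: "real => real" where "obs_rate r = 16 * R\<^sup>2 / r\<^sup>2"

definition obs_exp :: "real => real => real" where
 "obs_exp r T = R\<^sup>2 * exp (max 1 (obs_rate r)) / 4 + T"

definition obs_const :: "real => real" where
 "obs_const r = 2 * exp (4 * real DIM('a) * R\<^sup>2 / r\<^sup>2)"

definition obs_ratio :: "real => real" where
 "obs_ratio r = (1 + obs_rate r) / (1 + obs_rate r + 1 / 2)"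

definition obs_gap :: "real => real => nat => real" where
 "obs_gap r T m = T * (1 - obs_ratio r) / 2 * obs_ratio r ^ m"

definition obs_weight :: "real => real => nat => real" where
 "obs_weight r T m = obs_gap r T m * exp (- (obs_exp r T * (1 + obs_rate r) / obs_gap r T m)) / obs_const r"

lemma obs_facts:
 assumes r: "0 < r" and T: "0 < T"
 shows "0 <= obs_rate r" "0 < obs_const r" "2 / 3 <= obs_ratio r" "obs_ratio r < 1"
  "0 < obs_gap r T m" "obs_gap r T m <= T / 2" "T <= obs_exp r T" "0 < obs_weight r T m"
  "obs_gap r T (Suc m) = obs_ratio r * obs_gap r T m"
  "obs_weight r T m * exp (- (obs_exp r T / obs_gap r T m)) <= obs_weight r T (Suc m)"
  "obs_weight r T ----> 0"
proof -
 let ?\<gamma> = "obs_rate r" and ?q = "obs_ratio r" and ?d = "obs_gap r T" and ?C = "obs_exp r T"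
 show \<gamma>: "0 <= ?\<gamma>" by (simp add: obs_rate_def)
 show c: "0 < obs_const r" by (simp add: obs_const_def)
 show q: "2 / 3 <= ?q" "?q < 1" using \<gamma> by (auto simp: obs_ratio_def field_simps)
 show d: "0 < ?d m" for m using q T by (simp add: obs_gap_def)
 have "?q ^ m <= 1" for m using q by (intro power_le_one) auto
 then show dT: "?d m <= T / 2" for m
  using q T mult_mono[of "T * (1 - ?q) / 2" "T / 2" "?q ^ m" 1] by (simp add: obs_gap_def)
 show CT: "T <= ?C" by (simp add: obs_exp_def)
 show w: "0 < obs_weight r T m" for m using d[of m] c by (simp add: obs_weight_def)
 show S: "?d (Suc m) = ?q * ?d m" for m by (simp add: obs_gap_def)
 show "obs_weight r T m * exp (- (?C / ?d m)) <= obs_weight r T (Suc m)"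
 proof -
  have q0: "0 < ?q" using q by simp
  \<comment> \<open>The ratio is chosen such that \<open>(1 + \<gamma>) / q\<close> exceeds
    \<open>1 + \<gamma>\<close> by one half. Of the exponent C/d gained from
    \<open>exp (- E)\<close>, half pays for the smaller gap and half is left over.\<close>
  have cq: "?C * (1 + ?\<gamma>) / (?q * ?d m) = ?C * (1 + ?\<gamma>) / ?d m + ?C / ?d m - (?C / ?d m) / 2"
  proof -
   have "?C * (1 + ?\<gamma>) / (?q * ?d m) = (?C / ?d m) * ((1 + ?\<gamma>) / ?q)" by simp
   also have "(1 + ?\<gamma>) / ?q = 1 + ?\<gamma> + 1 - 1 / 2" using \<gamma> by (simp add: obs_ratio_def field_simps)
   also have "(?C / ?d m) * (1 + ?\<gamma> + 1 - 1 / 2) = ?C * (1 + ?\<gamma>) / ?d m + ?C / ?d m - (?C / ?d m) / 2"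
    by (simp add: ring_distribs diff_divide_distrib add_divide_distrib)
   finally show ?thesis .
  qed
  \<comment> \<open>The leftover half must compensate the factor q in the next gap. The summand T in
    \<open>obs_exp\<close> makes C/d at least 2, and exp (-1) is below 2/3, the lower bound for
    q.\<close>
  have "1 <= (?C / ?d m) / 2"
  proof -
   have "T / (T / 2) <= ?C / ?d m" using CT dT d T by (intro frac_le) auto
   then show ?thesis using T by simp
  qed
  then have "exp (- ((?C / ?d m) / 2)) <= exp (- 1)" by simp
  also have "... <= 1 / 2" using exp_ge_add_one_self[of "1::real"] by (simp add: exp_minus field_simps)
  also have "... <= ?q" using q by simp
  finally have e: "exp (- ((?C / ?d m) / 2)) <= ?q" .
  have "obs_weight r T m * exp (- (?C / ?d m)) = ?d m / obs_const r * (exp (- (?C * (1 + ?\<gamma>) / ?d m)) * exp (- (?C / ?d m)))"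
   by (simp add: obs_weight_def)
  also have "exp (- (?C * (1 + ?\<gamma>) / ?d m)) * exp (- (?C / ?d m)) = exp (- (?C * (1 + ?\<gamma>) / (?q * ?d m))) * exp (- ((?C / ?d m) / 2))"
   unfolding cq by (simp add: exp_add[symmetric])
  also have "?d m / obs_const r * (exp (- (?C * (1 + ?\<gamma>) / (?q * ?d m))) * exp (- ((?C / ?d m) / 2)))
    <= ?d m / obs_const r * (exp (- (?C * (1 + ?\<gamma>) / (?q * ?d m))) * ?q)"
   using e d[of m] c by (intro mult_left_mono) auto
  also have "... = obs_weight r T (Suc m)" by (simp add: obs_weight_def S)
  finally show ?thesis .
 qed
 show "obs_weight r T ----> 0"
 proof (rule tendsto_sandwich[OF _ _ tendsto_const])
  have "(%m. T * (1 - ?q) / 2 * ?q ^ m / obs_const r) ----> T * (1 - ?q) / 2 * 0 / obs_const r"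
   using q by (intro tendsto_intros LIMSEQ_power_zero) (use c in auto)
  then show "(%m. ?d m / obs_const r) ----> 0" by (simp add: obs_gap_def[abs_def])
  show "eventually (%m. obs_weight r T m <= ?d m / obs_const r) sequentially"
  proof (intro always_eventually allI)
   fix m
   have "exp (- (?C * (1 + ?\<gamma>) / ?d m)) <= 1" using \<gamma> CT T d[of m] by simp
   then have "?d m * exp (- (?C * (1 + ?\<gamma>) / ?d m)) <= ?d m * 1" using d[of m] by (intro mult_left_mono) auto
   then show "obs_weight r T m <= ?d m / obs_const r"
    unfolding obs_weight_def using c by (intro divide_right_mono) auto
  qed
 qed (intro always_eventually allI less_imp_le w)
qed

end

context heat_sum
begin

definition obs :: "real => real => real" where
 "obs r t = (LINT x|M. indicator (ball x0 r) x * (U t x)\<^sup>2)"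

lemma obs_nonneg: "0 <= obs r t"
 unfolding obs_def by (intro integral_nonneg_AE) auto

lemma continuous_obs: "continuous_on A (obs r)"
proof -
 have bM: "(indicator (ball x0 r) :: 'a => real) \<in> borel_measurable M"
  by (intro borel_measurable_indicator' measurable_restrict_space1) auto
 have i: "integrable M (%x. indicator (ball x0 r) x * (e j x * e k x))" for j k
  by (rule integrable_dominated[OF sqint_mult[OF H10g_sqint(1)[OF e] H10g_sqint(1)[OF e]]])
    (use bM sqint_measurable[OF H10g_sqint(1)[OF e]] in \<open>auto simp: indicator_def intro!: AE_I2 borel_measurable_times\<close>)
 let ?a = "%k t. c k * exp (- lam k * t)"
 have "obs r t = (\<Sum>j<N. \<Sum>k<N. ?a j t * ?a k t * (LINT x|M. indicator (ball x0 r) x * (e j x * e k x)))" for t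
 proof -
  have "obs r t = (LINT x|M. (\<Sum>j<N. \<Sum>k<N. ?a j t * ?a k t * (indicator (ball x0 r) x * (e j x * e k x))))"
   unfolding obs_def U_def power2_eq_square sum_product
   by (intro LINT_cong refl) (simp add: sum_distrib_left mult_ac)
  also have "... = (\<Sum>j<N. \<Sum>k<N. ?a j t * ?a k t * (LINT x|M. indicator (ball x0 r) x * (e j x * e k x)))"
   using i by (simp add: LINT_sum)
  finally show ?thesis .
 qed
 then have "obs r = (%t. \<Sum>j<N. \<Sum>k<N. ?a j t * ?a k t * (LINT x|M. indicator (ball x0 r) x * (e j x * e k x)))"
  by (simp add: fun_eq_iff)
 then show ?thesis by (simp only:) (intro continuous_intros)
qed

text \<open>Absorbing the decay up to time s into the coefficients yields another finite heat flow,
  started at s. With T = 0, \<open>obs_exp\<close> is the constant of \<open>interpolation\<close>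
  without the additional summand that the telescoping needs.\<close>

lemma interpolation_shift:
 assumes r: "0 < r" and st: "s < t" and E: "0 <= E"
 shows "(nrm2 M (U t))\<^sup>2 <= exp (- E) * (nrm2 M (U s))\<^sup>2
   + obs_const r * exp ((obs_exp r 0) / (t - s) + obs_rate r * E) * obs r t"
proof -
 interpret S: heat_sum \<Omega> x0 R N e g lam "%k. c k * exp (- lam k * s)"
  by unfold_locales (rule e eig orth lam; assumption?)+
 have "S.U (t - s) = U t" "S.U 0 = U s"
  unfolding S.U_def[abs_def] U_def[abs_def]
  by (simp_all add: fun_eq_iff mult.assoc exp_add[symmetric] right_diff_distrib)
 then show ?thesis using S.interpolation[OF r, of "t - s" E] st E
  by (simp add: obs_const_def obs_exp_def obs_rate_def obs_def)
qed

text \<open>Interpolation between consecutive times, averaged and multiplied by a weight, bounds the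
  weighted difference of their energies by the observation between them. The bounds add up over
  disjoint time intervals, and no energy at the initial time survives.\<close>

theorem observability:
 assumes r: "0 < r" and T: "0 < T"
 shows "obs_weight r T 0 * (nrm2 M (U T))\<^sup>2 <= integral {0..T} (obs r)"
proof -
 note F = obs_facts[OF r T]
 let ?d = "obs_gap r T" and ?w = "obs_weight r T" and ?C = "obs_exp r T" and ?\<gamma> = "obs_rate r" and ?q = "obs_ratio r"
 define l where "l m = T * ?q ^ m" for m
 define y where "y m = (nrm2 M (U (l m)))\<^sup>2" for m
 have l0: "l 0 = T" by (simp add: l_def)
 have "2 * ?d m = T * (1 - ?q) * ?q ^ m" for m by (simp add: obs_gap_def)
 then have lS: "l (Suc m) = l m - 2 * ?d m" for m by (simp add: l_def algebra_simps)
 have lp: "0 <= l m" for m using F(3) T by (simp add: l_def)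
 have io: "obs r integrable_on {a..b}" for a b
  by (rule integrable_continuous_real) (rule continuous_obs)
 have step: "?w m * y m - ?w (Suc m) * y (Suc m) <= integral {l (Suc m)..l m} (obs r)" for m
 proof -
  define E where "E = ?C / ?d m"
  have E: "0 <= E" using F(5)[of m] F(7) T by (simp add: E_def)
  define P where "P = obs_const r * exp (?C * (1 + ?\<gamma>) / ?d m)"
  have P: "0 < P" using F(2) by (simp add: P_def)
  \<comment> \<open>Only the upper half of the interval between consecutive times is used, so that
    the elapsed time t - l (Suc m) is at least the gap and the cost stays below P.\<close>
  have pt: "y m <= exp (- E) * y (Suc m) + P * obs r t" if t: "l m - ?d m <= t" "t <= l m" for t
  proof -
   have gap: "?d m <= t - l (Suc m)" using t lS by simp
   have "y m <= (nrm2 M (U t))\<^sup>2" unfolding y_def by (rule nrm2_U_antimono[OF t(2)])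
   also have "... <= exp (- E) * y (Suc m) + obs_const r * exp ((obs_exp r 0) / (t - l (Suc m)) + ?\<gamma> * E) * obs r t"
    unfolding y_def by (rule interpolation_shift[OF r _ E]) (use gap F(5)[of m] in simp)
   also have "... <= exp (- E) * y (Suc m) + P * obs r t"
   proof -
    have o: "0 <= obs_exp r 0" "obs_exp r 0 <= ?C" using T by (auto simp: obs_exp_def)
    have "obs_exp r 0 / (t - l (Suc m)) <= ?C / ?d m" using o gap F(5)[of m] by (intro frac_le) auto
    then have "obs_exp r 0 / (t - l (Suc m)) + ?\<gamma> * E <= ?C * (1 + ?\<gamma>) / ?d m"
     by (simp add: E_def ring_distribs add_divide_distrib mult.commute)
    then have "obs_const r * exp ((obs_exp r 0) / (t - l (Suc m)) + ?\<gamma> * E) <= P"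
     unfolding P_def using F(2) by (intro mult_left_mono) auto
    then show ?thesis using obs_nonneg[of r t] by (intro add_left_mono mult_right_mono) auto
   qed
   finally show ?thesis .
  qed
  have "integral {l m - ?d m..l m} (%t. y m) <= integral {l m - ?d m..l m} (%t. exp (- E) * y (Suc m) + P * obs r t)"
  proof (rule integral_le)
   show "(%t. exp (- E) * y (Suc m) + P * obs r t) integrable_on {l m - ?d m..l m}"
    by (intro integrable_continuous_real continuous_intros continuous_obs)
  qed (use pt in auto)
  moreover have "integral {l m - ?d m..l m} (%t. exp (- E) * y (Suc m) + P * obs r t) = ?d m * (exp (- E) * y (Suc m)) + P * integral {l m - ?d m..l m} (obs r)"
   using F(5)[of m] io by (subst Henstock_Kurzweil_Integration.integral_add) (auto intro: integrable_on_mult_right)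
  ultimately have "?d m * y m <= ?d m * (exp (- E) * y (Suc m)) + P * integral {l m - ?d m..l m} (obs r)"
   using F(5)[of m] by simp
  also have "integral {l m - ?d m..l m} (obs r) <= integral {l (Suc m)..l m} (obs r)"
   by (rule integral_subset_le) (use lS F(5)[of m] io obs_nonneg in auto)
  finally have "?d m * y m <= ?d m * (exp (- E) * y (Suc m)) + P * integral {l (Suc m)..l m} (obs r)"
   using P by simp
  then have "(?d m * y m) / P <= (?d m * (exp (- E) * y (Suc m)) + P * integral {l (Suc m)..l m} (obs r)) / P"
   using P by (intro divide_right_mono) auto
  moreover have "?d m / P = ?w m" by (simp add: obs_weight_def P_def exp_minus field_simps)
  then have "(?d m * z) / P = ?w m * z" for z by (metis times_divide_eq_left)
  ultimately have "?w m * y m <= ?w m * exp (- E) * y (Suc m) + integral {l (Suc m)..l m} (obs r)"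
   using P by (simp add: add_divide_distrib mult.assoc)
  moreover have "?w m * exp (- E) * y (Suc m) <= ?w (Suc m) * y (Suc m)"
   using F(10)[of m] by (intro mult_right_mono) (auto simp: E_def y_def)
  ultimately show ?thesis by linarith
 qed
 have tel: "?w 0 * y 0 - ?w k * y k <= integral {l k..T} (obs r)" for k
 proof (induction k)
  case 0 then show ?case by (simp add: l0)
 next
  case (Suc k)
  have le: "l (Suc k) <= l k" "l k <= T"
  proof -
   show "l (Suc k) <= l k" using lS[of k] F(5)[of k] by simp
   have "?q ^ k <= 1" using F(3,4) by (intro power_le_one) auto
   then show "l k <= T" using T by (simp add: l_def mult_left_le)
  qed
  have "integral {l (Suc k)..l k} (obs r) + integral {l k..T} (obs r) = integral {l (Suc k)..T} (obs r)"
   by (rule Henstock_Kurzweil_Integration.integral_combine[OF le io])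
  then show ?case using Suc step[of k] by linarith
 qed
 \<comment> \<open>The remaining term is a weight tending to 0 times an energy bounded by the one at
   time 0.\<close>
 have "?w 0 * y 0 <= integral {0..T} (obs r)"
 proof (rule LIMSEQ_le_const2)
  have "(%k. ?w 0 * y 0 - ?w k * (nrm2 M (U 0))\<^sup>2) ----> ?w 0 * y 0 - 0 * (nrm2 M (U 0))\<^sup>2"
   by (intro tendsto_intros F(11))
  then show "(%k. ?w 0 * y 0 - ?w k * (nrm2 M (U 0))\<^sup>2) ----> ?w 0 * y 0" by simp
  show "\<exists>N. \<forall>k\<ge>N. ?w 0 * y 0 - ?w k * (nrm2 M (U 0))\<^sup>2 <= integral {0..T} (obs r)"
  proof (intro exI[of _ 0] allI impI)
   fix k
   have "y k <= (nrm2 M (U 0))\<^sup>2" unfolding y_def by (rule nrm2_U_antimono[OF lp])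
   then have "?w k * y k <= ?w k * (nrm2 M (U 0))\<^sup>2" using F(8)[of k] by (intro mult_left_mono) auto
   moreover have "integral {l k..T} (obs r) <= integral {0..T} (obs r)"
    by (rule integral_subset_le) (use lp io obs_nonneg in auto)
   ultimately show "?w 0 * y 0 - ?w k * (nrm2 M (U 0))\<^sup>2 <= integral {0..T} (obs r)" using tel[of k] by linarith
  qed
 qed
 then show ?thesis by (simp add: y_def l0)
qed

end

section \<open>Eigenfunction expansions\<close>

context bdomain
begin

lemma normH1_nonneg [simp]: "0 <= normH1 \<Omega> v"
 by (simp add: normH1_def)

lemma normH1_eq_sqrt: "v \<in> H10 \<Omega> ==> normH1 \<Omega> v = sqrt (q_form v v)"
 using normH1_sq[of v] by (simp add: real_sqrt_unique)

lemma normH1_cmul: "v \<in> H10 \<Omega> ==> normH1 \<Omega> (%x. c * v x) = \<bar>c\<bar> * normH1 \<Omega> v"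
 using CF.q.ip_lincomb_sq[of v v c 0] CF.q.cmul_in[of v c]
 by (simp add: normH1_eq_sqrt real_sqrt_mult)

lemma Hm1_lincomb: "F \<in> Hm1 \<Omega> ==> v \<in> H10 \<Omega> ==> w \<in> H10 \<Omega> ==> F (%x. a * v x + b * w x) = a * F v + b * F w"
 by (simp add: Hm1_def)

lemma Hm1_cmul: "F \<in> Hm1 \<Omega> ==> v \<in> H10 \<Omega> ==> F (%x. a * v x) = a * F v"
 using Hm1_lincomb[of F v v a 0] by simp

lemma Hm1_zero: "F \<in> Hm1 \<Omega> ==> F (%x. 0) = 0"
 using Hm1_cmul[OF _ H10_zero, of F 0] by simp

lemma Hm1_sum: "F \<in> Hm1 \<Omega> ==> (!!k. e k \<in> H10 \<Omega>) ==> F (%x. \<Sum>k<N. c k * e k x) = (\<Sum>k<N. c k * F (e k))" for N :: nat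
proof (induction N)
 case (Suc N)
 then show ?case
  using Hm1_lincomb[OF Suc.prems(1) CF.q.sum_in[where e=e and N=N and c=c] Suc.prems(2)[of N], of 1 "c N"] by simp
qed (simp add: Hm1_zero)

lemma normHm1_bdd: "F \<in> Hm1 \<Omega> ==> bdd_above ((%v. \<bar>F v\<bar>) ` {v \<in> H10 \<Omega>. normH1 \<Omega> v <= 1})"
proof -
 assume "F \<in> Hm1 \<Omega>"
 then obtain B where B: "!!v. v \<in> H10 \<Omega> ==> \<bar>F v\<bar> <= B * normH1 \<Omega> v" unfolding Hm1_def by blast
 have "\<bar>F v\<bar> <= \<bar>B\<bar>" if "v \<in> H10 \<Omega>" "normH1 \<Omega> v <= 1" for v
 proof -
  have "B * normH1 \<Omega> v <= \<bar>B\<bar> * 1" using that(2) by (intro mult_mono) auto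
  then show ?thesis using B[OF that(1)] by simp
 qed
 then show ?thesis by (intro bdd_aboveI[of _ "\<bar>B\<bar>"]) auto
qed

lemma normHm1_nonneg: "F \<in> Hm1 \<Omega> ==> 0 <= normHm1 \<Omega> F"
 unfolding normHm1_def
 by (rule order_trans[OF _ cSUP_upper[OF _ normHm1_bdd, of "%x. 0"]])
  (auto simp: H10_zero normH1_eq_sqrt CF.q.ip_zero Hm1_zero)

lemma normHm1_bound:
 assumes F: "F \<in> Hm1 \<Omega>" and v: "v \<in> H10 \<Omega>"
 shows "\<bar>F v\<bar> <= normHm1 \<Omega> F * normH1 \<Omega> v"
proof (cases "normH1 \<Omega> v = 0")
 case True
 then show ?thesis using F v by (auto simp: Hm1_def)
next
 case False
 then have p: "0 < normH1 \<Omega> v" using normH1_nonneg[of v] by linarith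
 have "\<bar>F (%x. inverse (normH1 \<Omega> v) * v x)\<bar> <= normHm1 \<Omega> F"
  unfolding normHm1_def
  by (rule cSUP_upper[OF _ normHm1_bdd[OF F]]) (use p CF.q.cmul_in[OF v] in \<open>simp add: normH1_cmul[OF v]\<close>)
 then show ?thesis using p unfolding Hm1_cmul[OF F v]
  by (simp add: abs_mult divide_simps mult.commute)
qed

lemma Hm1_add:
 assumes F: "F \<in> Hm1 \<Omega>" and G: "G \<in> Hm1 \<Omega>"
 shows "(%v. a * F v + b * G v) \<in> Hm1 \<Omega>"
  and "normHm1 \<Omega> (%v. F v + G v) <= normHm1 \<Omega> F + normHm1 \<Omega> G"
proof -
 have "\<bar>a * F v + b * G v\<bar> <= (\<bar>a\<bar> * normHm1 \<Omega> F + \<bar>b\<bar> * normHm1 \<Omega> G) * normH1 \<Omega> v" if v: "v \<in> H10 \<Omega>" for v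
 proof -
  have "\<bar>a * F v + b * G v\<bar> <= \<bar>a\<bar> * \<bar>F v\<bar> + \<bar>b\<bar> * \<bar>G v\<bar>" by (simp add: abs_mult[symmetric])
  also have "... <= \<bar>a\<bar> * (normHm1 \<Omega> F * normH1 \<Omega> v) + \<bar>b\<bar> * (normHm1 \<Omega> G * normH1 \<Omega> v)"
   by (intro add_mono mult_left_mono normHm1_bound F G v) auto
  finally show ?thesis by (simp add: algebra_simps)
 qed
 moreover have "a * F (%x. c * v x + d * w x) + b * G (%x. c * v x + d * w x) = c * (a * F v + b * G v) + d * (a * F w + b * G w)"
  if "v \<in> H10 \<Omega>" "w \<in> H10 \<Omega>" for v w c d
  using that by (simp add: Hm1_lincomb F G algebra_simps)
 ultimately show "(%v. a * F v + b * G v) \<in> Hm1 \<Omega>" unfolding Hm1_def by blast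
 show "normHm1 \<Omega> (%v. F v + G v) <= normHm1 \<Omega> F + normHm1 \<Omega> G"
  unfolding normHm1_def[of \<Omega> "%v. F v + G v"]
 proof (rule cSUP_least)
  show "{v \<in> H10 \<Omega>. normH1 \<Omega> v <= 1} \<noteq> {}" using H10_zero normH1_eq_sqrt[OF H10_zero] CF.q.ip_zero[OF H10_zero] by auto
  fix v assume v: "v \<in> {v \<in> H10 \<Omega>. normH1 \<Omega> v <= 1}"
  have "\<bar>H v\<bar> <= normHm1 \<Omega> H" if "H \<in> Hm1 \<Omega>" for H
   unfolding normHm1_def by (rule cSUP_upper[OF v normHm1_bdd[OF that]])
  from this[OF F] this[OF G] show "\<bar>F v + G v\<bar> <= normHm1 \<Omega> F + normHm1 \<Omega> G" by linarith
 qed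
qed

lemma Hm1_form:
 assumes F: "semi_ip (H10 \<Omega>) F" and u: "u \<in> H10 \<Omega>" and b: "!!v. v \<in> H10 \<Omega> ==> \<bar>F u v\<bar> <= B * normH1 \<Omega> v"
 shows "F u \<in> Hm1 \<Omega>" "normHm1 \<Omega> (F u) <= \<bar>B\<bar>"
proof -
 interpret F: semi_ip "H10 \<Omega>" F by fact
 have "F u (%x. a * v x + b * w x) = a * F u v + b * F u w" if "v \<in> H10 \<Omega>" "w \<in> H10 \<Omega>" for v w a b
  using F.ip_lincomb[OF that u] F.ip_sym[OF u] F.lincomb that by simp
 then show "F u \<in> Hm1 \<Omega>" unfolding Hm1_def using b by blast
 show "normHm1 \<Omega> (F u) <= \<bar>B\<bar>"
  unfolding normHm1_def
 proof (rule cSUP_least)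
  show "{v \<in> H10 \<Omega>. normH1 \<Omega> v <= 1} \<noteq> {}" using H10_zero normH1_eq_sqrt[OF H10_zero] CF.q.ip_zero[OF H10_zero] by auto
  fix v assume v: "v \<in> {v \<in> H10 \<Omega>. normH1 \<Omega> v <= 1}"
  then have "B * normH1 \<Omega> v <= \<bar>B\<bar> * 1" by (intro mult_mono) auto
  then show "\<bar>F u v\<bar> <= \<bar>B\<bar>" using b[of v] v by simp
 qed
qed

lemma L2_functional_eq: "L2_functional \<Omega> u = m_form u"
 by (simp add: L2_functional_def m_form_def fun_eq_iff)

lemma neg_Laplace_eq: "neg_Laplace \<Omega> u = a_form u"
 by (simp add: neg_Laplace_def a_form_def fun_eq_iff)

lemma nrm2_le_normH1: "v \<in> H10 \<Omega> ==> nrm2 M v <= normH1 \<Omega> v"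
 using CF.m_le_q[of v] normH1_sq[of v] by (intro power2_le_imp_le[OF _ normH1_nonneg]) (simp add: m_form_self)

lemma L2_functional_Hm1:
 assumes "u \<in> H10 \<Omega>"
 shows "L2_functional \<Omega> u \<in> Hm1 \<Omega>" "normHm1 \<Omega> (L2_functional \<Omega> u) <= nrm2 M u"
proof -
 have "\<bar>m_form u v\<bar> <= nrm2 M u * normH1 \<Omega> v" if "v \<in> H10 \<Omega>" for v
 proof -
  have "\<bar>m_form u v\<bar> <= nrm2 M u * nrm2 M v"
   using CS_ineq[OF H10_sqint(1)[OF assms] H10_sqint(1)[OF that]] by (simp add: m_form_def)
  also have "... <= nrm2 M u * normH1 \<Omega> v" by (intro mult_left_mono nrm2_le_normH1 that) simp
  finally show ?thesis .
 qed
 from Hm1_form[OF CF.m.semi_ip_axioms assms this]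
 show "L2_functional \<Omega> u \<in> Hm1 \<Omega>" "normHm1 \<Omega> (L2_functional \<Omega> u) <= nrm2 M u"
  by (auto simp: L2_functional_eq)
qed

lemma a_form_q_form: "a_form u v = q_form u v - m_form u v"
 by (simp add: q_form_def)

lemma neg_Laplace_Hm1:
 assumes "u \<in> H10 \<Omega>"
 shows "neg_Laplace \<Omega> u \<in> Hm1 \<Omega>" "normHm1 \<Omega> (neg_Laplace \<Omega> u) <= normH1 \<Omega> u"
proof -
 have n: "nrm2 M (weak_grad \<Omega> v) <= normH1 \<Omega> v" if "v \<in> H10 \<Omega>" for v
  using normH1_sq[OF that] q_form_self[OF H10_H10g[OF that]]
  by (intro power2_le_imp_le[OF _ normH1_nonneg]) simp
 have b: "\<bar>a_form u v\<bar> <= normH1 \<Omega> u * normH1 \<Omega> v" if "v \<in> H10 \<Omega>" for v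
 proof -
  have "\<bar>a_form u v\<bar> <= nrm2 M (weak_grad \<Omega> u) * nrm2 M (weak_grad \<Omega> v)"
   using CS_ineq[OF H10_sqint(2)[OF assms] H10_sqint(2)[OF that]] by (simp add: a_form_def)
  also have "... <= normH1 \<Omega> u * normH1 \<Omega> v" by (intro mult_mono n assms that) auto
  finally show ?thesis .
 qed
 have "semi_ip (H10 \<Omega>) a_form"
 proof
  show "0 <= a_form v v" for v by (simp add: a_form_def)
  show "a_form v w = a_form w v" for v w by (simp add: a_form_def inner_commute)
  show "a_form (%x. a * v x + b * w x) z = a * a_form v z + b * a_form w z"
   if "v \<in> H10 \<Omega>" "w \<in> H10 \<Omega>" "z \<in> H10 \<Omega>" for v w z a b
   using that by (simp add: a_form_q_form CF.q.ip_lincomb CF.m.ip_lincomb algebra_simps)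
 qed (auto intro: H10_zero H10_lincomb)
 from Hm1_form[OF this assms b]
 show "neg_Laplace \<Omega> u \<in> Hm1 \<Omega>" "normHm1 \<Omega> (neg_Laplace \<Omega> u) <= normH1 \<Omega> u"
  by (auto simp: neg_Laplace_eq)
qed

end

locale eigen = bdomain +
 fixes e :: "nat => 'a => real" and \<kappa> :: "nat => real"
 assumes e_in: "e k \<in> H10 \<Omega>" and kap: "1 <= \<kappa> k"
  and orth: "i \<noteq> j ==> m_form (e i) (e j) = 0" and normalized: "m_form (e k) (e k) = 1 \<or> e k = (%x. 0)"
  and eigenvalue: "v \<in> H10 \<Omega> ==> q_form (e k) v = \<kappa> k * m_form (e k) v"
  and expansion: "v \<in> H10 \<Omega> ==> (%N. q_form (%x. v x - (\<Sum>k<N. m_form v (e k) * e k x)) (%x. v x - (\<Sum>k<N. m_form v (e k) * e k x))) ----> 0"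
begin

lemma kap_pos: "0 < \<kappa> k" using kap[of k] by linarith

lemma sum_in_H10: "(%x. \<Sum>k<N. c k * e k x) \<in> H10 \<Omega>" for N :: nat
 by (intro CF.q.sum_in e_in)

lemma m_form_e_sum: "m_form (e j) (%x. \<Sum>k<N. c k * e k x) = (if j < N then c j * m_form (e j) (e j) else 0)" for N :: nat
proof -
 have "m_form (e j) (%x. \<Sum>k<N. c k * e k x) = (\<Sum>k<N. c k * m_form (e k) (e j))"
  using CF.m.ip_sum[OF e_in e_in[of j]] CF.m.ip_sym[OF e_in sum_in_H10] by simp
 also have "... = (\<Sum>k<N. if k = j then c j * m_form (e j) (e j) else 0)"
  by (intro sum.cong refl) (use orth in auto)
 finally show ?thesis by simp
qed

lemma q_form_sum: "v \<in> H10 \<Omega> ==> q_form (%x. \<Sum>k<N. c k * e k x) v = (\<Sum>k<N. c k * \<kappa> k * m_form (e k) v)" for N :: nat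
 using CF.q.ip_sum[OF e_in] by (simp add: eigenvalue mult.assoc)

lemma remainder:
 fixes N :: nat
 assumes v: "v \<in> H10 \<Omega>"
 defines "r \<equiv> %x. v x - (\<Sum>k<N. m_form v (e k) * e k x)"
 shows "r \<in> H10 \<Omega>" "m_form r r = m_form v v - (\<Sum>k<N. (m_form v (e k))\<^sup>2)"
  and "q_form r r = q_form v v - (\<Sum>k<N. \<kappa> k * (m_form v (e k))\<^sup>2)"
proof -
 note B = CF.m.bessel_residual[where e=e, OF e_in v orth normalized]
 let ?S = "%x. \<Sum>k<N. m_form v (e k) * e k x"
 show r: "r \<in> H10 \<Omega>" "m_form r r = m_form v v - (\<Sum>k<N. (m_form v (e k))\<^sup>2)"
  unfolding r_def using B(1,3) by auto
 have S: "?S \<in> H10 \<Omega>" by (rule sum_in_H10)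
 have sq: "q_form ?S w = (\<Sum>k<N. \<kappa> k * (m_form v (e k))\<^sup>2)" if "w = v \<or> w = ?S" for w
 proof -
  have w: "w \<in> H10 \<Omega>" using that v S by auto
  have "m_form (e k) w = m_form v (e k)" if "k < N" for k
  proof -
   have "m_form (e k) v - m_form (e k) ?S = 0"
    using B(2)[where j=k and N=N] that CF.m.ip_diff[OF v S e_in] CF.m.ip_sym[OF e_in r(1)] CF.m.ip_sym[OF e_in v] CF.m.ip_sym[OF e_in S]
    unfolding r_def by simp
   then show ?thesis using \<open>w = v \<or> w = ?S\<close> CF.m.ip_sym[OF e_in v] by auto
  qed
  then show ?thesis unfolding q_form_sum[OF w] by (intro sum.cong) (auto simp: power2_eq_square)
 qed
 show "q_form r r = q_form v v - (\<Sum>k<N. \<kappa> k * (m_form v (e k))\<^sup>2)"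
  unfolding r_def CF.q.ip_diff_sq[OF v S] CF.q.ip_sym[OF v S] using sq[of v] sq[of ?S] by simp
qed

lemma q_sums:
 assumes v: "v \<in> H10 \<Omega>"
 shows "(%k. \<kappa> k * (m_form v (e k))\<^sup>2) sums q_form v v"
 unfolding sums_def
 using tendsto_diff[OF tendsto_const[of "q_form v v"] expansion[OF v]] remainder(3)[OF v] by simp

lemma m_remainder_tendsto:
 assumes v: "v \<in> H10 \<Omega>"
 shows "(%N. m_form (%x. v x - (\<Sum>k<N. m_form v (e k) * e k x)) (%x. v x - (\<Sum>k<N. m_form v (e k) * e k x))) ----> 0"
 by (rule tendsto_sandwich[OF _ _ tendsto_const expansion[OF v]])
  (auto intro!: always_eventually CF.m_le_q CF.m.ip_nonneg remainder(1)[OF v])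

lemma m_sums:
 assumes v: "v \<in> H10 \<Omega>"
 shows "(%k. (m_form v (e k))\<^sup>2) sums m_form v v"
 unfolding sums_def
 using tendsto_diff[OF tendsto_const[of "m_form v v"] m_remainder_tendsto[OF v]] remainder(2)[OF v] by simp

text \<open>Turns the dual norm into a square sum over the modes. One inequality tests F with
  partial sums of its Riesz representative, the other is Cauchy-Schwarz on expansions of arbitrary
  unit vectors.\<close>

lemma Hm1_sums:
 assumes F: "F \<in> Hm1 \<Omega>"
 shows "(%k. (F (e k))\<^sup>2 / \<kappa> k) sums (normHm1 \<Omega> F)\<^sup>2"
proof -
 let ?a = "%k. (F (e k))\<^sup>2 / \<kappa> k"
 have a0: "0 <= ?a k" for k using kap_pos[of k] by simp
 have bes: "(\<Sum>k<N. ?a k) <= (normHm1 \<Omega> F)\<^sup>2" for N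
 proof -
  \<comment> \<open>The coefficients of the Riesz representative of F in the H1 product. For it, F
    ?v and \<open>q_form ?v ?v\<close> are the same sum \<open>?A\<close>.\<close>
  let ?c = "%k. F (e k) / \<kappa> k"
  let ?v = "%x. \<Sum>k<N. ?c k * e k x"
  let ?A = "\<Sum>k<N. ?a k"
  have Fv: "F ?v = ?A"
   unfolding Hm1_sum[OF F e_in] by (intro sum.cong refl) (simp add: power2_eq_square)
  have "?c k * \<kappa> k * m_form (e k) ?v = ?a k" if "k < N" for k
   using normalized[of k] kap_pos[of k] that Hm1_zero[OF F] CF.m.ip_zero[OF H10_zero]
   unfolding m_form_e_sum by (auto simp: power2_eq_square)
  then have qv: "q_form ?v ?v = ?A" unfolding q_form_sum[OF sum_in_H10] by (intro sum.cong) auto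
  have "?A <= normHm1 \<Omega> F * sqrt ?A"
   using normHm1_bound[OF F sum_in_H10[where c="?c" and N=N]]
   unfolding normH1_eq_sqrt[OF sum_in_H10[where c="?c" and N=N]] Fv qv by linarith
  moreover have "0 <= ?A" by (intro sum_nonneg a0)
  ultimately have *: "sqrt ?A * sqrt ?A <= normHm1 \<Omega> F * sqrt ?A" by simp
  have "sqrt ?A <= normHm1 \<Omega> F"
  proof (cases "?A = 0")
   case True
   then show ?thesis using normHm1_nonneg[OF F] by simp
  next
   case False
   then show ?thesis using \<open>0 <= ?A\<close> by (intro mult_right_le_imp_le[OF *]) simp
  qed
  then show ?thesis using \<open>0 <= ?A\<close> real_le_rsqrt real_sqrt_le_iff sqrt_le_D by blast
 qed
 have su: "summable ?a" by (rule summableI_nonneg_bounded[OF a0 bes])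
 have le: "suminf ?a <= (normHm1 \<Omega> F)\<^sup>2" by (rule suminf_le_const[OF su bes])
 have "normHm1 \<Omega> F <= sqrt (suminf ?a)"
  unfolding normHm1_def
 proof (rule cSUP_least)
  show "{v \<in> H10 \<Omega>. normH1 \<Omega> v <= 1} \<noteq> {}" using H10_zero normH1_eq_sqrt[OF H10_zero] CF.q.ip_zero[OF H10_zero] by auto
  fix v assume "v \<in> {v \<in> H10 \<Omega>. normH1 \<Omega> v <= 1}"
  then have v: "v \<in> H10 \<Omega>" and "(normH1 \<Omega> v)\<^sup>2 <= 1\<^sup>2" using power_mono[OF _ normH1_nonneg, of v 1 2] by auto
  then have v1: "q_form v v <= 1" using normH1_sq[OF v] by simp
  let ?S = "%N x. \<Sum>k<N. m_form v (e k) * e k x"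
  have "(F (?S N))\<^sup>2 <= suminf ?a" for N
  proof -
   \<comment> \<open>Splitting by the square root of \<open>\<kappa> k\<close> matches the weight of
     the H1 norm in one factor with the inverse weight in the other.\<close>
   have "F (?S N) = (\<Sum>k<N. (sqrt (\<kappa> k) * m_form v (e k)) * (F (e k) / sqrt (\<kappa> k)))"
    unfolding Hm1_sum[OF F e_in] by (intro sum.cong refl) (use kap_pos in \<open>simp add: less_imp_neq[symmetric]\<close>)
   then have "(F (?S N))\<^sup>2 <= (\<Sum>k<N. (sqrt (\<kappa> k) * m_form v (e k))\<^sup>2) * (\<Sum>k<N. (F (e k) / sqrt (\<kappa> k))\<^sup>2)"
    by (simp only: Cauchy_Schwarz_ineq_sum)
   also have "... = (\<Sum>k<N. \<kappa> k * (m_form v (e k))\<^sup>2) * (\<Sum>k<N. ?a k)"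
    using kap_pos by (simp add: power_mult_distrib power_divide less_imp_le)
   also have "... <= 1 * suminf ?a"
   proof (rule mult_mono)
    have "(\<Sum>k<N. \<kappa> k * (m_form v (e k))\<^sup>2) <= q_form v v"
     using sums_unique[OF q_sums[OF v]] sum_le_suminf[OF sums_summable[OF q_sums[OF v]], of "{..<N}"] kap_pos
     by (simp add: less_imp_le)
    then show "(\<Sum>k<N. \<kappa> k * (m_form v (e k))\<^sup>2) <= 1" using v1 by linarith
    show "(\<Sum>k<N. ?a k) <= suminf ?a" by (intro sum_le_suminf su) (use a0 in auto)
   qed (auto intro!: sum_nonneg a0)
   finally show ?thesis by simp
  qed
  then have b: "\<bar>F (?S N)\<bar> <= sqrt (suminf ?a)" for N by (intro real_le_rsqrt) simp
  have "(%N. F v - F (?S N)) ----> 0"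
  proof (rule Lim_null_comparison)
   let ?r = "%N x. v x - ?S N x"
   have "F v - F (?S N) = F (?r N)" for N
    using Hm1_lincomb[OF F v sum_in_H10, of 1 "-1"] by simp
   then show "\<forall>\<^sub>F N in sequentially. norm (F v - F (?S N)) <= normHm1 \<Omega> F * sqrt (q_form (?r N) (?r N))"
    using normHm1_bound[OF F remainder(1)[OF v]] normH1_eq_sqrt[OF remainder(1)[OF v]] by simp
   have "(%N. normHm1 \<Omega> F * sqrt (q_form (?r N) (?r N))) ----> normHm1 \<Omega> F * sqrt 0"
    by (intro tendsto_intros expansion v)
   then show "(%N. normHm1 \<Omega> F * sqrt (q_form (?r N) (?r N))) ----> 0" by simp
  qed
  then have "(%N. F (?S N)) ----> F v"
   using tendsto_diff[OF tendsto_const[of "F v"]] by fastforce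
  then have "(%N. \<bar>F (?S N)\<bar>) ----> \<bar>F v\<bar>" by (rule tendsto_rabs)
  then show "\<bar>F v\<bar> <= sqrt (suminf ?a)" by (rule LIMSEQ_le_const2) (use b in auto)
 qed
 then have "(normHm1 \<Omega> F)\<^sup>2 <= suminf ?a"
  using power_mono[OF _ normHm1_nonneg[OF F], of "sqrt (suminf ?a)" 2] suminf_nonneg[OF su a0] by simp
 then show ?thesis using le su by (simp add: sums_iff)
qed

lemma neg_Laplace_e: "u \<in> H10 \<Omega> ==> neg_Laplace \<Omega> u (e k) = (\<kappa> k - 1) * m_form u (e k)"
 using eigenvalue[of u k] CF.q.ip_sym[OF _ e_in, of u k] CF.m.ip_sym[OF _ e_in, of u k]
 by (simp add: neg_Laplace_eq a_form_q_form algebra_simps)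

end

section \<open>Weak derivatives in time\<close>

lemma test_deriv:
 fixes \<phi> :: "real => real"
 assumes "\<phi> \<in> test_functions S"
 shows "(\<phi> has_real_derivative deriv \<phi> t) (at t)" "deriv \<phi> = grad \<phi>"
proof -
 have "(\<phi> has_real_derivative grad \<phi> t) (at t)" for t
  using smooth_fun_has_derivative_grad[OF test_smooth[OF assms], of t]
  by (simp add: has_field_derivative_def)
 moreover from this show "deriv \<phi> = grad \<phi>" by (auto simp: fun_eq_iff dest: DERIV_imp_deriv)
 ultimately show "(\<phi> has_real_derivative deriv \<phi> t) (at t)" by simp
qed

lemma integrable_bounded_mult:
 fixes f g :: "'x => real"
 assumes "integrable M f" "g \<in> borel_measurable M" "!!x. \<bar>g x\<bar> <= B"
 shows "integrable M (%x. g x * f x)"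
proof (rule integrable_dominated)
 show "integrable M (%x. B * f x)" using assms(1) by simp
 have "\<bar>g x\<bar> <= \<bar>B\<bar>" for x using assms(3)[of x] by linarith
 then show "AE x in M. norm (g x * f x) <= norm (B * f x)"
  by (auto intro!: AE_I2 mult_right_mono simp: abs_mult)
qed (use assms in auto)

locale time_interval =
 fixes T :: real
 assumes T_pos: "0 < T"
begin

sublocale I: bdomain "{0<..<T}"
 by unfold_locales auto

abbreviation "J \<equiv> lebesgue_on {0<..<T}"

lemma sqint_continuous:
 assumes "continuous_on UNIV (g :: real => real)"
 shows "sqint J g"
proof -
 have "compact (g ` {0..T})" by (intro compact_continuous_image continuous_on_subset[OF assms]) auto
 then obtain B where "\<forall>x\<in>{0..T}. \<bar>g x\<bar> <= B" by (auto dest!: compact_imp_bounded simp: bounded_iff)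
 then show ?thesis
  by (intro I.sqint_bounded[of _ B] borel_measurable_continuous_lebesgue_on assms) auto
qed

lemma borel_measurable_J: "f \<in> borel_measurable borel ==> f \<in> borel_measurable J"
 by (intro measurable_restrict_space1 measurable_completion) simp

lemma sqint_indicator_mult: "sqint J g ==> A \<in> sets borel ==> sqint J (%x. indicator A x * (g x :: real))"
 using sqint_bounded_mult[of J g "indicator A" 1] borel_measurable_J[of "indicator A"] by (simp add: indicator_le_1)

lemma LINT_deriv:
 assumes G: "!!x. (G has_real_derivative g x) (at x)" and g: "continuous_on UNIV g" and st: "0 <= s" "s <= t" "t <= T"
 shows "(LINT x|J. indicator {s..t} x * g x) = G t - G s"
proof -
 have "integrable J (%x. indicator {s..t} x * g x)"
  by (intro I.sqint_L1 sqint_indicator_mult sqint_continuous g) auto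
 then have "(LINT x|J. indicator {s..t} x * g x) = integral {0<..<T} (%x. indicator {s..t} x * g x)"
  by (rule lebesgue_integral_eq_integral) auto
 also have "... = integral {0..T} (%x. if x \<in> {s..t} then g x else 0)"
  unfolding integral_open_interval_real by (intro Henstock_Kurzweil_Integration.integral_cong) auto
 also have "... = integral {s..t} g"
  unfolding Henstock_Kurzweil_Integration.integral_restrict_Int
  by (rule arg_cong[where f="%A. integral A g"]) (use st in auto)
 also have "... = G t - G s"
  using G st by (intro integral_unique fundamental_theorem_of_calculus)
   (auto simp: has_real_derivative_iff_has_vector_derivative[symmetric] intro: has_field_derivative_at_within)
 finally show ?thesis .
qed

text \<open>Serves two kernels on the square of the time interval: the indicator of s <= t, for
  primitives, and the exponential decay kernel. Boundedness of the kernel makes the integrand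
  integrable over the square.\<close>

lemma kernel_Fubini:
 fixes k :: "real => real => real" and p :: "real => real"
 assumes p: "integrable J p" and k: "(%(t, s). k t s) \<in> borel_measurable (borel \<Otimes>\<^sub>M borel)"
  and B: "!!t s. t \<in> {0<..<T} ==> s \<in> {0<..<T} ==> \<bar>k t s\<bar> <= B"
 shows "integrable J (%t. LINT s|J. k t s * p s)" "integrable J (%s. p s * (LINT t|J. k t s))"
  and "(LINT t|J. LINT s|J. k t s * p s) = (LINT s|J. p s * (LINT t|J. k t s))"
  and "t \<in> {0<..<T} ==> integrable J (%s. k t s * p s)"
proof -
 interpret J: finite_measure J by (rule I.finite_M)
 interpret P: pair_sigma_finite J J by unfold_locales
 have id: "(%x. x) \<in> measurable J borel" by (rule borel_measurable_J) simp
 have pm [measurable]: "p \<in> borel_measurable J" using p by auto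
 have k': "(%x. case x of (t, s) => k t s) \<in> borel_measurable (J \<Otimes>\<^sub>M J)"
 proof -
  have "(%x. (fst x, snd x)) \<in> (J \<Otimes>\<^sub>M J) \<rightarrow>\<^sub>M borel \<Otimes>\<^sub>M borel"
   by (intro measurable_Pair measurable_compose[OF measurable_fst id] measurable_compose[OF measurable_snd id])
  from measurable_compose[OF this k] show ?thesis by (simp add: split_beta')
 qed
 have km: "(%(t, s). k t s * p s) \<in> borel_measurable (J \<Otimes>\<^sub>M J)"
  using k' by (simp add: split_beta')
 have k1: "k t \<in> borel_measurable J" if "t \<in> {0<..<T}" for t
  using measurable_compose_Pair1[OF _ k', of t] that by simp
 have bd: "norm (k t s * p s) <= norm (B * p s)" if "t \<in> {0<..<T}" "s \<in> {0<..<T}" for t s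
 proof -
  have "\<bar>k t s\<bar> <= \<bar>B\<bar>" using B[OF that] by linarith
  then show ?thesis by (simp add: abs_mult mult_right_mono)
 qed
 have Bp: "integrable J (%s. B * p s)" using p by simp
 show inner: "integrable J (%s. k t s * p s)" if "t \<in> {0<..<T}" for t
  by (rule integrable_dominated[OF Bp])
   (use bd[OF that] k1[OF that] in \<open>auto intro!: AE_I2\<close>)
 have int: "integrable (J \<Otimes>\<^sub>M J) (%(t, s). k t s * p s)"
 proof (rule P.Fubini_integrable[OF km])
  show "AE t in J. integrable J (%s. case (t, s) of (t, s) => k t s * p s)"
   by (rule AE_I2) (simp add: inner)
  show "integrable J (%t. LINT s|J. norm (case (t, s) of (t, s) => k t s * p s))"
  proof (rule J.integrable_const_bound[where B="LINT s|J. norm (B * p s)"])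
   show "(%t. LINT s|J. norm (case (t, s) of (t, s) => k t s * p s)) \<in> borel_measurable J"
    using km by measurable
   show "AE t in J. norm (LINT s|J. norm (case (t, s) of (t, s) => k t s * p s)) <= (LINT s|J. norm (B * p s))"
    using inner bd Bp by (intro AE_I2) (auto intro!: integral_mono)
  qed
 qed
 show "integrable J (%t. LINT s|J. k t s * p s)" using P.integrable_fst[OF int] by simp
 show "integrable J (%s. p s * (LINT t|J. k t s))"
  using P.integrable_snd[OF int] by (simp add: mult.commute)
 show "(LINT t|J. LINT s|J. k t s * p s) = (LINT s|J. p s * (LINT t|J. k t s))"
  using P.Fubini_integral[of "%t s. k t s * p s"] int by (simp add: mult.commute)
qed

text \<open>A primitive is constant on each side of the support of \<open>\<psi>\<close>. Mean zero
  makes the two constants equal, and subtracting them gives compact support.\<close>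

lemma test_primitive:
 assumes \<psi>: "\<psi> \<in> test_functions {0<..<T}" and z: "(LINT t|J. \<psi> t) = 0"
 obtains \<Phi> where "\<Phi> \<in> test_functions {0<..<T}" "deriv \<Phi> = \<psi>"
proof -
 have cont: "continuous_on UNIV \<psi>" using smooth_fun_continuous[OF test_smooth[OF \<psi>]] .
 have "\<exists>F. \<forall>x :: real. (-\<infinity> :: ereal) < x \<longrightarrow> x < (\<infinity> :: ereal) \<longrightarrow> (F has_vector_derivative \<psi> x) (at x)"
  by (rule einterval_antiderivative) (use cont in \<open>auto simp: continuous_on_eq_continuous_at\<close>)
 then obtain F where F: "!!x. (F has_real_derivative \<psi> x) (at x)"
  by (auto simp: has_real_derivative_iff_has_vector_derivative)
 obtain K where K: "compact K" "K \<subseteq> {0<..<T}" "!!x. x \<notin> K ==> \<psi> x = 0"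
  using test_obtain[OF \<psi>] by metis
 obtain \<alpha> \<beta> where ab: "K \<subseteq> {\<alpha>..\<beta>}" "0 < \<alpha>" "\<beta> < T"
 proof (cases "K = {}")
  case True
  then show ?thesis using that[of "T/2" "T/2"] T_pos by auto
 next
  case False
  obtain m where "m \<in> K" "\<forall>x\<in>K. m <= x" using compact_attains_inf[OF K(1) False] by auto
  moreover obtain n where "n \<in> K" "\<forall>x\<in>K. x <= n" using compact_attains_sup[OF K(1) False] by auto
  ultimately show ?thesis using K(2) by (intro that[of m n]) auto
 qed
 have off: "\<psi> x = 0" if "x < \<alpha> \<or> \<beta> < x" for x using K(3)[of x] ab(1) that by force
 have F0: "(F has_real_derivative 0) (at x within S)" if "x < \<alpha> \<or> \<beta> < x" for x S
  using has_field_derivative_at_within[OF F[of x], of S] off[OF that] by simp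
 have "\<exists>c. \<forall>x\<in>{..<\<alpha>}. F x = c"
  by (rule has_field_derivative_zero_constant) (use F0 in auto)
 then obtain c where c: "!!x. x < \<alpha> ==> F x = c" by auto
 have "\<exists>d. \<forall>x\<in>{\<beta><..}. F x = d"
  by (rule has_field_derivative_zero_constant) (use F0 in auto)
 then obtain d where d: "!!x. x > \<beta> ==> F x = d" by auto
 have "F T - F 0 = (LINT x|J. indicator {0..T} x * \<psi> x)"
  using LINT_deriv[OF F cont, of 0 T] T_pos by simp
 also have "... = (LINT x|J. \<psi> x)" by (intro LINT_cong) auto
 finally have cd: "d = c" using z c[of 0] d[of T] ab by simp
 let ?\<Phi> = "%x. F x - c"
 have D: "(?\<Phi> has_real_derivative \<psi> x) (at x)" for x using F[of x] by (auto intro!: derivative_eq_intros)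
 have "smooth_fun ?\<Phi>"
 proof (rule smooth_funI)
  show "(?\<Phi> has_derivative (%h. \<psi> x * h)) (at x)" for x using D[of x] by (simp add: has_field_derivative_def)
  show "smooth_fun (%x. \<psi> x * b)" for b by (intro smooth_fun_mult smooth_fun_const test_smooth[OF \<psi>])
 qed
 moreover have "\<exists>K. compact K \<and> K \<subseteq> {0<..<T} \<and> (\<forall>x. x \<notin> K \<longrightarrow> ?\<Phi> x = 0)"
  by (intro exI[of _ "{\<alpha>..\<beta>}"]) (use c d cd ab in \<open>auto simp: not_le\<close>)
 ultimately have "?\<Phi> \<in> test_functions {0<..<T}" by (simp add: test_functions_iff)
 moreover have "deriv ?\<Phi> = \<psi>" using D DERIV_imp_deriv by (fastforce simp: fun_eq_iff)
 ultimately show ?thesis by (rule that)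
qed

text \<open>Zero weak derivative means orthogonality to all derivatives of test functions, that is,
  to all test functions of mean zero. Correcting a test function by a multiple of a fixed
  \<open>\<rho>\<close> identifies the constant.\<close>

lemma du_Bois_Reymond:
 assumes h: "integrable J h" and z: "!!\<phi>. \<phi> \<in> test_functions {0<..<T} ==> (LINT t|J. deriv \<phi> t * h t) = 0"
 obtains c where "AE t in J. h t = c"
proof -
 interpret finite_measure J by (rule I.finite_M)
 have hi: "integrable J (%t. (h t - c) * \<psi> t)" if \<psi>: "\<psi> \<in> test_functions {0<..<T}" for \<psi> c
 proof -
  obtain B where "!!x. \<bar>\<psi> x\<bar> <= B" using test_bounded[OF \<psi>] by metis
  then have "integrable J (%t. \<psi> t * (h t - c))"
   by (intro integrable_bounded_mult) (use h test_measurable(3)[OF \<psi>] in auto)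
  then show ?thesis by (simp add: mult.commute)
 qed
 have z0: "(LINT t|J. h t * \<psi> t) = 0" if \<psi>: "\<psi> \<in> test_functions {0<..<T}" and 0: "(LINT t|J. \<psi> t) = 0" for \<psi>
  using test_primitive[OF \<psi> 0] z by (metis (no_types, lifting) LINT_cong mult.commute)
 show ?thesis
 \<comment> \<open>If no test function had a nonzero integral, every one would have mean zero and h
   itself would vanish almost everywhere; this replaces the construction of a
   \<open>\<rho>\<close>.\<close>
 proof (cases "\<exists>\<rho>\<in>test_functions {0<..<T}. (LINT t|J. \<rho> t) \<noteq> 0")
  case False
  have "AE t in J. h t = 0"
   by (rule fundamental_lemma[OF I.open_\<Omega> h]) (use False z0 in auto)
  then show ?thesis by (rule that)
 next
  case True
  then obtain \<rho> where \<rho>: "\<rho> \<in> test_functions {0<..<T}" "(LINT t|J. \<rho> t) \<noteq> 0" by auto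
  define c where "c = (LINT t|J. h t * \<rho> t) / (LINT t|J. \<rho> t)"
  have "AE t in J. h t - c = 0"
  proof (rule fundamental_lemma[OF I.open_\<Omega>])
   show "integrable J (%t. h t - c)" using h by simp
   fix \<psi> assume \<psi>: "\<psi> \<in> test_functions {0<..<T}"
   \<comment> \<open>Subtracting \<open>?m\<close> times \<open>\<rho>\<close> from
     \<open>\<psi>\<close> leaves a test function of mean zero.\<close>
   let ?m = "(LINT t|J. \<psi> t) / (LINT t|J. \<rho> t)"
   note i = I.sqint_L1[OF I.test_sqint(1)]
   have "(LINT t|J. h t * (1 * \<psi> t + (- ?m) * \<rho> t)) = 0"
    by (rule z0[OF test_lincomb[OF \<psi> \<rho>(1)]]) (use i[OF \<psi>] i[OF \<rho>(1)] \<rho>(2) in simp)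
   also have "(%t. h t * (1 * \<psi> t + (- ?m) * \<rho> t)) = (%t. h t * \<psi> t - ?m * (h t * \<rho> t))" by (auto simp: algebra_simps)
   finally have "(LINT t|J. h t * \<psi> t) = ?m * (LINT t|J. h t * \<rho> t)"
    using hi[OF \<psi>, of 0] hi[OF \<rho>(1), of 0] by simp
   then show "(LINT t|J. (h t - c) * \<psi> t) = 0"
    using hi[OF \<psi>, of 0] i[OF \<psi>] by (simp add: left_diff_distrib c_def)
  qed
  then show ?thesis by (intro that[of c]) auto
 qed
qed

text \<open>By Fubini the primitive of p has weak derivative p, so its difference from h has weak
  derivative zero. Writing the primitive with an indicator kernel puts it in the form of
  \<open>kernel_Fubini\<close>.\<close>

lemma weak_derivative_primitive:
 assumes h: "integrable J h" and p: "integrable J p"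
  and w: "!!\<phi>. \<phi> \<in> test_functions {0<..<T} ==> (LINT t|J. deriv \<phi> t * h t) = - (LINT t|J. \<phi> t * p t)"
 obtains c where "AE t in J. h t = c + (LINT s|J. indicator {s..} t * p s)"
proof -
 define P where "P t = (LINT s|J. indicator {s..} t * p s)" for t
 have i1: "(%(t::real, s). indicator {s..} t :: real) = (%x. if snd x <= fst x then 1 else 0)" by (auto simp: fun_eq_iff)
 have im: "(%(t::real, s). indicator {s..} t :: real) \<in> borel_measurable (borel \<Otimes>\<^sub>M borel)"
  unfolding i1 by measurable
 have Pi: "integrable J P" unfolding P_def by (rule kernel_Fubini(1)[OF p im, of 1]) auto
 show ?thesis
 proof (rule du_Bois_Reymond)
  show "integrable J (%t. h t - P t)" using h Pi by simp
  fix \<phi> assume \<phi>: "\<phi> \<in> test_functions {0<..<T}"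
  obtain B where B: "!!x. norm (grad \<phi> x) <= B" using test_bounded[OF \<phi>] by metis
  have d: "deriv \<phi> = grad \<phi>" by (rule test_deriv(2)[OF \<phi>])
  have dm [measurable]: "grad \<phi> \<in> borel_measurable borel" by (rule test_measurable(2)[OF \<phi>])
  have dc: "continuous_on UNIV (grad \<phi>)" by (rule continuous_on_grad[OF test_smooth[OF \<phi>]])
  obtain K where K: "K \<subseteq> {0<..<T}" "!!x. x \<notin> K ==> \<phi> x = 0" using test_obtain[OF \<phi>] by metis
  have km: "(%(t, s). grad \<phi> t * indicator {s..} t) \<in> borel_measurable (borel \<Otimes>\<^sub>M borel)"
   using im by (simp add: split_beta')
  have kb: "\<bar>grad \<phi> t * indicator {s..} t\<bar> <= B" for t s
   using B[of t] order_trans[OF norm_ge_zero B[of t]] by (auto simp: indicator_def)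
  have "(LINT t|J. grad \<phi> t * P t) = (LINT t|J. LINT s|J. (grad \<phi> t * indicator {s..} t) * p s)"
   by (simp add: P_def mult.assoc)
  also have "... = (LINT s|J. p s * (LINT t|J. grad \<phi> t * indicator {s..} t))"
   by (rule kernel_Fubini(3)[OF p km kb])
  also have "... = (LINT s|J. - (\<phi> s * p s))"
  proof (rule LINT_cong[OF refl])
   fix s assume "s \<in> space J"
   then have s: "0 < s" "s < T" by auto
   have "(LINT t|J. grad \<phi> t * indicator {s..} t) = (LINT t|J. indicator {s..T} t * grad \<phi> t)"
    by (intro LINT_cong) (auto simp: indicator_def)
   also have "(LINT t|J. indicator {s..T} t * grad \<phi> t) = \<phi> T - \<phi> s"
    by (rule LINT_deriv) (use s test_deriv[OF \<phi>] dc in auto)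
   finally have "(LINT t|J. grad \<phi> t * indicator {s..} t) = \<phi> T - \<phi> s" .
   moreover have "\<phi> T = 0" by (rule K(2)) (use K(1) in auto)
   ultimately show "p s * (LINT t|J. grad \<phi> t * indicator {s..} t) = - (\<phi> s * p s)" by simp
  qed
  finally have 1: "(LINT t|J. grad \<phi> t * P t) = (LINT t|J. grad \<phi> t * h t)" using w[OF \<phi>] by (simp add: d)
  have gi: "integrable J (%t. grad \<phi> t * f t)" if "integrable J f" for f
   by (intro integrable_bounded_mult[of _ _ _ B]) (use that B dm in \<open>auto intro: borel_measurable_J\<close>)
  then show "(LINT t|J. deriv \<phi> t * (h t - P t)) = 0"
   using 1 gi[OF h] gi[OF Pi] by (simp add: d right_diff_distrib)
 next
  fix c assume "AE t in J. h t - P t = c"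
  then have "AE t in J. h t = c + P t" by eventually_elim auto
  then show ?thesis unfolding P_def by (rule that)
 qed
qed

end

section \<open>Duhamel's formula for a single mode\<close>

context time_interval
begin

definition kernel :: "real => real => real => real" where
 "kernel \<mu> t s = (if s <= t then exp (- \<mu> * (t - s)) else 0)"

definition duhamel :: "real => (real => real) => real => real" where
 "duhamel \<mu> f t = (LINT s|J. kernel \<mu> t s * f s)"

lemma kernel_bounds: "0 <= \<mu> ==> 0 <= kernel \<mu> t s" "0 <= \<mu> ==> kernel \<mu> t s <= 1"
 by (auto simp: kernel_def)

lemma kernel_measurable: "(%(t, s). kernel \<mu> t s) \<in> borel_measurable (borel \<Otimes>\<^sub>M borel)"
proof -
 have eq: "(%(t, s). kernel \<mu> t s) = (%x. if snd x <= fst x then exp (- \<mu> * (fst x - snd x)) else 0)"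
  by (auto simp: kernel_def fun_eq_iff)
 show ?thesis unfolding eq by measurable
qed

lemma sqint_kernel: "sqint J (kernel \<mu> t)" "sqint J (%t. kernel \<mu> t s)"
proof -
 have 1: "kernel \<mu> t = (%s. indicator {..t} s * exp (- \<mu> * (t - s)))"
  and 2: "(%t. kernel \<mu> t s) = (%t. indicator {s..} t * exp (- \<mu> * (t - s)))"
  by (auto simp: kernel_def fun_eq_iff)
 show "sqint J (kernel \<mu> t)" "sqint J (%t. kernel \<mu> t s)"
  unfolding 1 2 by (intro sqint_indicator_mult sqint_continuous continuous_intros; simp)+
qed

text \<open>The factor \<open>1 + \<mu>\<close> is the weight of the H1 norm on the mode, and the
  bound does not depend on \<open>\<mu>\<close>. The kernel is at most 1, which contributes at most
  T; \<open>\<mu>\<close> times the kernel has an explicit primitive and contributes at most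
  1.\<close>

lemma kernel_integral_fst:
 assumes \<mu>: "0 <= \<mu>" and s: "0 <= s" "s <= T"
 shows "(1 + \<mu>) * (LINT t|J. kernel \<mu> t s) <= T + 1"
proof -
 let ?g = "%t. 1 + \<mu> * exp (- \<mu> * (t - s))"
 have c: "continuous_on UNIV ?g" by (intro continuous_intros)
 have "(1 + \<mu>) * (LINT t|J. kernel \<mu> t s) = (LINT t|J. (1 + \<mu>) * kernel \<mu> t s)" by simp
 also have "... <= (LINT t|J. indicator {s..T} t * ?g t)"
 proof (rule integral_mono)
  show "integrable J (%t. (1 + \<mu>) * kernel \<mu> t s)" using I.sqint_L1[OF sqint_kernel(2)] by simp
  show "integrable J (%t. indicator {s..T} t * ?g t)" by (intro I.sqint_L1 sqint_indicator_mult sqint_continuous c) simp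
  show "(1 + \<mu>) * kernel \<mu> t s <= indicator {s..T} t * ?g t" if "t \<in> space J" for t
   using that \<mu> by (auto simp: kernel_def indicator_def algebra_simps mult_left_mono)
 qed
 also have "... = (T - exp (- \<mu> * (T - s))) - (s - exp (- \<mu> * (s - s)))"
  by (rule LINT_deriv[OF _ c]) (use s in \<open>auto intro!: derivative_eq_intros\<close>)
 also have "... <= T + 1" using s less_imp_le[OF exp_gt_zero[of "- \<mu> * (T - s)"]] by (simp del: exp_ge_zero)
 finally show ?thesis .
qed

lemma kernel_integral_snd:
 assumes \<mu>: "0 <= \<mu>" and t: "0 <= t" "t <= T"
 shows "(1 + \<mu>) * (LINT s|J. kernel \<mu> t s) <= T + 1"
proof -
 let ?g = "%s. 1 + \<mu> * exp (- \<mu> * (t - s))"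
 have c: "continuous_on UNIV ?g" by (intro continuous_intros)
 have "(1 + \<mu>) * (LINT s|J. kernel \<mu> t s) = (LINT s|J. (1 + \<mu>) * kernel \<mu> t s)" by simp
 also have "... <= (LINT s|J. indicator {0..t} s * ?g s)"
 proof (rule integral_mono)
  show "integrable J (%s. (1 + \<mu>) * kernel \<mu> t s)" using I.sqint_L1[OF sqint_kernel(1)] by simp
  show "integrable J (%s. indicator {0..t} s * ?g s)" by (intro I.sqint_L1 sqint_indicator_mult sqint_continuous c) simp
  show "(1 + \<mu>) * kernel \<mu> t s <= indicator {0..t} s * ?g s" if "s \<in> space J" for s
   using that \<mu> by (auto simp: kernel_def indicator_def algebra_simps mult_left_mono)
 qed
 also have "... = (t + exp (- \<mu> * (t - t))) - (0 + exp (- \<mu> * (t - 0)))"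
  by (rule LINT_deriv[OF _ c]) (use t in \<open>auto intro!: derivative_eq_intros\<close>)
 also have "... <= T + 1" using t less_imp_le[OF exp_gt_zero[of "- \<mu> * (t - 0)"]] by (simp del: exp_ge_zero)
 finally show ?thesis .
qed

text \<open>Schur's test: the kernel is split into square roots before Cauchy-Schwarz. One factor
  integrates to the gain; the other kernel stays under the integral, so that
  \<open>duhamel_L2\<close> can integrate it in t for a second gain.\<close>

lemma duhamel_sq:
 assumes \<mu>: "0 <= \<mu>" and f: "sqint J f" and t: "0 <= t" "t <= T"
 shows "(1 + \<mu>) * (duhamel \<mu> f t)\<^sup>2 <= (T + 1) * (LINT s|J. kernel \<mu> t s * (f s)\<^sup>2)"
proof -
 note kb = kernel_bounds[OF \<mu>]
 let ?r = "%s. sqrt (kernel \<mu> t s)"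
 have km: "kernel \<mu> t \<in> borel_measurable J" using sqint_kernel(1) sqint_measurable by blast
 have r: "sqint J ?r" by (rule I.sqint_bounded[of _ 1]) (use km kb in auto)
 have rf: "sqint J (%s. ?r s * f s)"
  using sqint_bounded_mult[OF f, of ?r 1] km kb by simp
 have "(duhamel \<mu> f t)\<^sup>2 = (LINT s|J. ?r s \<bullet> (?r s * f s))\<^sup>2"
  unfolding duhamel_def using kb by (simp add: mult.assoc[symmetric])
 also have "... <= (LINT s|J. nsq (?r s)) * (LINT s|J. nsq (?r s * f s))"
  by (rule CS_sq[OF r rf])
 also have "... = (LINT s|J. kernel \<mu> t s) * (LINT s|J. kernel \<mu> t s * (f s)\<^sup>2)"
  using kb by (simp add: abs_mult power_mult_distrib)
 finally have "(1 + \<mu>) * (duhamel \<mu> f t)\<^sup>2 <= (1 + \<mu>) * ((LINT s|J. kernel \<mu> t s) * (LINT s|J. kernel \<mu> t s * (f s)\<^sup>2))"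
  using \<mu> by (intro mult_left_mono) auto
 also have "... <= (T + 1) * (LINT s|J. kernel \<mu> t s * (f s)\<^sup>2)"
  unfolding mult.assoc[symmetric] using kb
  by (intro mult_right_mono kernel_integral_snd \<mu> t) (auto intro: integral_nonneg_AE)
 finally show ?thesis .
qed

lemma duhamel_bound:
 assumes \<mu>: "0 <= \<mu>" and f: "sqint J f" and t: "0 <= t" "t <= T"
 shows "(duhamel \<mu> f t)\<^sup>2 <= (T + 1) * (LINT s|J. (f s)\<^sup>2 / (1 + \<mu>))"
proof -
 note kb = kernel_bounds[OF \<mu>]
 have f2: "integrable J (%s. (f s)\<^sup>2)" using sqint_integrable[OF f] by simp
 have "(LINT s|J. kernel \<mu> t s * (f s)\<^sup>2) <= (LINT s|J. (f s)\<^sup>2)"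
 proof (rule integral_mono)
  show "integrable J (%s. kernel \<mu> t s * (f s)\<^sup>2)"
   by (rule integrable_bounded_mult[OF f2, of _ 1]) (use kb sqint_measurable[OF sqint_kernel(1)] in auto)
  show "kernel \<mu> t s * (f s)\<^sup>2 <= (f s)\<^sup>2" for s using kb by (intro mult_left_le_one_le) auto
 qed (rule f2)
 then have "(1 + \<mu>) * (duhamel \<mu> f t)\<^sup>2 <= (T + 1) * (LINT s|J. (f s)\<^sup>2)"
  using duhamel_sq[OF assms] T_pos by (smt (verit) mult_left_mono)
 then show ?thesis using \<mu> by (simp add: field_simps)
qed

lemma duhamel_measurable: "integrable J f ==> 0 <= \<mu> ==> duhamel \<mu> f \<in> borel_measurable J"
 using kernel_Fubini(1)[of f "kernel \<mu>" 1] kernel_measurable kernel_bounds unfolding duhamel_def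
 by (auto simp: abs_le_iff intro: order_trans[OF _ kernel_bounds(1)])

text \<open>Integrating \<open>duhamel_sq\<close> in time and exchanging the integrals uses the
  kernel bound in its other variable. Together the two bounds lead from the dual norm of the source
  to the H1 norm of the solution.\<close>

lemma duhamel_L2:
 assumes \<mu>: "0 <= \<mu>" and f: "sqint J f"
 shows "sqint J (duhamel \<mu> f)"
  and "(1 + \<mu>) * (LINT t|J. (duhamel \<mu> f t)\<^sup>2) <= (T + 1)\<^sup>2 * (LINT s|J. (f s)\<^sup>2 / (1 + \<mu>))"
proof -
 note kb = kernel_bounds[OF \<mu>]
 have f2: "integrable J (%s. (f s)\<^sup>2)" using sqint_integrable[OF f] by simp
 have kB: "\<bar>kernel \<mu> t s\<bar> <= 1" for t s using kb[of t s] by simp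
 note F = kernel_Fubini[OF f2 kernel_measurable kB]
 show w: "sqint J (duhamel \<mu> f)"
 proof (rule I.sqint_bounded)
  show "duhamel \<mu> f \<in> borel_measurable J" by (rule duhamel_measurable[OF I.sqint_L1[OF f] \<mu>])
  show "norm (duhamel \<mu> f t) <= sqrt ((T + 1) * (LINT s|J. (f s)\<^sup>2 / (1 + \<mu>)))" if "t \<in> {0<..<T}" for t
   using duhamel_bound[OF assms, of t] that by (auto intro: real_le_rsqrt)
 qed
 let ?Q = "%t. LINT s|J. kernel \<mu> t s * (f s)\<^sup>2"
 have w2: "integrable J (%t. (duhamel \<mu> f t)\<^sup>2)" using sqint_integrable[OF w] by simp
 have "(1 + \<mu>) * (LINT t|J. (duhamel \<mu> f t)\<^sup>2) = (LINT t|J. (1 + \<mu>) * (duhamel \<mu> f t)\<^sup>2)" by simp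
 also have "... <= (LINT t|J. (T + 1) * ?Q t)"
  by (rule integral_mono) (use w2 F(1) duhamel_sq[OF assms] in auto)
 also have "... = (T + 1) * (LINT s|J. (f s)\<^sup>2 * (LINT t|J. kernel \<mu> t s))" using F(3) by simp
 also have "... <= (T + 1) * (LINT s|J. (f s)\<^sup>2 * ((T + 1) / (1 + \<mu>)))"
 proof (rule mult_left_mono[OF integral_mono])
  show "(f s)\<^sup>2 * (LINT t|J. kernel \<mu> t s) <= (f s)\<^sup>2 * ((T + 1) / (1 + \<mu>))" if "s \<in> space J" for s
   using kernel_integral_fst[OF \<mu>, of s] that \<mu> by (intro mult_left_mono) (auto simp: field_simps)
 qed (use F(2) f2 T_pos in auto)
 also have "... = (T + 1)\<^sup>2 * (LINT s|J. (f s)\<^sup>2 / (1 + \<mu>))" by (simp add: power2_eq_square)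
 finally show "(1 + \<mu>) * (LINT t|J. (duhamel \<mu> f t)\<^sup>2) <= (T + 1)\<^sup>2 * (LINT s|J. (f s)\<^sup>2 / (1 + \<mu>))" .
qed

lemma duhamel_continuous:
 assumes \<mu>: "0 <= \<mu>" and f: "integrable J f"
 shows "continuous_on S (duhamel \<mu> f)"
 unfolding continuous_on_eq_continuous_within
proof
 fix t
 have kB: "\<bar>kernel \<mu> t s\<bar> <= 1" for t s using kernel_bounds[OF \<mu>, of t s] by simp
 have m: "(%s. kernel \<mu> t s * f s) \<in> borel_measurable J" for t
  using sqint_measurable[OF sqint_kernel(1)] f by auto
 show "continuous (at t within S) (duhamel \<mu> f)"
  unfolding continuous_within duhamel_def tendsto_at_iff_sequentially comp_def
 proof (intro allI impI)
  fix X assume X: "\<forall>i. X i \<in> S - {t}" and lim: "X ----> t"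
  show "(%n. LINT s|J. kernel \<mu> (X n) s * f s) ----> (LINT s|J. kernel \<mu> t s * f s)"
  proof (rule integral_dominated_convergence[where w="%s. \<bar>f s\<bar>"])
   show "AE s in J. (%n. kernel \<mu> (X n) s * f s) ----> kernel \<mu> t s * f s"
   proof -
    \<comment> \<open>For fixed s the kernel jumps in t only at t = s, so the pointwise limit fails
      at most at one value of s.\<close>
    have "AE s in J. s \<noteq> t"
     using AE_completion[OF AE_lborel_singleton[of t]] by (auto simp: AE_restrict_space_iff)
    then show ?thesis
    proof eventually_elim
     case (elim s)
     have e: "(%n. exp (- \<mu> * (X n - s))) ----> exp (- \<mu> * (t - s))" by (intro tendsto_intros lim)
     have "(%n. kernel \<mu> (X n) s) ----> kernel \<mu> t s"
     proof (cases "s < t")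
      case True
      have "\<forall>\<^sub>F n in sequentially. exp (- \<mu> * (X n - s)) = kernel \<mu> (X n) s"
       using order_tendstoD(1)[OF lim True] by eventually_elim (simp add: kernel_def)
      from Lim_transform_eventually[OF e this] show ?thesis using True by (simp add: kernel_def)
     next
      case False
      then have "t < s" using elim by simp
      have "\<forall>\<^sub>F n in sequentially. 0 = kernel \<mu> (X n) s"
       using order_tendstoD(2)[OF lim \<open>t < s\<close>] by eventually_elim (simp add: kernel_def)
      from Lim_transform_eventually[OF tendsto_const this] show ?thesis using \<open>t < s\<close> by (simp add: kernel_def)
     qed
     then show ?case by (intro tendsto_intros)
    qed
   qed
   show "AE s in J. norm (kernel \<mu> (X n) s * f s) <= \<bar>f s\<bar>" for n
    using kB by (intro AE_I2) (simp add: abs_mult mult_left_le_one_le)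
  qed (use m f in auto)
 qed
qed

text \<open>The integrating factor \<open>exp (\<mu> * t)\<close> is smooth, so it may be moved onto
  the test function. The product with h then has the weak derivative
  \<open>exp (\<mu> * t) * (p t + \<mu> * h t)\<close>, and \<open>weak_derivative_primitive\<close>
  applies.\<close>

lemma duhamel_representation:
 assumes \<mu>: "0 <= \<mu>" and h: "sqint J h" and p: "sqint J p"
  and w: "!!\<phi>. \<phi> \<in> test_functions {0<..<T} ==> (LINT t|J. deriv \<phi> t * h t) = - (LINT t|J. \<phi> t * p t)"
 obtains c where "AE t in J. h t = exp (- \<mu> * t) * c + duhamel \<mu> (%s. p s + \<mu> * h s) t"
proof -
 let ?E = "%t. exp (\<mu> * t)"
 have E: "sqint J (%t. ?E t * f t)" if "sqint J f" for f
 proof -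
  have b: "\<bar>?E t\<bar> <= exp (\<mu> * T)" if "t \<in> space J" for t using that \<mu> by (auto intro: mult_left_mono)
  have m: "?E \<in> borel_measurable J" by (intro borel_measurable_J borel_measurable_continuous_onI continuous_intros)
  from sqint_bounded_mult[OF that m b] show ?thesis by (simp only: real_scaleR_def)
 qed

 have sE: "smooth_fun ?E"
  by (intro smooth_fun_exp) (simp add: smooth_fun_def C_diff_linear bounded_linear_mult_right)
 show ?thesis
 proof (rule weak_derivative_primitive)
  show "integrable J (%t. ?E t * h t)" "integrable J (%t. ?E t * (p t + \<mu> * h t))"
   by (intro I.sqint_L1 E h sqint_add p sqint_cmult)+
  fix \<phi> assume \<phi>: "\<phi> \<in> test_functions {0<..<T}"
  let ?\<psi> = "%t. \<phi> t * ?E t"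
  have \<psi>: "?\<psi> \<in> test_functions {0<..<T}" by (rule test_mult[OF \<phi> sE])
  have d: "deriv ?\<psi> t = ?E t * deriv \<phi> t + \<mu> * (\<phi> t * ?E t)" for t
   by (rule DERIV_imp_deriv) (auto intro!: derivative_eq_intros test_deriv(1)[OF \<phi>])
  have s: "sqint J \<phi>" "sqint J (deriv \<phi>)" using I.test_sqint[OF \<phi>] test_deriv(2)[OF \<phi>] by auto
  note i = sqint_mult[OF s(2) E[OF h]] sqint_mult[OF s(1) E[OF h]] sqint_mult[OF s(1) E[OF p]]
  have "(LINT t|J. deriv ?\<psi> t * h t) = (LINT t|J. deriv \<phi> t * (?E t * h t) + \<mu> * (\<phi> t * (?E t * h t)))"
   unfolding d by (simp add: algebra_simps)
  also have "... = (LINT t|J. deriv \<phi> t * (?E t * h t)) + \<mu> * (LINT t|J. \<phi> t * (?E t * h t))"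
   using i by simp
  finally have "(LINT t|J. deriv \<phi> t * (?E t * h t)) = - (LINT t|J. \<phi> t * (?E t * p t)) - \<mu> * (LINT t|J. \<phi> t * (?E t * h t))"
   using w[OF \<psi>] by (simp add: mult.assoc)
  also have "... = - (LINT t|J. \<phi> t * (?E t * p t) + \<mu> * (\<phi> t * (?E t * h t)))" using i by simp
  also have "(%t. \<phi> t * (?E t * p t) + \<mu> * (\<phi> t * (?E t * h t))) = (%t. \<phi> t * (?E t * (p t + \<mu> * h t)))"
   by (auto simp: algebra_simps)
  finally show "(LINT t|J. deriv \<phi> t * (?E t * h t)) = - (LINT t|J. \<phi> t * (?E t * (p t + \<mu> * h t)))" .
 next
  fix c assume "AE t in J. ?E t * h t = c + (LINT s|J. indicator {s..} t * (?E s * (p s + \<mu> * h s)))"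
  then have "AE t in J. h t = exp (- \<mu> * t) * c + duhamel \<mu> (%s. p s + \<mu> * h s) t"
  proof eventually_elim
   case (elim t)
   have "h t = exp (- \<mu> * t) * (?E t * h t)" by (simp add: exp_minus)
   also have "... = exp (- \<mu> * t) * c + (LINT s|J. exp (- \<mu> * t) * (indicator {s..} t * (?E s * (p s + \<mu> * h s))))"
    unfolding elim distrib_left[of _ c] integral_mult_right_zero ..
   also have "(%s. exp (- \<mu> * t) * (indicator {s..} t * (?E s * (p s + \<mu> * h s)))) = (%s. kernel \<mu> t s * (p s + \<mu> * h s))"
    by (auto simp: kernel_def fun_eq_iff exp_diff exp_minus right_diff_distrib field_simps)
   finally show ?case by (simp add: duhamel_def)
  qed
  then show ?thesis by (rule that)
 qed
qed

text \<open>Recovers the initial coefficient from square integrals in time, uniformly in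
  \<open>\<mu>\<close>. The weight \<open>2 * (1 + \<mu>) * exp (- 2 * (1 + \<mu>) * t)\<close> has
  total mass at least \<open>1 - exp (- 2 * T)\<close>; using \<open>1 + \<mu>\<close> in place of
  \<open>\<mu>\<close> keeps this true at \<open>\<mu>\<close> = 0.\<close>

lemma initial_bound:
 assumes \<mu>: "0 <= \<mu>" and h: "sqint J h" and f: "sqint J f"
  and eq: "AE t in J. h t = exp (- \<mu> * t) * c + duhamel \<mu> f t"
 shows "(1 - exp (- 2 * T)) * c\<^sup>2 <= 4 * (1 + \<mu>) * (LINT t|J. (h t)\<^sup>2) + 4 * (T + 1)\<^sup>2 * (LINT t|J. (f t)\<^sup>2 / (1 + \<mu>))"
proof -
 note w = duhamel_L2[OF \<mu> f]
 have i: "integrable J (%t. (h t)\<^sup>2)" "integrable J (%t. (duhamel \<mu> f t)\<^sup>2)"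
  using sqint_integrable[OF h] sqint_integrable[OF w(1)] by auto
 let ?g = "%t. 2 * (1 + \<mu>) * exp (- 2 * (1 + \<mu>) * t)"
 have c: "continuous_on UNIV ?g" by (intro continuous_intros)
 have "(LINT x|J. indicator {0..T} x * ?g x) = - exp (- 2 * (1 + \<mu>) * T) - (- exp (- 2 * (1 + \<mu>) * 0))"
  by (rule LINT_deriv[OF _ c]) (use T_pos in \<open>auto intro!: derivative_eq_intros simp: algebra_simps\<close>)
 also have "(LINT x|J. indicator {0..T} x * ?g x) = (LINT x|J. ?g x)"
  by (intro LINT_cong) auto
 finally have "(LINT x|J. ?g x) = 1 - exp (- 2 * (1 + \<mu>) * T)" by simp
 moreover have "exp (- 2 * (1 + \<mu>) * T) <= exp (- 2 * T)"
  using mult_nonneg_nonneg[OF \<mu> less_imp_le[OF T_pos]] by (simp add: algebra_simps)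
 ultimately have "1 - exp (- 2 * T) <= (LINT x|J. ?g x)" by linarith
 then have "(1 - exp (- 2 * T)) * c\<^sup>2 <= (LINT x|J. ?g x) * c\<^sup>2" by (rule mult_right_mono) simp
 also have "... = (LINT x|J. ?g x * c\<^sup>2)" by simp
 also have "... <= (LINT x|J. 4 * (1 + \<mu>) * ((h x)\<^sup>2 + (duhamel \<mu> f x)\<^sup>2))"
 proof (rule integral_mono_AE)
  show "integrable J (%x. ?g x * c\<^sup>2)" using I.sqint_L1[OF sqint_continuous[OF c]] by simp
  show "AE x in J. ?g x * c\<^sup>2 <= 4 * (1 + \<mu>) * ((h x)\<^sup>2 + (duhamel \<mu> f x)\<^sup>2)"
   using eq AE_space
  proof eventually_elim
   case (elim x)
   then have x: "0 < x" by simp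
   have "exp (- 2 * (1 + \<mu>) * x) <= exp (- 2 * \<mu> * x)" using x by (simp add: algebra_simps)
   also have "... = (exp (- \<mu> * x))\<^sup>2" by (simp add: exp_double[symmetric] power2_eq_square mult_exp_exp)
   finally have "?g x * c\<^sup>2 <= 2 * (1 + \<mu>) * (exp (- \<mu> * x))\<^sup>2 * c\<^sup>2"
    using \<mu> by (intro mult_right_mono mult_left_mono) auto
   also have "... = 2 * (1 + \<mu>) * (h x - duhamel \<mu> f x)\<^sup>2" using elim by (simp add: power_mult_distrib)
   also have "... <= 2 * (1 + \<mu>) * (2 * ((h x)\<^sup>2 + (duhamel \<mu> f x)\<^sup>2))"
    using \<mu> norm_add_sq_le[of "h x" "- duhamel \<mu> f x"] by (intro mult_left_mono) auto
   also have "... = 4 * (1 + \<mu>) * ((h x)\<^sup>2 + (duhamel \<mu> f x)\<^sup>2)" by (simp add: algebra_simps)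
   finally show ?case .
  qed
 qed (use i in auto)
 also have "... = 4 * (1 + \<mu>) * (LINT t|J. (h t)\<^sup>2) + 4 * ((1 + \<mu>) * (LINT t|J. (duhamel \<mu> f t)\<^sup>2))"
  using i by (simp add: algebra_simps)
 finally show ?thesis using w(2) by linarith
qed

end

section \<open>Coefficients of the solution\<close>

lemma complete_lebesgue_on: "S \<in> sets lebesgue ==> complete_measure (lebesgue_on S)"
proof
 fix A B assume S: "S \<in> sets lebesgue" and BA: "B \<subseteq> A" and A: "A \<in> null_sets (lebesgue_on S)"
 then have "A \<in> null_sets lebesgue" "A \<subseteq> S" by (auto simp: null_sets_restrict_space)
 with BA S show "B \<in> sets (lebesgue_on S)"
  by (auto simp: sets_restrict_space_iff intro: completion.complete)
qed

lemma measurable_AE_cong: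
 fixes f g :: "'x => real"
 assumes "complete_measure M" "f \<in> borel_measurable M" "AE x in M. f x = g x"
 shows "g \<in> borel_measurable M"
proof (rule measurableI)
 interpret complete_measure M by fact
 fix A :: "real set" assume A: "A \<in> sets borel"
 show "g -` A \<inter> space M \<in> sets M"
 proof (rule in_sets_AE)
  show "AE x in M. x \<in> f -` A \<inter> space M \<longleftrightarrow> x \<in> g -` A \<inter> space M"
   using assms(3) by eventually_elim simp
  show "f -` A \<inter> space M \<in> sets M" using assms(2) A by (rule measurable_sets)
 qed simp
qed simp

lemma measurable_AE_limit:
 fixes f :: "nat => 'x => real"
 assumes "complete_measure M" "!!n. f n \<in> borel_measurable M" "AE x in M. (%n. f n x) ----> g x"
 shows "g \<in> borel_measurable M"
proof (rule measurable_AE_cong[OF assms(1)])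
 show "(%x. lim (%n. f n x)) \<in> borel_measurable M" using assms(2) by measurable
 show "AE x in M. lim (%n. f n x) = g x" using assms(3) by eventually_elim (rule limI)
qed

text \<open>Strong measurability gives approximation by simple functions in norm; a functional that
  is Lipschitz on \<open>X\<close> turns it into pointwise almost everywhere convergence of real
  functions. This is how the coefficients of u and of its time derivative become measurable.\<close>

lemma strongly_measurable_functional:
 assumes F: "strongly_measurable a b X nrm F"
  and L: "!!v w. v \<in> X ==> w \<in> X ==> \<bar>L v - L w\<bar> <= C * nrm (%y. v y - w y)"
 shows "(%t. L (F t)) \<in> borel_measurable (lebesgue_on {a<..<b})"
proof -
 obtain s where s: "!!k::nat. simple_function (lebesgue_on {a<..<b}) (s k)" "!!k t. s k t \<in> X"
  and lim: "AE t in lebesgue_on {a<..<b}. (%k. nrm (%y. F t y - s k t y)) ----> 0"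
  and X: "AE t in lebesgue_on {a<..<b}. F t \<in> X"
  using F unfolding strongly_measurable_def by blast
 show ?thesis
 proof (rule measurable_AE_limit)
  show "complete_measure (lebesgue_on {a<..<b})" by (rule complete_lebesgue_on) auto
  show "(%t. L (s k t)) \<in> borel_measurable (lebesgue_on {a<..<b})" for k
   using simple_function_compose1[OF s(1)] by (rule borel_measurable_simple_function)
  show "AE t in lebesgue_on {a<..<b}. (%k. L (s k t)) ----> L (F t)"
   using lim X
  proof eventually_elim
   case (elim t)
   have "(%k. C * nrm (%y. F t y - s k t y)) ----> C * 0" by (intro tendsto_intros elim(1))
   then have l: "(%k. C * nrm (%y. F t y - s k t y)) ----> 0" by simp
   have "(%k. L (s k t) - L (F t)) ----> 0"
    by (rule Lim_null_comparison[OF _ l]) (use L[OF elim(2) s(2)] in \<open>simp add: abs_minus_commute\<close>)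
   then show ?case by (rule LIM_zero_cancel)
  qed
 qed
qed

text \<open>Only the square of the norm is known to be measurable, and its root is the absolute
  value. The bars matter because \<open>normHm1\<close> is a supremum whose sign is known only for
  members of \<open>Hm1\<close>.\<close>

lemma L2_time_sqint: "F \<in> L2_time a b X nrm ==> sqint (lebesgue_on {a<..<b}) (%t. \<bar>nrm (F t)\<bar>)"
proof -
 assume "F \<in> L2_time a b X nrm"
 then have i: "integrable (lebesgue_on {a<..<b}) (%t. (nrm (F t))\<^sup>2)" by (simp add: L2_time_def)
 then have "(%t. \<bar>nrm (F t)\<bar>) \<in> borel_measurable (lebesgue_on {a<..<b})"
  using measurable_compose[OF borel_measurable_integrable[OF i], of sqrt borel] by simp
 then show ?thesis using i by (simp add: sqint_def)
qed

locale energy = eigen \<Omega> e \<kappa> + time_interval T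
 for \<Omega> :: "'a::euclidean_space set" and e \<kappa> and T :: real +
 fixes u :: "real => 'a => real"
 assumes u: "u \<in> energy_space \<Omega> T"
begin

definition tder :: "real => ('a => real) => real" where
 "tder = weak_tderiv \<Omega> 0 T (%s. L2_functional \<Omega> (u s))"

definition coef :: "nat => real => real" where
 "coef k t = m_form (u t) (e k)"

text \<open>The value of Lu on e k for almost every time, written so that the scalar equation of the
  mode can be read off.\<close>

definition force :: "nat => real => real" where
 "force k t = tder t (e k) + (\<kappa> k - 1) * coef k t"

lemma u_L2_time: "u \<in> L2_time 0 T (H10 \<Omega>) (normH1 \<Omega>)"
 using u by (simp add: energy_space_def)

lemma u_H10: "AE t in J. u t \<in> H10 \<Omega>"
 using u_L2_time by (auto simp: L2_time_def strongly_measurable_def)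

lemma normH1_u_sqint: "sqint J (%t. normH1 \<Omega> (u t))"
 using L2_time_sqint[OF u_L2_time] by simp

lemma tder: "tder \<in> L2_time 0 T (Hm1 \<Omega>) (normHm1 \<Omega>)" "has_weak_tderiv \<Omega> 0 T (%t. L2_functional \<Omega> (u t)) tder"
proof -
 have "\<exists>g. g \<in> L2_time 0 T (Hm1 \<Omega>) (normHm1 \<Omega>) \<and> has_weak_tderiv \<Omega> 0 T (%t. L2_functional \<Omega> (u t)) g"
  using u by (auto simp: energy_space_def H1_time_Hm1_def)
 from someI_ex[OF this]
 show "tder \<in> L2_time 0 T (Hm1 \<Omega>) (normHm1 \<Omega>)" "has_weak_tderiv \<Omega> 0 T (%t. L2_functional \<Omega> (u t)) tder"
  by (auto simp: tder_def weak_tderiv_def)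
qed

lemma tder_Hm1: "AE t in J. tder t \<in> Hm1 \<Omega>"
 using tder(1) by (auto simp: L2_time_def strongly_measurable_def)

lemma Hm1_functional_lipschitz:
 assumes "F \<in> Hm1 \<Omega>" "G \<in> Hm1 \<Omega>"
 shows "\<bar>F (e k) - G (e k)\<bar> <= normH1 \<Omega> (e k) * normHm1 \<Omega> (%v. F v - G v)"
 using normHm1_bound[OF Hm1_add(1)[OF assms, of 1 "-1"] e_in[of k]] by (simp add: mult.commute)

lemma sqint_L2_time_Hm1:
 assumes F: "F \<in> L2_time a b (Hm1 \<Omega>) (normHm1 \<Omega>)"
 shows "sqint (lebesgue_on {a<..<b}) (%t. F t (e k))"
proof (rule sqint_dominated[OF L2_time_sqint[OF F]])
 have s: "strongly_measurable a b (Hm1 \<Omega>) (normHm1 \<Omega>) F" using F by (simp add: L2_time_def)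
 show "(%t. F t (e k)) \<in> borel_measurable (lebesgue_on {a<..<b})"
  by (rule strongly_measurable_functional[OF s]) (rule Hm1_functional_lipschitz)
 have "AE t in lebesgue_on {a<..<b}. F t \<in> Hm1 \<Omega>" using s by (simp add: strongly_measurable_def)
 then show "AE t in lebesgue_on {a<..<b}. norm (F t (e k)) <= normH1 \<Omega> (e k) * norm \<bar>normHm1 \<Omega> (F t)\<bar>"
 proof eventually_elim
  case (elim t)
  have "normHm1 \<Omega> (F t) * normH1 \<Omega> (e k) <= \<bar>normHm1 \<Omega> (F t)\<bar> * normH1 \<Omega> (e k)" by (intro mult_right_mono) auto
  then show ?case using normHm1_bound[OF elim e_in[of k]] by (simp add: mult.commute)
 qed
qed

lemma coef_sqint: "sqint J (coef k)"
proof (rule sqint_dominated[OF normH1_u_sqint])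
 have b: "\<bar>m_form v (e k)\<bar> <= nrm2 M (e k) * normH1 \<Omega> v" if v: "v \<in> H10 \<Omega>" for v
 proof -
  have "\<bar>m_form v (e k)\<bar> <= nrm2 M v * nrm2 M (e k)"
   using CS_ineq[OF H10_sqint(1)[OF v] H10_sqint(1)[OF e_in[of k]]] by (simp add: m_form_def)
  also have "... <= normH1 \<Omega> v * nrm2 M (e k)" by (intro mult_right_mono nrm2_le_normH1 v) auto
  finally show ?thesis by (simp add: mult.commute)
 qed
 show "coef k \<in> borel_measurable J"
  unfolding coef_def[abs_def]
 proof (rule strongly_measurable_functional[where L="%v. m_form v (e k)"])
  show "strongly_measurable 0 T (H10 \<Omega>) (normH1 \<Omega>) u" using u_L2_time by (simp add: L2_time_def)
  show "\<bar>m_form v (e k) - m_form w (e k)\<bar> <= nrm2 M (e k) * normH1 \<Omega> (%y. v y - w y)" if "v \<in> H10 \<Omega>" "w \<in> H10 \<Omega>" for v w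
   using b[OF CF.q.diff_in[OF that]] CF.m.ip_diff[OF that e_in] by simp
 qed
 show "AE t in J. norm (coef k t) <= nrm2 M (e k) * norm (normH1 \<Omega> (u t))"
  using u_H10 by eventually_elim (use b in \<open>simp add: coef_def\<close>)
qed

lemma force_sqint: "sqint J (force k)"
 unfolding force_def by (intro sqint_add sqint_cmult coef_sqint sqint_L2_time_Hm1[OF tder(1)])

text \<open>The second comparison, of the time derivative with Lu and u, is the one that later
  recovers the norm of the time derivative.\<close>

lemma heat_op_Hm1: "AE t in J. heat_op \<Omega> T u t \<in> Hm1 \<Omega> \<and> normHm1 \<Omega> (heat_op \<Omega> T u t) <= normHm1 \<Omega> (tder t) + normH1 \<Omega> (u t)
  \<and> normHm1 \<Omega> (tder t) <= normHm1 \<Omega> (heat_op \<Omega> T u t) + normH1 \<Omega> (u t)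
  \<and> (\<forall>k. heat_op \<Omega> T u t (e k) = force k t)"
 using u_H10 tder_Hm1
proof eventually_elim
 case (elim t)
 note L = neg_Laplace_Hm1[OF elim(1)]
 have h: "heat_op \<Omega> T u t = (%v. tder t v + neg_Laplace \<Omega> (u t) v)" by (simp add: heat_op_def tder_def fun_eq_iff)
 have H: "heat_op \<Omega> T u t \<in> Hm1 \<Omega>" using Hm1_add(1)[OF elim(2) L(1), of 1 1] by (simp add: h)
 have "normHm1 \<Omega> (heat_op \<Omega> T u t) <= normHm1 \<Omega> (tder t) + normH1 \<Omega> (u t)"
  using Hm1_add(2)[OF elim(2) L(1)] L(2) by (simp add: h)
 moreover have "normHm1 \<Omega> (tder t) <= normHm1 \<Omega> (heat_op \<Omega> T u t) + normH1 \<Omega> (u t)"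
 proof -
  have n: "(%v. - neg_Laplace \<Omega> (u t) v) \<in> Hm1 \<Omega>" using Hm1_add(1)[OF L(1) L(1), of "-1" 0] by simp
  have "normHm1 \<Omega> (%v. - neg_Laplace \<Omega> (u t) v) = normHm1 \<Omega> (neg_Laplace \<Omega> (u t))" by (simp add: normHm1_def)
  then show ?thesis using Hm1_add(2)[OF H n] L(2) by (simp add: h)
 qed
 moreover have "heat_op \<Omega> T u t (e k) = force k t" for k
  using neg_Laplace_e[OF elim(1)] by (simp add: h force_def coef_def)
 ultimately show ?case using H by simp
qed

definition forcing :: real where
 "forcing = (LINT t|J. (normHm1 \<Omega> (heat_op \<Omega> T u t))\<^sup>2)"

lemma forcing_nonneg [simp]: "0 <= forcing" by (simp add: forcing_def)

lemma heat_op_sums: "AE t in J. (%k. (force k t)\<^sup>2 / \<kappa> k) sums (normHm1 \<Omega> (heat_op \<Omega> T u t))\<^sup>2"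
 using heat_op_Hm1
proof eventually_elim
 case (elim t)
 then have H: "heat_op \<Omega> T u t \<in> Hm1 \<Omega>" and f: "!!k. heat_op \<Omega> T u t (e k) = force k t" by auto
 from Hm1_sums[OF H] show ?case by (simp only: f)
qed

lemma force_integrable: "integrable J (%t. (force k t)\<^sup>2 / \<kappa> k)"
 using sqint_integrable[OF force_sqint] by simp

lemma heat_op_integrable: "integrable J (%t. (normHm1 \<Omega> (heat_op \<Omega> T u t))\<^sup>2)"
proof (rule integrable_dominated)
 show "integrable J (%t. 2 * \<bar>normHm1 \<Omega> (tder t)\<bar>\<^sup>2 + 2 * (normH1 \<Omega> (u t))\<^sup>2)"
  using sqint_integrable[OF L2_time_sqint[OF tder(1)]] sqint_integrable[OF normH1_u_sqint] by simp
 \<comment> \<open>The dual norm is a supremum over an uncountable set; the series over the modes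
   makes it a limit of measurable partial sums.\<close>
 show "(%t. (normHm1 \<Omega> (heat_op \<Omega> T u t))\<^sup>2) \<in> borel_measurable J"
 proof (rule measurable_AE_limit)
  show "complete_measure J" by (rule complete_lebesgue_on) auto
  show "(%t. \<Sum>k<n. (force k t)\<^sup>2 / \<kappa> k) \<in> borel_measurable J" for n
   using force_integrable by (intro borel_measurable_sum) auto
  show "AE t in J. (%n. \<Sum>k<n. (force k t)\<^sup>2 / \<kappa> k) ----> (normHm1 \<Omega> (heat_op \<Omega> T u t))\<^sup>2"
   using heat_op_sums by (simp add: sums_def)
 qed
 show "AE t in J. norm ((normHm1 \<Omega> (heat_op \<Omega> T u t))\<^sup>2) <= norm (2 * \<bar>normHm1 \<Omega> (tder t)\<bar>\<^sup>2 + 2 * (normH1 \<Omega> (u t))\<^sup>2)"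
  using heat_op_Hm1
 proof eventually_elim
  case (elim t)
  have "(normHm1 \<Omega> (heat_op \<Omega> T u t))\<^sup>2 <= (normHm1 \<Omega> (tder t) + normH1 \<Omega> (u t))\<^sup>2"
   using elim normHm1_nonneg by (intro power_mono) auto
  also have "... <= 2 * (normHm1 \<Omega> (tder t))\<^sup>2 + 2 * (normH1 \<Omega> (u t))\<^sup>2"
   using norm_add_sq_le[of "normHm1 \<Omega> (tder t)" "normH1 \<Omega> (u t)"] by simp
  finally show ?case by simp
 qed
qed

lemma force_sum_le: "(\<Sum>k<N. (LINT t|J. (force k t)\<^sup>2 / \<kappa> k)) <= forcing"
proof -
 have "(\<Sum>k<N. (LINT t|J. (force k t)\<^sup>2 / \<kappa> k)) = (LINT t|J. (\<Sum>k<N. (force k t)\<^sup>2 / \<kappa> k))"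
  using force_integrable by (intro LINT_sum[symmetric])
 also have "... <= forcing"
  unfolding forcing_def
 proof (rule integral_mono_AE)
  show "AE t in J. (\<Sum>k<N. (force k t)\<^sup>2 / \<kappa> k) <= (normHm1 \<Omega> (heat_op \<Omega> T u t))\<^sup>2"
   using heat_op_sums
  proof eventually_elim
   case (elim t)
   show ?case unfolding sums_unique[OF elim]
    by (rule sum_le_suminf[OF sums_summable[OF elim]]) (use kap_pos in \<open>auto simp: less_imp_le\<close>)
  qed
 qed (use force_integrable heat_op_integrable in auto)
 finally show ?thesis .
qed

lemma kap_minus: "0 <= \<kappa> k - 1" using kap[of k] by simp

text \<open>The k-th coefficient of the value of u at time 0, obtained from Duhamel's formula before
  u is known to have a representative continuous in time.\<close>

definition init :: "nat => real" where
 "init k = (SOME a. AE t in J. coef k t = exp (- (\<kappa> k - 1) * t) * a + duhamel (\<kappa> k - 1) (force k) t)"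

lemma coef_eq: "AE t in J. coef k t = exp (- (\<kappa> k - 1) * t) * init k + duhamel (\<kappa> k - 1) (force k) t"
proof -
 have "(LINT t|J. deriv \<phi> t * coef k t) = - (LINT t|J. \<phi> t * tder t (e k))" if "\<phi> \<in> test_functions {0<..<T}" for \<phi>
  using tder(2) that e_in[of k] unfolding has_weak_tderiv_def by (simp add: L2_functional_eq coef_def)
 then obtain a where "AE t in J. coef k t = exp (- (\<kappa> k - 1) * t) * a + duhamel (\<kappa> k - 1) (%s. tder s (e k) + (\<kappa> k - 1) * coef k s) t"
  by (rule duhamel_representation[OF kap_minus[of k] coef_sqint sqint_L2_time_Hm1[OF tder(1)]])
 then have "\<exists>a. AE t in J. coef k t = exp (- (\<kappa> k - 1) * t) * a + duhamel (\<kappa> k - 1) (force k) t"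
  unfolding force_def[abs_def] by blast
 from someI_ex[OF this] show ?thesis unfolding init_def .
qed

definition damped :: "nat => real => real" where
 "damped k t = duhamel (\<kappa> k - 1) (force k) t"

lemma damped_sum_le: "0 <= t ==> t <= T ==> (\<Sum>k<N. (damped k t)\<^sup>2) <= (T + 1) * forcing"
proof -
 assume t: "0 <= t" "t <= T"
 have "(\<Sum>k<N. (damped k t)\<^sup>2) <= (\<Sum>k<N. (T + 1) * (LINT t|J. (force k t)\<^sup>2 / \<kappa> k))"
  using duhamel_bound[OF kap_minus force_sqint t] unfolding damped_def by (intro sum_mono) simp
 also have "... <= (T + 1) * forcing"
  unfolding sum_distrib_left[symmetric] using T_pos force_sum_le by (intro mult_left_mono) auto
 finally show ?thesis .
qed

lemma damped_sqint: "sqint J (damped k)"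
 unfolding damped_def by (rule duhamel_L2(1)[OF kap_minus force_sqint])

lemma damped_L2_sum_le: "(\<Sum>k<N. \<kappa> k * (LINT t|J. (damped k t)\<^sup>2)) <= (T + 1)\<^sup>2 * forcing"
proof -
 have "(\<Sum>k<N. \<kappa> k * (LINT t|J. (damped k t)\<^sup>2)) <= (\<Sum>k<N. (T + 1)\<^sup>2 * (LINT t|J. (force k t)\<^sup>2 / \<kappa> k))"
  using duhamel_L2(2)[OF kap_minus force_sqint] unfolding damped_def by (intro sum_mono) simp
 also have "... <= (T + 1)\<^sup>2 * forcing"
  unfolding sum_distrib_left[symmetric] using force_sum_le by (intro mult_left_mono) auto
 finally show ?thesis .
qed

lemma coef_sums: "AE t in J. (%k. \<kappa> k * (coef k t)\<^sup>2) sums (normH1 \<Omega> (u t))\<^sup>2 \<and> (%k. (coef k t)\<^sup>2) sums (nrm2 M (u t))\<^sup>2"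
 using u_H10 by eventually_elim (use q_sums m_sums in \<open>simp add: coef_def normH1_sq m_form_self\<close>)

text \<open>The value at time 0 lies in L2: \<open>initial_bound\<close> charges the k-th
  coefficient to the H1 weight of the solution and the dual weight of the source, both of which are
  summable over the modes.\<close>

lemma init_summable: "summable (%k. (init k)\<^sup>2)"
proof -
 let ?d = "1 - exp (- 2 * T)"
 let ?B = "4 * (LINT t|J. (normH1 \<Omega> (u t))\<^sup>2) + 4 * (T + 1)\<^sup>2 * forcing"
 have ci: "integrable J (%t. (coef k t)\<^sup>2)" for k using sqint_integrable[OF coef_sqint] by simp
 have "summable (%k. ?d * (init k)\<^sup>2)"
 proof (rule summableI_nonneg_bounded)
  show "0 <= ?d * (init k)\<^sup>2" for k using T_pos by simp
  fix N
  have "(\<Sum>k<N. ?d * (init k)\<^sup>2) <= (\<Sum>k<N. 4 * (\<kappa> k * (LINT t|J. (coef k t)\<^sup>2)) + 4 * (T + 1)\<^sup>2 * (LINT t|J. (force k t)\<^sup>2 / \<kappa> k))"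
   using initial_bound[OF kap_minus coef_sqint force_sqint coef_eq] by (intro sum_mono) (simp add: mult.assoc)
  also have "... = 4 * (\<Sum>k<N. \<kappa> k * (LINT t|J. (coef k t)\<^sup>2)) + 4 * (T + 1)\<^sup>2 * (\<Sum>k<N. (LINT t|J. (force k t)\<^sup>2 / \<kappa> k))"
   by (simp only: sum.distrib sum_distrib_left)
  also have "... <= ?B"
  proof (intro add_mono mult_left_mono force_sum_le)
   have "(\<Sum>k<N. \<kappa> k * (LINT t|J. (coef k t)\<^sup>2)) = (LINT t|J. (\<Sum>k<N. \<kappa> k * (coef k t)\<^sup>2))"
    using ci by (subst LINT_sum) auto
   also have "... <= (LINT t|J. (normH1 \<Omega> (u t))\<^sup>2)"
   proof (rule integral_mono_AE)
    show "AE t in J. (\<Sum>k<N. \<kappa> k * (coef k t)\<^sup>2) <= (normH1 \<Omega> (u t))\<^sup>2"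
     using coef_sums
    proof eventually_elim
     case (elim t)
     then have s: "(%k. \<kappa> k * (coef k t)\<^sup>2) sums (normH1 \<Omega> (u t))\<^sup>2" by simp
     show ?case unfolding sums_unique[OF s]
      by (rule sum_le_suminf[OF sums_summable[OF s]]) (use kap_pos in \<open>auto simp: less_imp_le\<close>)
    qed
   qed (use ci sqint_integrable[OF normH1_u_sqint] in auto)
   finally show "(\<Sum>k<N. \<kappa> k * (LINT t|J. (coef k t)\<^sup>2)) <= (LINT t|J. (normH1 \<Omega> (u t))\<^sup>2)" .
  qed auto
  finally show "(\<Sum>k<N. ?d * (init k)\<^sup>2) <= ?B" .
 qed
 then show ?thesis using T_pos by (simp add: summable_cmult_iff)
qed

lemma coef_eq_all: "AE t in J. \<forall>k. coef k t = exp (- (\<kappa> k - 1) * t) * init k + damped k t"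
 unfolding AE_all_countable damped_def using coef_eq by blast

end

context eigen
begin

lemma nrm2_sum_le: "(nrm2 M (%x. \<Sum>k<N. a k * e k x))\<^sup>2 <= (\<Sum>k<N. (a k)\<^sup>2)"
proof -
 have "(nrm2 M (%x. \<Sum>k<N. a k * e k x))\<^sup>2 = (\<Sum>k<N. a k * m_form (e k) (%x. \<Sum>k<N. a k * e k x))"
  unfolding m_form_self[symmetric] by (rule CF.m.ip_sum[OF e_in sum_in_H10])
 also have "... <= (\<Sum>k<N. (a k)\<^sup>2)"
 proof (rule sum_mono)
  fix k assume "k \<in> {..<N}"
  then show "a k * m_form (e k) (%x. \<Sum>k<N. a k * e k x) <= (a k)\<^sup>2"
   using normalized[of k] CF.m.ip_zero[OF H10_zero] unfolding m_form_e_sum by (auto simp: power2_eq_square)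
 qed
 finally show ?thesis .
qed

lemma sum_sqint: "sqint M (%x. \<Sum>k<N. a k * e k x)" for N :: nat
 by (rule H10_sqint(1)[OF sum_in_H10])

lemma Riesz_Fischer:
 assumes a: "summable (%k. (a k)\<^sup>2)"
 shows "\<exists>g. sqint M g \<and> (%N. nrm2 M (%x. (\<Sum>k<N. a k * e k x) - g x)) ----> 0"
proof -
 let ?P = "%N x. \<Sum>k<N. a k * e k x"
 let ?A = "%N. \<Sum>k<N. (a k)\<^sup>2"
 have le: "(ndist M (?P j) (?P i))\<^sup>2 <= \<bar>?A i - ?A j\<bar>" if "i <= j" for i j
 proof -
  let ?b = "%k. if i <= k then a k else 0"
  have split: "(\<Sum>k<j. f k) = (\<Sum>k<i. f k) + (\<Sum>k=i..<j. f k)" for f :: "nat => real"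
   using sum.atLeastLessThan_concat[of 0 i j f] that by (simp add: atLeast0LessThan)
  have z: "(\<Sum>k<j. f (?b k) k) = (\<Sum>k=i..<j. f (a k) k)" if "!!k. f 0 k = 0" for f :: "real => nat => real"
   unfolding split using that by simp
  have eq: "(%x. ?P j x - ?P i x) = (%x. \<Sum>k<j. ?b k * e k x)"
   using z[of "%c k. c * e k x" for x] split by (simp add: fun_eq_iff)
  have "?A j - ?A i = (\<Sum>k<j. (?b k)\<^sup>2)" using z[of "%c k. c\<^sup>2"] split by simp
  then show ?thesis using nrm2_sum_le[of ?b j] unfolding eq by linarith
 qed
 have le2: "(ndist M (?P i) (?P j))\<^sup>2 <= \<bar>?A i - ?A j\<bar>" for i j
  using le[of i j] le[of j i] nrm2_minus_commute[of M "?P i" "?P j"] abs_minus_commute[of "?A i" "?A j"]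
  by (cases "i <= j") auto
 have "Cauchy ?A" using a by (simp add: summable_iff_convergent convergent_Cauchy)
 show ?thesis
 proof (rule sqint_complete[OF sum_sqint])
  fix \<epsilon> :: real assume \<epsilon>: "\<epsilon> > 0"
  then obtain N where N: "!!i j. i \<ge> N ==> j \<ge> N ==> dist (?A i) (?A j) < \<epsilon>\<^sup>2"
   using \<open>Cauchy ?A\<close> unfolding Cauchy_def by (meson zero_less_power)
  show "\<exists>N. \<forall>i\<ge>N. \<forall>j\<ge>N. ndist M (?P i) (?P j) < \<epsilon>"
  proof (intro exI[of _ N] allI impI)
   fix i j assume "i \<ge> N" "j \<ge> N"
   then have "(ndist M (?P i) (?P j))\<^sup>2 < \<epsilon>\<^sup>2" using N[of i j] le2[of i j] by (simp add: dist_real_def)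
   then show "ndist M (?P i) (?P j) < \<epsilon>" using \<epsilon> by (simp add: power2_less_imp_less)
  qed
 next
  fix g assume "sqint M g" "(%N. ndist M (?P N) g) ----> 0"
  then show ?thesis by blast
 qed
qed

end

section \<open>The representative continuous in time\<close>

lemma AE_lebesgue_interval:
 assumes "AE t in lebesgue. P t" "a < (b::real)"
 obtains t where "a < t" "t < b" "P t"
proof (rule ccontr)
 assume "\<not> thesis"
 then have P: "\<not> P t" if "t \<in> {a<..<b}" for t using \<open>!!t. a < t ==> t < b ==> P t ==> thesis\<close> that by auto
 have "AE t in lebesgue. t \<notin> {a<..<b}" using assms(1) by eventually_elim (use P in blast)
 then have "{a<..<b} \<in> null_sets lebesgue" by (subst AE_iff_null_sets) auto
 then have "{a<..<b} \<in> null_sets lborel" by (simp add: null_sets_completion_iff)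
 then show False using assms(2) by (auto simp: null_sets_def)
qed

context energy
begin

definition mode :: "nat => real => real" where
 "mode k t = exp (- (\<kappa> k - 1) * t) * init k + damped k t"

text \<open>A summable bound for the squared modes that is uniform in time, as the M-test in
  \<open>mode_difference\<close> requires.\<close>

definition mode_bound :: "nat => real" where
 "mode_bound k = 2 * (init k)\<^sup>2 + 2 * ((T + 1) * (LINT t|J. (force k t)\<^sup>2 / \<kappa> k))"

lemma mode_sq_le: "0 <= t ==> t <= T ==> (mode k t)\<^sup>2 <= mode_bound k"
proof -
 assume t: "0 <= t" "t <= T"
 have "(mode k t)\<^sup>2 <= 2 * (exp (- (\<kappa> k - 1) * t) * init k)\<^sup>2 + 2 * (damped k t)\<^sup>2"
  using norm_add_sq_le[of "exp (- (\<kappa> k - 1) * t) * init k" "damped k t"] by (simp add: mode_def)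
 also have "... <= mode_bound k"
  unfolding mode_bound_def
 proof (intro add_mono mult_left_mono)
  have "- (\<kappa> k - 1) * t <= 0"
   using mult_nonneg_nonneg[OF kap_minus t(1), of k] by (simp only: mult_minus_left neg_le_0_iff_le)
  then have "(exp (- (\<kappa> k - 1) * t))\<^sup>2 * (init k)\<^sup>2 <= 1 * (init k)\<^sup>2"
   by (intro mult_right_mono power_le_one) auto
  then show "(exp (- (\<kappa> k - 1) * t) * init k)\<^sup>2 <= (init k)\<^sup>2" by (simp add: power_mult_distrib)
  show "(damped k t)\<^sup>2 <= (T + 1) * (LINT t|J. (force k t)\<^sup>2 / \<kappa> k)"
   using duhamel_bound[OF kap_minus force_sqint t, of k k] by (simp add: damped_def)
 qed auto
 finally show ?thesis .
qed

lemma summable_mode_bound: "summable mode_bound"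
proof -
 have "summable (%k. LINT t|J. (force k t)\<^sup>2 / \<kappa> k)"
  by (rule summableI_nonneg_bounded[OF _ force_sum_le])
   (use kap_pos in \<open>auto intro!: integral_nonneg_AE AE_I2 divide_nonneg_pos simp: less_imp_le\<close>)
 then show ?thesis unfolding mode_bound_def[abs_def] by (intro summable_add summable_mult init_summable)
qed

lemma mode_continuous: "continuous_on S (mode k)"
proof -
 have "continuous_on S (damped k)"
  unfolding damped_def[abs_def] by (rule duhamel_continuous[OF kap_minus I.sqint_L1[OF force_sqint]])
 then show ?thesis unfolding mode_def[abs_def] by (intro continuous_intros)
qed

lemma mode_difference:
 assumes t: "0 <= t" "t <= T"
 defines "D \<equiv> %s. \<Sum>k. (mode k s - mode k t)\<^sup>2"
 shows "(D \<longlongrightarrow> 0) (at t within {0..T})"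
  and "0 <= s ==> s <= T ==> (\<Sum>k<N. (mode k s - mode k t)\<^sup>2) <= D s"
proof -
 have b: "norm ((mode k s - mode k t)\<^sup>2) <= 4 * mode_bound k" if "s \<in> {0..T}" for k s
  using norm_add_sq_le[of "mode k s" "- mode k t"] mode_sq_le[of s k] mode_sq_le[of t k] that t by simp
 have s4: "summable (%k. 4 * mode_bound k)" by (intro summable_mult summable_mode_bound)
 have "uniform_limit {0..T} (%n s. \<Sum>k<n. (mode k s - mode k t)\<^sup>2) D sequentially"
  unfolding D_def by (rule Weierstrass_m_test[OF b s4])
 then have "continuous_on {0..T} D"
  by (rule uniform_limit_theorem[rotated])
   (auto intro!: always_eventually continuous_intros mode_continuous)
 then have "(D \<longlongrightarrow> D t) (at t within {0..T})" using t by (simp add: continuous_on_def)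
 then show "(D \<longlongrightarrow> 0) (at t within {0..T})" by (simp add: D_def)
 show "(\<Sum>k<N. (mode k s - mode k t)\<^sup>2) <= D s" if "0 <= s" "s <= T"
  unfolding D_def
 proof (rule sum_le_suminf)
  show "summable (%k. (mode k s - mode k t)\<^sup>2)"
   by (rule summable_comparison_test'[OF s4]) (use b[of s] that in auto)
 qed auto
qed

text \<open>\<open>continuous_rep\<close> is a choice, so nothing is known of it before this. At
  every time the modes are square summable and define an L2 function; a uniformly convergent series
  of squared mode differences controls its continuity.\<close>

lemma continuous_rep_exists:
 "\<exists>w. continuous_L2 \<Omega> T w \<and> (AE t in J. AE x in M. w t x = u t x)"
proof -
 let ?P = "%N t x. \<Sum>k<N. mode k t * e k x"
 have "\<exists>g. t \<in> {0..T} \<longrightarrow> sqint M g \<and> (%N. ndist M (?P N t) g) ----> 0" for t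
 proof (cases "t \<in> {0..T}")
  case True
  have "summable (%k. (mode k t)\<^sup>2)"
   by (rule summable_comparison_test'[OF summable_mode_bound]) (use mode_sq_le True in auto)
  from Riesz_Fischer[OF this] show ?thesis by blast
 qed blast
 then obtain w where w: "!!t. t \<in> {0..T} ==> sqint M (w t)"
  and lim: "!!t. t \<in> {0..T} ==> (%N. ndist M (?P N t) (w t)) ----> 0"
  using choice[of "%t g. t \<in> {0..T} \<longrightarrow> sqint M g \<and> (%N. ndist M (?P N t) g) ----> 0"] by blast
 \<comment> \<open>The inequality holds for partial sums and passes to their limits at the two
   times.\<close>
 have dist: "(ndist M (w s) (w t))\<^sup>2 <= (\<Sum>k. (mode k s - mode k t)\<^sup>2)" if s: "s \<in> {0..T}" and t: "t \<in> {0..T}" for s t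
 proof (rule LIMSEQ_le_const2)
  have "(%N. ndist M (?P N s) (?P N t)) ----> ndist M (w s) (w t)"
  proof (rule nrm2_tendsto_norm)
   have "(%N. ndist M (?P N s) (w s) + ndist M (?P N t) (w t)) ----> 0 + 0"
    by (intro tendsto_intros lim s t)
   then have l: "(%N. ndist M (?P N s) (w s) + ndist M (?P N t) (w t)) ----> 0" by simp
   have "nrm2 M (%x. ?P N s x - ?P N t x - (w s x - w t x)) <= ndist M (?P N s) (w s) + ndist M (?P N t) (w t)" for N
   proof -
    have "(%x. ?P N s x - ?P N t x - (w s x - w t x)) = (%x. (?P N s x - w s x) + (w t x - ?P N t x))" by auto
    then show ?thesis
     using nrm2_triangle[OF sqint_diff[OF sum_sqint[where a="%k. mode k s" and N=N] w[OF s]]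
       sqint_diff[OF w[OF t] sum_sqint[where a="%k. mode k t" and N=N]]]
      nrm2_minus_commute[of M "w t" "?P N t"] by simp
   qed
   then show "(%N. nrm2 M (%x. ?P N s x - ?P N t x - (w s x - w t x))) ----> 0"
    by (intro Lim_null_comparison[OF _ l]) auto
  qed (intro sqint_diff sum_sqint w s t)+
  then show "(%N. (ndist M (?P N s) (?P N t))\<^sup>2) ----> (ndist M (w s) (w t))\<^sup>2" by (rule tendsto_power)
  have "(ndist M (?P N s) (?P N t))\<^sup>2 <= (\<Sum>k. (mode k s - mode k t)\<^sup>2)" for N
  proof -
   have "(%x. ?P N s x - ?P N t x) = (%x. \<Sum>k<N. (mode k s - mode k t) * e k x)"
    by (simp add: left_diff_distrib sum_subtractf)
   then show ?thesis
    using nrm2_sum_le[of "%k. mode k s - mode k t" N] mode_difference(2)[of t s N] s t by simp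
  qed
  then show "\<exists>N. \<forall>n\<ge>N. (ndist M (?P n s) (?P n t))\<^sup>2 <= (\<Sum>k. (mode k s - mode k t)\<^sup>2)" by blast
 qed
 have "continuous_L2 \<Omega> T w"
  unfolding continuous_L2_def L2_iff normL2_eq
 proof (intro ballI conjI w)
  fix t assume t: "t \<in> {0..T}"
  have "((%s. sqrt (\<Sum>k. (mode k s - mode k t)\<^sup>2)) \<longlongrightarrow> sqrt 0) (at t within {0..T})"
   using mode_difference(1)[of t] t by (intro tendsto_intros) auto
  then have l: "((%s. sqrt (\<Sum>k. (mode k s - mode k t)\<^sup>2)) \<longlongrightarrow> 0) (at t within {0..T})" by simp
  show "((%s. ndist M (w s) (w t)) \<longlongrightarrow> 0) (at t within {0..T})"
  proof (rule Lim_null_comparison[OF _ l])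
   have "norm (ndist M (w s) (w t)) <= sqrt (\<Sum>k. (mode k s - mode k t)\<^sup>2)" if "s \<in> {0..T}" for s
    using real_le_rsqrt[OF dist[OF that t]] by simp
   then show "\<forall>\<^sub>F s in at t within {0..T}. norm (ndist M (w s) (w t)) <= sqrt (\<Sum>k. (mode k s - mode k t)\<^sup>2)"
    by (simp add: eventually_at_filter)
  qed
 qed
 moreover have "AE t in J. AE x in M. w t x = u t x"
  using coef_eq_all u_H10 AE_space
 proof eventually_elim
  case (elim t)
  then have t: "t \<in> {0..T}" and c: "!!k. m_form (u t) (e k) = mode k t" by (auto simp: coef_def mode_def)
  note us = H10_sqint(1)[OF elim(2)]
  have "(%N. (ndist M (u t) (?P N t))\<^sup>2) ----> 0"
   using m_remainder_tendsto[OF elim(2)] unfolding m_form_self c .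
  then have "(%N. sqrt ((ndist M (u t) (?P N t))\<^sup>2)) ----> sqrt 0" by (rule tendsto_real_sqrt)
  then have l: "(%N. ndist M (?P N t) (u t)) ----> 0" using nrm2_minus_commute[of M "u t"] by simp
  have "(%N. ndist M (?P N t) (w t) + ndist M (?P N t) (u t)) ----> 0 + 0"
   by (intro tendsto_intros l lim t)
  moreover have "ndist M (w t) (u t) <= ndist M (?P N t) (w t) + ndist M (?P N t) (u t)" for N
   using nrm2_triangle[OF sqint_diff[OF w[OF t] sum_sqint[where a="%k. mode k t" and N=N]]
     sqint_diff[OF sum_sqint[where a="%k. mode k t" and N=N] us]]
    nrm2_minus_commute[of M "w t" "?P N t"] by simp
  ultimately have "ndist M (w t) (u t) <= 0"
   by (intro LIMSEQ_le_const) auto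
  then have "ndist M (w t) (u t) = 0" using nrm2_nonneg[of M "%x. w t x - u t x"] by linarith
  then have "AE x in M. w t x - u t x = 0" using nrm2_eq_0_iff[OF sqint_diff[OF w[OF t] us]] by blast
  then show ?case by eventually_elim simp
 qed
 ultimately show ?thesis by blast
qed

text \<open>A bound valid for almost every time after T1 extends to every time of the closed
  interval, since times with the bound lie arbitrarily close and the representative is continuous in
  L2.\<close>

lemma normC_L2_le:
 assumes T1: "0 < T1" "T1 < T" and B: "AE t in J. T1 < t \<longrightarrow> nrm2 M (u t) <= B"
 shows "normC_L2 \<Omega> T1 T u <= B"
proof -
 define w where "w = continuous_rep \<Omega> T u"
 have w: "continuous_L2 \<Omega> T w" "AE t in J. AE x in M. w t x = u t x"
  using someI_ex[OF continuous_rep_exists] by (auto simp: w_def continuous_rep_def)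
 have ws: "sqint M (w t)" and wc: "((%s. ndist M (w s) (w t)) \<longlongrightarrow> 0) (at t within {0..T})" if "t \<in> {0..T}" for t
  using w(1) that by (auto simp: continuous_L2_def L2_iff normL2_eq)
 have "AE t in J. T1 < t \<longrightarrow> nrm2 M (w t) <= B"
  using B w(2) u_H10 AE_space
 proof eventually_elim
  case (elim t)
  have "nrm2 M (w t) = nrm2 M (u t)"
   by (rule nrm2_cong_AE) (use elim sqint_measurable[OF ws[of t]] sqint_measurable[OF H10_sqint(1)[OF elim(3)]] in auto)
  then show ?case using elim by simp
 qed
 then have ae: "AE t in lebesgue. 0 < t \<and> t < T \<longrightarrow> T1 < t \<longrightarrow> nrm2 M (w t) <= B"
  by (simp add: AE_restrict_space_iff)
 have "nrm2 M (w t) <= B" if t: "t \<in> {T1..T}" for t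
 proof (rule ccontr)
  assume "\<not> nrm2 M (w t) <= B"
  then have p: "0 < nrm2 M (w t) - B" by simp
  have t0: "t \<in> {0..T}" using t T1 by auto
  obtain d where d: "0 < d" "!!s. s \<in> {0..T} ==> s \<noteq> t ==> \<bar>s - t\<bar> < d ==> ndist M (w s) (w t) < nrm2 M (w t) - B"
   using tendstoD[OF wc[OF t0] p] unfolding eventually_at dist_real_def by auto
  \<comment> \<open>The interval lies to the right of t, except at t = T, where it must lie to the
    left; both endpoints of the time range are thus reached from inside.\<close>
  obtain a b where ab: "a < b" "T1 <= a" "b <= T" "!!s. a < s ==> s < b ==> s \<noteq> t \<and> \<bar>s - t\<bar> < d"
  proof (cases "t < T")
   case True
   then show ?thesis using t d(1) by (intro that[of t "min T (t + d)"]) auto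
  next
   case False
   then show ?thesis using t d(1) T1 by (intro that[of "max T1 (t - d)" t]) auto
  qed
  obtain s where s: "a < s" "s < b" "0 < s \<and> s < T \<longrightarrow> T1 < s \<longrightarrow> nrm2 M (w s) <= B"
   by (rule AE_lebesgue_interval[OF ae ab(1)])
  have s0: "s \<in> {0..T}" "nrm2 M (w s) <= B" using s ab T1 by auto
  have "nrm2 M (w t) <= ndist M (w t) (w s) + nrm2 M (w s)"
   using nrm2_triangle[OF sqint_diff[OF ws[OF t0] ws[OF s0(1)]] ws[OF s0(1)]] by simp
  then show False
   using d(2)[OF s0(1)] ab(4)[OF s(1,2)] s0(2) nrm2_minus_commute[of M "w t" "w s"] by linarith
 qed
 then show ?thesis unfolding normC_L2_def normL2_eq w_def[symmetric] by (intro cSUP_least) (use T1 in auto)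
qed

end

section \<open>Integration over the space-time cylinder\<close>

lemma Tonelli_lebesgue:
 fixes F :: "real \<times> 'a::euclidean_space => real"
 assumes F: "F \<in> borel_measurable lebesgue" "!!z. 0 <= F z"
  and slice: "AE t in lebesgue. integrable lebesgue (%x. F (t, x)) \<and> (LINT x|lebesgue. F (t, x)) <= Q t"
  and Q: "integrable lebesgue Q"
 shows "integrable lebesgue (%t. LINT x|lebesgue. F (t, x))"
  and "(LINT t|lebesgue. LINT x|lebesgue. F (t, x)) = (LINT z|lebesgue. F z)"
proof -
 let ?q = "%t. LINT x|lebesgue. F (t, x)"
 \<comment> \<open>A Lebesgue measurable function on the product need not be measurable for the
   product of the completed measures. Tonelli is applied to a Borel function G equal to F almost
   everywhere, hence on almost every slice.\<close>
 obtain G where G: "G \<in> borel_measurable lborel" "AE z in lborel. F z = G z"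
  using completion_ex_borel_measurable_real[OF F(1)] by blast

 have Gm: "(%z. ennreal (G z)) \<in> borel_measurable (lborel \<Otimes>\<^sub>M lborel)" using G(1) by (simp add: lborel_prod)
 have FG: "AE t in lborel. AE x in lborel. F (t, x) = G (t, x)"
  by (rule lborel_pair.AE_pair[of "%z. F z = G z", unfolded lborel_prod, OF G(2)])
 define E where "E t = (\<integral>\<^sup>+x. ennreal (G (t, x)) \<partial>lborel)" for t
 have Em: "E \<in> borel_measurable lborel"
  unfolding E_def[abs_def] by (rule lborel.borel_measurable_nn_integral_fst[OF Gm])
 have qE: "AE t in lebesgue. ennreal (?q t) = E t"
  using slice AE_completion[OF FG]
 proof eventually_elim
  case (elim t)
  have "ennreal (?q t) = (\<integral>\<^sup>+x. ennreal (F (t, x)) \<partial>lebesgue)"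
   using elim(1) F(2) by (intro nn_integral_eq_integral[symmetric]) auto
  also have "... = (\<integral>\<^sup>+x. ennreal (F (t, x)) \<partial>lborel)" by (rule nn_integral_completion)
  also have "... = E t" unfolding E_def by (rule nn_integral_cong_AE) (use elim(2) in auto)
  finally show ?case .
 qed
 have q0: "0 <= ?q t" for t using F(2) by (simp add: integral_nonneg_AE)
 have qm: "?q \<in> borel_measurable lebesgue"
 proof (rule measurable_AE_cong)
  show "complete_measure (lebesgue :: real measure)" by (rule completion.complete_measure_axioms)
  show "(%t. enn2real (E t)) \<in> borel_measurable lebesgue" by (intro measurable_completion) (use Em in measurable)
  show "AE t in lebesgue. enn2real (E t) = ?q t"
   using qE by eventually_elim (use q0 in \<open>metis enn2real_ennreal\<close>)
 qed
 show qi: "integrable lebesgue ?q"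
  by (rule integrable_dominated[OF Q qm])
   (use slice in \<open>eventually_elim, use q0 in \<open>auto simp: abs_le_iff intro: order_trans\<close>\<close>)
 have "ennreal (LINT t|lebesgue. ?q t) = (\<integral>\<^sup>+t. ennreal (?q t) \<partial>lebesgue)"
  using qi q0 by (intro nn_integral_eq_integral[symmetric]) auto
 also have "... = (\<integral>\<^sup>+t. E t \<partial>lebesgue)" by (rule nn_integral_cong_AE[OF qE])
 also have "... = (\<integral>\<^sup>+z. ennreal (G z) \<partial>(lborel \<Otimes>\<^sub>M lborel))"
  unfolding nn_integral_completion E_def by (rule lborel.nn_integral_fst[OF Gm])
 also have "... = (\<integral>\<^sup>+z. ennreal (F z) \<partial>lborel)"
  unfolding lborel_prod by (rule nn_integral_cong_AE) (use G(2) in auto)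
 also have "... = (\<integral>\<^sup>+z. ennreal (F z) \<partial>lebesgue)" by (rule nn_integral_completion[symmetric])
 finally have eq: "(\<integral>\<^sup>+z. ennreal (F z) \<partial>lebesgue) = ennreal (LINT t|lebesgue. ?q t)" ..
 show "(LINT t|lebesgue. ?q t) = (LINT z|lebesgue. F z)"
  using integral_eq_nn_integral[of F lebesgue] F q0 eq by (simp add: integral_nonneg_AE)
qed

context energy
begin

text \<open>The observation enters the mode estimates slice by slice, so the norm over the cylinder
  must be an iterated integral. The squared H1 norm of u dominates the slices and is integrable in
  time.\<close>

lemma cylinder:
 assumes \<omega>: "open \<omega>" "\<omega> \<subseteq> \<Omega>"
 shows "integrable J (%t. LINT x|M. indicator \<omega> x * (u t x)\<^sup>2)"
  and "(LINT t|J. LINT x|M. indicator \<omega> x * (u t x)\<^sup>2) = (normL2 ({0<..<T} \<times> \<omega>) (%(t, x). u t x))\<^sup>2"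
proof -
 let ?I = "{0<..<T}"
 let ?F = "%z. indicator (?I \<times> \<omega>) z * (u (fst z) (snd z))\<^sup>2"
 have oS: "?I \<times> S \<in> sets lebesgue" if "open S" for S :: "'a set"
 proof -
  have "open (?I \<times> S)" by (intro open_Times that open_greaterThanLessThan)
  then show ?thesis using borel_open by (intro sets_completionI_sets) simp
 qed
 have [simp]: "\<omega> \<in> sets lebesgue" using \<omega>(1) by auto
 have "(%z. indicator (?I \<times> \<Omega>) z *\<^sub>R u (fst z) (snd z)) \<in> borel_measurable lebesgue"
  using u oS[OF open_\<Omega>] by (subst borel_measurable_restrict_space_iff[symmetric]) (auto simp: energy_space_def split_beta')
 then have "(%z. indicator (?I \<times> \<omega>) z * (indicator (?I \<times> \<Omega>) z *\<^sub>R u (fst z) (snd z))\<^sup>2) \<in> borel_measurable lebesgue"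
  using oS[OF \<omega>(1)] by (intro borel_measurable_times borel_measurable_power borel_measurable_indicator) auto
 also have "(%z. indicator (?I \<times> \<omega>) z * (indicator (?I \<times> \<Omega>) z *\<^sub>R u (fst z) (snd z))\<^sup>2) = ?F"
  using \<omega>(2) by (auto simp: fun_eq_iff indicator_def)
 finally have Fm: "?F \<in> borel_measurable lebesgue" .
 have slice: "AE t in lebesgue. integrable lebesgue (%x. ?F (t, x)) \<and> (LINT x|lebesgue. ?F (t, x)) <= indicator ?I t * (normH1 \<Omega> (u t))\<^sup>2"
 proof -
  have "AE t in lebesgue. t \<in> ?I \<longrightarrow> u t \<in> H10 \<Omega>" using u_H10 by (simp add: AE_restrict_space_iff)
  then show ?thesis
  proof eventually_elim
   case (elim t)
   show ?case
   proof (cases "t \<in> ?I")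
    case True
    then have h: "u t \<in> H10 \<Omega>" using elim by simp
    have i: "integrable M (%x. (u t x)\<^sup>2)" using sqint_integrable[OF H10_sqint(1)[OF h]] by simp
    then have i1: "integrable lebesgue (%x. indicator \<Omega> x * (u t x)\<^sup>2)" by (simp add: integrable_restrict_space)
    have eq: "?F (t, x) = indicator \<omega> x * (indicator \<Omega> x * (u t x)\<^sup>2)" for x
     using True \<omega>(2) by (auto simp: indicator_def)
    have i2: "integrable lebesgue (%x. ?F (t, x))"
     unfolding eq by (rule integrable_bounded_mult[OF i1, of _ 1]) (auto intro!: borel_measurable_indicator simp: indicator_le_1)
    have "(LINT x|lebesgue. ?F (t, x)) <= (LINT x|lebesgue. indicator \<Omega> x * (u t x)\<^sup>2)"
     using i1 i2 unfolding eq by (intro integral_mono) (auto simp: indicator_def)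
    also have "... = (nrm2 M (u t))\<^sup>2" by (simp add: nrm2_sq integral_restrict_space)
    also have "... <= (normH1 \<Omega> (u t))\<^sup>2" by (intro power_mono nrm2_le_normH1 h) simp
    finally show ?thesis using i2 True by simp
   next
    case False
    then have z: "?F (t, x) = 0" for x by auto
    show ?thesis unfolding z using False by simp
   qed
  qed
 qed
 have "integrable J (%t. (normH1 \<Omega> (u t))\<^sup>2)" using sqint_integrable[OF normH1_u_sqint] by simp
 then have Q: "integrable lebesgue (%t. indicator ?I t * (normH1 \<Omega> (u t))\<^sup>2)" by (simp add: integrable_restrict_space)
 note T = Tonelli_lebesgue[OF Fm _ slice Q]
 have q: "(LINT x|lebesgue. ?F (t, x)) = indicator ?I t * (LINT x|M. indicator \<omega> x * (u t x)\<^sup>2)" for t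
 proof (cases "t \<in> ?I")
  case True
  have "(LINT x|M. indicator \<omega> x * (u t x)\<^sup>2) = (LINT x|lebesgue. indicator \<Omega> x * (indicator \<omega> x * (u t x)\<^sup>2))"
   by (simp add: integral_restrict_space)
  also have "... = (LINT x|lebesgue. ?F (t, x))"
   using True \<omega>(2) by (intro LINT_cong) (auto simp: indicator_def)
  finally show ?thesis using True by simp
 next
  case False
  then have z: "?F (t, x) = 0" for x by auto
  show ?thesis unfolding z using False by simp
 qed
 show "integrable J (%t. LINT x|M. indicator \<omega> x * (u t x)\<^sup>2)"
  using T(1) unfolding q by (simp add: integrable_restrict_space)
 have "(LINT t|J. LINT x|M. indicator \<omega> x * (u t x)\<^sup>2) = (LINT t|lebesgue. LINT x|lebesgue. ?F (t, x))"
  unfolding q by (simp add: integral_restrict_space)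
 also have "... = (LINT z|lebesgue. ?F z)" by (rule T(2)) simp
 also have "... = (normL2 (?I \<times> \<omega>) (%(t, x). u t x))\<^sup>2"
  using oS[OF \<omega>(1)] by (simp add: normL2_eq nrm2_sq integral_restrict_space split_beta')
 finally show "(LINT t|J. LINT x|M. indicator \<omega> x * (u t x)\<^sup>2) = (normL2 (?I \<times> \<omega>) (%(t, x). u t x))\<^sup>2" .
qed

end

section \<open>Estimates after the initial time\<close>

locale observed = energy \<Omega> e \<kappa> T u + star_domain \<Omega> x0 R
 for \<Omega> :: "'a::euclidean_space set" and e \<kappa> and T :: real and u and x0 and R +
 fixes \<omega> :: "'a set" and r T1 :: real
 assumes \<omega>: "open \<omega>" "\<omega> \<subseteq> \<Omega>" "ball x0 r \<subseteq> \<omega>" and r: "0 < r" and T1: "0 < T1" "T1 < T"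
begin

definition decay :: "nat => real => real" where
 "decay k t = init k * exp (- (\<kappa> k - 1) * t)"

text \<open>The squared L2 norm at time T1 of the free part truncated to N modes; the factor
  \<open>m_form (e k) (e k)\<close> removes the zero members of the sequence.\<close>

definition late_energy :: "nat => real" where
 "late_energy N = (\<Sum>k<N. (decay k T1)\<^sup>2 * m_form (e k) (e k))"

definition tail :: "nat => real => real" where
 "tail N t = (nrm2 M (u t))\<^sup>2 - (\<Sum>k<N. (coef k t)\<^sup>2)"

definition observation :: real where
 "observation = (LINT t|J. LINT x|M. indicator \<omega> x * (u t x)\<^sup>2)"

lemma coef_decay: "AE t in J. \<forall>k. coef k t = decay k t + damped k t"
 using coef_eq_all unfolding decay_def by (simp add: mult.commute)

lemma coef_sq_integrable: "integrable J (%t. (coef k t)\<^sup>2)"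
 using sqint_integrable[OF coef_sqint] by simp

lemma nrm2_u_integrable: "integrable J (%t. (nrm2 M (u t))\<^sup>2)"
proof (rule integrable_dominated)
 show "integrable J (%t. (normH1 \<Omega> (u t))\<^sup>2)" using sqint_integrable[OF normH1_u_sqint] by simp
 show "(%t. (nrm2 M (u t))\<^sup>2) \<in> borel_measurable J"
 proof (rule measurable_AE_limit)
  show "complete_measure J" by (rule complete_lebesgue_on) auto
  show "(%t. \<Sum>k<n. (coef k t)\<^sup>2) \<in> borel_measurable J" for n
   using coef_sq_integrable by (intro borel_measurable_sum) auto
  show "AE t in J. (%n. \<Sum>k<n. (coef k t)\<^sup>2) ----> (nrm2 M (u t))\<^sup>2"
   using coef_sums by (simp add: sums_def)
 qed
 show "AE t in J. norm ((nrm2 M (u t))\<^sup>2) <= norm ((normH1 \<Omega> (u t))\<^sup>2)"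
  using u_H10 by eventually_elim (simp add: power_mono nrm2_le_normH1)
qed

lemma tail_integrable: "integrable J (tail N)"
 unfolding tail_def[abs_def]
 by (intro Bochner_Integration.integrable_diff nrm2_u_integrable Bochner_Integration.integrable_sum coef_sq_integrable)

lemma tail_tendsto: "(%N. LINT t|J. tail N t) ----> 0"
proof -
 have "(%N. LINT t|J. tail N t) ----> (LINT t|J. 0)"
 proof (rule integral_dominated_convergence[where w="%t. (nrm2 M (u t))\<^sup>2"])
  show "AE t in J. (%N. tail N t) ----> 0"
   using coef_sums
  proof eventually_elim
   case (elim t)
   then have "(%N. (nrm2 M (u t))\<^sup>2 - (\<Sum>k<N. (coef k t)\<^sup>2)) ----> (nrm2 M (u t))\<^sup>2 - (nrm2 M (u t))\<^sup>2"
    by (intro tendsto_intros) (simp add: sums_def)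
   then show ?case by (simp add: tail_def)
  qed
  show "AE t in J. norm (tail N t) <= (nrm2 M (u t))\<^sup>2" for N
   using coef_sums
  proof eventually_elim
   case (elim t)
   then have s: "(%k. (coef k t)\<^sup>2) sums (nrm2 M (u t))\<^sup>2" by simp
   have "(\<Sum>k<N. (coef k t)\<^sup>2) <= (nrm2 M (u t))\<^sup>2"
    unfolding sums_unique[OF s] by (rule sum_le_suminf[OF sums_summable[OF s]]) auto
   moreover have "0 <= (\<Sum>k<N. (coef k t)\<^sup>2)" by (intro sum_nonneg) simp
   ultimately show ?case by (simp add: tail_def)
  qed
  show "tail N \<in> borel_measurable J" for N using tail_integrable by auto
 qed (use nrm2_u_integrable in auto)
 then show ?thesis by simp
qed

lemma heat_sum: "heat_sum \<Omega> x0 R e (%k. weak_grad \<Omega> (e k)) (%k. \<kappa> k - 1)"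
proof unfold_locales
 show "H10g (e k) (weak_grad \<Omega> (e k))" for k by (rule H10_H10g[OF e_in])
 show "(LINT x|M. weak_grad \<Omega> (e k) x \<bullet> h x) = (\<kappa> k - 1) * (LINT x|M. e k x * v x)" if "H10g v h" for v h k
  using a_form_eq[OF H10_H10g[OF e_in[of k]] that] eigenvalue[OF H10g_H10[OF that], of k]
  by (simp add: q_form_def m_form_def algebra_simps)
qed (auto intro: orth kap)

text \<open>Observability is applied to the truncated free part on the interval up to T1. Its
  observation is compared with that of u, the discarded modes and the driven part, all over the
  whole time interval.\<close>

lemma late_energy_step: "obs_weight r T1 0 * late_energy N <= 3 * (observation + (LINT t|J. tail N t) + (T + 1)\<^sup>2 * forcing)"
proof -
 interpret H: heat_sum \<Omega> x0 R N e "%k. weak_grad \<Omega> (e k)" "%k. \<kappa> k - 1" init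
  by (rule heat_sum)
 have di: "integrable J (%t. (damped k t)\<^sup>2)" for k using sqint_integrable[OF damped_sqint] by simp
 have bm: "indicator A \<in> borel_measurable M" if "open A" for A :: "'a set"
  using that by (intro borel_measurable_indicator' measurable_restrict_space1) auto
 have "late_energy N = (nrm2 M (H.U T1))\<^sup>2" unfolding H.nrm2_U late_energy_def decay_def ..
 then have "obs_weight r T1 0 * late_energy N <= integral {0..T1} (H.obs r)" using H.observability[OF r T1(1)] by simp
 also have "... <= integral {0..T} (H.obs r)"
  by (rule integral_subset_le)
   (use T1 in \<open>auto intro!: H.obs_nonneg integrable_continuous_real H.continuous_obs\<close>)
 also have "... = (LINT t|J. H.obs r t)"
  unfolding integral_open_interval_real
  by (rule lebesgue_integral_eq_integral[symmetric]) (auto intro: I.sqint_L1 sqint_continuous H.continuous_obs)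
 also have "... <= (LINT t|J. 3 * ((LINT x|M. indicator \<omega> x * (u t x)\<^sup>2) + tail N t + (\<Sum>k<N. (damped k t)\<^sup>2)))"
 proof (rule integral_mono_AE)
  show "integrable J (H.obs r)" by (intro I.sqint_L1 sqint_continuous H.continuous_obs)
  show "integrable J (%t. 3 * ((LINT x|M. indicator \<omega> x * (u t x)\<^sup>2) + tail N t + (\<Sum>k<N. (damped k t)\<^sup>2)))"
   using cylinder(1)[OF \<omega>(1,2)] tail_integrable di by simp
  show "AE t in J. H.obs r t <= 3 * ((LINT x|M. indicator \<omega> x * (u t x)\<^sup>2) + tail N t + (\<Sum>k<N. (damped k t)\<^sup>2))"
   using u_H10 coef_decay
  proof eventually_elim
   case (elim t)
   let ?r = "%x. u t x - (\<Sum>k<N. coef k t * e k x)" and ?w = "%x. \<Sum>k<N. damped k t * e k x"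
   note rem = remainder[OF elim(1), of N, folded coef_def]
   have i: "integrable M (%x. (v x)\<^sup>2)" if "v \<in> H10 \<Omega>" for v using sqint_integrable[OF H10_sqint(1)[OF that]] by simp
   have iu: "integrable M (%x. indicator A x * (v x)\<^sup>2)" if "v \<in> H10 \<Omega>" "open A" for v A
    by (rule integrable_bounded_mult[OF i[OF that(1)] bm[OF that(2)], of 1]) (simp add: indicator_le_1)
   \<comment> \<open>Each retained coefficient of u is the sum of a free and a driven one; solving
     for the free part leaves three terms, and the square of their sum costs the factor 3.\<close>
   have eq: "H.U t x = u t x - ?r x - ?w x" for x
    unfolding H.U_def using elim(2) by (simp add: decay_def sum_subtractf[symmetric] algebra_simps sum.distrib)
   have sq3: "(a - b - c)\<^sup>2 <= 3 * (a\<^sup>2 + b\<^sup>2 + c\<^sup>2)" for a b c :: real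
    using zero_le_power2[of "a + b"] zero_le_power2[of "a + c"] zero_le_power2[of "b - c"]
    by (simp add: power2_eq_square algebra_simps)
   have "H.obs r t <= (LINT x|M. 3 * (indicator \<omega> x * (u t x)\<^sup>2 + (?r x)\<^sup>2 + (?w x)\<^sup>2))"
    unfolding H.obs_def
   proof (rule integral_mono)
    show "integrable M (%x. indicator (ball x0 r) x * (H.U t x)\<^sup>2)" by (rule iu[OF H10g_H10[OF H.UG]]) simp
    show "integrable M (%x. 3 * (indicator \<omega> x * (u t x)\<^sup>2 + (?r x)\<^sup>2 + (?w x)\<^sup>2))"
     using iu[OF elim(1) \<omega>(1)] i[OF rem(1)] i[OF sum_in_H10] by simp
    show "indicator (ball x0 r) x * (H.U t x)\<^sup>2 <= 3 * (indicator \<omega> x * (u t x)\<^sup>2 + (?r x)\<^sup>2 + (?w x)\<^sup>2)" for x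
    proof (cases "x \<in> ball x0 r")
     case True
     then have "x \<in> \<omega>" using \<omega>(3) by auto
     then show ?thesis using True sq3[of "u t x" "?r x" "?w x"] unfolding eq by simp
    qed simp
   qed
   also have "... = 3 * ((LINT x|M. indicator \<omega> x * (u t x)\<^sup>2) + m_form ?r ?r + (nrm2 M ?w)\<^sup>2)"
    using iu[OF elim(1) \<omega>(1)] i[OF rem(1)] i[OF sum_in_H10] by (simp add: m_form_self nrm2_sq)
   also have "... <= 3 * ((LINT x|M. indicator \<omega> x * (u t x)\<^sup>2) + tail N t + (\<Sum>k<N. (damped k t)\<^sup>2))"
    using nrm2_sum_le[of "%k. damped k t" N] rem(2) by (simp add: tail_def m_form_self)
   finally show ?case .
  qed
 qed
 also have "... = 3 * (observation + (LINT t|J. tail N t) + (\<Sum>k<N. LINT t|J. (damped k t)\<^sup>2))"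
  unfolding observation_def using cylinder(1)[OF \<omega>(1,2)] tail_integrable di by simp
 also have "... <= 3 * (observation + (LINT t|J. tail N t) + (T + 1)\<^sup>2 * forcing)"
 proof -
  have "(\<Sum>k<N. LINT t|J. (damped k t)\<^sup>2) <= (\<Sum>k<N. \<kappa> k * (LINT t|J. (damped k t)\<^sup>2))"
  proof (rule sum_mono)
   fix k
   show "(LINT t|J. (damped k t)\<^sup>2) <= \<kappa> k * (LINT t|J. (damped k t)\<^sup>2)"
    using mult_right_mono[OF kap[of k], of "LINT t|J. (damped k t)\<^sup>2"] by simp
  qed
  then show ?thesis using damped_L2_sum_le[of N] by simp
 qed
 finally show ?thesis .
qed

lemma obs_weight_pos: "0 < obs_weight r T1 0" by (rule obs_facts(8)[OF r T1(1)])

definition late_bound :: real where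
 "late_bound = 3 * (observation + (T + 1)\<^sup>2 * forcing) / obs_weight r T1 0"

text \<open>The truncated energies increase with the number of modes. For fixed K the inequality can
  therefore be used with n tending to infinity, where the tail of u disappears because the
  observability constant does not depend on n.\<close>

lemma late_energy_le: "late_energy K <= late_bound"
proof -
 have mono: "late_energy K <= late_energy N" if "K <= N" for N
  unfolding late_energy_def using that
  by (intro sum_mono2) (auto intro!: mult_nonneg_nonneg CF.m.ip_nonneg e_in)
 have "obs_weight r T1 0 * late_energy K <= 3 * (observation + 0 + (T + 1)\<^sup>2 * forcing)"
 proof (rule LIMSEQ_le_const)
  show "(%N. 3 * (observation + (LINT t|J. tail N t) + (T + 1)\<^sup>2 * forcing)) ----> 3 * (observation + 0 + (T + 1)\<^sup>2 * forcing)"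
   by (intro tendsto_intros tail_tendsto)
  show "\<exists>N. \<forall>n\<ge>N. obs_weight r T1 0 * late_energy K <= 3 * (observation + (LINT t|J. tail n t) + (T + 1)\<^sup>2 * forcing)"
  proof (intro exI[of _ K] allI impI)
   fix n assume "K <= n"
   from mult_left_mono[OF mono[OF this] less_imp_le[OF obs_weight_pos]]
   show "obs_weight r T1 0 * late_energy K <= 3 * (observation + (LINT t|J. tail n t) + (T + 1)\<^sup>2 * forcing)"
    using late_energy_step[of n] by linarith
  qed
 qed
 then show ?thesis using obs_weight_pos by (simp add: late_bound_def field_simps)
qed

lemma decay_after: "decay k t = kernel (\<kappa> k - 1) t T1 * decay k T1" if "T1 <= t"
proof -
 have "- (\<kappa> k - 1) * t = - (\<kappa> k - 1) * (t - T1) + - (\<kappa> k - 1) * T1" by (simp add: algebra_simps)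
 then show ?thesis using that unfolding decay_def kernel_def by (simp add: exp_add)
qed

text \<open>The free part after T1 is its value at T1 times the decay kernel. The kernel is kept to
  the first power, so that its time integral can later absorb the weight \<open>\<kappa> k\<close>.
  For a zero e k both the coefficient and the factor \<open>m_form (e k) (e k)\<close>
  vanish.\<close>

lemma coef_after:
 "AE t in J. T1 < t \<longrightarrow> (\<forall>k. (coef k t)\<^sup>2 <= 2 * (kernel (\<kappa> k - 1) t T1 * ((decay k T1)\<^sup>2 * m_form (e k) (e k))) + 2 * (damped k t)\<^sup>2)"
 using coef_decay u_H10
proof eventually_elim
 case (elim t)
 have "(coef k t)\<^sup>2 <= 2 * (kernel (\<kappa> k - 1) t T1 * ((decay k T1)\<^sup>2 * m_form (e k) (e k))) + 2 * (damped k t)\<^sup>2" if "T1 < t" for k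
 proof (cases "e k = (%x. 0)")
  case True
  then show ?thesis using elim(2) CF.m.ip_zero[OF H10_zero] CF.m.ip_zero_right by (simp add: coef_def)
 next
  case False
  then have m: "m_form (e k) (e k) = 1" using normalized[of k] by simp
  note kb = kernel_bounds[OF kap_minus[of k], of t T1]
  have "(coef k t)\<^sup>2 <= 2 * (decay k t)\<^sup>2 + 2 * (damped k t)\<^sup>2"
   using elim(1) norm_add_sq_le[of "decay k t" "damped k t"] by simp
  also have "(decay k t)\<^sup>2 = (kernel (\<kappa> k - 1) t T1)\<^sup>2 * (decay k T1)\<^sup>2"
   using decay_after[of t k] that by (simp add: power_mult_distrib)
  also have "... <= kernel (\<kappa> k - 1) t T1 * (decay k T1)\<^sup>2"
   using kb by (intro mult_right_mono) (auto simp: power2_eq_square mult_left_le_one_le)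
  finally show ?thesis using m by simp
 qed
 then show ?case by blast
qed

lemma nrm2_after: "AE t in J. T1 < t \<longrightarrow> nrm2 M (u t) <= sqrt (2 * late_bound + 2 * ((T + 1) * forcing))"
 using coef_after coef_sums AE_space
proof eventually_elim
 case (elim t)
 show ?case
 proof
  assume t: "T1 < t"
  then have t0: "0 <= t" "t <= T" using elim(3) T1 by auto
  have "(\<Sum>k<N. (coef k t)\<^sup>2) <= 2 * late_bound + 2 * ((T + 1) * forcing)" for N
  proof -
   have "(\<Sum>k<N. (coef k t)\<^sup>2) <= (\<Sum>k<N. 2 * ((decay k T1)\<^sup>2 * m_form (e k) (e k)) + 2 * (damped k t)\<^sup>2)"
   proof (rule sum_mono)
    fix k
    have "kernel (\<kappa> k - 1) t T1 * ((decay k T1)\<^sup>2 * m_form (e k) (e k)) <= (decay k T1)\<^sup>2 * m_form (e k) (e k)"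
     using kernel_bounds[OF kap_minus[of k], of t T1] CF.m.ip_nonneg[OF e_in[of k]] by (intro mult_left_le_one_le) auto
    then show "(coef k t)\<^sup>2 <= 2 * ((decay k T1)\<^sup>2 * m_form (e k) (e k)) + 2 * (damped k t)\<^sup>2"
     using elim(1) t by (smt (verit))
   qed
   also have "... = 2 * late_energy N + 2 * (\<Sum>k<N. (damped k t)\<^sup>2)"
    by (simp add: late_energy_def sum.distrib sum_distrib_left)
   also have "... <= 2 * late_bound + 2 * ((T + 1) * forcing)"
    by (intro add_mono mult_left_mono late_energy_le damped_sum_le t0) auto
   finally show ?thesis .
  qed
  moreover have "(%N. \<Sum>k<N. (coef k t)\<^sup>2) ----> (nrm2 M (u t))\<^sup>2" using elim(2) by (simp add: sums_def)
  ultimately have "(nrm2 M (u t))\<^sup>2 <= 2 * late_bound + 2 * ((T + 1) * forcing)"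
   by (intro LIMSEQ_le_const2) auto
  then show "nrm2 M (u t) <= sqrt (2 * late_bound + 2 * ((T + 1) * forcing))" by (rule real_le_rsqrt)
 qed
qed

text \<open>Decay after T1 gains the derivative that separates the L2 energy at T1 from the H1 norm:
  \<open>\<kappa> k\<close> times the time integral of the kernel is at most T + 1. Partial sums
  over the modes are estimated first, then dominated convergence applies.\<close>

lemma normH1_after:
 "(LINT t|J. indicator {T1<..} t * (normH1 \<Omega> (u t))\<^sup>2) <= 2 * ((T + 1) * late_bound) + 2 * ((T + 1)\<^sup>2 * forcing)"
proof (rule LIMSEQ_le_const2)
 let ?i = "%t. indicator {T1<..} t :: real"
 have im: "?i \<in> borel_measurable J" by (intro borel_measurable_J) simp
 have Hi: "integrable J (%t. (normH1 \<Omega> (u t))\<^sup>2)" using sqint_integrable[OF normH1_u_sqint] by simp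
 have ci: "integrable J (%t. ?i t * (\<kappa> k * (coef k t)\<^sup>2))" for k
  by (rule integrable_bounded_mult[OF _ im, of _ 1]) (use coef_sq_integrable[of k] in \<open>auto simp: indicator_le_1\<close>)
 have di: "integrable J (%t. (damped k t)\<^sup>2)" for k using sqint_integrable[OF damped_sqint] by simp
 show "(%N. LINT t|J. ?i t * (\<Sum>k<N. \<kappa> k * (coef k t)\<^sup>2)) ----> (LINT t|J. ?i t * (normH1 \<Omega> (u t))\<^sup>2)"
 proof (rule integral_dominated_convergence[where w="%t. (normH1 \<Omega> (u t))\<^sup>2"])
  show "AE t in J. (%N. ?i t * (\<Sum>k<N. \<kappa> k * (coef k t)\<^sup>2)) ----> ?i t * (normH1 \<Omega> (u t))\<^sup>2"
   using coef_sums by eventually_elim (auto simp: sums_def intro!: tendsto_mult_left)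
  show "AE t in J. norm (?i t * (\<Sum>k<N. \<kappa> k * (coef k t)\<^sup>2)) <= (normH1 \<Omega> (u t))\<^sup>2" for N
   using coef_sums
  proof eventually_elim
   case (elim t)
   then have s: "(%k. \<kappa> k * (coef k t)\<^sup>2) sums (normH1 \<Omega> (u t))\<^sup>2" by simp
   have "(\<Sum>k<N. \<kappa> k * (coef k t)\<^sup>2) <= (normH1 \<Omega> (u t))\<^sup>2"
    unfolding sums_unique[OF s]
    by (rule sum_le_suminf[OF sums_summable[OF s]]) (use kap_pos in \<open>auto simp: less_imp_le\<close>)
   moreover have "0 <= (\<Sum>k<N. \<kappa> k * (coef k t)\<^sup>2)" using kap_pos by (intro sum_nonneg) (simp add: less_imp_le)
   ultimately show ?case by (simp add: indicator_def)
  qed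
  show "(%t. ?i t * (normH1 \<Omega> (u t))\<^sup>2) \<in> borel_measurable J" using im Hi by auto
  show "(%t. ?i t * (\<Sum>k<N. \<kappa> k * (coef k t)\<^sup>2)) \<in> borel_measurable J" for N
   using im coef_sq_integrable by (intro borel_measurable_times borel_measurable_sum) auto
 qed (rule Hi)
 have "(LINT t|J. ?i t * (\<Sum>k<N. \<kappa> k * (coef k t)\<^sup>2)) <= 2 * ((T + 1) * late_bound) + 2 * ((T + 1)\<^sup>2 * forcing)" for N
 proof -
  have "(LINT t|J. ?i t * (\<kappa> k * (coef k t)\<^sup>2))
    <= 2 * ((T + 1) * ((decay k T1)\<^sup>2 * m_form (e k) (e k))) + 2 * (\<kappa> k * (LINT t|J. (damped k t)\<^sup>2))" for k
  proof -
   let ?d = "(decay k T1)\<^sup>2 * m_form (e k) (e k)"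
   have d0: "0 <= ?d" by (intro mult_nonneg_nonneg CF.m.ip_nonneg e_in) simp
   have ki: "integrable J (%t. kernel (\<kappa> k - 1) t T1)" by (rule I.sqint_L1[OF sqint_kernel(2)])
   have "(LINT t|J. ?i t * (\<kappa> k * (coef k t)\<^sup>2)) <= (LINT t|J. \<kappa> k * (2 * (kernel (\<kappa> k - 1) t T1 * ?d) + 2 * (damped k t)\<^sup>2))"
   proof (rule integral_mono_AE[OF ci])
    show "integrable J (%t. \<kappa> k * (2 * (kernel (\<kappa> k - 1) t T1 * ?d) + 2 * (damped k t)\<^sup>2))" using ki di by simp
    show "AE t in J. ?i t * (\<kappa> k * (coef k t)\<^sup>2) <= \<kappa> k * (2 * (kernel (\<kappa> k - 1) t T1 * ?d) + 2 * (damped k t)\<^sup>2)"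
     using coef_after
    proof eventually_elim
     case (elim t)
     show ?case
     proof (cases "T1 < t")
      case True
      then show ?thesis using elim kap_pos[of k] by (simp add: less_imp_le)
     next
      case False
      then show ?thesis using d0 kap_pos[of k] kernel_bounds[OF kap_minus[of k], of t T1]
       by (auto intro!: mult_nonneg_nonneg add_nonneg_nonneg)
     qed
    qed
   qed
   \<comment> \<open>Here \<open>\<kappa> k\<close> is rewritten as
     \<open>1 + (\<kappa> k - 1)\<close> to match \<open>kernel_integral_fst\<close>.\<close>
   also have "... = 2 * (((1 + (\<kappa> k - 1)) * (LINT t|J. kernel (\<kappa> k - 1) t T1)) * ?d) + 2 * (\<kappa> k * (LINT t|J. (damped k t)\<^sup>2))"
    using ki di by (simp add: algebra_simps)
   also have "... <= 2 * ((T + 1) * ?d) + 2 * (\<kappa> k * (LINT t|J. (damped k t)\<^sup>2))"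
    using kernel_integral_fst[OF kap_minus[of k], of T1] T1 d0 by (intro add_right_mono mult_left_mono mult_right_mono) auto
   finally show ?thesis .
  qed
  then have "(\<Sum>k<N. LINT t|J. ?i t * (\<kappa> k * (coef k t)\<^sup>2))
    <= (\<Sum>k<N. 2 * ((T + 1) * ((decay k T1)\<^sup>2 * m_form (e k) (e k))) + 2 * (\<kappa> k * (LINT t|J. (damped k t)\<^sup>2)))"
   by (rule sum_mono)
  also have "... = 2 * ((T + 1) * late_energy N) + 2 * (\<Sum>k<N. \<kappa> k * (LINT t|J. (damped k t)\<^sup>2))"
   by (simp only: late_energy_def sum.distrib sum_distrib_left)
  also have "... <= 2 * ((T + 1) * late_bound) + 2 * ((T + 1)\<^sup>2 * forcing)"
   using T_pos by (intro add_mono mult_left_mono late_energy_le damped_L2_sum_le) auto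
  also have "(\<Sum>k<N. LINT t|J. ?i t * (\<kappa> k * (coef k t)\<^sup>2)) = (LINT t|J. ?i t * (\<Sum>k<N. \<kappa> k * (coef k t)\<^sup>2))"
   unfolding sum_distrib_left by (rule LINT_sum[symmetric]) (rule ci)
  finally show ?thesis .
 qed
 then show "\<exists>N. \<forall>n\<ge>N. (LINT t|J. ?i t * (\<Sum>k<n. \<kappa> k * (coef k t)\<^sup>2)) <= 2 * ((T + 1) * late_bound) + 2 * ((T + 1)\<^sup>2 * forcing)"
  by blast
qed

end

section \<open>Restriction to times after T1 and the final estimate\<close>

lemma integral_mono_nonneg_AE:
 fixes f g :: "'x => real"
 assumes "integrable M g" "AE x in M. 0 <= f x \<and> f x <= g x"
 shows "(LINT x|M. f x) <= (LINT x|M. g x)"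
 by (rule integral_mono_AE'[OF assms(1)]) (use assms(2) in \<open>auto\<close>)

lemma test_functions_mono: "\<phi> \<in> test_functions S ==> S \<subseteq> S' ==> \<phi> \<in> test_functions S'"
 unfolding test_functions_iff by (meson order_trans)

lemma simple_function_lebesgue_on_subset:
 assumes "simple_function (lebesgue_on S) f" "S' \<subseteq> S" "S \<in> sets lebesgue" "S' \<in> sets lebesgue"
 shows "simple_function (lebesgue_on S') f"
 unfolding simple_function_def
proof (intro conjI ballI)
 have "finite (f ` S)" using assms(1) by (simp add: simple_function_def)
 then show "finite (f ` space (lebesgue_on S'))" using assms(2) by (simp add: finite_subset[OF image_mono])
 fix y
 have "f -` {y} \<inter> S' = (f -` {y} \<inter> S) \<inter> S'" using assms(2) by auto
 moreover have "f -` {y} \<inter> S \<in> sets lebesgue"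
 proof (cases "y \<in> f ` S")
  case True
  then show ?thesis using assms(1,3) by (auto simp: simple_function_def sets_restrict_space_iff)
 next
  case False
  then have "f -` {y} \<inter> S = {}" by auto
  then show ?thesis by simp
 qed
 ultimately show "f -` {y} \<inter> space (lebesgue_on S') \<in> sets (lebesgue_on S')"
  using assms(4) by (simp add: sets_restrict_space_iff)
qed

context observed
begin

abbreviation "J1 \<equiv> lebesgue_on {T1<..<T}"

lemma AE_J1: "AE t in J. P t ==> AE t in J1. P t"
 using T1 by (auto simp: AE_restrict_space_iff)

lemma LINT_J1: "(LINT t|J1. f t) = (LINT t|J. indicator {T1<..} t * (f t :: real))"
proof -
 have "(LINT t|J. indicator {T1<..} t * f t) = (LINT t|lebesgue. indicator {0<..<T} t * (indicator {T1<..} t * f t))"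
  by (simp add: integral_restrict_space)
 also have "... = (LINT t|lebesgue. indicator {T1<..<T} t * f t)"
  using T1 by (intro LINT_cong) (auto simp: indicator_def)
 finally show ?thesis by (simp add: integral_restrict_space)
qed

lemma LINT_J1_eq: "(!!t. t \<notin> {T1<..<T} ==> f t = 0) ==> (LINT t|J1. f t) = (LINT t|J. (f t :: real))"
 unfolding LINT_J1 by (intro LINT_cong) (auto simp: indicator_def)

lemma integrable_J1: "integrable J f ==> integrable J1 (f :: real => real)"
proof -
 assume "integrable J f"
 then have "integrable lebesgue (%t. indicator {0<..<T} t * f t)" by (simp add: integrable_restrict_space)
 then have "integrable lebesgue (%t. indicator {T1<..<T} t * (indicator {0<..<T} t * f t))"
  by (rule integrable_bounded_mult[of _ _ _ 1]) (auto intro!: borel_measurable_indicator simp: indicator_le_1)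
 also have "(%t. indicator {T1<..<T} t * (indicator {0<..<T} t * f t)) = (%t. indicator {T1<..<T} t * f t)"
  using T1 by (auto simp: indicator_def fun_eq_iff)
 finally show ?thesis by (simp add: integrable_restrict_space)
qed

lemma L2_time_J1: "f \<in> L2_time 0 T X nrm ==> f \<in> L2_time T1 T X nrm"
proof -
 assume f: "f \<in> L2_time 0 T X nrm"
 then obtain s where s: "!!k::nat. simple_function J (s k) \<and> (\<forall>t. s k t \<in> X)"
  and l: "AE t in J. (%k. nrm (%y. f t y - s k t y)) ----> 0" and X: "AE t in J. f t \<in> X"
  unfolding L2_time_def strongly_measurable_def by blast
 have "simple_function J1 (s k)" for k
  by (rule simple_function_lebesgue_on_subset[where S="{0<..<T}"]) (use s T1 in auto)
 then have "strongly_measurable T1 T X nrm f"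
  unfolding strongly_measurable_def using s AE_J1[OF l] AE_J1[OF X] by blast
 then show ?thesis using f integrable_J1 by (simp add: L2_time_def)
qed

definition late_tder :: "real => ('a => real) => real" where
 "late_tder = weak_tderiv \<Omega> T1 T (%s. L2_functional \<Omega> (u s))"

lemma tder_J1: "tder \<in> L2_time T1 T (Hm1 \<Omega>) (normHm1 \<Omega>)" "has_weak_tderiv \<Omega> T1 T (%t. L2_functional \<Omega> (u t)) tder"
proof -
 show "tder \<in> L2_time T1 T (Hm1 \<Omega>) (normHm1 \<Omega>)" by (rule L2_time_J1[OF tder(1)])
 show "has_weak_tderiv \<Omega> T1 T (%t. L2_functional \<Omega> (u t)) tder"
  unfolding has_weak_tderiv_def
 proof (intro ballI)
  fix \<phi> v assume \<phi>: "\<phi> \<in> test_functions {T1<..<T}" and v: "v \<in> H10 \<Omega>"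
  obtain K where K: "K \<subseteq> {T1<..<T}" "!!x. x \<notin> K ==> \<phi> x = 0" "!!x. x \<notin> K ==> grad \<phi> x = 0"
   using test_obtain[OF \<phi>] by metis
  have K0: "\<phi> t = 0" "grad \<phi> t = 0" if "t \<notin> {T1<..<T}" for t using that K by blast+
  have "\<phi> \<in> test_functions {0<..<T}" by (rule test_functions_mono[OF \<phi>]) (use T1 in auto)
  then have "(LINT t|J. deriv \<phi> t * L2_functional \<Omega> (u t) v) = - (LINT t|J. \<phi> t * tder t v)"
   using tder(2) v unfolding has_weak_tderiv_def by blast
  moreover have "(LINT t|J1. deriv \<phi> t * L2_functional \<Omega> (u t) v) = (LINT t|J. deriv \<phi> t * L2_functional \<Omega> (u t) v)"
   by (intro LINT_J1_eq) (simp add: test_deriv(2)[OF \<phi>] K0)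
  moreover have "(LINT t|J1. \<phi> t * tder t v) = (LINT t|J. \<phi> t * tder t v)"
   by (intro LINT_J1_eq) (simp add: K0)
  ultimately show "(LINT t|J1. deriv \<phi> t * L2_functional \<Omega> (u t) v) = - (LINT t|J1. \<phi> t * tder t v)" by simp
 qed
qed

lemma late_tder: "late_tder \<in> L2_time T1 T (Hm1 \<Omega>) (normHm1 \<Omega>)" "has_weak_tderiv \<Omega> T1 T (%t. L2_functional \<Omega> (u t)) late_tder"
proof -
 have "\<exists>g. g \<in> L2_time T1 T (Hm1 \<Omega>) (normHm1 \<Omega>) \<and> has_weak_tderiv \<Omega> T1 T (%t. L2_functional \<Omega> (u t)) g"
  using tder_J1 by blast
 from someI_ex[OF this]
 show "late_tder \<in> L2_time T1 T (Hm1 \<Omega>) (normHm1 \<Omega>)" "has_weak_tderiv \<Omega> T1 T (%t. L2_functional \<Omega> (u t)) late_tder"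
  by (auto simp: late_tder_def weak_tderiv_def)
qed

text \<open>The weak derivative on the shorter interval is a separate choice from the one on the
  full interval. The fundamental lemma makes them agree on every e k for almost every time, and by
  \<open>Hm1_sums\<close> these values determine the dual norm.\<close>

lemma late_tder_norm: "AE t in J1. normHm1 \<Omega> (late_tder t) = normHm1 \<Omega> (tder t)"
proof -
 interpret L: bdomain "{T1<..<T}" by unfold_locales auto
 have "AE t in J1. late_tder t (e k) = tder t (e k)" for k
 proof -
  note s = sqint_L2_time_Hm1[OF late_tder(1), of k] sqint_L2_time_Hm1[OF tder_J1(1), of k]
  have "AE t in J1. late_tder t (e k) - tder t (e k) = 0"
  proof (rule fundamental_lemma)
   show "integrable J1 (%t. late_tder t (e k) - tder t (e k))" by (intro L.sqint_L1 sqint_diff s)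
   fix \<phi> assume \<phi>: "\<phi> \<in> test_functions {T1<..<T}"
   have "(LINT t|J1. \<phi> t * late_tder t (e k)) = (LINT t|J1. \<phi> t * tder t (e k))"
    using late_tder(2) tder_J1(2) \<phi> e_in[of k] unfolding has_weak_tderiv_def by force
   then have "(LINT t|J1. late_tder t (e k) * \<phi> t) = (LINT t|J1. tder t (e k) * \<phi> t)"
    by (simp only: mult.commute)
   then show "(LINT t|J1. (late_tder t (e k) - tder t (e k)) * \<phi> t) = 0"
    using sqint_mult[OF s(1) L.test_sqint(1)[OF \<phi>]] sqint_mult[OF s(2) L.test_sqint(1)[OF \<phi>]]
    by (simp add: left_diff_distrib)
  qed simp
  then show ?thesis by eventually_elim simp
 qed
 then have "AE t in J1. \<forall>k. late_tder t (e k) = tder t (e k)" by (simp add: AE_all_countable)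
 moreover have "AE t in J1. late_tder t \<in> Hm1 \<Omega>" "AE t in J1. tder t \<in> Hm1 \<Omega>"
  using late_tder(1) tder_J1(1) by (auto simp: L2_time_def strongly_measurable_def)
 ultimately show ?thesis
 proof eventually_elim
  case (elim t)
  have "(normHm1 \<Omega> (late_tder t))\<^sup>2 = (normHm1 \<Omega> (tder t))\<^sup>2"
   using sums_unique2[OF Hm1_sums[OF elim(2)]] Hm1_sums[OF elim(3)] elim(1) by simp
  then show ?case using normHm1_nonneg[OF elim(2)] normHm1_nonneg[OF elim(3)] by simp
 qed
qed

lemma final_estimate:
 defines "A \<equiv> normL2 ({0<..<T} \<times> \<omega>) (%(t, x). u t x)" and "S \<equiv> normL2_time 0 T (normHm1 \<Omega>) (heat_op \<Omega> T u)"
  and "C \<equiv> 2 * (T + 1) ^ 3 * (3 / obs_weight r T1 0 + 1)"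
 shows "normC_L2 \<Omega> T1 T u + normL2_time T1 T (normH1 \<Omega>) u + normH1_time_Hm1 \<Omega> T1 T (%t. L2_functional \<Omega> (u t))
  <= 3 * sqrt (3 * C + 2) * (A + S)"
proof -
 let ?H = "LINT t|J1. (normH1 \<Omega> (u t))\<^sup>2"
 have A: "observation = A\<^sup>2" unfolding observation_def A_def by (rule cylinder(2)[OF \<omega>(1,2)])
 have S: "forcing = S\<^sup>2" unfolding forcing_def S_def normL2_time_def by simp
 have A0: "0 <= A" and S0: "0 <= S" by (simp_all add: A_def S_def normL2_def normL2_time_def)
 have w: "0 < obs_weight r T1 0" by (rule obs_weight_pos)
 have T1': "1 <= T + 1" using T_pos by simp
 have C0: "0 <= C" using w T1' by (simp add: C_def)
 have late: "late_bound <= 3 * (T + 1)\<^sup>2 / obs_weight r T1 0 * (A\<^sup>2 + S\<^sup>2)"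
 proof -
  have "A\<^sup>2 <= (T + 1)\<^sup>2 * A\<^sup>2" using T1' by (simp add: mult_le_cancel_right1)
  then have "3 * (A\<^sup>2 + (T + 1)\<^sup>2 * S\<^sup>2) <= 3 * (T + 1)\<^sup>2 * (A\<^sup>2 + S\<^sup>2)" by (simp add: algebra_simps)
  then show ?thesis using w unfolding late_bound_def A S by (simp add: divide_right_mono)
 qed
 have key: "2 * ((T + 1) * late_bound) + 2 * ((T + 1)\<^sup>2 * forcing) <= C * (A\<^sup>2 + S\<^sup>2)"
 proof -
  let ?P = "(T + 1) ^ 3 * (A\<^sup>2 + S\<^sup>2)"
  have "(T + 1)\<^sup>2 * S\<^sup>2 <= ?P"
   using power_increasing[of 2 3 "T + 1"] T1' by (intro mult_mono) auto
  moreover have "(T + 1) * late_bound <= (T + 1) * (3 * (T + 1)\<^sup>2 / obs_weight r T1 0 * (A\<^sup>2 + S\<^sup>2))"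
   using T1' by (intro mult_left_mono late) auto
  moreover have "(T + 1) * (3 * (T + 1)\<^sup>2 / obs_weight r T1 0 * (A\<^sup>2 + S\<^sup>2)) = ?P * (3 / obs_weight r T1 0)"
   by (simp add: power2_eq_square power3_eq_cube)
  moreover have "C * (A\<^sup>2 + S\<^sup>2) = 2 * (?P * (3 / obs_weight r T1 0)) + 2 * ?P"
   unfolding C_def by (simp add: algebra_simps add_divide_distrib)
  ultimately show ?thesis unfolding S by linarith
 qed
 have sq: "A\<^sup>2 + S\<^sup>2 <= (A + S)\<^sup>2" using A0 S0 by (simp add: power2_sum)
 \<comment> \<open>A single constant serves all three norms: once its square is below the common
   bound, each norm is at most \<open>sqrt (3 * C + 2) * (A + S)\<close>, and the factor 3 of the
   claim counts the norms.\<close>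
 have root: "x <= sqrt (3 * C + 2) * (A + S)" if "x\<^sup>2 <= (3 * C + 2) * (A\<^sup>2 + S\<^sup>2)" for x
 proof (rule power2_le_imp_le)
  have "(3 * C + 2) * (A\<^sup>2 + S\<^sup>2) <= (3 * C + 2) * (A + S)\<^sup>2" by (rule mult_left_mono[OF sq]) (use C0 in simp)
  also have "... = (sqrt (3 * C + 2) * (A + S))\<^sup>2" using C0 by (simp add: power_mult_distrib)
  finally show "x\<^sup>2 <= (sqrt (3 * C + 2) * (A + S))\<^sup>2" using that by linarith
 qed (use A0 S0 C0 in auto)
 have CK: "C * (A\<^sup>2 + S\<^sup>2) <= (3 * C + 2) * (A\<^sup>2 + S\<^sup>2)" using C0 by (intro mult_right_mono) auto
 have "normC_L2 \<Omega> T1 T u <= sqrt (2 * late_bound + 2 * ((T + 1) * forcing))"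
  by (rule normC_L2_le[OF T1 nrm2_after])
 also have "... <= sqrt (3 * C + 2) * (A + S)"
 proof (rule root)
  have lb: "0 <= late_bound" using late_energy_le[of 0] by (simp add: late_energy_def)
  have "late_bound <= (T + 1) * late_bound" using mult_right_mono[OF T1' lb] by simp
  moreover have "(T + 1) * forcing <= (T + 1)\<^sup>2 * forcing"
   by (rule mult_right_mono[OF self_le_power[OF T1']]) simp_all
  ultimately have "2 * late_bound + 2 * ((T + 1) * forcing) <= C * (A\<^sup>2 + S\<^sup>2)" using key by linarith
  moreover have "0 <= 2 * late_bound + 2 * ((T + 1) * forcing)"
   using lb T1' forcing_nonneg by (intro add_nonneg_nonneg mult_nonneg_nonneg) auto
  ultimately show "(sqrt (2 * late_bound + 2 * ((T + 1) * forcing)))\<^sup>2 <= (3 * C + 2) * (A\<^sup>2 + S\<^sup>2)"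
   using CK by simp
 qed
 finally have 1: "normC_L2 \<Omega> T1 T u <= sqrt (3 * C + 2) * (A + S)" .
 have H: "?H <= C * (A\<^sup>2 + S\<^sup>2)" using normH1_after key unfolding LINT_J1 by linarith
 have H0: "0 <= ?H" by simp
 have 2: "normL2_time T1 T (normH1 \<Omega>) u <= sqrt (3 * C + 2) * (A + S)"
  unfolding normL2_time_def by (rule root) (use H CK in simp)
 have Hi: "integrable J1 (%t. (normH1 \<Omega> (u t))\<^sup>2)"
  using integrable_J1 sqint_integrable[OF normH1_u_sqint] by simp
 have 3: "(LINT t|J1. (normHm1 \<Omega> (L2_functional \<Omega> (u t)))\<^sup>2) <= ?H"
 proof (rule integral_mono_nonneg_AE[OF Hi])
  show "AE t in J1. 0 <= (normHm1 \<Omega> (L2_functional \<Omega> (u t)))\<^sup>2 \<and> (normHm1 \<Omega> (L2_functional \<Omega> (u t)))\<^sup>2 <= (normH1 \<Omega> (u t))\<^sup>2"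
   using AE_J1[OF u_H10]
  proof eventually_elim
   case (elim t)
   have "normHm1 \<Omega> (L2_functional \<Omega> (u t)) <= normH1 \<Omega> (u t)"
    using L2_functional_Hm1(2)[OF elim] nrm2_le_normH1[OF elim] by linarith
   then show ?case using normHm1_nonneg[OF L2_functional_Hm1(1)[OF elim]] by (simp add: power_mono)
  qed
 qed
 have 4: "(LINT t|J1. (normHm1 \<Omega> (late_tder t))\<^sup>2) <= 2 * S\<^sup>2 + 2 * ?H"
 proof -
  have hi: "integrable J1 (%t. (normHm1 \<Omega> (heat_op \<Omega> T u t))\<^sup>2)" by (rule integrable_J1[OF heat_op_integrable])
  have "(LINT t|J1. (normHm1 \<Omega> (late_tder t))\<^sup>2) <= (LINT t|J1. 2 * (normHm1 \<Omega> (heat_op \<Omega> T u t))\<^sup>2 + 2 * (normH1 \<Omega> (u t))\<^sup>2)"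
  proof (rule integral_mono_nonneg_AE)
   show "integrable J1 (%t. 2 * (normHm1 \<Omega> (heat_op \<Omega> T u t))\<^sup>2 + 2 * (normH1 \<Omega> (u t))\<^sup>2)" using hi Hi by simp
   show "AE t in J1. 0 <= (normHm1 \<Omega> (late_tder t))\<^sup>2 \<and> (normHm1 \<Omega> (late_tder t))\<^sup>2
     <= 2 * (normHm1 \<Omega> (heat_op \<Omega> T u t))\<^sup>2 + 2 * (normH1 \<Omega> (u t))\<^sup>2"
    using late_tder_norm AE_J1[OF heat_op_Hm1] AE_J1[OF tder_Hm1]
   proof eventually_elim
    case (elim t)
    have "(normHm1 \<Omega> (tder t))\<^sup>2 <= (normHm1 \<Omega> (heat_op \<Omega> T u t) + normH1 \<Omega> (u t))\<^sup>2"
     using elim(2) normHm1_nonneg[OF elim(3)] by (intro power_mono) auto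
    also have "... <= 2 * (normHm1 \<Omega> (heat_op \<Omega> T u t))\<^sup>2 + 2 * (normH1 \<Omega> (u t))\<^sup>2"
     using norm_add_sq_le[of "normHm1 \<Omega> (heat_op \<Omega> T u t)" "normH1 \<Omega> (u t)"] by simp
    finally show ?case using elim(1) by simp
   qed
  qed
  also have "... = 2 * (LINT t|J1. (normHm1 \<Omega> (heat_op \<Omega> T u t))\<^sup>2) + 2 * ?H" using hi Hi by simp
  also have "(LINT t|J1. (normHm1 \<Omega> (heat_op \<Omega> T u t))\<^sup>2) <= forcing"
   unfolding LINT_J1 forcing_def
   by (rule integral_mono_nonneg_AE[OF heat_op_integrable]) (auto simp: indicator_def)
  finally show ?thesis using S by simp
 qed
 \<comment> \<open>The values contribute one and the time derivative two copies of the squared H1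
   norm after T1, each at most \<open>C * (A\<^sup>2 + S\<^sup>2)\<close>; the source adds
   \<open>2 * S\<^sup>2\<close>. This is the origin of \<open>3 * C + 2\<close>.\<close>
 have 5: "normH1_time_Hm1 \<Omega> T1 T (%t. L2_functional \<Omega> (u t)) <= sqrt (3 * C + 2) * (A + S)"
 proof (rule root)
  have "(normH1_time_Hm1 \<Omega> T1 T (%t. L2_functional \<Omega> (u t)))\<^sup>2
    = (LINT t|J1. (normHm1 \<Omega> (L2_functional \<Omega> (u t)))\<^sup>2) + (LINT t|J1. (normHm1 \<Omega> (late_tder t))\<^sup>2)"
   by (simp add: normH1_time_Hm1_def normL2_time_def late_tder_def[symmetric])
  also have "... <= 3 * (C * (A\<^sup>2 + S\<^sup>2)) + 2 * S\<^sup>2" using 3 4 H by linarith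
  also have "... <= (3 * C + 2) * (A\<^sup>2 + S\<^sup>2)" by (simp add: algebra_simps)
  finally show "(normH1_time_Hm1 \<Omega> T1 T (%t. L2_functional \<Omega> (u t)))\<^sup>2 <= (3 * C + 2) * (A\<^sup>2 + S\<^sup>2)" .
 qed
 show ?thesis using 1 2 5 by simp
qed

end

lemma (in bdomain) eigen_exists: "\<exists>e \<kappa>. eigen \<Omega> e \<kappa>"
proof (rule CF.spectral)
 fix e :: "nat => 'a => real" and \<kappa> :: "nat => real"
 assume "!!k. e k \<in> H10 \<Omega>" "!!k. 1 <= \<kappa> k" "!!i j. i \<noteq> j ==> m_form (e i) (e j) = 0"
  "!!k. m_form (e k) (e k) = 1 \<or> e k = (%x. 0)"
  "!!k v. v \<in> H10 \<Omega> ==> q_form (e k) v = \<kappa> k * m_form (e k) v"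
  "!!v. v \<in> H10 \<Omega> ==> (%N. q_form (%x. v x - (\<Sum>k<N. m_form v (e k) * e k x)) (%x. v x - (\<Sum>k<N. m_form v (e k) * e k x))) ----> 0"
 then have "eigen \<Omega> e \<kappa>" by unfold_locales
 then show ?thesis by blast
qed

theorem theorem2:
  fixes \<Omega> \<omega> :: "(real ^ 'n) set" and T1 T :: real
  assumes "open \<Omega>"
    and "compact (closure \<Omega>)" and "convex (closure \<Omega>)" and "polyhedron (closure \<Omega>)"
    and "interior (closure \<Omega>) = \<Omega>"
    and "open \<omega>" and "\<omega> \<subseteq> \<Omega>" and "\<omega> \<noteq> {}"
    and "0 < T1" and "T1 < T"
  shows "\<exists>C>0. \<forall>u\<in>energy_space \<Omega> T.
           normC_L2 \<Omega> T1 T u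
           + normL2_time T1 T (normH1 \<Omega>) u
           + normH1_time_Hm1 \<Omega> T1 T (\<lambda>t. L2_functional \<Omega> (u t))
           \<le> C * (normL2 ({0<..<T} \<times> \<omega>) (\<lambda>(t, x). u t x)
                  + normL2_time 0 T (normHm1 \<Omega>) (heat_op \<Omega> T u))"
proof -
 \<comment> \<open>Convexity is given for the closure and passes to the domain itself, which is the
   interior of its closure. It makes the domain star-shaped about any of its points, in particular
   about a centre in the observation set.\<close>
 have cv: "convex \<Omega>" using convex_interior[OF \<open>convex (closure \<Omega>)\<close>] \<open>interior (closure \<Omega>) = \<Omega>\<close> by simp
 have bd: "bounded \<Omega>" using \<open>compact (closure \<Omega>)\<close> bounded_subset[OF compact_imp_bounded closure_subset] by blast
 interpret B: bdomain \<Omega> by unfold_locales (use \<open>open \<Omega>\<close> bd in auto)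
 obtain x0 where x0: "x0 \<in> \<omega>" using \<open>\<omega> \<noteq> {}\<close> by auto
 obtain r where r: "0 < r" "ball x0 r \<subseteq> \<omega>" using \<open>open \<omega>\<close> x0 open_contains_ball by blast
 obtain R where R: "0 < R" "!!x. x \<in> \<Omega> ==> norm (x - x0) <= R"
 proof -
  obtain a where a: "0 < a" "\<forall>x\<in>\<Omega>. norm x <= a" using bd bounded_pos by blast
  have "norm (x - x0) <= a + norm x0" if "x \<in> \<Omega>" for x
   using norm_triangle_ineq4[of x x0] bspec[OF a(2) that] by linarith
  moreover have "0 < a + norm x0" using a(1) by (simp add: add_pos_nonneg)
  ultimately show ?thesis by (intro that)
 qed
 have star: "x0 + s *\<^sub>R (x - x0) \<in> \<Omega>" if "x \<in> \<Omega>" "0 <= s" "s <= 1" for x s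
 proof -
  have "(1 - s) *\<^sub>R x0 + s *\<^sub>R x \<in> \<Omega>"
   using convexD[OF cv, of x0 x "1 - s" s] x0 \<open>\<omega> \<subseteq> \<Omega>\<close> that by auto
  then show ?thesis by (simp add: algebra_simps)
 qed
 interpret S: star_domain \<Omega> x0 R
  by unfold_locales (use star R in auto)
 obtain e \<kappa> where "eigen \<Omega> e \<kappa>" using B.eigen_exists by blast
 then interpret E: eigen \<Omega> e \<kappa> .
 let ?C = "2 * (T + 1) ^ 3 * (3 / S.obs_weight r T1 0 + 1)"
 show ?thesis
 proof (intro exI[of _ "3 * sqrt (3 * ?C + 2)"] conjI ballI)
  have "0 < S.obs_weight r T1 0" by (rule S.obs_facts(8)[OF r(1) \<open>0 < T1\<close>])
  then show "0 < 3 * sqrt (3 * ?C + 2)"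
   using \<open>0 < T1\<close> \<open>T1 < T\<close> by (simp add: add_nonneg_pos)
  fix u assume u: "u \<in> energy_space \<Omega> T"
  interpret O: observed \<Omega> e \<kappa> T u x0 R \<omega> r T1
   by unfold_locales (use u r \<open>open \<omega>\<close> \<open>\<omega> \<subseteq> \<Omega>\<close> \<open>0 < T1\<close> \<open>T1 < T\<close> in auto)
  show "normC_L2 \<Omega> T1 T u + normL2_time T1 T (normH1 \<Omega>) u + normH1_time_Hm1 \<Omega> T1 T (%t. L2_functional \<Omega> (u t))
    <= 3 * sqrt (3 * ?C + 2) * (normL2 ({0<..<T} \<times> \<omega>) (%(t, x). u t x) + normL2_time 0 T (normHm1 \<Omega>) (heat_op \<Omega> T u))"
   by (rule O.final_estimate)
 qed
qed

end
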